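(* Let $k\ge1$, $n=2k+1$, let $E=\mathbb{C}/\Lambda$ be a complex elliptic curve, and let $\tau\in\mathbb{C}\setminus\frac1n\Lambda$. Let $V$ be the degree-one component of $Q_{2k+1,k}(E,\tau)$, with basis $x_0,\dots,x_{2k}$; via the identification $x_\alpha=w_\alpha$ described in the context, $V=H^0(E^k,\mathcal{L}_{(2k+1)/k})$ is the space of linear forms on $\mathbb{P}^{2k}$, so that elements of $V^{\otimes2}$ are bilinear forms on $\mathbb{P}^{2k}\times\mathbb{P}^{2k}$. If (the image of) $\tau$ in $E$ is not a $2$-torsion point, then the quadratic relations for $Q_{2k+1,k}(E,\tau)$ are exactly those elements of $V^{\otimes2}$ that vanish on the graph of the automorphism $$\sigma':S^kE\to S^kE,\qquad \sigma'(\!(z_1,\dots,z_k)\!)=(\!(z_1+\tau,\dots,z_k+\tau)\!),$$ where $S^kE$ is embedded in $\mathbb{P}^{2k}$ as the characteristic variety $X_{(2k+1)/k}$.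
   Context: **Elliptic curve and theta functions.** Fix $\eta\in\mathbb{C}$ with $\mathrm{Im}\,\eta>0$, $\Lambda=\mathbb{Z}+\mathbb{Z}\eta$, $E=\mathbb{C}/\Lambda$. Write $e(x)=e^{2\pi i x}$ and $\theta(z)=\sum_{m\in\mathbb{Z}}(-1)^m e\big(mz+\tfrac{m(m-1)}2\eta\big)$. For $\alpha\in\mathbb{Z}$ let $$\theta_\alpha(z)=e\Big(\alpha z+\tfrac{\alpha}{2n}+\tfrac{\alpha(\alpha-n)}{2n}\eta\Big)\prod_{m=0}^{n-1}\theta\Big(z+\tfrac mn+\tfrac{\alpha}{n}\eta\Big);$$ it depends only on $\alpha$ modulo $n$. **The algebra.** For coprime $n>k\ge1$ and $\tau\in\mathbb{C}\setminus\frac1n\Lambda$, $Q_{n,k}(E,\tau)$ is the free algebra $\mathbb{C}\langle x_0,\dots,x_{n-1}\rangle$ (indices in $\mathbb{Z}_n=\mathbb{Z}/n$) modulo the $n^2$ relations $$\sum_{r\in\mathbb{Z}_n}\frac{\theta_{j-i+r(k-1)}(0)}{\theta_{j-i-r}(-\tau)\,\theta_{kr}(\tau)}\,x_{j-r}x_{i+r}=0,\qquad (i,j)\in\mathbb{Z}_n^2 .$$ Its quadratic relations are the elements of the subspace of $V^{\otimes2}$ spanned by the left-hand sides. **Characteristic variety.** For $n=2k+1$ the negative continued fraction is $\frac{2k+1}{k}=[3,2,\dots,2]$ with $k-1$ twos; write $(n_1,\dots,n_k)=(3,2,\dots,2)$. Let $\mathcal{L}_{(2k+1)/k}=\mathcal{O}_{E^k}(D)$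 with $D=\sum_{i=1}^k E^{i-1}\times D_i\times E^{k-i}+\sum_{j=1}^{k-1}\Delta_{j,j+1}$, $D_i=(n_i-2+\delta_{i,1}+\delta_{i,k})(0)$, $\Delta_{j,j+1}=\{z\in E^k:z_j=z_{j+1}\}$. It is generated by its global sections, whose space has dimension $2k+1$. Let $\Phi:E^k\to\mathbb{P}^{2k}=\mathbb{P}(H^0(E^k,\mathcal{L}_{(2k+1)/k})^* )$ be the associated morphism; its image is $X_{(2k+1)/k}$. **The identification $x_\alpha=w_\alpha$.** $H^0(E^k,\mathcal{L}_{(2k+1)/k})$ is identified with the space of holomorphic functions $f$ on $\mathbb{C}^k$ that are $1$-periodic in each variable and satisfy $f(\dots,z_i+\eta,\dots)=(-1)^{n_i}e\big(-n_iz_i+z_{i-1}+z_{i+1}+(\delta_{i,1}-1)\eta\big)f(z)$ for $1\le i\le k$ ($z_0=z_{k+1}=0$). Put $k_i=k-i+1$ and $l_i=2i-1$ for $1\le i\le k$. The theta-function basis $\{w_\alpha\}_{\alpha\in\mathbb{Z}_n}$ satisfies $w_\alpha(z+\frac1n(l_1,\dots,l_k))=e(\frac{\alpha}{n})w_\alpha(z)$ and $w_\alpha(z+\frac{\eta}{n}(k_1,\dots,k_k))=c\,e(-z_1)\,w_{\alpha+1}(z)$ with $c\ne0$ a constant independent of $\alpha$. (These properties determine the basis up to replacing $w_\alpha$ by $\lambda\mu^\alpha w_\alpha$ with $\lambda\ne0$, $\mu^n=1$, which does not change the space of quadratic relations.) In these terms $\Phi(z)=(w_0(z),\dots,w_{2k}(z))$.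 **Symmetric power.** $S^kE=E^k/\mathfrak{S}_k$ is the symmetric power, and $(\!(z_1,\dots,z_k)\!)$ is the image of $(z_1,\dots,z_k)$. The map $\Phi$ factors as $E^k\xrightarrow{\rho}S^kE\xrightarrow{i}\mathbb{P}^{2k}$ with $\rho(z_1,\dots,z_k)=(\!(z_2-z_1,z_3-z_2,\dots,z_k-z_{k-1},-z_k)\!)$ and $i$ a closed immersion with image $X_{(2k+1)/k}$; this is the identification of $S^kE$ with $X_{(2k+1)/k}$. The graph of $\sigma'$ is regarded as the subset $\{(i(p),i(\sigma'(p))):p\in S^kE\}$ of $\mathbb{P}^{2k}\times\mathbb{P}^{2k}$. *)

theory Defs
  imports "HOL-Analysis.Analysis" "HOL-Library.Function_Algebras" "HOL-Library.Multiset"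
begin

section \<open>Complex vector spaces of functions\<close>

definition fscale :: "complex \<Rightarrow> ('a \<Rightarrow> complex) \<Rightarrow> 'a \<Rightarrow> complex" where
  "fscale c f = (\<lambda>x. c * f x)"

interpretation cfun: vector_space "fscale :: complex \<Rightarrow> ('a \<Rightarrow> complex) \<Rightarrow> 'a \<Rightarrow> complex"
  by unfold_locales (simp_all add: fscale_def fun_eq_iff algebra_simps)


section \<open>Elliptic curve and theta functions\<close>

definition ee :: "complex \<Rightarrow> complex" where
  "ee x = exp (2 * of_real pi * \<i> * x)"

definition period_lattice :: "complex \<Rightarrow> complex set" where
  "period_lattice eta = {of_int a + of_int b * eta | a b. True}"

definition lattice_rel :: "complex \<Rightarrow> (complex \<times> complex) set" where
  "lattice_rel eta = {(x, y). x - y \<in> period_lattice eta}"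

definition ell_curve :: "complex \<Rightarrow> complex set set" where
  "ell_curve eta = UNIV // lattice_rel eta"

definition ell_point :: "complex \<Rightarrow> complex \<Rightarrow> complex set" where
  "ell_point eta x = lattice_rel eta `` {x}"

definition theta :: "complex \<Rightarrow> complex \<Rightarrow> complex" where
  "theta eta z = (\<Sum>\<^sub>\<infinity>m\<in>(UNIV :: int set).
     (-1) powi m * ee (of_int m * z + of_int m * (of_int m - 1) / 2 * eta))"

definition theta_ind :: "nat \<Rightarrow> complex \<Rightarrow> int \<Rightarrow> complex \<Rightarrow> complex" where
  "theta_ind n eta \<alpha> z =
     ee (of_int \<alpha> * z + of_int \<alpha> / (2 * of_nat n)
         + of_int \<alpha> * (of_int \<alpha> - of_nat n) / (2 * of_nat n) * eta)
     * (\<Prod>m<n. theta eta (z + of_nat m / of_nat n + of_int \<alpha> / of_nat n * eta))"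


section \<open>The quadratic relations of the algebra\<close>

text \<open>\<open>\<int>\<^sub>n\<close> is represented by the residues \<open>0, \<dots>, n - 1\<close>. An element of \<open>V \<otimes> V\<close> is
  the array of its coefficients in the basis \<open>x\<^sub>a \<otimes> x\<^sub>b\<close>.\<close>

definition Zn :: "nat \<Rightarrow> int set" where
  "Zn n = {0..<int n}"

definition tensor_square :: "nat \<Rightarrow> (int \<times> int \<Rightarrow> complex) set" where
  "tensor_square n = {t. \<forall>p. p \<notin> Zn n \<times> Zn n \<longrightarrow> t p = 0}"

definition xx :: "nat \<Rightarrow> int \<Rightarrow> int \<Rightarrow> int \<times> int \<Rightarrow> complex" where
  "xx n a b = (\<lambda>p. if p = (a mod int n, b mod int n) then 1 else 0)"

definition relation :: "nat \<Rightarrow> nat \<Rightarrow> complex \<Rightarrow> complex \<Rightarrow> int \<Rightarrow> int \<Rightarrow> int \<times> int \<Rightarrow> complex" where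
  "relation n k eta tau i j =
     (\<Sum>r\<in>Zn n. fscale
        (theta_ind n eta (j - i + r * (int k - 1)) 0
          / (theta_ind n eta (j - i - r) (- tau) * theta_ind n eta (int k * r) tau))
        (xx n (j - r) (i + r)))"

definition quadratic_relations :: "nat \<Rightarrow> nat \<Rightarrow> complex \<Rightarrow> complex \<Rightarrow> (int \<times> int \<Rightarrow> complex) set" where
  "quadratic_relations n k eta tau =
     cfun.span {relation n k eta tau i j | i j. i \<in> Zn n \<and> j \<in> Zn n}"


section \<open>Sections of the line bundle\<close>

text \<open>Points of \<open>\<complex>\<^sup>k\<close> have coordinates \<open>z 1, \<dots>, z k\<close>, the others being \<open>0\<close>; in particular
  \<open>z 0 = z (k + 1) = 0\<close>, as used in the quasi-periodicity below.\<close>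

definition Ck :: "nat \<Rightarrow> (nat \<Rightarrow> complex) set" where
  "Ck k = {z. \<forall>i. i \<notin> {1..k} \<longrightarrow> z i = 0}"

text \<open>Complex (Frechet) differentiability at every point of \<open>\<complex>\<^sup>k\<close>; the derivative is
  \<open>h \<mapsto> \<Sum>\<^sub>i d\<^sub>i h\<^sub>i\<close>.\<close>

definition holomorphic_Ck :: "nat \<Rightarrow> ((nat \<Rightarrow> complex) \<Rightarrow> complex) \<Rightarrow> bool" where
  "holomorphic_Ck k f \<longleftrightarrow>
     (\<forall>z\<in>Ck k. \<exists>d :: nat \<Rightarrow> complex. \<forall>\<epsilon>>0. \<exists>\<delta>>0. \<forall>h\<in>Ck k.
        (\<Sum>i=1..k. cmod (h i)) < \<delta> \<longrightarrow>
        cmod (f (\<lambda>i. z i + h i) - f z - (\<Sum>i=1..k. d i * h i)) \<le> \<epsilon> * (\<Sum>i=1..k. cmod (h i)))"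

text \<open>The entries \<open>(3, 2, \<dots>, 2)\<close> of the negative continued fraction of \<open>(2k + 1) / k\<close>.\<close>

definition ncf :: "nat \<Rightarrow> nat" where
  "ncf i = (if i = 1 then 3 else 2)"

text \<open>Functions on \<open>\<complex>\<^sup>k\<close> are extended by \<open>0\<close> outside \<^term>\<open>Ck k\<close>, which makes \<open>H0\<close> a linear
  subspace of the full function space.\<close>

definition H0 :: "nat \<Rightarrow> complex \<Rightarrow> ((nat \<Rightarrow> complex) \<Rightarrow> complex) set" where
  "H0 k eta = {f. (\<forall>z. z \<notin> Ck k \<longrightarrow> f z = 0) \<and> holomorphic_Ck k f \<and>
     (\<forall>z\<in>Ck k. \<forall>i\<in>{1..k}.
        f (z(i := z i + 1)) = f z \<and>
        f (z(i := z i + eta)) =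
          (-1) ^ ncf i
          * ee (- of_nat (ncf i) * z i + z (i - 1) + z (i + 1)
                + ((if i = 1 then 1 else 0) - 1) * eta)
          * f z)}"

text \<open>Translation of \<open>z\<close> by \<open>s (c\<^sub>1, \<dots>, c\<^sub>k)\<close>.\<close>

definition translate :: "nat \<Rightarrow> complex \<Rightarrow> (nat \<Rightarrow> nat) \<Rightarrow> (nat \<Rightarrow> complex) \<Rightarrow> nat \<Rightarrow> complex" where
  "translate k s c z = (\<lambda>i. if i \<in> {1..k} then z i + s * of_nat (c i) else z i)"

text \<open>The basis \<open>(w\<^sub>\<alpha>)\<close>, \<open>\<alpha> \<in> \<int>\<^sub>n\<close>, \<open>n = 2k + 1\<close>, of \<open>H0\<close> that is identified with
  \<open>(x\<^sub>\<alpha>)\<close>. These conditions determine it up to replacing \<open>w\<^sub>\<alpha>\<close> by \<open>\<lambda> \<mu>\<^sup>\<alpha> w\<^sub>\<alpha>\<close> with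
  \<open>\<lambda> \<noteq> 0\<close> and \<open>\<mu>\<^sup>n = 1\<close>. Only the values of \<open>w\<close> on \<^term>\<open>Zn n\<close> are relevant.\<close>

definition theta_basis :: "nat \<Rightarrow> complex \<Rightarrow> (int \<Rightarrow> (nat \<Rightarrow> complex) \<Rightarrow> complex) \<Rightarrow> bool" where
  "theta_basis k eta w \<longleftrightarrow>
     (let n = 2 * k + 1 in
       inj_on w (Zn n) \<and> cfun.independent (w ` Zn n) \<and> cfun.span (w ` Zn n) = H0 k eta \<and>
       (\<forall>\<alpha>\<in>Zn n. \<forall>z\<in>Ck k.
          w \<alpha> (translate k (1 / of_nat n) (\<lambda>i. 2 * i - 1) z) = ee (of_int \<alpha> / of_nat n) * w \<alpha> z) \<and>
       (\<exists>c. c \<noteq> 0 \<and> (\<forall>\<alpha>\<in>Zn n. \<forall>z\<in>Ck k.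
          w \<alpha> (translate k (eta / of_nat n) (\<lambda>i. k - i + 1) z)
            = c * ee (- z 1) * w ((\<alpha> + 1) mod int n) z)))"


section \<open>The characteristic variety and the symmetric power\<close>

text \<open>The point \<open>[u]\<close> of projective space, as the set of all its homogeneous coordinate vectors.\<close>

definition proj_point :: "(int \<Rightarrow> complex) \<Rightarrow> (int \<Rightarrow> complex) set" where
  "proj_point u = {fscale c u | c. c \<noteq> 0}"

text \<open>The morphism \<open>\<Phi>(z) = (w\<^sub>0(z), \<dots>, w\<^sub>2\<^sub>k(z))\<close>, written on the universal cover \<open>\<complex>\<^sup>k\<close> of
  \<open>E\<^sup>k\<close>; its image is the characteristic variety.\<close>

definition Phi :: "nat \<Rightarrow> (int \<Rightarrow> (nat \<Rightarrow> complex) \<Rightarrow> complex) \<Rightarrow> (nat \<Rightarrow> complex) \<Rightarrow> (int \<Rightarrow> complex) set" where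
  "Phi k w z = proj_point (\<lambda>\<alpha>. if \<alpha> \<in> Zn (2 * k + 1) then w \<alpha> z else 0)"

definition char_variety :: "nat \<Rightarrow> (int \<Rightarrow> (nat \<Rightarrow> complex) \<Rightarrow> complex) \<Rightarrow> (int \<Rightarrow> complex) set set" where
  "char_variety k w = Phi k w ` Ck k"

text \<open>Points of the symmetric power are unordered \<open>k\<close>-tuples, that is multisets of size \<open>k\<close>, of
  points of \<open>E\<close>; \<open>sym_point eta k z\<close> is the image of \<open>(z\<^sub>1, \<dots>, z\<^sub>k)\<close>.\<close>

definition sym_power :: "complex \<Rightarrow> nat \<Rightarrow> complex set multiset set" where
  "sym_power eta k = {M. size M = k \<and> set_mset M \<subseteq> ell_curve eta}"

definition sym_point :: "complex \<Rightarrow> nat \<Rightarrow> (nat \<Rightarrow> complex) \<Rightarrow> complex set multiset" where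
  "sym_point eta k z = image_mset (\<lambda>i. ell_point eta (z i)) (mset_set {1..k})"

text \<open>The last entry is \<open>- z\<^sub>k\<close> since \<open>z (k + 1) = 0\<close> on \<^term>\<open>Ck k\<close>.\<close>

definition rho :: "complex \<Rightarrow> nat \<Rightarrow> (nat \<Rightarrow> complex) \<Rightarrow> complex set multiset" where
  "rho eta k z = sym_point eta k (\<lambda>i. z (i + 1) - z i)"

text \<open>The map \<open>i\<close> with \<open>i \<circ> \<rho> = \<Phi>\<close>.\<close>

definition sym_embedding ::
    "nat \<Rightarrow> complex \<Rightarrow> (int \<Rightarrow> (nat \<Rightarrow> complex) \<Rightarrow> complex) \<Rightarrow> complex set multiset \<Rightarrow> (int \<Rightarrow> complex) set" where
  "sym_embedding k eta w p =
     (THE q. q \<in> char_variety k w \<and> (\<exists>z\<in>Ck k. rho eta k z = p \<and> Phi k w z = q))"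

text \<open>Translation of every point of the multiset by \<open>\<tau>\<close>; a point of \<open>E\<close> is a coset of the
  lattice.\<close>

definition sigma' :: "complex \<Rightarrow> complex set multiset \<Rightarrow> complex set multiset" where
  "sigma' tau M = image_mset (\<lambda>P. (\<lambda>x. x + tau) ` P) M"

definition graph_sigma' ::
    "nat \<Rightarrow> complex \<Rightarrow> complex \<Rightarrow> (int \<Rightarrow> (nat \<Rightarrow> complex) \<Rightarrow> complex) \<Rightarrow> ((int \<Rightarrow> complex) set \<times> (int \<Rightarrow> complex) set) set" where
  "graph_sigma' k eta tau w =
     {(sym_embedding k eta w p, sym_embedding k eta w (sigma' tau p)) | p. p \<in> sym_power eta k}"

definition vanishes_at ::
    "nat \<Rightarrow> (int \<times> int \<Rightarrow> complex) \<Rightarrow> (int \<Rightarrow> complex) set \<Rightarrow> (int \<Rightarrow> complex) set \<Rightarrow> bool" where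
  "vanishes_at n t P Q \<longleftrightarrow>
     (\<forall>u\<in>P. \<forall>v\<in>Q. (\<Sum>a\<in>Zn n. \<Sum>b\<in>Zn n. t (a, b) * u a * v b) = 0)"

end

(*
  In the coordinates y_j = z_{j+1} - z_j of the symmetric power, write W_a for the basis and, for
  parameters A, B, let R(A,B) be the linear operator on V (x) V that maps x_i (x) x_j to the sum of
  th_{j-i+r(k-1)}(A+B) / (th_{j-i-r}(A) th_{kr}(B)) x_{j-r} (x) x_{i+r}, denominators cleared. The
  relations span the image of R(-tau,tau).

  A three-term identity with a free parameter e evaluates the relations at the pairs (y, y') where
  y' is y shifted by A + 2B in all coordinates and by n(e-B) in the last one: the difference of its
  sides is a theta function of negative order on a suitable line. Let K(x) be the space of
  bilinear forms vanishing at all pairs (y, y + x). For e = B the identity gives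
  R(A,B) t in K(A+2B) iff t in K(2B-A), so that the image of R(-tau,tau) lies in K(tau), and
  dim K(x) does not depend on x because R(A,B) is injective for generic A, B. Equality then
  follows from dim ker R(-tau,tau) + dim K <= n^2. The identity shows that the kernel meets
  K(3 tau) trivially when 2 n tau is not in the lattice; otherwise an element of the kernel is
  in K(3 tau) as soon as it vanishes at n suitable pairs, and 2 dim K <= n^2 - n since K(0) contains no
  nonzero symmetric tensor. Vanishing of bilinear forms is propagated throughout by counting zeros
  of theta functions in one variable.
*)

theory Submission
  imports Defs "HOL-Complex_Analysis.Complex_Analysis" "HOL-Combinatorics.Permutations"
begin

text \<open>The combinations A + 2 B and 2 B - A explain the constants: at (A, B) = (-tau, tau) they
  are tau and 3 tau, and the coefficient \<open>TT (A + B)\<close> of the diagonal value vanishes,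
  so that every image satisfies the conditions of K(tau). The value of dim K is never computed:
  K(tau) and K(3 tau) have the same dimension, and the kernel is measured against K(3 tau). The
  parameter e gives access to pairs off the diagonal. At e = -A one of the two products disappears,
  and a form in the kernel is seen to vanish on a second family of pairs, shifted in one coordinate
  by some c. Vanishing on a diagonal and on one such family with c outside Lambda forces the form to
  be zero. For R(-tau, tau) the shift is c = -2 n tau, so this fails exactly when 2 n tau is in
  Lambda. Then n tau is a half period, and the same identity says that the zeros of the form on the
  diagonal are invariant under moving one coordinate by n tau. Every zero thus comes with a second
  one, which reduces vanishing to n evaluations; the bound on 2 dim K absorbs the loss of n
  dimensions.\<close>

section \<open>The exponential \<open>ee\<close> and entire functions of one variable\<close>

lemma ee_add: "ee (x + y) = ee x * ee y"
  by (simp add: ee_def distrib_left exp_add)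

lemma ee_0 [simp]: "ee 0 = 1"
  by (simp add: ee_def)

lemma ee_nonzero [simp]: "ee x \<noteq> 0"
  by (simp add: ee_def)

lemma ee_minus: "ee (- x) = inverse (ee x)"
  by (simp add: ee_def exp_minus)

lemma ee_diff: "ee (x - y) = ee x / ee y"
  using ee_add[of x "-y"] by (simp add: ee_minus field_simps)

lemma ee_eq_1_iff: "ee x = 1 \<longleftrightarrow> x \<in> \<int>"
proof -
  have "ee x = 1 \<longleftrightarrow> (\<exists>n::int. x = of_int n)"
    unfolding ee_def exp_eq_1
  proof (safe)
    fix n :: int
    assume 1: "Re (2 * of_real pi * \<i> * x) = 0" and 2: "Im (2 * of_real pi * \<i> * x) = of_int (2 * n) * pi"
    have "Im x = 0" using 1 by simp
    moreover have "Re x = of_int n" using 2 by simp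
    ultimately show "\<exists>n::int. x = of_int n" by (intro exI[of _ n]) (simp add: complex_eq_iff)
  qed (auto intro!: exI)
  thus ?thesis by (auto simp: Ints_def)
qed

lemma ee_of_int [simp]: "ee (of_int m) = 1"
  by (simp add: ee_eq_1_iff)

lemma ee_1 [simp]: "ee 1 = 1"
  using ee_of_int[of 1] by simp

lemma ee_of_nat [simp]: "ee (of_nat m) = 1"
  using ee_of_int[of "int m"] by simp

lemma ee_eqI: "x - y \<in> \<int> \<Longrightarrow> ee x = ee y"
  by (metis diff_add_cancel ee_add ee_eq_1_iff mult_1)

lemma ee_half [simp]: "ee (1/2) = -1"
  by (simp add: ee_def mult.commute[of _ \<i>])

lemma ee_power: "ee x ^ m = ee (of_nat m * x)"
  by (induction m) (simp_all add: ee_add algebra_simps)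

lemma norm_ee: "norm (ee x) = exp (- 2 * pi * Im x)"
  by (simp add: ee_def norm_exp_eq_Re)

lemma ee_holomorphic [holomorphic_intros]: "f holomorphic_on S \<Longrightarrow> (\<lambda>x. ee (f x)) holomorphic_on S"
  unfolding ee_def by (intro holomorphic_intros)

lemma entire_compose:
  assumes "f holomorphic_on UNIV" "g holomorphic_on S"
  shows "(\<lambda>x. f (g x)) holomorphic_on S"
  using holomorphic_on_compose_gen[OF assms(2,1)] by (auto simp: o_def)

lemma entire_deriv_has:
  "f holomorphic_on UNIV \<Longrightarrow> (f has_field_derivative deriv f z) (at z)"
  by (simp add: holomorphic_derivI)

lemma entire_continuous: "f holomorphic_on UNIV \<Longrightarrow> isCont f z"
  using holomorphic_on_imp_continuous_on[of f UNIV] by (simp add: continuous_on_eq_continuous_at)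

lemma isCont_eventually_nonzero:
  fixes f :: "complex \<Rightarrow> complex"
  assumes "isCont f a" "f a \<noteq> 0"
  shows "\<forall>\<^sub>F w in nhds a. f w \<noteq> 0"
proof -
  have "(f \<longlongrightarrow> f a) (nhds a)" using assms(1) by (simp add: isCont_def tendsto_at_iff_tendsto_nhds)
  thus ?thesis using assms(2) by (rule tendsto_imp_eventually_ne)
qed

text \<open>By continuity a nonzero value would persist on a disk, and a disk is uncountable. This
  is the device by which genericity conditions are dropped later: each of them excludes only
  countably many parameters.\<close>

lemma entire_zero_off_countable:
  assumes f: "f holomorphic_on UNIV" and C: "countable C" and z: "\<And>z. z \<notin> C \<Longrightarrow> f z = 0"
  shows "f z = 0"
proof (rule ccontr)
  assume nz: "f z \<noteq> 0"
  have "isCont f z" using f by (rule entire_continuous)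
  then have "\<forall>\<^sub>F w in nhds z. f w \<noteq> 0"
    using nz by (rule isCont_eventually_nonzero)
  then obtain e where e: "e > 0" "\<And>w. dist w z < e \<Longrightarrow> f w \<noteq> 0"
    by (auto simp: eventually_nhds_metric)
  have "ball z e \<subseteq> C"
  proof
    fix w assume "w \<in> ball z e"
    then have "f w \<noteq> 0" using e(2)[of w] by (simp add: dist_commute)
    thus "w \<in> C" using z by blast
  qed
  then have "countable (ball z e)" using C countable_subset by blast
  thus False using e(1) using uncountable_ball[of e z] by simp
qed

text \<open>All zeros of g are simple and f vanishes at them, so the singularities of f / g are
  removable. The value of h at such a zero is exported because it tells whether f has a double zero
  there.\<close>

lemma entire_division:
  assumes f: "f holomorphic_on UNIV" and g: "g holomorphic_on UNIV"
    and z: "\<And>z. g z = 0 \<Longrightarrow> f z = 0 \<and> deriv g z \<noteq> 0"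
  obtains h where "h holomorphic_on UNIV" "\<And>z. f z = g z * h z"
    "\<And>z. g z = 0 \<Longrightarrow> h z = deriv f z / deriv g z"
proof
  define h where "h z = (if g z = 0 then deriv f z / deriv g z else f z / g z)" for z
  show "f z = g z * h z" for z using z by (simp add: h_def)
  show "g z = 0 \<Longrightarrow> h z = deriv f z / deriv g z" for z by (simp add: h_def)
  show "h holomorphic_on UNIV"
  proof (rule holomorphic_onI)
    fix a :: complex
    \<comment> \<open>Near a zero a of g the quotient f / g equals the quotient of the difference
      quotients at a; these are entire, and the lower one is nonzero at a.\<close>
    define f1 where "f1 = (\<lambda>z. if z = a then deriv f a else (f z - f a) / (z - a))"
    define g1 where "g1 = (\<lambda>z. if z = a then deriv g a else (g z - g a) / (z - a))"
    have f1: "f1 holomorphic_on UNIV" unfolding f1_def by (rule pole_lemma_open[OF f open_UNIV])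
    have g1: "g1 holomorphic_on UNIV" unfolding g1_def by (rule pole_lemma_open[OF g open_UNIV])
    show "h field_differentiable at a within UNIV"
    proof (cases "g a = 0")
      case True
      have fa: "f a = 0" "deriv g a \<noteq> 0" using z[OF True] by auto
      have "g1 a \<noteq> 0" using fa by (simp add: g1_def)
      moreover have "isCont g1 a" using g1 by (rule entire_continuous)
      ultimately have "\<forall>\<^sub>F w in nhds a. g1 w \<noteq> 0"
        by (intro isCont_eventually_nonzero)
      then have ev: "\<forall>\<^sub>F w in nhds a. h w = f1 w / g1 w"
      proof (eventually_elim)
        case (elim w)
        show ?case
        proof (cases "w = a")
          case True thus ?thesis using \<open>g a = 0\<close> by (simp add: h_def f1_def g1_def)
        next
          case False
          hence "g w \<noteq> 0" using elim \<open>g a = 0\<close> by (simp add: g1_def)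
          thus ?thesis using False \<open>g a = 0\<close> fa by (simp add: h_def f1_def g1_def)
        qed
      qed
      have "(\<lambda>w. f1 w / g1 w) field_differentiable at a"
        using f1 g1 \<open>g1 a \<noteq> 0\<close> by (intro field_differentiable_divide) (auto simp: holomorphic_on_def)
      then obtain D where "((\<lambda>w. f1 w / g1 w) has_field_derivative D) (at a)"
        by (auto simp: field_differentiable_def)
      then have "(h has_field_derivative D) (at a)"
        using DERIV_cong_ev[OF refl ev refl] by simp
      thus ?thesis by (auto simp: field_differentiable_def)
    next
      case False
      moreover have "isCont g a" using g by (rule entire_continuous)
      ultimately have "\<forall>\<^sub>F w in nhds a. g w \<noteq> 0"
        by (intro isCont_eventually_nonzero)
      then have ev: "\<forall>\<^sub>F w in nhds a. h w = f w / g w"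
        by eventually_elim (simp add: h_def)
      have "(\<lambda>w. f w / g w) field_differentiable at a"
        using f g False by (intro field_differentiable_divide) (auto simp: holomorphic_on_def)
      then obtain D where "((\<lambda>w. f w / g w) has_field_derivative D) (at a)"
        by (auto simp: field_differentiable_def)
      then have "(h has_field_derivative D) (at a)"
        using DERIV_cong_ev[OF refl ev refl] by simp
      thus ?thesis by (auto simp: field_differentiable_def)
    qed
  qed
qed

text \<open>The values of f may have any type. Applied to truth values, the lemma carries a property
  such as f z = 0 along a period for which f itself only has a multiplier.\<close>

lemma shift_int_period:
  assumes "\<And>z::complex. f (z + p) = f z"
  shows "f (z + of_int m * p) = f z"
proof (induction m rule: int_induct[where k = 0])
  case (step1 i)
  have "f (z + of_int (i + 1) * p) = f ((z + of_int i * p) + p)" by (simp add: algebra_simps)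
  thus ?case using step1 assms by simp
next
  case (step2 i)
  have "f (z + of_int i * p) = f ((z + of_int (i - 1) * p) + p)" by (simp add: algebra_simps)
  thus ?case using step2 assms by simp
qed simp

section \<open>The lattice Lambda and doubly periodic functions\<close>

locale half_plane =
  fixes eta :: complex
  assumes Im_eta: "Im eta > 0"
begin

text \<open>Every value is already taken on the period parallelogram, which lies in the compact disk
  of radius 1 + |eta|, so Liouville's theorem applies.\<close>

lemma elliptic_entire_const:
  assumes f: "f holomorphic_on UNIV" and 1: "\<And>z. f (z + 1) = f z" and 2: "\<And>z. f (z + eta) = f z"
  shows "f z = f w"
proof -
  define R where "R = 1 + norm eta"
  have "f z \<in> f ` cball 0 R" for z
  proof -
    \<comment> \<open>Reduction to the parallelogram: b removes the integral part of the
      eta-coordinate of z; what remains after the fractional part t of that coordinate is real, and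
      a removes its integral part.\<close>
    define b where "b = \<lfloor>Im z / Im eta\<rfloor>"
    define z1 where "z1 = z + of_int (- b) * eta"
    define a where "a = \<lfloor>Re (z - of_int b * eta - of_real (frac (Im z / Im eta)) * eta)\<rfloor>"
    define u where "u = z + of_int (-b) * eta + of_int (-a) * 1"
    have fu: "f u = f z" unfolding u_def using shift_int_period[of f 1] shift_int_period[of f eta] 1 2 by metis
    define t where "t = frac (Im z / Im eta)"
    define v where "v = z - of_int b * eta - of_real t * eta"
    have "Im v = 0" using Im_eta unfolding v_def t_def b_def frac_def
      by (simp add: field_simps)
    then have "v = of_real (Re v)" by (simp add: complex_eq_iff)
    have "u = v + of_real t * eta - of_int a" unfolding u_def v_def by simp
    also have "\<dots> = of_real (frac (Re v)) + of_real t * eta"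
      by (subst \<open>v = of_real (Re v)\<close>) (simp add: frac_def a_def v_def t_def complex_eq_iff)
    finally have "norm u \<le> norm (of_real (frac (Re v)) :: complex) + norm (of_real t * eta)"
      by (metis norm_triangle_ineq)
    also have "\<dots> \<le> 1 + 1 * norm eta"
      by (intro add_mono) (auto simp: norm_mult t_def frac_lt_1 less_imp_le intro!: mult_left_le_one_le)
    finally have "u \<in> cball 0 R" by (simp add: R_def)
    thus ?thesis using fu by (metis imageI)
  qed
  then have "range f \<subseteq> f ` cball 0 R" by auto
  moreover have "compact (f ` cball 0 R)"
    by (intro compact_continuous_image holomorphic_on_imp_continuous_on holomorphic_on_subset[OF f]) auto
  ultimately have "bounded (range f)" using bounded_subset compact_imp_bounded by blast
  then have "f constant_on UNIV" using f Liouville_theorem by blast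
  thus ?thesis by (auto simp: constant_on_def)
qed

definition Lam :: "complex set" where "Lam = period_lattice eta"

lemma Lam_iff: "x \<in> Lam \<longleftrightarrow> (\<exists>a b :: int. x = of_int a + of_int b * eta)"
  by (auto simp: Lam_def period_lattice_def)

lemma Lam_0 [simp]: "0 \<in> Lam"
  unfolding Lam_iff by (rule exI[of _ 0], rule exI[of _ 0]) simp

lemma Lam_add: "x \<in> Lam \<Longrightarrow> y \<in> Lam \<Longrightarrow> x + y \<in> Lam"
proof -
  assume "x \<in> Lam" "y \<in> Lam"
  then obtain a b c d :: int where "x = of_int a + of_int b * eta" "y = of_int c + of_int d * eta"
    by (auto simp: Lam_iff)
  then have "x + y = of_int (a + c) + of_int (b + d) * eta" by (simp add: algebra_simps)
  thus ?thesis unfolding Lam_iff by blast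
qed

lemma Lam_minus: "x \<in> Lam \<Longrightarrow> - x \<in> Lam"
proof -
  assume "x \<in> Lam"
  then obtain a b :: int where "x = of_int a + of_int b * eta" by (auto simp: Lam_iff)
  then have "- x = of_int (- a) + of_int (- b) * eta" by simp
  thus ?thesis unfolding Lam_iff by blast
qed

lemma Lam_diff: "x \<in> Lam \<Longrightarrow> y \<in> Lam \<Longrightarrow> x - y \<in> Lam"
  using Lam_add[of x "-y"] Lam_minus by simp

lemma Lam_minus_iff: "- x \<in> Lam \<longleftrightarrow> x \<in> Lam"
  using Lam_minus by force

lemma Lam_mult_int: "x \<in> Lam \<Longrightarrow> of_int m * x \<in> Lam"
proof -
  assume "x \<in> Lam"
  then obtain a b :: int where "x = of_int a + of_int b * eta" by (auto simp: Lam_iff)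
  then have "of_int m * x = of_int (m * a) + of_int (m * b) * eta" by (simp add: algebra_simps)
  thus ?thesis unfolding Lam_iff by blast
qed

lemma Lam_mult_nat: "x \<in> Lam \<Longrightarrow> of_nat m * x \<in> Lam"
  using Lam_mult_int[of x "int m"] by simp

lemma Lam_basis [simp]: "of_int a + of_int b * eta \<in> Lam" "of_int a \<in> Lam" "eta \<in> Lam" "1 \<in> Lam"
proof -
  show 1: "of_int a + of_int b * eta \<in> Lam" for a b unfolding Lam_iff by blast
  show "of_int a \<in> Lam" using 1[of a 0] by simp
  show "eta \<in> Lam" using 1[of 0 1] by simp
  show "1 \<in> Lam" using 1[of 1 0] by simp
qed

lemma countable_Lam: "countable Lam"
proof -
  have "Lam \<subseteq> (\<lambda>(a::int,b::int). of_int a + of_int b * eta) ` UNIV"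
  proof
    fix x assume "x \<in> Lam"
    then obtain a b :: int where "x = of_int a + of_int b * eta" by (auto simp: Lam_iff)
    then have "x = (\<lambda>(a::int,b::int). of_int a + of_int b * eta) (a, b)" by simp
    thus "x \<in> (\<lambda>(a::int,b::int). of_int a + of_int b * eta) ` UNIV" by blast
  qed
  thus ?thesis by (rule countable_subset) (intro countable_image countableI_type)
qed

text \<open>The exceptional sets of parameters are unions of sets of this form, which is why later
  conditions are written as c * u + d in \<open>Lam\<close> with an explicit coefficient c.\<close>

lemma countable_affine_Lam:
  assumes "c \<noteq> 0"
  shows "countable {u. c * u + d \<in> Lam}"
proof -
  have "{u. c * u + d \<in> Lam} \<subseteq> (\<lambda>l. (l - d) / c) ` Lam"
  proof
    fix u assume "u \<in> {u. c * u + d \<in> Lam}"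
    moreover have "u = ((c * u + d) - d) / c" using assms by simp
    ultimately show "u \<in> (\<lambda>l. (l - d) / c) ` Lam" by blast
  qed
  thus ?thesis by (rule countable_subset) (intro countable_image countable_Lam)
qed

lemma eta_coeffs_eq:
  assumes "of_real a + of_real b * eta = of_real c + of_real d * eta"
  shows "a = c \<and> b = d"
proof -
  have "Im (of_real a + of_real b * eta) = Im (of_real c + of_real d * eta)" using assms by simp
  then have "b * Im eta = d * Im eta" by simp
  then have "b = d" using Im_eta by simp
  thus ?thesis using assms by simp
qed

lemma half_not_Lam: "(1::complex)/2 \<notin> Lam" "eta/2 \<notin> Lam" "(1+eta)/2 \<notin> Lam"
proof -
  have *: False if mem: "of_real a + of_real b * eta \<in> Lam" and ni: "a \<notin> \<int> \<or> b \<notin> \<int>" for a b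
  proof -
    obtain m l :: int where "of_real a + of_real b * eta = of_int m + of_int l * eta"
      using mem unfolding Lam_iff by blast
    then have "of_real a + of_real b * eta = of_real (of_int m) + of_real (of_int l) * eta" by simp
    from eta_coeffs_eq[OF this] ni show False by auto
  qed
  have h: "(1/2::real) \<notin> \<int>"
  proof
    assume "(1/2::real) \<in> \<int>"
    then obtain m :: int where "(1/2::real) = of_int m" by (auto simp: Ints_def)
    then have "(1::real) = of_int (2 * m)" by simp
    then have "1 = 2 * m" by linarith
    thus False by presburger
  qed
  show "(1::complex)/2 \<notin> Lam" using *[of "1/2" 0] h by auto
  show "eta/2 \<notin> Lam" using *[of 0 "1/2"] h by auto
  show "(1+eta)/2 \<notin> Lam" using *[of "1/2" "1/2"] h by (auto simp: add_divide_distrib)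
qed

section \<open>Products and theta functions\<close>

definition nome :: complex where "nome = ee eta"

lemma nome_less_1: "norm nome < 1"
  unfolding nome_def norm_ee using Im_eta by simp

lemma nome_nonzero [simp]: "nome \<noteq> 0" by (simp add: nome_def)

text \<open>The product of 1 - q^m e(z) over m >= 1 with q = \<open>nome\<close>; \<open>lim\<close>
  takes its intended value by \<open>half_prod_uniform\<close>.\<close>

definition half_prod :: "complex \<Rightarrow> complex" where
  "half_prod z = lim (\<lambda>N. \<Prod>m<N. 1 - nome ^ (m + 1) * ee z)"

lemma half_prod_uniform:
  assumes "compact X"
  shows "uniform_limit X (\<lambda>N z. \<Prod>m<N. 1 - nome ^ (m + 1) * ee z) half_prod sequentially"
proof -
  have cont: "continuous_on A ee" for A unfolding ee_def by (intro continuous_intros)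
  obtain K where K: "\<And>z. z \<in> X \<Longrightarrow> norm (ee z) \<le> K" "K > 0"
  proof -
    have "bounded (ee ` X)" using assms cont compact_continuous_image compact_imp_bounded by blast
    then obtain K where "\<And>z. z \<in> X \<Longrightarrow> norm (ee z) \<le> K" by (auto simp: bounded_iff)
    then show ?thesis using that[of "max K 1"] by force
  qed
  have "uniformly_convergent_on X (\<lambda>N z. \<Sum>m<N. norm ((1 - nome ^ (m + 1) * ee z) - 1))"
  proof (rule Weierstrass_m_test'_ev)
    show "\<forall>\<^sub>F m in sequentially. \<forall>z\<in>X. norm (norm ((1 - nome ^ (m + 1) * ee z) - 1)) \<le> norm nome ^ m * K"
    proof (intro always_eventually allI ballI)
      fix m z assume "z \<in> X"
      have "norm ((1 - nome ^ (m + 1) * ee z) - 1) = norm nome ^ (m+1) * norm (ee z)"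
        by (simp add: norm_mult norm_power)
      also have "\<dots> \<le> norm nome ^ m * K"
        using nome_less_1 K(1)[OF \<open>z \<in> X\<close>]
        by (intro mult_mono power_decreasing) auto
      finally show "norm (norm ((1 - nome ^ (m + 1) * ee z) - 1)) \<le> norm nome ^ m * K" by simp
    qed
    show "summable (\<lambda>m. norm nome ^ m * K)"
      using nome_less_1 by (intro summable_mult2 summable_geometric) simp
  qed
  then have "uniformly_convergent_on X (\<lambda>N z. \<Prod>m<N. 1 - nome ^ (m + 1) * ee z)"
    by (intro uniformly_convergent_on_prod') (auto intro!: continuous_intros cont assms)
  thus ?thesis unfolding half_prod_def uniformly_convergent_uniform_limit_iff .
qed

lemma half_prod_LIMSEQ: "(\<lambda>N. \<Prod>m<N. 1 - nome ^ (m + 1) * ee z) \<longlonglongrightarrow> half_prod z"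
  using tendsto_uniform_limitI[OF half_prod_uniform[of "{z}"]] by simp

lemma half_prod_holomorphic: "half_prod holomorphic_on UNIV"
proof (rule holomorphic_uniform_sequence[of UNIV "\<lambda>N z. \<Prod>m<N. 1 - nome ^ (m + 1) * ee z"])
  show "\<exists>d>0. cball x d \<subseteq> UNIV \<and> uniform_limit (cball x d) (\<lambda>N z. \<Prod>m<N. 1 - nome ^ (m + 1) * ee z) half_prod sequentially" for x
    by (intro exI[of _ 1] conjI half_prod_uniform) auto
qed (auto intro!: holomorphic_intros)

lemma half_prod_1: "half_prod (z + 1) = half_prod z"
  unfolding half_prod_def by (simp add: ee_add)

lemma half_prod_eta: "half_prod z = (1 - nome * ee z) * half_prod (z + eta)"
proof -
  have "(\<lambda>N. \<Prod>m<Suc N. 1 - nome ^ (m + 1) * ee z) \<longlonglongrightarrow> half_prod z"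
    using half_prod_LIMSEQ LIMSEQ_Suc by blast
  moreover have "(\<Prod>m<Suc N. 1 - nome ^ (m + 1) * ee z) =
      (1 - nome * ee z) * (\<Prod>m<N. 1 - nome ^ (m + 1) * ee (z + eta))" for N
    unfolding prod.lessThan_Suc_shift by (simp add: ee_add nome_def algebra_simps)
  moreover have "(\<lambda>N. (1 - nome * ee z) * (\<Prod>m<N. 1 - nome ^ (m + 1) * ee (z + eta)))
       \<longlonglongrightarrow> (1 - nome * ee z) * half_prod (z + eta)"
    by (intro tendsto_mult tendsto_const half_prod_LIMSEQ)
  ultimately show ?thesis by (simp add: LIMSEQ_unique)
qed

text \<open>An absolutely convergent product vanishes only if one of its factors does.\<close>

lemma half_prod_nonzero:
  assumes "\<And>m. nome ^ (m + 1) * ee z \<noteq> 1"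
  shows "half_prod z \<noteq> 0"
proof -
  have "summable (\<lambda>m. norm nome ^ m * (norm nome * norm (ee z)))"
    using nome_less_1 by (intro summable_mult2 summable_geometric) simp
  then have "summable (\<lambda>m. norm ((1 - nome ^ (m + 1) * ee z) - 1))"
    by (simp add: norm_mult norm_power mult_ac)
  then have "abs_convergent_prod (\<lambda>m. 1 - nome ^ (m + 1) * ee z)"
    by (rule summable_imp_abs_convergent_prod)
  then have "convergent_prod (\<lambda>m. 1 - nome ^ (m + 1) * ee z)"
    by (rule abs_convergent_prod_imp_convergent_prod)
  moreover from this have "(\<lambda>N. \<Prod>m\<le>N. 1 - nome ^ (m + 1) * ee z) \<longlonglongrightarrow> prodinf (\<lambda>m. 1 - nome ^ (m + 1) * ee z)"
    by (rule convergent_prod_LIMSEQ)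
  moreover have "(\<lambda>N. \<Prod>m<Suc N. 1 - nome ^ (m + 1) * ee z) \<longlonglongrightarrow> half_prod z"
    using half_prod_LIMSEQ LIMSEQ_Suc by blast
  ultimately have "half_prod z = prodinf (\<lambda>m. 1 - nome ^ (m + 1) * ee z)"
    by (simp add: LIMSEQ_unique lessThan_Suc_atMost)
  moreover have "prodinf (\<lambda>m. 1 - nome ^ (m + 1) * ee z) \<noteq> 0"
    using assms by (intro prodinf_nonzero \<open>convergent_prod _\<close>) (auto simp: algebra_simps)
  ultimately show ?thesis by simp
qed

text \<open>The product side of Jacobi's triple product, up to a constant: it provides entire functions
  with known simple zeros before the zeros of the series \<open>theta\<close> are known.\<close>

definition tprod :: "complex \<Rightarrow> complex" where
  "tprod z = half_prod (z - eta) * half_prod (- z)"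

text \<open>Splitting off the factor 1 - e(z) isolates the zero at 0: the remaining product is
  nonzero there, which later gives simplicity.\<close>

lemma tprod_alt: "tprod z = (1 - ee z) * (half_prod z * half_prod (- z))"
  unfolding tprod_def using half_prod_eta[of "z - eta"] by (simp add: nome_def ee_diff)

lemma tprod_holomorphic: "tprod holomorphic_on UNIV"
  unfolding tprod_def
  by (intro holomorphic_intros entire_compose[OF half_prod_holomorphic])

lemma tprod_1: "tprod (z + 1) = tprod z"
proof -
  have "half_prod (z + 1 - eta) = half_prod (z - eta)"
    using half_prod_1[of "z - eta"] by (simp add: algebra_simps)
  moreover have "half_prod (- (z + 1)) = half_prod (- z)"
    using half_prod_1[of "- (z + 1)"] by simp
  ultimately show ?thesis by (simp add: tprod_def)
qed

lemma tprod_eta: "tprod (z + eta) = - ee (- z) * tprod z"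
proof -
  have 1: "half_prod (- z - eta) = (1 - ee (- z)) * half_prod (- z)"
    using half_prod_eta[of "- z - eta"] by (simp add: nome_def ee_diff)
  have "tprod (z + eta) = half_prod z * ((1 - ee (- z)) * half_prod (- z))"
    using 1 by (simp add: tprod_def)
  also have "1 - ee (- z) = - ee (- z) * (1 - ee z)"
    by (simp add: ee_minus field_simps)
  finally show ?thesis by (simp add: tprod_alt)
qed

lemma tprod_zero_Lam: "tprod z = 0 \<Longrightarrow> z \<in> Lam"
proof -
  assume "tprod z = 0"
  then have "ee z = 1 \<or> half_prod z = 0 \<or> half_prod (- z) = 0" by (auto simp: tprod_alt)
  then have "ee z = 1 \<or> (\<exists>m. nome ^ (m + 1) * ee z = 1) \<or> (\<exists>m. nome ^ (m + 1) * ee (- z) = 1)"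
    using half_prod_nonzero by blast
  then obtain l :: int where "ee (of_int l * eta + z) = 1"
  proof (elim disjE exE)
    assume "ee z = 1" thus thesis using that[of 0] by simp
  next
    fix m assume "nome ^ (m + 1) * ee z = 1"
    then have "ee (of_int (int (m + 1)) * eta + z) = 1" by (simp only: nome_def ee_power ee_add of_int_of_nat_eq)
    thus thesis by (rule that)
  next
    fix m assume "nome ^ (m + 1) * ee (- z) = 1"
    then have "ee (of_nat (m + 1) * eta + - z) = 1" by (simp only: nome_def ee_power ee_add)
    then have "ee (- (of_nat (m + 1) * eta + - z)) = 1" by (metis ee_minus inverse_1)
    then have "ee (of_int (- int (m + 1)) * eta + z) = 1" by (simp add: algebra_simps)
    thus thesis by (rule that)
  qed
  then obtain a :: int where "of_int l * eta + z = of_int a" by (auto simp: ee_eq_1_iff Ints_def)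
  then have "z = of_int a + of_int (- l) * eta" by (simp add: algebra_simps)
  thus "z \<in> Lam" unfolding Lam_iff by blast
qed

lemma tprod_0: "tprod 0 = 0" by (simp add: tprod_alt)

lemma half_prod_0: "half_prod 0 \<noteq> 0"
proof (rule half_prod_nonzero)
  fix m
  have "norm (nome ^ (m + 1)) < 1" unfolding norm_power using nome_less_1 by (intro power_less_one_iff[THEN iffD2]) auto
  thus "nome ^ (m + 1) * ee 0 \<noteq> 1" by auto
qed

lemma tprod_deriv_0: "deriv tprod 0 \<noteq> 0"
proof -
  have "((\<lambda>z. half_prod z * half_prod (- z)) has_field_derivative deriv (\<lambda>z. half_prod z * half_prod (- z)) 0) (at 0)"
    by (intro entire_deriv_has holomorphic_intros entire_compose[OF half_prod_holomorphic] half_prod_holomorphic)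
  moreover have "((\<lambda>z. 1 - ee z) has_field_derivative (- (2 * of_real pi * \<i>))) (at 0)"
    unfolding ee_def by (auto intro!: derivative_eq_intros)
  ultimately have "((\<lambda>z. (1 - ee z) * (half_prod z * half_prod (- z))) has_field_derivative
      (- (2 * of_real pi * \<i>)) * (half_prod 0 * half_prod (- 0))
        + deriv (\<lambda>z. half_prod z * half_prod (- z)) 0 * (1 - ee 0)) (at 0)"
    by (intro DERIV_mult)
  then have "((\<lambda>z. (1 - ee z) * (half_prod z * half_prod (- z))) has_field_derivative
      (- (2 * of_real pi * \<i>)) * (half_prod 0 * half_prod 0)) (at 0)"
    by simp
  then have "(tprod has_field_derivative (- (2 * of_real pi * \<i>)) * (half_prod 0 * half_prod 0)) (at 0)"
    by (simp add: tprod_alt[abs_def])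
  then have "deriv tprod 0 = (- (2 * of_real pi * \<i>)) * (half_prod 0 * half_prod 0)"
    by (rule DERIV_imp_deriv)
  thus ?thesis using half_prod_0 by simp
qed

text \<open>Since the multiplier u never vanishes, being a zero is a genuinely periodic
  property.\<close>

lemma quasi_zero_Lam:
  assumes "\<And>z. f (z + 1) = f z" "\<And>z. f (z + eta) = u z * f z" "\<And>z. u z \<noteq> (0::complex)" "l \<in> Lam"
  shows "f (z + l) = 0 \<longleftrightarrow> f z = 0"
proof -
  obtain a b :: int where l: "l = of_int a + of_int b * eta" using assms(4) by (auto simp: Lam_iff)
  have "f (z + of_int b * eta) = 0 \<longleftrightarrow> f z = 0"
    using shift_int_period[of "\<lambda>z. f z = 0" eta z b] assms(2,3) by simp
  moreover have "f (z + l) = f (z + of_int b * eta)"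
    using shift_int_period[of f 1 "z + of_int b * eta" a] assms(1) by (simp add: l algebra_simps)
  ultimately show ?thesis by simp
qed

text \<open>At a zero of f the term containing the derivative of the multiplier drops out. Thus
  simplicity of zeros propagates along periods.\<close>

lemma deriv_quasi:
  assumes f: "f holomorphic_on UNIV" and u: "u holomorphic_on UNIV"
    and q: "\<And>z. f (z + p) = u z * f z" and z: "f z = 0"
  shows "deriv f (z + p) = u z * deriv f z"
proof -
  have "((\<lambda>z. f (z + p)) has_field_derivative deriv f (z + p)) (at z)"
    using entire_deriv_has[OF f, of "z + p"] by (simp add: DERIV_shift)
  moreover have "((\<lambda>z. u z * f z) has_field_derivative (deriv u z * f z + deriv f z * u z)) (at z)"
    by (intro DERIV_mult entire_deriv_has f u)
  ultimately show ?thesis using q z by (auto simp: mult.commute dest: DERIV_unique)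
qed

lemma tprod_zero_iff: "tprod z = 0 \<longleftrightarrow> z \<in> Lam"
proof
  assume "z \<in> Lam"
  thus "tprod z = 0"
    using quasi_zero_Lam[of tprod "\<lambda>z. - ee (- z)" z 0] tprod_1 tprod_eta tprod_0 by simp
qed (rule tprod_zero_Lam)

lemma tprod_deriv: "z \<in> Lam \<Longrightarrow> deriv tprod z \<noteq> 0"
proof -
  assume "z \<in> Lam"
  then obtain a b :: int where z: "z = of_int a + of_int b * eta" by (auto simp: Lam_iff)
  define S where "S w \<longleftrightarrow> tprod w = 0 \<and> deriv tprod w \<noteq> 0" for w
  have 1: "S (w + 1) = S w" for w
  proof -
    have "tprod w = 0 \<Longrightarrow> deriv tprod (w + 1) = 1 * deriv tprod w"
      by (rule deriv_quasi[OF tprod_holomorphic]) (auto simp: tprod_1)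
    thus ?thesis unfolding S_def by (auto simp: tprod_1)
  qed
  have 2: "S (w + eta) = S w" for w
  proof -
    have "tprod w = 0 \<Longrightarrow> deriv tprod (w + eta) = - ee (- w) * deriv tprod w"
      by (rule deriv_quasi[OF tprod_holomorphic]) (auto simp: tprod_eta intro!: holomorphic_intros)
    thus ?thesis unfolding S_def by (auto simp: tprod_eta)
  qed
  have "S z = S 0"
    using shift_int_period[of S 1 "of_int b * eta" a] shift_int_period[of S eta 0 b] 1 2
    by (simp add: z add.commute)
  thus ?thesis using tprod_deriv_0 tprod_0 by (simp add: S_def)
qed

section \<open>Quasi-periodic entire functions\<close>

text \<open>\<open>qper d C f\<close>: \<open>f\<close> is a theta function of order \<open>d\<close> for the lattice.\<close>

definition qper :: "int \<Rightarrow> complex \<Rightarrow> (complex \<Rightarrow> complex) \<Rightarrow> bool" where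
  "qper d C f \<longleftrightarrow> f holomorphic_on UNIV \<and> C \<noteq> 0 \<and> (\<forall>z. f (z + 1) = f z) \<and>
     (\<forall>z. f (z + eta) = C * ee (- of_int d * z) * f z)"

lemma qper_mult:
  assumes "qper d C f" "qper e D g"
  shows "qper (d + e) (C * D) (\<lambda>z. f z * g z)"
proof -
  have "ee (- of_int (d + e) * z) = ee (- of_int d * z) * ee (- of_int e * z)" for z
    by (simp add: ee_add[symmetric] algebra_simps)
  thus ?thesis using assms unfolding qper_def by (auto intro!: holomorphic_intros)
qed

lemma qper_tprod: "qper 1 (- ee c) (\<lambda>z. tprod (z - c))"
proof -
  have 1: "tprod (z + 1 - c) = tprod (z - c)" for z
    using tprod_1[of "z - c"] by (simp add: algebra_simps)
  have 2: "tprod (z + eta - c) = - ee c * ee (- z) * tprod (z - c)" for z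
    using tprod_eta[of "z - c"] by (simp add: algebra_simps ee_diff ee_minus field_simps)
  show ?thesis unfolding qper_def using 1 2
    by (auto intro!: entire_compose[OF tprod_holomorphic] holomorphic_intros)
qed

text \<open>The product g(w) g(2 z - w) is doubly periodic in w, because the multipliers C and 1 / C
  cancel; so it is constant. Its values at w = z and w = z0 are g(z)^2 and 0.\<close>

lemma qper_0_zero:
  assumes g: "qper 0 C g" and z: "g z0 = 0"
  shows "g z = 0"
proof -
  define B where "B w = g w * g (2 * z - w)" for w
  have hol: "g holomorphic_on UNIV" and C: "C \<noteq> 0" and p1: "\<And>z. g (z + 1) = g z" and p2: "\<And>z. g (z + eta) = C * g z"
    using g by (auto simp: qper_def)
  have "B z = B z0"
  proof (rule elliptic_entire_const[of B])
    show "B holomorphic_on UNIV" unfolding B_def by (intro holomorphic_intros hol entire_compose[OF hol])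
    show "B (w + 1) = B w" for w
      using p1[of w] p1[of "2 * z - (w + 1)"] by (simp add: B_def algebra_simps)
    show "B (w + eta) = B w" for w
      using p2[of w] p2[of "2 * z - (w + eta)"] C by (simp add: B_def algebra_simps)
  qed
  thus ?thesis using z by (simp add: B_def)
qed

text \<open>Multiplying by -d factors \<open>tprod (z - c)\<close> raises the order to 0 and creates
  a zero at c, so the product vanishes identically. Choosing c different from z modulo Lambda lets
  the factors be cancelled at z.\<close>

lemma qper_neg_zero:
  assumes f: "qper d C f" and d: "d < 0"
  shows "f z = 0"
proof -
  have step: "\<exists>D. qper (d + int m) D (\<lambda>z. f z * tprod (z - c) ^ m)" for m c
  proof (induction m)
    case 0 thus ?case using f by auto
  next
    case (Suc m)
    then obtain D where "qper (d + int m) D (\<lambda>z. f z * tprod (z - c) ^ m)" by blast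
    from qper_mult[OF this qper_tprod[of c]] show ?case by (auto simp: mult_ac add_ac)
  qed
  obtain c where c: "z - c \<notin> Lam"
    using half_not_Lam(1) by (metis add_diff_cancel_left' diff_add_cancel)
  obtain D where D: "qper 0 D (\<lambda>z. f z * tprod (z - c) ^ nat (- d))"
    using step[of "nat (- d)" c] d by auto
  have "f z * tprod (z - c) ^ nat (- d) = 0"
    by (rule qper_0_zero[OF D, of c]) (use d in \<open>simp add: tprod_0\<close>)
  thus ?thesis using c by (simp add: tprod_zero_iff)
qed

text \<open>\<open>tprod (z - z0)\<close> has order one and simple zeros exactly on z0 + Lambda,
  where f vanishes as well.\<close>

lemma qper_divide:
  assumes f: "qper d C f" and z0: "f z0 = 0"
  obtains g where "qper (d - 1) (- C * ee (- z0)) g" "\<And>z. f z = tprod (z - z0) * g z"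
    "deriv f z0 = 0 \<Longrightarrow> g z0 = 0"
proof -
  have hol: "f holomorphic_on UNIV" and C: "C \<noteq> 0" and p1: "\<And>z. f (z + 1) = f z"
    and p2: "\<And>z. f (z + eta) = C * ee (- of_int d * z) * f z"
    using f by (auto simp: qper_def)
  have dt: "deriv (\<lambda>z. tprod (z - z0)) z = deriv tprod (z - z0)" for z
    using entire_deriv_has[OF tprod_holomorphic, of "z - z0"]
    by (intro DERIV_imp_deriv) (simp add: DERIV_shift[of tprod _ z "- z0", simplified])
  obtain g where g: "g holomorphic_on UNIV" "\<And>z. f z = tprod (z - z0) * g z"
    "\<And>z. tprod (z - z0) = 0 \<Longrightarrow> g z = deriv f z / deriv (\<lambda>z. tprod (z - z0)) z"
  proof (rule entire_division[of f "\<lambda>z. tprod (z - z0)"])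
    fix z assume "tprod (z - z0) = 0"
    then have l: "z - z0 \<in> Lam" by (simp add: tprod_zero_iff)
    then have "f z = 0" using quasi_zero_Lam[of f "\<lambda>z. C * ee (- of_int d * z)" "z - z0" z0] p1 p2 C z0 by simp
    thus "f z = 0 \<and> deriv (\<lambda>z. tprod (z - z0)) z \<noteq> 0" using l tprod_deriv by (simp add: dt)
  qed (auto intro!: hol entire_compose[OF tprod_holomorphic] holomorphic_intros)
  show ?thesis
  proof (rule that)
    show "f z = tprod (z - z0) * g z" for z by (rule g)
    show "deriv f z0 = 0 \<Longrightarrow> g z0 = 0" using g(3)[of z0] by (simp add: tprod_0)
    show "qper (d - 1) (- C * ee (- z0)) g"
      unfolding qper_def
    proof (intro conjI allI)
      \<comment> \<open>Off this countable set the functional equations of the quotient follow by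
        cancellation; both sides being entire, they then hold everywhere.\<close>
      have cnt: "countable {z. z - z0 \<in> Lam}" using countable_affine_Lam[of 1 "- z0"] by simp
      have t1: "tprod (z + 1 - z0) = tprod (z - z0)" for z using qper_tprod[of z0] by (simp add: qper_def)
      have t2: "tprod (z + eta - z0) = - ee z0 * ee (- z) * tprod (z - z0)" for z
        using qper_tprod[of z0] by (simp add: qper_def)
      show "g (z + 1) = g z" for z
      proof -
        have "g (z + 1) - g z = 0"
        proof (rule entire_zero_off_countable[OF _ cnt, of "\<lambda>z. g (z + 1) - g z"])
          fix w assume "w \<notin> {z. z - z0 \<in> Lam}"
          then have "tprod (w - z0) \<noteq> 0" by (simp add: tprod_zero_iff)
          thus "g (w + 1) - g w = 0" using p1[of w] g(2)[of w] g(2)[of "w + 1"] t1[of w] by simp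
        qed (intro holomorphic_intros g(1) entire_compose[OF g(1)])
        thus ?thesis by simp
      qed
      show "g (z + eta) = - C * ee (- z0) * ee (- of_int (d - 1) * z) * g z" for z
      proof -
        have "g (z + eta) - - C * ee (- z0) * ee (- of_int (d - 1) * z) * g z = 0"
        proof (rule entire_zero_off_countable[OF _ cnt, of "\<lambda>z. g (z + eta) - - C * ee (- z0) * ee (- of_int (d - 1) * z) * g z"])
          fix w assume "w \<notin> {z. z - z0 \<in> Lam}"
          then have t: "tprod (w - z0) \<noteq> 0" by (simp add: tprod_zero_iff)
          have "- ee z0 * ee (- w) * tprod (w - z0) * g (w + eta) = C * ee (- of_int d * w) * (tprod (w - z0) * g w)"
            using p2[of w] g(2)[of w] g(2)[of "w + eta"] t2[of w] by simp
          then have "tprod (w - z0) * (- ee z0 * ee (- w) * g (w + eta)) = tprod (w - z0) * (C * ee (- of_int d * w) * g w)"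
            by (simp only: mult_ac)
          then have "- ee z0 * ee (- w) * g (w + eta) = C * ee (- of_int d * w) * g w"
            using t mult_cancel_left by blast
          then have e1: "ee z0 * ee (- w) * g (w + eta) = - (C * ee (- of_int d * w) * g w)"
            by (metis minus_mult_left minus_minus)
          have "ee (- of_int (d - 1) * w) = ee (- of_int d * w) * ee w"
            by (simp add: ee_add[symmetric] algebra_simps)
          then have "ee z0 * ee (- w) * (- C * ee (- z0) * ee (- of_int (d - 1) * w) * g w)
              = - ((ee z0 * ee (- z0)) * (ee (- w) * ee w) * (C * ee (- of_int d * w) * g w))"
            by (simp only: mult_ac minus_mult_left[symmetric] minus_mult_right[symmetric])
          also have "\<dots> = ee z0 * ee (- w) * g (w + eta)"
            unfolding e1 by (simp add: ee_minus)
          finally have "ee z0 * ee (- w) * g (w + eta) = ee z0 * ee (- w) * (- C * ee (- z0) * ee (- of_int (d - 1) * w) * g w)" ..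
          then have "g (w + eta) = - C * ee (- z0) * ee (- of_int (d - 1) * w) * g w"
            by (subst (asm) mult_cancel_left) simp
          thus "g (w + eta) - - C * ee (- z0) * ee (- of_int (d - 1) * w) * g w = 0" by simp
        qed (intro holomorphic_intros g(1) entire_compose[OF g(1)])
        thus ?thesis by (simp only: right_minus_eq)
      qed
    qed (use g(1) C in auto)
  qed
qed

section \<open>Counting zeros modulo the lattice\<close>

text \<open>A list and not a set, so that zeros can be divided out one at a time. As Lambda is
  symmetric, the order of the entries does not matter.\<close>

definition distinct_mod :: "complex list \<Rightarrow> bool" where
  "distinct_mod zs \<longleftrightarrow> sorted_wrt (\<lambda>x y. x - y \<notin> Lam) zs"

text \<open>Each division lowers the order by one and multiplies the constant by -e(-x). The
  constant of the quotient is kept explicit for the case where its order reaches 0.\<close>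

lemma qper_zeros:
  assumes "qper d C f" "distinct_mod zs" "\<And>z. z \<in> set zs \<Longrightarrow> f z = 0"
  obtains g where "qper (d - int (length zs)) ((-1) ^ length zs * C * ee (- sum_list zs)) g"
    "\<And>z. f z = (\<Prod>x\<leftarrow>zs. tprod (z - x)) * g z"
  using assms
proof (induction zs arbitrary: d C f thesis)
  case Nil thus ?case by auto
next
  case (Cons x zs)
  obtain h where h: "qper (d - 1) (- C * ee (- x)) h" "\<And>z. f z = tprod (z - x) * h z"
  proof (rule qper_divide[OF Cons.prems(2), of x])
    show "f x = 0" using Cons.prems(4) by simp
  qed (rule that)
  have z: "h z = 0" if "z \<in> set zs" for z
  proof -
    have "x - z \<notin> Lam" using Cons.prems(3) that by (auto simp: distinct_mod_def)
    then have "z - x \<notin> Lam" using Lam_minus_iff[of "z - x"] by simp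
    moreover have "f z = 0" using Cons.prems(4) that by simp
    ultimately show ?thesis using h(2)[of z] by (simp add: tprod_zero_iff)
  qed
  obtain g where g: "qper (d - 1 - int (length zs)) ((-1) ^ length zs * (- C * ee (- x)) * ee (- sum_list zs)) g"
    "\<And>z. h z = (\<Prod>x\<leftarrow>zs. tprod (z - x)) * g z"
    using Cons.IH[OF _ h(1) _ z] Cons.prems(3) by (auto simp: distinct_mod_def)
  show ?case
  proof (rule Cons.prems(1))
    have eq: "(-1) ^ length zs * (- C * ee (- x)) * ee (- sum_list zs) = (-1) ^ length (x # zs) * C * ee (- sum_list (x # zs))"
      by (simp add: ee_add[symmetric] algebra_simps)
    show "qper (d - int (length (x # zs))) ((-1) ^ length (x # zs) * C * ee (- sum_list (x # zs))) g"
      using g(1) unfolding eq by (simp add: algebra_simps)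
    show "f z = (\<Prod>x\<leftarrow>x # zs. tprod (z - x)) * g z" for z using g(2) h(2) by simp
  qed
qed

text \<open>After all listed zeros are divided out, a function of negative order remains.\<close>

lemma qper_too_many_zeros:
  assumes "qper d C f" "distinct_mod zs" "\<And>z. z \<in> set zs \<Longrightarrow> f z = 0" "int (length zs) > d"
  shows "f z = 0"
proof -
  obtain g where g: "qper (d - int (length zs)) ((-1) ^ length zs * C * ee (- sum_list zs)) g"
    "\<And>z. f z = (\<Prod>x\<leftarrow>zs. tprod (z - x)) * g z"
    using qper_zeros[OF assms(1-3)] by blast
  have "g z = 0" using qper_neg_zero[OF g(1)] assms(4) by simp
  thus ?thesis using g(2) by simp
qed

text \<open>A nonzero function of order 0 has no zeros, so its logarithmic derivative is entire and
  doubly periodic, hence a constant a. Then g(w) = c exp(a w), and the period 1 forces a to be an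
  integer multiple of 2 pi i.\<close>

lemma qper_0_multiplier:
  assumes g: "qper 0 C g" and nz: "g z \<noteq> 0"
  obtains j :: int where "C = ee (of_int j * eta)"
proof -
  have hol: "g holomorphic_on UNIV" and C: "C \<noteq> 0" and p1: "\<And>z. g (z + 1) = g z" and p2: "\<And>z. g (z + eta) = C * g z"
    using g by (auto simp: qper_def)
  have nz': "g w \<noteq> 0" for w using qper_0_zero[OF g, of w] nz by blast
  define L where "L w = deriv g w / g w" for w
  have dhol: "deriv g holomorphic_on UNIV" using hol by (intro holomorphic_deriv) auto
  have Lhol: "L holomorphic_on UNIV" unfolding L_def by (intro holomorphic_intros dhol hol nz')
  have d: "((\<lambda>z. g (z + p)) has_field_derivative deriv g (w + p)) (at w)" for w p
    using entire_deriv_has[OF hol, of "w + p"] by (simp add: DERIV_shift)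
  have L1: "L (w + 1) = L w" for w
  proof -
    have "deriv g (w + 1) = deriv g w"
      using d[of 1 w] DERIV_unique[OF _ entire_deriv_has[OF hol]] by (simp add: p1)
    thus ?thesis by (simp add: L_def p1)
  qed
  have L2: "L (w + eta) = L w" for w
  proof -
    have "((\<lambda>z. C * g z) has_field_derivative deriv g (w + eta)) (at w)"
      using d[of eta w] by (simp add: p2)
    moreover have "((\<lambda>z. C * g z) has_field_derivative C * deriv g w) (at w)"
      by (intro DERIV_cmult entire_deriv_has hol)
    ultimately have "deriv g (w + eta) = C * deriv g w" by (rule DERIV_unique)
    thus ?thesis using C by (simp add: L_def p2)
  qed
  define a where "a = L 0"
  have La: "deriv g w = a * g w" for w
    using elliptic_entire_const[OF Lhol L1 L2, of w 0] nz'[of w] by (simp add: a_def L_def field_simps)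
  have "\<exists>c. \<forall>w. g w * exp (- a * w) = c"
  proof -
    have "((\<lambda>w. g w * exp (- a * w)) has_field_derivative 0) (at w)" for w
      using entire_deriv_has[OF hol, of w] by (auto intro!: derivative_eq_intros simp: La)
    then have "\<exists>c. \<forall>w\<in>UNIV. g w * exp (- a * w) = c"
      by (intro has_field_derivative_zero_constant) auto
    thus ?thesis by simp
  qed
  then obtain c where c: "\<And>w. g w * exp (- a * w) = c" by blast
  then have gw: "g w = c * exp (a * w)" for w
    using c[of w] by (simp add: exp_minus field_simps)
  have c0: "c \<noteq> 0" using gw nz' by force
  have "c * exp (a * 1) = c" using p1[of 0] gw by simp
  then have "exp a = 1" using c0 by simp
  then obtain j :: int where "Re a = 0" "Im a = of_int (2 * j) * pi" unfolding exp_eq_1 by blast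
  then have a: "a = 2 * of_real pi * \<i> * of_int j" by (simp add: complex_eq_iff)
  have "c * exp (a * eta) = C * c" using p2[of 0] gw[of 0] gw[of eta] by simp
  then have "C = exp (a * eta)" using c0 by (simp add: mult.commute)
  also have "\<dots> = ee (of_int j * eta)" by (simp add: a ee_def mult_ac)
  finally show ?thesis by (rule that)
qed

text \<open>Abel's condition: for a nonzero function the sum of its d zeros is determined modulo
  Lambda by the constant C. If it is violated, the quotient has order 0 and a multiplier that
  \<open>qper_0_multiplier\<close> forbids.\<close>

lemma qper_generic_zeros:
  assumes "qper d C f" "distinct_mod zs" "\<And>z. z \<in> set zs \<Longrightarrow> f z = 0" "int (length zs) = d"
    and "\<And>j::int. (-1) ^ length zs * C * ee (- sum_list zs) \<noteq> ee (of_int j * eta)"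
  shows "f z = 0"
proof -
  obtain g where g: "qper (d - int (length zs)) ((-1) ^ length zs * C * ee (- sum_list zs)) g"
    "\<And>z. f z = (\<Prod>x\<leftarrow>zs. tprod (z - x)) * g z"
    using qper_zeros[OF assms(1-3)] by blast
  have "g z = 0"
  proof (rule ccontr)
    assume "g z \<noteq> 0"
    moreover have "qper 0 ((-1) ^ length zs * C * ee (- sum_list zs)) g" using g(1) assms(4) by simp
    ultimately obtain j :: int where "(-1) ^ length zs * C * ee (- sum_list zs) = ee (of_int j * eta)"
      using qper_0_multiplier by blast
    thus False using assms(5) by blast
  qed
  thus ?thesis using g(2) by simp
qed

text \<open>Each double zero is divided out twice and so counts as two.\<close>

lemma qper_double_zeros:
  assumes "qper d C f" "distinct_mod zs" "\<And>z. z \<in> set zs \<Longrightarrow> f z = 0 \<and> deriv f z = 0" "2 * int (length zs) > d"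
  shows "f z = 0"
  using assms
proof (induction zs arbitrary: d C f)
  case Nil thus ?case using qper_neg_zero by auto
next
  case (Cons x zs)
  have fx: "f x = 0" "deriv f x = 0" using Cons.prems(3) by auto
  obtain h where h: "qper (d - 1) (- C * ee (- x)) h" "\<And>z. f z = tprod (z - x) * h z"
    and "deriv f x = 0 \<Longrightarrow> h x = 0"
    by (rule qper_divide[OF Cons.prems(1) fx(1)]) (rule that, assumption, blast, blast)
  then have hx: "h x = 0" using fx by blast
  obtain g where g: "qper (d - 2) (- (- C * ee (- x)) * ee (- x)) g" "\<And>z. h z = tprod (z - x) * g z"
    using qper_divide[OF h(1) hx] by (auto simp: algebra_simps)
  have ghol: "g holomorphic_on UNIV" using g(1) by (simp add: qper_def)
  \<comment> \<open>Away from x + Lambda the square T is nonzero, so the remaining double zeros of f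
    are double zeros of g.\<close>
  define T where "T z = tprod (z - x) * tprod (z - x)" for z
  have Thol: "T holomorphic_on UNIV" unfolding T_def
    by (intro holomorphic_intros entire_compose[OF tprod_holomorphic])
  have fT: "f = (\<lambda>z. T z * g z)" using g(2) h(2) by (simp add: T_def fun_eq_iff)
  have z: "g z = 0 \<and> deriv g z = 0" if "z \<in> set zs" for z
  proof -
    have "x - z \<notin> Lam" using Cons.prems(2) that by (auto simp: distinct_mod_def)
    then have "z - x \<notin> Lam" using Lam_minus_iff[of "z - x"] by simp
    then have Tz: "T z \<noteq> 0" by (simp add: T_def tprod_zero_iff)
    have fz: "f z = 0" "deriv f z = 0" using Cons.prems(3) that by auto
    have gz: "g z = 0" using fz Tz by (simp add: fT)
    have "((\<lambda>z. T z * g z) has_field_derivative deriv T z * g z + deriv g z * T z) (at z)"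
      by (intro DERIV_mult entire_deriv_has Thol ghol)
    then have "(f has_field_derivative deriv g z * T z) (at z)"
      using gz by (simp add: fT)
    then have "deriv f z = deriv g z * T z" by (rule DERIV_imp_deriv)
    thus ?thesis using fz gz Tz by simp
  qed
  have "g z = 0"
  proof (rule Cons.IH[OF g(1) _ z])
    show "distinct_mod zs" using Cons.prems(2) by (simp add: distinct_mod_def)
    show "d - 2 < 2 * int (length zs)" using Cons.prems(4) by simp
  qed
  thus ?case using fT by simp
qed

end

section \<open>The theta series, its functional equations and its zeros\<close>

lemma ee_sum: "(\<Prod>m\<in>A. ee (f m)) = ee (\<Sum>m\<in>A. f m)"
  by (induction A rule: infinite_finite_induct) (simp_all add: ee_add)

lemma ee_mult_int_period: "ee (x + of_int m) = ee x"
  by (simp add: ee_add)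

lemma summable_int_exp_abs: "(\<lambda>m::int. exp (- real_of_int \<bar>m\<bar>)) summable_on UNIV"
proof -
  have nat: "(\<lambda>m::nat. exp (- real m)) summable_on UNIV"
  proof -
    have "summable (\<lambda>m::nat. exp (- 1 :: real) ^ m)" by (rule summable_geometric) simp
    then have "summable (\<lambda>m::nat. norm (exp (- real m)))"
      by (simp add: exp_of_nat_mult[symmetric])
    thus ?thesis by (rule norm_summable_imp_summable_on)
  qed
  have U: "UNIV = range int \<union> (\<lambda>m. - 1 - int m) ` UNIV"
  proof -
    have "x \<in> range int \<union> (\<lambda>m. - 1 - int m) ` UNIV" for x
    proof (cases "x \<ge> 0")
      case True
      then have "x = int (nat x)" by simp
      thus ?thesis by blast
    next
      case False
      then have "x = - 1 - int (nat (- 1 - x))" by simp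
      thus ?thesis by blast
    qed
    thus ?thesis by blast
  qed
  show ?thesis
    unfolding U
  proof (rule summable_on_Un_disjoint)
    show "(\<lambda>m::int. exp (- real_of_int \<bar>m\<bar>)) summable_on range int"
      using nat by (subst summable_on_reindex) (auto simp: o_def)
    have "(\<lambda>m::nat. exp (- 1) * exp (- real m)) summable_on UNIV"
      by (intro summable_on_cmult_right nat)
    then have "(\<lambda>m::nat. exp (- real_of_int \<bar>- 1 - int m\<bar>)) summable_on UNIV"
      by (simp add: exp_add[symmetric] algebra_simps)
    thus "(\<lambda>m::int. exp (- real_of_int \<bar>m\<bar>)) summable_on (\<lambda>m. - 1 - int m) ` UNIV"
      by (subst summable_on_reindex) (auto simp: o_def inj_on_def)
  qed auto
qed

lemma roots_of_unity_sum:
  assumes "m \<noteq> (0::int)" "\<bar>m\<bar> < int N"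
  shows "(\<Sum>j<N. ee (of_int m * (of_nat j / of_nat N))) = 0"
proof -
  define x where "x = ee (of_int m / of_nat N)"
  have N: "N \<noteq> 0" using assms by auto
  have x1: "x \<noteq> 1"
  proof
    assume "x = 1"
    then obtain l :: int where "of_int m / of_nat N = (of_int l :: complex)"
      by (auto simp: x_def ee_eq_1_iff Ints_def)
    then have "(of_int m :: complex) = of_int (l * int N)" using N by (simp add: field_simps)
    then have "m = l * int N" by (simp only: of_int_eq_iff)
    moreover from this have "\<bar>m\<bar> \<ge> int N" using assms(1)
      by (simp add: abs_mult) (use mult_le_cancel_right1[of "int N" "\<bar>l\<bar>"] in auto)
    ultimately show False using assms(2) by simp
  qed
  have "x ^ N = 1" using N by (simp add: x_def ee_power)
  have "(\<Sum>j<N. ee (of_int m * (of_nat j / of_nat N))) = (\<Sum>j<N. x ^ j)"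
    by (simp add: x_def ee_power mult_ac)
  also have "\<dots> = 0" using x1 \<open>x ^ N = 1\<close> by (simp add: geometric_sum)
  finally show ?thesis .
qed

context half_plane
begin

definition theta_term :: "int \<Rightarrow> complex \<Rightarrow> complex" where
  "theta_term m z = (-1) powi m * ee (of_int m * z + of_int m * (of_int m - 1) / 2 * eta)"

lemma theta_eq: "theta eta z = (\<Sum>\<^sub>\<infinity>m\<in>UNIV. theta_term m z)"
  by (simp add: theta_def theta_term_def)

lemma theta_term_bound:
  obtains K where "K \<ge> 0" "\<And>m z. norm z \<le> R \<Longrightarrow> norm (theta_term m z) \<le> K * exp (- real_of_int \<bar>m\<bar>)"
proof
  define b where "b = pi * Im eta"
  have b: "b > 0" using Im_eta by (simp add: b_def)
  \<comment> \<open>The exponent is at most c x - b x^2 - x in x = |m|: the linear terms in c come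
    from Im z, from the b m in b m (m - 1), and from the e^(-|m|) to be extracted. The maximum of c
    x - b x^2 is c^2 / (4 b).\<close>
  define c where "c = 2 * pi * \<bar>R\<bar> + b + 1"
  show "exp (c\<^sup>2 / (4 * b)) \<ge> 0" by simp
  fix m :: int and z :: complex assume z: "norm z \<le> R"
  have "Im (of_int m * (of_int m - 1) / 2 * eta) = real_of_int m * (real_of_int m - 1) / 2 * Im eta"
  proof -
    have "of_int m * (of_int m - 1) / 2 * eta = complex_of_real (real_of_int m * (real_of_int m - 1) / 2) * eta" by simp
    thus ?thesis by (simp only: times_complex.sel Im_complex_of_real Re_complex_of_real)
  qed
  then have im: "Im (of_int m * z + of_int m * (of_int m - 1) / 2 * eta) =
      real_of_int m * Im z + real_of_int m * (real_of_int m - 1) / 2 * Im eta" by simp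
  have "norm (theta_term m z) = exp (- 2 * pi * (real_of_int m * Im z + real_of_int m * (real_of_int m - 1) / 2 * Im eta))"
    unfolding theta_term_def norm_mult norm_ee im by (simp add: norm_power_int)
  also have "- 2 * pi * (real_of_int m * Im z + real_of_int m * (real_of_int m - 1) / 2 * Im eta)
      = - (2 * pi * real_of_int m * Im z) - b * real_of_int m * (real_of_int m - 1)"
    by (simp add: b_def field_simps)
  also have "\<dots> \<le> c\<^sup>2 / (4 * b) - real_of_int \<bar>m\<bar>"
  proof -
    define x where "x = real_of_int \<bar>m\<bar>"
    have "- (2 * pi * real_of_int m * Im z) \<le> 2 * pi * x * \<bar>R\<bar>"
    proof -
      have "- (2 * pi * real_of_int m * Im z) \<le> \<bar>2 * pi * real_of_int m * Im z\<bar>" by simp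
      also have "\<dots> = 2 * pi * x * \<bar>Im z\<bar>" by (simp add: abs_mult x_def)
      also have "\<dots> \<le> 2 * pi * x * \<bar>R\<bar>"
        using abs_Im_le_cmod[of z] z by (intro mult_left_mono) (auto simp: x_def)
      finally show ?thesis .
    qed
    moreover have "- (b * real_of_int m * (real_of_int m - 1)) \<le> - b * x\<^sup>2 + b * x"
    proof -
      have "b * real_of_int m \<le> b * x" using b by (intro mult_left_mono) (auto simp: x_def)
      thus ?thesis by (simp add: x_def algebra_simps power2_eq_square)
    qed
    moreover have "2 * pi * x * \<bar>R\<bar> + (- b * x\<^sup>2 + b * x) + x \<le> c\<^sup>2 / (4 * b)"
    proof -
      have "0 \<le> (c - 2 * b * x)\<^sup>2 / (4 * b)" using b by simp
      also have "\<dots> = c\<^sup>2 / (4 * b) - (2 * pi * x * \<bar>R\<bar> + (- b * x\<^sup>2 + b * x) + x)"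
        using b by (simp add: c_def field_simps power2_eq_square)
      finally show ?thesis by simp
    qed
    ultimately have "- (2 * pi * real_of_int m * Im z) - b * real_of_int m * (real_of_int m - 1) \<le> c\<^sup>2 / (4 * b) - x"
      by linarith
    thus ?thesis by (simp add: x_def)
  qed
  finally show "norm (theta_term m z) \<le> exp (c\<^sup>2 / (4 * b)) * exp (- real_of_int \<bar>m\<bar>)"
    by (simp add: exp_add[symmetric])
qed

lemma theta_uniform:
  "uniform_limit (cball 0 R) (\<lambda>X z. \<Sum>m\<in>X. theta_term m z) (theta eta) (finite_subsets_at_top UNIV)"
proof -
  obtain K where K: "K \<ge> 0" "\<And>m z. norm z \<le> R \<Longrightarrow> norm (theta_term m z) \<le> K * exp (- real_of_int \<bar>m\<bar>)"
    using theta_term_bound by blast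
  show ?thesis unfolding theta_eq[abs_def]
  proof (rule Weierstrass_m_test_general)
    show "norm (theta_term x y) \<le> K * exp (- real_of_int \<bar>x\<bar>)" if "y \<in> cball 0 R" for x y
      using K(2) that by simp
    show "(\<lambda>x. K * exp (- real_of_int \<bar>x\<bar>)) summable_on UNIV"
      by (intro summable_on_cmult_right summable_int_exp_abs)
  qed
qed

lemma theta_term_holomorphic: "theta_term m holomorphic_on S"
  unfolding theta_term_def by (intro holomorphic_intros)

lemma theta_holomorphic: "theta eta holomorphic_on UNIV"
proof (rule holomorphic_onI)
  fix x :: complex
  define R where "R = norm x + 1"
  have "theta eta holomorphic_on ball 0 R"
  proof (rule holomorphic_uniform_limit)
    show "uniform_limit (cball 0 R) (\<lambda>X z. \<Sum>m\<in>X. theta_term m z) (theta eta) (finite_subsets_at_top UNIV)"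
      by (rule theta_uniform)
    show "\<forall>\<^sub>F X in finite_subsets_at_top UNIV. continuous_on (cball 0 R) (\<lambda>z. \<Sum>m\<in>X. theta_term m z) \<and>
        (\<lambda>z. \<Sum>m\<in>X. theta_term m z) holomorphic_on ball 0 R"
      by (intro always_eventually allI conjI holomorphic_on_imp_continuous_on holomorphic_on_sum theta_term_holomorphic)
  qed auto
  moreover have "x \<in> ball 0 R" by (simp add: R_def)
  ultimately show "theta eta field_differentiable at x within UNIV"
    by (simp add: holomorphic_on_imp_differentiable_at)
qed

lemma theta_1: "theta eta (z + 1) = theta eta z"
  unfolding theta_eq theta_term_def
  by (intro infsum_cong) (simp add: algebra_simps ee_add)

text \<open>The substitution m -> 1 - m fixes m (m - 1) and changes the sign of (-1)^m.\<close>

lemma theta_reflect: "theta eta (- z) = - ee (- z) * theta eta z"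
proof -
  have b: "bij_betw (\<lambda>m::int. 1 - m) UNIV UNIV"
    by (rule bij_betwI[where g = "\<lambda>m. 1 - m"]) auto
  have "theta eta (- z) = (\<Sum>\<^sub>\<infinity>m\<in>UNIV. theta_term (1 - m) (- z))"
    unfolding theta_eq by (rule infsum_reindex_bij_betw[OF b, symmetric])
  also have "\<dots> = (\<Sum>\<^sub>\<infinity>m\<in>UNIV. - ee (- z) * theta_term m z)"
  proof (rule infsum_cong)
    fix m :: int
    have "(-1 :: complex) powi (1 - m) = - ((-1) powi m)"
      by (simp add: power_int_diff power_int_minus_left)
    moreover have "of_int (1 - m) * - z + of_int (1 - m) * (of_int (1 - m) - 1) / 2 * eta
        = - z + (of_int m * z + of_int m * (of_int m - 1) / 2 * eta)"
      by (simp add: field_simps)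
    ultimately show "theta_term (1 - m) (- z) = - ee (- z) * theta_term m z"
      unfolding theta_term_def by (simp only: ee_add) simp
  qed
  also have "\<dots> = - ee (- z) * theta eta z"
    unfolding theta_eq by (rule infsum_cmult_right')
  finally show ?thesis .
qed

lemma theta_eta: "theta eta (z + eta) = - ee (- z) * theta eta z"
proof -
  have b: "bij_betw (\<lambda>m::int. m - 1) UNIV UNIV"
    by (rule bij_betwI[where g = "\<lambda>m. m + 1"]) auto
  have "theta eta (z + eta) = (\<Sum>\<^sub>\<infinity>m\<in>UNIV. theta_term (m - 1) (z + eta))"
    unfolding theta_eq by (rule infsum_reindex_bij_betw[OF b, symmetric])
  also have "\<dots> = (\<Sum>\<^sub>\<infinity>m\<in>UNIV. - ee (- z) * theta_term m z)"
  proof (rule infsum_cong)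
    fix m :: int
    have "(-1 :: complex) powi (m - 1) = - ((-1) powi m)"
      by (simp add: power_int_diff)
    moreover have "of_int (m - 1) * (z + eta) + of_int (m - 1) * (of_int (m - 1) - 1) / 2 * eta
        = - z + (of_int m * z + of_int m * (of_int m - 1) / 2 * eta)"
      by (simp add: field_simps)
    ultimately show "theta_term (m - 1) (z + eta) = - ee (- z) * theta_term m z"
      unfolding theta_term_def by (simp only: ee_add) simp
  qed
  also have "\<dots> = - ee (- z) * theta eta z"
    unfolding theta_eq by (rule infsum_cmult_right')
  finally show ?thesis .
qed

lemma theta_0: "theta eta 0 = 0"
  using theta_reflect[of 0] by simp

text \<open>Averaging over the points \<open>j / N\<close> isolates the constant term of the series.\<close>

lemma theta_not_identically_zero: "\<exists>z. theta eta z \<noteq> 0"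
proof (rule ccontr)
  assume "\<not> ?thesis"
  then have 0: "theta eta z = 0" for z by blast
  have "\<forall>\<^sub>F X in finite_subsets_at_top UNIV. \<forall>x\<in>cball 0 1. dist (\<Sum>m\<in>X. theta_term m x) (theta eta x) < 1/2"
    using theta_uniform[of 1] by (rule uniform_limitD) simp
  then obtain X0 where X0: "finite X0"
    "\<forall>Y. finite Y \<and> X0 \<subseteq> Y \<and> Y \<subseteq> UNIV \<longrightarrow>
       (\<forall>x\<in>cball 0 1. dist (\<Sum>m\<in>Y. theta_term m x) (theta eta x) < 1/2)"
    unfolding eventually_finite_subsets_at_top by (elim exE conjE) (rule that)
  define X where "X = insert 0 X0"
  have finX: "finite X" "0 \<in> X" using X0 by (auto simp: X_def)
  have X: "norm (\<Sum>m\<in>X. theta_term m x) < 1/2" if "norm x \<le> 1" for x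
    using X0(2)[rule_format, of X x] X0(1) that 0[of x] by (simp add: X_def subset_insertI)
  define N where "N = nat (Max (abs ` X)) + 1"
  have N: "\<bar>m\<bar> < int N" if "m \<in> X" for m
  proof -
    have "\<bar>m\<bar> \<le> Max (abs ` X)" using finX that by (intro Max_ge) auto
    moreover from this have "0 \<le> Max (abs ` X)" by linarith
    ultimately show ?thesis by (simp add: N_def)
  qed
  define a where "a m = (-1) powi m * ee (of_int m * (of_int m - 1) / 2 * eta)" for m :: int
  have tt: "theta_term m z = a m * ee (of_int m * z)" for m z
    by (simp add: theta_term_def a_def ee_add)
  have "(\<Sum>j<N. \<Sum>m\<in>X. theta_term m (of_nat j / of_nat N)) =
     (\<Sum>m\<in>X. a m * (\<Sum>j<N. ee (of_int m * (of_nat j / of_nat N))))"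
    unfolding tt by (subst sum.swap) (simp add: sum_distrib_left)
  also have "\<dots> = (\<Sum>m\<in>X. if m = 0 then of_nat N else 0)"
    using roots_of_unity_sum N by (intro sum.cong) (auto simp: a_def)
  also have "\<dots> = of_nat N" using finX by simp
  finally have "real N = norm (\<Sum>j<N. \<Sum>m\<in>X. theta_term m (of_nat j / of_nat N))" by simp
  also have "\<dots> \<le> (\<Sum>j<N. norm (\<Sum>m\<in>X. theta_term m (of_nat j / of_nat N)))" by (rule norm_sum)
  also have "\<dots> \<le> (\<Sum>j<N. 1/2)"
  proof (rule sum_mono)
    fix j assume "j \<in> {..<N}"
    then have "real j / real N \<le> 1" by (simp add: divide_le_eq)
    then have "norm (of_nat j / of_nat N :: complex) \<le> 1" by (simp add: norm_divide)
    thus "norm (\<Sum>m\<in>X. theta_term m (of_nat j / of_nat N)) \<le> 1/2" using X less_imp_le by blast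
  qed
  finally show False by (simp add: N_def)
qed

text \<open>Both \<open>theta\<close> and \<open>tprod\<close> have order one with the same constant
  and vanish at 0, so their quotient is entire and doubly periodic, hence constant; the constant is
  nonzero because \<open>theta\<close> is not identically zero.\<close>

lemma theta_zero_iff: "theta eta z = 0 \<longleftrightarrow> z \<in> Lam"
  and theta_deriv_0: "deriv (theta eta) 0 \<noteq> 0"
proof -
  have q: "qper 1 (-1) (theta eta)"
    unfolding qper_def using theta_holomorphic theta_1 theta_eta by simp
  obtain g where g0: "qper (1 - 1) (- (-1) * ee (- 0)) g" and g: "\<And>z. theta eta z = tprod (z - 0) * g z"
    by (rule qper_divide[OF q theta_0]) (rule that, assumption, blast)
  have gc: "g z = g w" for z w
  proof (rule elliptic_entire_const[of g])
    show "g holomorphic_on UNIV" "\<And>z. g (z + 1) = g z" "\<And>z. g (z + eta) = g z"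
      using g0 by (simp_all add: qper_def)
  qed
  define c where "c = g 0"
  have th: "theta eta z = tprod z * c" for z using g gc[of z 0] by (simp add: c_def)
  have c: "c \<noteq> 0" using theta_not_identically_zero th by auto
  show "theta eta z = 0 \<longleftrightarrow> z \<in> Lam" using c th by (simp add: tprod_zero_iff)
  have "((\<lambda>z. tprod z * c) has_field_derivative deriv tprod 0 * c) (at 0)"
    by (intro DERIV_cmult_right entire_deriv_has tprod_holomorphic)
  then have "deriv (theta eta) 0 = deriv tprod 0 * c"
    by (intro DERIV_imp_deriv) (simp add: th[abs_def])
  thus "deriv (theta eta) 0 \<noteq> 0" using c tprod_deriv_0 by simp
qed

end

section \<open>Residues modulo \<open>n\<close>\<close>

lemma Zn_iff: "x \<in> Zn n \<longleftrightarrow> 0 \<le> x \<and> x < int n"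
  by (auto simp: Zn_def)

lemma finite_Zn [simp]: "finite (Zn n)" by (simp add: Zn_def)

lemma card_Zn [simp]: "card (Zn n) = n" by (simp add: Zn_def)

lemma mod_in_Zn [simp]: "n > 0 \<Longrightarrow> x mod int n \<in> Zn n"
  by (simp add: Zn_iff)

lemma Zn_mod [simp]: "x \<in> Zn n \<Longrightarrow> x mod int n = x"
  by (simp add: Zn_iff)

lemma Zn_affine_bij:
  assumes n: "n > 0" and c: "coprime c (int n)"
  shows "bij_betw (\<lambda>x. (c * x + d) mod int n) (Zn n) (Zn n)"
proof -
  have "inj_on (\<lambda>x. (c * x + d) mod int n) (Zn n)"
  proof (rule inj_onI)
    fix x y assume xy: "x \<in> Zn n" "y \<in> Zn n" "(c * x + d) mod int n = (c * y + d) mod int n"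
    then have "int n dvd (c * x + d) - (c * y + d)" by (simp add: mod_eq_dvd_iff)
    then have "int n dvd c * (x - y)" by (simp add: algebra_simps)
    then have "int n dvd x - y" using c by (simp add: coprime_dvd_mult_right_iff coprime_commute)
    then have "x mod int n = y mod int n" by (simp add: mod_eq_dvd_iff)
    thus "x = y" using xy by simp
  qed
  moreover have "(\<lambda>x. (c * x + d) mod int n) ` Zn n \<subseteq> Zn n" using n by auto
  ultimately show ?thesis by (simp add: bij_betw_def endo_inj_surj)
qed

lemma periodic_mod:
  assumes "\<And>x. f (x + int n) = f x"
  shows "f (x mod int n) = f x"
proof -
  have "f (y + m * int n) = f y" for y m
  proof (induction m rule: int_induct[where k = 0])
    case (step1 i) thus ?case using assms[of "y + i * int n"] by (simp add: algebra_simps)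
  next
    case (step2 i) thus ?case using assms[of "y + (i - 1) * int n"] by (simp add: algebra_simps)
  qed simp
  from this[of "x mod int n" "x div int n"] show ?thesis by (simp add: algebra_simps)
qed

lemma prod_Zn_affine:
  assumes "n > 0" "coprime c (int n)" "\<And>x. f (x + int n) = f x"
  shows "(\<Prod>x\<in>Zn n. f (c * x + d)) = (\<Prod>x\<in>Zn n. f x)"
proof -
  have "(\<Prod>x\<in>Zn n. f (c * x + d)) = (\<Prod>x\<in>Zn n. f ((c * x + d) mod int n))"
    using periodic_mod[of f n] assms(3) by (intro prod.cong) auto
  thus ?thesis using prod.reindex_bij_betw[OF Zn_affine_bij[OF assms(1,2)], of f d] by simp
qed

lemma sum_Zn_affine:
  assumes "n > 0" "coprime c (int n)" "\<And>x. f (x + int n) = f x"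
  shows "(\<Sum>x\<in>Zn n. f (c * x + d)) = (\<Sum>x\<in>Zn n. f x)"
proof -
  have "(\<Sum>x\<in>Zn n. f (c * x + d)) = (\<Sum>x\<in>Zn n. f ((c * x + d) mod int n))"
    using periodic_mod[of f n] assms(3) by (intro sum.cong) auto
  thus ?thesis using sum.reindex_bij_betw[OF Zn_affine_bij[OF assms(1,2)], of f d] by simp
qed

lemma prod_rotate:
  fixes g :: "nat \<Rightarrow> 'a :: comm_monoid_mult"
  assumes "g n = g 0"
  shows "(\<Prod>m<n. g (Suc m)) = (\<Prod>m<n. g m)"
proof (cases n)
  case (Suc l)
  have "(\<Prod>m<n. g m) = g 0 * (\<Prod>m<l. g (Suc m))" unfolding Suc by (rule prod.lessThan_Suc_shift)
  moreover have "(\<Prod>m<n. g (Suc m)) = (\<Prod>m<l. g (Suc m)) * g n" unfolding Suc by (rule prod.lessThan_Suc)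
  ultimately show ?thesis using assms by (simp add: mult.commute)
qed simp

lemma prod_reflect:
  fixes g :: "nat \<Rightarrow> 'a :: comm_monoid_mult"
  assumes "g n = g 0"
  shows "(\<Prod>m<n. g (n - m)) = (\<Prod>m<n. g m)"
proof -
  have "(\<Prod>m<n. g (n - m)) = (\<Prod>m<n. g (Suc m))"
    by (rule prod.reindex_bij_witness[where i = "\<lambda>m. n - Suc m" and j = "\<lambda>m. n - Suc m"]) (auto simp: Suc_diff_Suc)
  thus ?thesis using prod_rotate[of g n] assms by simp
qed

section \<open>The functions \<open>\<theta>\<^sub>\<alpha>\<close>\<close>

locale odd_theta = half_plane +
  fixes k :: nat
  assumes k_pos: "k \<ge> 1"
begin

definition n :: nat where "n = 2 * k + 1"

lemma n_pos [simp]: "n > 0" by (simp add: n_def)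

lemma of_nat_n: "(of_nat n :: complex) = 2 * of_nat k + 1" by (simp add: n_def)

lemma n_nonzero [simp]: "n \<noteq> 0" by (simp add: n_def)

lemma of_nat_n_nonzero [simp]: "(of_nat n :: complex) \<noteq> 0" by simp

lemma n_div_2: "((of_nat n - 1) / 2 :: complex) = of_nat k" by (simp add: n_def)

lemma minus_one_n: "(-1 :: complex) ^ n = -1" by (simp add: n_def)

lemma sum_n: "(\<Sum>m<n. (of_nat m :: complex)) = of_nat n * of_nat k"
proof -
  have "(\<Sum>m<l. (of_nat m :: complex)) = of_nat l * (of_nat l - 1) / 2" for l
    by (induction l) (simp_all add: field_simps)
  from this[of n] show ?thesis by (simp add: n_div_2[symmetric])
qed

lemma sum_Zn_n: "(\<Sum>a\<in>Zn n. (of_int a :: complex)) = of_nat n * of_nat k"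
proof -
  have "(\<Sum>a\<in>Zn n. (of_int a :: complex)) = (\<Sum>m<n. of_nat m)"
    by (rule sum.reindex_bij_witness[where i = int and j = nat]) (auto simp: Zn_iff)
  thus ?thesis by (simp add: sum_n)
qed

abbreviation th :: "int \<Rightarrow> complex \<Rightarrow> complex" where "th a z \<equiv> theta_ind n eta a z"

lemma th_holomorphic: "th a holomorphic_on S"
proof -
  have "(\<lambda>z. ee (of_int a * z + of_int a / (2 * of_nat n) + of_int a * (of_int a - of_nat n) / (2 * of_nat n) * eta) *
      (\<Prod>m<n. theta eta (z + of_nat m / of_nat n + of_int a / of_nat n * eta))) holomorphic_on S"
    by (intro holomorphic_intros entire_compose[OF theta_holomorphic])
  thus ?thesis by (simp add: theta_ind_def[abs_def])
qed

text \<open>Adding 1/n rotates the n factors cyclically, and the period 1 of \<open>theta\<close>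
  closes the cycle.\<close>

lemma th_1n: "th a (z + 1 / of_nat n) = ee (of_int a / of_nat n) * th a z"
proof -
  define g where "g m = theta eta (z + of_nat m / of_nat n + of_int a / of_nat n * eta)" for m
  have "g n = g 0"
    using theta_1[of "z + of_int a / of_nat n * eta"] by (simp add: g_def add_ac)
  then have "(\<Prod>m<n. g (Suc m)) = (\<Prod>m<n. g m)" by (rule prod_rotate)
  moreover have "theta eta (z + 1 / of_nat n + of_nat m / of_nat n + of_int a / of_nat n * eta) = g (Suc m)" for m
    by (simp add: g_def add_divide_distrib add_ac)
  moreover have "of_int a * (z + 1 / of_nat n) + of_int a / (2 * of_nat n) + of_int a * (of_int a - of_nat n) / (2 * of_nat n) * eta
     = of_int a / of_nat n + (of_int a * z + of_int a / (2 * of_nat n) + of_int a * (of_int a - of_nat n) / (2 * of_nat n) * eta)"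
    by (simp add: distrib_left)
  ultimately show ?thesis
    unfolding theta_ind_def by (simp only: ee_add g_def mult.assoc)
qed

text \<open>Exponent of the multiplier for the step eta / n. It does not depend on the index, so it
  can be taken out of sums and products over indices.\<close>

definition gth :: "complex \<Rightarrow> complex" where
  "gth z = - z - 1 / (2 * of_nat n) + (of_nat n - 1) / (2 * of_nat n) * eta"

lemma th_etan: "th a (z + eta / of_nat n) = ee (gth z) * th (a + 1) z"
proof -
  have "z + eta / of_nat n + of_nat m / of_nat n + of_int a / of_nat n * eta
      = z + of_nat m / of_nat n + of_int (a + 1) / of_nat n * eta" for m
    by (simp add: field_simps)
  moreover have "of_int a * (z + eta / of_nat n) + of_int a / (2 * of_nat n) + of_int a * (of_int a - of_nat n) / (2 * of_nat n) * eta
     = gth z + (of_int (a + 1) * z + of_int (a + 1) / (2 * of_nat n) + of_int (a + 1) * (of_int (a + 1) - of_nat n) / (2 * of_nat n) * eta)"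
    by (simp add: gth_def field_simps)
  ultimately show ?thesis
    unfolding theta_ind_def by (simp only: ee_add mult.assoc)
qed

lemma th_prod_eta:
  "(\<Prod>m<n. theta eta (z + eta + of_nat m / of_nat n + of_int a / of_nat n * eta))
   = - ee (- of_nat n * z - of_int a * eta) * (\<Prod>m<n. theta eta (z + of_nat m / of_nat n + of_int a / of_nat n * eta))"
proof -
  define w where "w m = z + of_nat m / of_nat n + of_int a / of_nat n * eta" for m
  have "(\<Prod>m<n. theta eta (z + eta + of_nat m / of_nat n + of_int a / of_nat n * eta)) = (\<Prod>m<n. (-1) * (ee (- w m) * theta eta (w m)))"
  proof (rule prod.cong)
    fix m
    have "z + eta + of_nat m / of_nat n + of_int a / of_nat n * eta = w m + eta" by (simp add: w_def)
    thus "theta eta (z + eta + of_nat m / of_nat n + of_int a / of_nat n * eta) = (-1) * (ee (- w m) * theta eta (w m))"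
      by (simp only: theta_eta) simp
  qed simp
  also have "\<dots> = - ((\<Prod>m<n. ee (- w m)) * (\<Prod>m<n. theta eta (w m)))"
    by (simp only: prod.distrib prod_constant) (simp add: minus_one_n)
  also have "(\<Prod>m<n. ee (- w m)) = ee (\<Sum>m<n. - w m)" by (rule ee_sum)
  also have "(\<Sum>m<n. - w m) = (- of_nat n * z - of_int a * eta) + of_int (- int k)"
  proof -
    have "(\<Sum>m<n. of_nat m / of_nat n :: complex) = of_nat k"
      using sum_n by (simp add: sum_divide_distrib[symmetric])
    moreover have "(\<Sum>m<n. - w m) = - (of_nat n * z + (\<Sum>m<n. of_nat m / of_nat n) + of_nat n * (of_int a / of_nat n * eta))"
      by (simp only: w_def sum_negf sum.distrib sum_constant card_lessThan)
    ultimately show ?thesis by simp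
  qed
  also have "ee \<dots> = ee (- of_nat n * z - of_int a * eta)" by (rule ee_mult_int_period)
  finally show ?thesis by (simp add: w_def)
qed

lemma th_eta: "th a (z + eta) = - ee (- of_nat n * z) * th a z"
proof -
  have "ee (of_int a * (z + eta) + of_int a / (2 * of_nat n) + of_int a * (of_int a - of_nat n) / (2 * of_nat n) * eta)
      * ee (- of_nat n * z - of_int a * eta)
     = ee (- of_nat n * z) * ee (of_int a * z + of_int a / (2 * of_nat n) + of_int a * (of_int a - of_nat n) / (2 * of_nat n) * eta)"
    unfolding ee_add[symmetric] by (rule arg_cong[where f = ee]) (simp add: algebra_simps)
  thus ?thesis unfolding theta_ind_def th_prod_eta by (simp add: mult_ac)
qed

text \<open>Raising the index by n shifts every factor by eta. The resulting sign -1 of the product,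
  n being odd, is compensated by the term \<open>of_int a / (2 * of_nat n)\<close> of the prefactor,
  which grows by 1/2.\<close>

lemma th_period: "th (a + int n) z = th a z"
proof -
  have "z + of_nat m / of_nat n + of_int (a + int n) / of_nat n * eta = z + eta + of_nat m / of_nat n + of_int a / of_nat n * eta" for m
    by (simp add: field_simps)
  moreover have "ee (of_int (a + int n) * z + of_int (a + int n) / (2 * of_nat n) + of_int (a + int n) * (of_int (a + int n) - of_nat n) / (2 * of_nat n) * eta)
      * ee (- of_nat n * z - of_int a * eta)
     = - ee (of_int a * z + of_int a / (2 * of_nat n) + of_int a * (of_int a - of_nat n) / (2 * of_nat n) * eta)"
  proof -
    have "of_int (a + int n) * z + of_int (a + int n) / (2 * of_nat n) + of_int (a + int n) * (of_int (a + int n) - of_nat n) / (2 * of_nat n) * eta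
        + (- of_nat n * z - of_int a * eta)
      = 1 / 2 + (of_int a * z + of_int a / (2 * of_nat n) + of_int a * (of_int a - of_nat n) / (2 * of_nat n) * eta)"
      by (simp add: field_simps)
    thus ?thesis unfolding ee_add[symmetric] by (simp only: ee_add[of "1/2"] ee_half) simp
  qed
  moreover have "x * y = - u \<Longrightarrow> x * (- y * p) = u * p" for x y u p :: complex
    by (metis minus_minus mult.assoc mult_minus_left mult_minus_right)
  ultimately show ?thesis unfolding theta_ind_def by (simp only: th_prod_eta)
qed

lemma th_mod [simp]: "th (a mod int n) z = th a z"
  by (rule periodic_mod) (rule th_period)

text \<open>Reflection reverses the order of the factors, m -> n - m, and turns the index into its
  negative; the sign is (-1)^n.\<close>

lemma th_reflect: "th a (- z) = - ee (of_int a / of_nat n - of_nat n * z) * th (- a) z"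
proof -
  define w where "w m = z - of_nat m / of_nat n + of_int (- a) / of_nat n * eta" for m
  have "(\<Prod>m<n. theta eta (- z + of_nat m / of_nat n + of_int a / of_nat n * eta)) = (\<Prod>m<n. (-1) * (ee (- w m) * theta eta (w m)))"
  proof (rule prod.cong)
    fix m
    have "- z + of_nat m / of_nat n + of_int a / of_nat n * eta = - w m" by (simp add: w_def)
    thus "theta eta (- z + of_nat m / of_nat n + of_int a / of_nat n * eta) = (-1) * (ee (- w m) * theta eta (w m))"
      by (simp only: theta_reflect) simp
  qed simp
  also have "\<dots> = - ((\<Prod>m<n. ee (- w m)) * (\<Prod>m<n. theta eta (w m)))"
    by (simp only: prod.distrib prod_constant) (simp add: minus_one_n)
  also have "(\<Prod>m<n. ee (- w m)) = ee (\<Sum>m<n. - w m)" by (rule ee_sum)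
  also have "(\<Sum>m<n. - w m) = (- of_nat n * z + of_int a * eta) + of_int (int k)"
  proof -
    have "(\<Sum>m<n. of_nat m / of_nat n :: complex) = of_nat k"
      using sum_n by (simp add: sum_divide_distrib[symmetric])
    moreover have "(\<Sum>m<n. - w m) = - (of_nat n * z - (\<Sum>m<n. of_nat m / of_nat n) + of_nat n * (of_int (- a) / of_nat n * eta))"
      by (simp only: w_def sum_negf sum.distrib sum_subtractf sum_constant card_lessThan)
    ultimately show ?thesis by simp
  qed
  also have "ee \<dots> = ee (- of_nat n * z + of_int a * eta)" by (rule ee_mult_int_period)
  also have "(\<Prod>m<n. theta eta (w m)) = (\<Prod>m<n. theta eta (z + of_nat m / of_nat n + of_int (- a) / of_nat n * eta))"
  proof -
    define g where "g m = theta eta (z + of_nat m / of_nat n + of_int (- a) / of_nat n * eta)" for m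
    have "z + of_nat n / of_nat n + of_int (- a) / of_nat n * eta = (z + of_nat 0 / of_nat n + of_int (- a) / of_nat n * eta) + 1"
      by simp
    then have "g n = g 0" by (simp only: g_def theta_1)
    then have "(\<Prod>m<n. g (n - m)) = (\<Prod>m<n. g m)" by (rule prod_reflect)
    moreover have "theta eta (w m) = g (n - m)" if "m < n" for m
    proof -
      have "z + of_nat (n - m) / of_nat n + of_int (- a) / of_nat n * eta = w m + 1"
        using that by (simp add: w_def of_nat_diff diff_divide_distrib)
      thus ?thesis by (simp only: g_def theta_1)
    qed
    ultimately show ?thesis by (simp add: g_def)
  qed
  finally have P: "(\<Prod>m<n. theta eta (- z + of_nat m / of_nat n + of_int a / of_nat n * eta)) =
      - (ee (- of_nat n * z + of_int a * eta) * (\<Prod>m<n. theta eta (z + of_nat m / of_nat n + of_int (- a) / of_nat n * eta)))" .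
  have "ee (of_int a * - z + of_int a / (2 * of_nat n) + of_int a * (of_int a - of_nat n) / (2 * of_nat n) * eta) * ee (- of_nat n * z + of_int a * eta)
     = ee (of_int a / of_nat n - of_nat n * z) * ee (of_int (- a) * z + of_int (- a) / (2 * of_nat n) + of_int (- a) * (of_int (- a) - of_nat n) / (2 * of_nat n) * eta)"
    unfolding ee_add[symmetric] by (rule arg_cong[where f = ee]) (simp add: field_simps)
  thus ?thesis unfolding theta_ind_def P by (simp add: mult_ac)
qed

lemma th_zero: "th a z = 0 \<Longrightarrow> \<exists>m<n. z + of_nat m / of_nat n + of_int a / of_nat n * eta \<in> Lam"
  by (auto simp: theta_ind_def theta_zero_iff)

lemma th_0_0: "th 0 0 = 0"
proof -
  have "(\<Prod>m<n. theta eta (0 + of_nat m / of_nat n + of_int 0 / of_nat n * eta)) = 0"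
    by (rule prod_zero) (auto intro!: bexI[of _ 0] simp: theta_0)
  thus ?thesis unfolding theta_ind_def by simp
qed

lemma frac_Lam:
  assumes "of_int a / of_nat n + of_int b / of_nat n * eta \<in> Lam"
  shows "int n dvd a \<and> int n dvd b"
proof -
  obtain c d :: int where "of_int a / of_nat n + of_int b / of_nat n * eta = of_int c + of_int d * eta"
    using assms unfolding Lam_iff by blast
  then have "of_int a + of_int b * eta = of_nat n * (of_int c + of_int d * eta)"
    by (simp add: field_simps)
  then have "of_real (real_of_int a) + of_real (real_of_int b) * eta
      = of_real (real_of_int (int n * c)) + of_real (real_of_int (int n * d)) * eta"
    by (simp add: algebra_simps)
  then have "real_of_int a = real_of_int (int n * c) \<and> real_of_int b = real_of_int (int n * d)"
    by (rule eta_coeffs_eq)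
  then have "a = int n * c" "b = int n * d" by (simp_all only: of_int_eq_iff)
  thus ?thesis by simp
qed

lemma th_at_0: "th a 0 = 0 \<Longrightarrow> int n dvd a"
proof -
  assume "th a 0 = 0"
  then obtain m where "0 + of_nat m / of_nat n + of_int a / of_nat n * eta \<in> Lam" using th_zero by blast
  then show ?thesis using frac_Lam[of "int m" a] by simp
qed

section \<open>The products over all residues and their zeros\<close>

text \<open>A theta function of order n^2 whose zeros are simple and form exactly (1/n) Lambda, the
  set of excluded values of tau.\<close>

definition TT :: "complex \<Rightarrow> complex" where "TT z = (\<Prod>a\<in>Zn n. th a z)"

definition QQ :: "int \<Rightarrow> complex \<Rightarrow> complex" where "QQ a z = (\<Prod>b\<in>Zn n - {a mod int n}. th b z)"

lemma TT_holomorphic: "TT holomorphic_on S"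
  unfolding TT_def[abs_def] by (intro holomorphic_intros th_holomorphic)

lemma QQ_holomorphic: "QQ a holomorphic_on S"
  unfolding QQ_def[abs_def] by (intro holomorphic_intros th_holomorphic)

lemma TT_QQ: "TT z = th a z * QQ a z"
proof -
  have "TT z = th (a mod int n) z * (\<Prod>b\<in>Zn n - {a mod int n}. th b z)"
    unfolding TT_def by (rule prod.remove) auto
  thus ?thesis by (simp add: QQ_def)
qed

lemma QQ_at_0: "a mod int n \<noteq> 0 \<Longrightarrow> QQ a 0 = 0"
  unfolding QQ_def by (rule prod_zero) (auto intro!: bexI[of _ 0] simp: th_0_0 Zn_iff)

lemma QQ_0_0: "QQ 0 0 \<noteq> 0"
proof -
  have "th b 0 \<noteq> 0" if "b \<in> Zn n - {0}" for b
  proof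
    assume "th b 0 = 0"
    then have "int n dvd b" by (rule th_at_0)
    thus False using that zdvd_not_zless by (auto simp: Zn_iff)
  qed
  thus ?thesis by (simp add: QQ_def)
qed

lemma TT_0: "TT 0 = 0" using TT_QQ[of 0 0] th_0_0 by simp

text \<open>The residues 0, ..., n - 1 divided by n add up to k, an integer because n is
  odd.\<close>

lemma TT_1n: "TT (z + 1 / of_nat n) = TT z"
proof -
  have "(\<Prod>a\<in>Zn n. ee (of_int a / of_nat n)) = ee (of_nat k)"
    unfolding ee_sum sum_divide_distrib[symmetric] sum_Zn_n by simp
  thus ?thesis unfolding TT_def th_1n prod.distrib by simp
qed

lemma TT_etan: "TT (z + eta / of_nat n) = - ee (- of_nat n * z + of_nat k * eta) * TT z"
proof -
  have "(\<Prod>a\<in>Zn n. th (a + 1) z) = TT z"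
    using prod_Zn_affine[of n 1 "\<lambda>a. th a z" 1] th_period by (simp add: TT_def)
  moreover have "ee (gth z) ^ n = - ee (- of_nat n * z + of_nat k * eta)"
  proof -
    have "of_nat n * gth z = - (1 / 2) + (- of_nat n * z + of_nat k * eta)"
      by (simp add: gth_def n_div_2[symmetric] field_simps)
    then have "ee (gth z) ^ n = ee (- (1 / 2)) * ee (- of_nat n * z + of_nat k * eta)"
      by (simp only: ee_power ee_add)
    thus ?thesis by (simp add: ee_minus)
  qed
  ultimately show ?thesis unfolding TT_def th_etan prod.distrib by simp
qed

lemma TT_reflect: "TT (- z) = - ee (- ((of_nat n)\<^sup>2 * z)) * TT z"
proof -
  have "(\<Prod>a\<in>Zn n. th (- a) z) = TT z"
    using prod_Zn_affine[of n "-1" "\<lambda>a. th a z" 0] th_period by (simp add: TT_def)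
  moreover have "(\<Prod>a\<in>Zn n. - ee (of_int a / of_nat n - of_nat n * z)) = - ee (- ((of_nat n)\<^sup>2 * z))"
  proof -
    have "(\<Prod>a\<in>Zn n. - ee (of_int a / of_nat n - of_nat n * z)) = (\<Prod>a\<in>Zn n. (-1) * ee (of_int a / of_nat n - of_nat n * z))"
      by simp
    also have "\<dots> = - ee (\<Sum>a\<in>Zn n. of_int a / of_nat n - of_nat n * z)"
      by (simp only: prod.distrib prod_constant ee_sum) (simp add: minus_one_n)
    also have "(\<Sum>a\<in>Zn n. of_int a / of_nat n - of_nat n * z) = - ((of_nat n)\<^sup>2 * z) + of_int (int k)"
    proof -
      have "(\<Sum>a\<in>Zn n. of_int a / of_nat n :: complex) = of_nat k"
        unfolding sum_divide_distrib[symmetric] sum_Zn_n by simp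
      thus ?thesis by (simp add: sum_subtractf power2_eq_square)
    qed
    also have "ee \<dots> = ee (- ((of_nat n)\<^sup>2 * z))" by (rule ee_mult_int_period)
    finally show ?thesis .
  qed
  ultimately show ?thesis unfolding TT_def th_reflect prod.distrib by simp
qed

lemma TT_eta: "TT (z + eta) = - ee (- ((of_nat n)\<^sup>2 * z)) * TT z"
proof -
  have "TT (z + eta) = (\<Prod>a\<in>Zn n. (-1) * (ee (- of_nat n * z) * th a z))"
    unfolding TT_def th_eta by simp
  also have "\<dots> = - (ee (- of_nat n * z) ^ n * TT z)"
    by (simp only: prod.distrib prod_constant TT_def) (simp add: minus_one_n)
  finally show ?thesis by (simp add: ee_power power2_eq_square mult_ac)
qed

lemma TT_1: "TT (z + 1) = TT z"
  using shift_int_period[of TT "1 / of_nat n" z "int n"] TT_1n by simp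

lemma QQ_1n: "QQ a (z + 1 / of_nat n) = ee (- (of_int a / of_nat n)) * QQ a z"
proof -
  have "(\<Prod>b\<in>Zn n - {a mod int n}. ee (of_int b / of_nat n)) = ee (- (of_int a / of_nat n))"
  proof -
    have "(\<Sum>b\<in>Zn n. of_int b / of_nat n :: complex) = of_nat k"
      unfolding sum_divide_distrib[symmetric] sum_Zn_n by simp
    then have "(\<Sum>b\<in>Zn n - {a mod int n}. of_int b / of_nat n :: complex) = of_nat k - of_int (a mod int n) / of_nat n"
      by (subst sum_diff) auto
    also have "\<dots> = - (of_int a / of_nat n) + of_int (int k + a div int n)"
    proof -
      have "(of_int a :: complex) = of_int (a div int n) * of_nat n + of_int (a mod int n)"
        by (metis div_mult_mod_eq of_int_add of_int_mult of_int_of_nat_eq)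
      thus ?thesis by (simp add: field_simps)
    qed
    finally show ?thesis unfolding ee_sum by (simp only: ee_mult_int_period)
  qed
  thus ?thesis unfolding QQ_def th_1n prod.distrib by simp
qed

lemma QQ_etan: "QQ a (z + eta / of_nat n) = ee (gth z) ^ (n - 1) * QQ (a + 1) z"
proof -
  have bij: "bij_betw (\<lambda>x. (x + 1) mod int n) (Zn n) (Zn n)"
    using Zn_affine_bij[of n 1 1] by simp
  have "bij_betw (\<lambda>x. (x + 1) mod int n) (Zn n - {a mod int n}) (Zn n - {(a + 1) mod int n})"
    using bij_betw_DiffI[OF bij, of "{a mod int n}" "{(a + 1) mod int n}"]
    by (simp add: bij_betw_def mod_simps)
  then have "(\<Prod>b\<in>Zn n - {a mod int n}. th ((b + 1) mod int n) z) = (\<Prod>b\<in>Zn n - {(a + 1) mod int n}. th b z)"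
    by (rule prod.reindex_bij_betw)
  then have "(\<Prod>b\<in>Zn n - {a mod int n}. th (b + 1) z) = QQ (a + 1) z" by (simp add: QQ_def)
  moreover have "card (Zn n - {a mod int n}) = n - 1" by (subst card_Diff_singleton) auto
  ultimately show ?thesis unfolding QQ_def[of a] th_etan prod.distrib by simp
qed

lemma nLam_iff: "of_nat n * z \<in> Lam \<longleftrightarrow> (\<exists>a b :: int. z = of_int a * (1 / of_nat n) + of_int b * (eta / of_nat n))"
  unfolding Lam_iff by (rule ex_cong1, rule ex_cong1) (auto simp: field_simps)

lemma TT_zero_iff: "TT z = 0 \<longleftrightarrow> of_nat n * z \<in> Lam"
proof
  assume "TT z = 0"
  then obtain a where "a \<in> Zn n" "th a z = 0" by (auto simp: TT_def)
  then obtain m where "z + of_nat m / of_nat n + of_int a / of_nat n * eta \<in> Lam" using th_zero by blast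
  then have "of_nat n * (z + of_nat m / of_nat n + of_int a / of_nat n * eta) - (of_int (int m) + of_int a * eta) \<in> Lam"
    by (intro Lam_diff Lam_mult_nat Lam_basis)
  thus "of_nat n * z \<in> Lam" by (simp add: field_simps)
next
  assume "of_nat n * z \<in> Lam"
  then obtain a b :: int where z: "z = of_int a * (1 / of_nat n) + of_int b * (eta / of_nat n)"
    unfolding nLam_iff by blast
  have "TT z = TT (of_int b * (eta / of_nat n))"
    using shift_int_period[of TT "1 / of_nat n" "of_int b * (eta / of_nat n)" a] TT_1n by (simp add: z add.commute)
  moreover have "(TT (0 + of_int b * (eta / of_nat n)) = 0) = (TT 0 = 0)"
    by (rule shift_int_period) (simp add: TT_etan)
  ultimately show "TT z = 0" using TT_0 by simp
qed

text \<open>At 0 the only vanishing factor of the whole product is the one with index 0 and m =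
  0.\<close>

lemma TT_deriv_0: "deriv TT 0 \<noteq> 0"
proof -
  define R where "R z = (\<Prod>m\<in>{1..<n}. theta eta (z + of_nat m / of_nat n)) * QQ 0 z" for z
  have R: "TT z = theta eta z * R z" for z
  proof -
    have "th 0 z = (\<Prod>m\<in>{0..<n}. theta eta (z + of_nat m / of_nat n))"
      by (simp add: theta_ind_def atLeast0LessThan)
    also have "\<dots> = theta eta z * (\<Prod>m\<in>{1..<n}. theta eta (z + of_nat m / of_nat n))"
      using prod.atLeast_Suc_lessThan[of 0 n "\<lambda>m. theta eta (z + of_nat m / of_nat n)"] by simp
    finally show ?thesis using TT_QQ[of z 0] by (simp add: R_def)
  qed
  have hol: "R holomorphic_on UNIV" unfolding R_def
    by (intro holomorphic_intros entire_compose[OF theta_holomorphic] QQ_holomorphic)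
  have "theta eta (of_nat m / of_nat n) \<noteq> 0" if "m \<in> {1..<n}" for m
  proof
    assume "theta eta (of_nat m / of_nat n) = 0"
    then have "of_nat m / of_nat n \<in> Lam" by (simp add: theta_zero_iff)
    then have "int n dvd int m" using frac_Lam[of "int m" 0] by simp
    thus False using that by (auto dest: dvd_imp_le)
  qed
  then have R0: "R 0 \<noteq> 0" using QQ_0_0 by (simp add: R_def)
  have "((\<lambda>z. theta eta z * R z) has_field_derivative deriv (theta eta) 0 * R 0 + deriv R 0 * theta eta 0) (at 0)"
    by (intro DERIV_mult entire_deriv_has hol theta_holomorphic)
  then have "(TT has_field_derivative deriv (theta eta) 0 * R 0) (at 0)"
    by (simp add: R[abs_def] theta_0)
  then have "deriv TT 0 = deriv (theta eta) 0 * R 0" by (rule DERIV_imp_deriv)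
  thus ?thesis using R0 theta_deriv_0 by simp
qed

lemma TT_deriv: "TT z = 0 \<Longrightarrow> deriv TT z \<noteq> 0"
proof -
  assume "TT z = 0"
  then obtain a b :: int where z: "z = of_int a * (1 / of_nat n) + of_int b * (eta / of_nat n)"
    unfolding TT_zero_iff nLam_iff by blast
  \<comment> \<open>Having a simple zero is a periodic property by \<open>deriv_quasi\<close>;
    stated as a truth value it can be shifted to the origin.\<close>
  define S where "S w \<longleftrightarrow> TT w = 0 \<and> deriv TT w \<noteq> 0" for w
  have 1: "S (w + 1 / of_nat n) = S w" for w
  proof -
    have "TT w = 0 \<Longrightarrow> deriv TT (w + 1 / of_nat n) = 1 * deriv TT w"
      by (rule deriv_quasi[OF TT_holomorphic]) (auto simp: TT_1n)
    thus ?thesis unfolding S_def by (auto simp: TT_1n)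
  qed
  have 2: "S (w + eta / of_nat n) = S w" for w
  proof -
    have "TT w = 0 \<Longrightarrow> deriv TT (w + eta / of_nat n) = - ee (- of_nat n * w + of_nat k * eta) * deriv TT w"
      by (rule deriv_quasi[OF TT_holomorphic]) (auto simp: TT_etan intro!: holomorphic_intros)
    thus ?thesis unfolding S_def by (auto simp: TT_etan)
  qed
  have "S z = S 0"
    using shift_int_period[of S "1 / of_nat n" "of_int b * (eta / of_nat n)" a] shift_int_period[of S "eta / of_nat n" 0 b] 1 2
    by (simp add: z add.commute)
  thus ?thesis using TT_deriv_0 TT_0 by (simp add: S_def)
qed

end

section \<open>The theta basis in the coordinates of the symmetric power\<close>

lemma cfun_scale_apply: "fscale c f x = c * f x" by (simp add: fscale_def)

lemma cfun_sum_apply: "(\<Sum>a\<in>A. F a) x = (\<Sum>a\<in>A. F a x :: complex)"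
  by (induction A rule: infinite_finite_induct) auto

lemma cfun_sum_scale_apply: "(\<Sum>a\<in>A. fscale (c a) (F a)) x = (\<Sum>a\<in>A. c a * F a x)"
  by (simp add: cfun_sum_apply cfun_scale_apply)

definition sh :: "(nat \<Rightarrow> complex) \<Rightarrow> complex \<Rightarrow> nat \<Rightarrow> complex" where
  "sh y u = (\<lambda>i. y i + u)"

lemma sh_apply [simp]: "sh y u i = y i + u" by (simp add: sh_def)

lemma sh_sh [simp]: "sh (sh y u) v = sh y (u + v)" by (simp add: sh_def fun_eq_iff)

lemma sh_0 [simp]: "sh y 0 = y" by (simp add: sh_def)

text \<open>Singling out the last coordinate is no loss, since permuting the coordinates multiplies
  all basis elements by one common scalar (\<open>W_transpose\<close>).\<close>

definition sk :: "nat \<Rightarrow> (nat \<Rightarrow> complex) \<Rightarrow> complex \<Rightarrow> complex \<Rightarrow> nat \<Rightarrow> complex" where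
  "sk k y u q = (\<lambda>i. y i + u + (if i = k then q else 0))"

locale theta_w = odd_theta +
  fixes w :: "int \<Rightarrow> (nat \<Rightarrow> complex) \<Rightarrow> complex"
  assumes theta_basis: "theta_basis k eta w"
begin

text \<open>\<open>Zf y\<close> is the point \<open>z\<close> with \<open>z\<^sub>j\<^sub>+\<^sub>1 - z\<^sub>j = y\<^sub>j\<close>, so that \<open>rho (Zf y)\<close> is the class of \<open>y\<close>.
  \<open>W a\<close> is \<open>w a\<close> in the coordinates \<open>y\<close>, and \<open>SS y = - z\<^sub>1\<close>.\<close>

definition Zf :: "(nat \<Rightarrow> complex) \<Rightarrow> nat \<Rightarrow> complex" where
  "Zf y = (\<lambda>t. if t \<in> {1..k} then - (\<Sum>s\<in>{t..k}. y s) else 0)"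

definition W :: "int \<Rightarrow> (nat \<Rightarrow> complex) \<Rightarrow> complex" where
  "W a y = w (a mod int n) (Zf y)"

definition SS :: "(nat \<Rightarrow> complex) \<Rightarrow> complex" where "SS y = (\<Sum>s\<in>{1..k}. y s)"

lemma Zf_Ck [simp]: "Zf y \<in> Ck k" by (auto simp: Zf_def Ck_def)

lemma Zf_1: "Zf y 1 = - SS y" using k_pos by (simp add: Zf_def SS_def)

lemma Zf_Suc: "j \<in> {1..k} \<Longrightarrow> Zf y (j + 1) - Zf y j = y j"
proof -
  assume j: "j \<in> {1..k}"
  then have "{j..k} = insert j {j + 1..k}" by auto
  then have "(\<Sum>s\<in>{j..k}. y s) = y j + (\<Sum>s\<in>{j + 1..k}. y s)" by simp
  thus ?thesis using j by (auto simp: Zf_def)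
qed

lemma Zf_cong: "(\<And>i. i \<in> {1..k} \<Longrightarrow> y i = y' i) \<Longrightarrow> Zf y = Zf y'"
  unfolding Zf_def by (intro ext if_cong refl arg_cong[where f = uminus] sum.cong) auto

lemma W_cong: "(\<And>i. i \<in> {1..k} \<Longrightarrow> y i = y' i) \<Longrightarrow> W a y = W a y'"
  unfolding W_def using Zf_cong by metis

lemma Zf_surj:
  assumes "z \<in> Ck k"
  shows "Zf (\<lambda>i. z (i + 1) - z i) = z"
proof
  fix t
  have z: "z i = 0" if "i \<notin> {1..k}" for i using assms that by (simp add: Ck_def)
  show "Zf (\<lambda>i. z (i + 1) - z i) t = z t"
  proof (cases "t \<in> {1..k}")
    case True
    have "(\<Sum>s\<in>{t..k}. z (s + 1) - z s) = z (k + 1) - z t"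
      using sum_Suc_diff[of t k z] True by simp
    thus ?thesis using True z[of "k + 1"] by (simp add: Zf_def)
  next
    case False
    thus ?thesis using z[OF False] unfolding Zf_def by (simp only: if_False)
  qed
qed

lemma W_mod [simp]: "W (a mod int n) y = W a y" by (simp add: W_def)

lemma W_cong_mod: "int n dvd a - b \<Longrightarrow> W a y = W b y"
  by (simp add: W_def mod_eq_dvd_iff[symmetric])

lemma n_alt: "2 * k + 1 = n" by (simp add: n_def)

lemmas basis_conjs = theta_basis[unfolded theta_basis_def Let_def n_alt]

lemmas w_inj = basis_conjs[THEN conjunct1]
  and w_indep = basis_conjs[THEN conjunct2, THEN conjunct1]
  and w_span = basis_conjs[THEN conjunct2, THEN conjunct2, THEN conjunct1]
  and w_translate_1n = basis_conjs[THEN conjunct2, THEN conjunct2, THEN conjunct2, THEN conjunct1]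
  and w_translate_etan = basis_conjs[THEN conjunct2, THEN conjunct2, THEN conjunct2, THEN conjunct2]

lemma w_H0: "a \<in> Zn n \<Longrightarrow> w a \<in> H0 k eta"
  unfolding w_span[symmetric] by (intro cfun.span_base imageI)

lemma H0_D:
  assumes "f \<in> H0 k eta"
  shows "z \<notin> Ck k \<Longrightarrow> f z = 0" "holomorphic_Ck k f"
    "z \<in> Ck k \<Longrightarrow> i \<in> {1..k} \<Longrightarrow> f (z(i := z i + 1)) = f z"
    "z \<in> Ck k \<Longrightarrow> i \<in> {1..k} \<Longrightarrow> f (z(i := z i + eta)) = (-1) ^ ncf i * ee (- of_nat (ncf i) * z i + z (i - 1) + z (i + 1)
                + ((if i = 1 then 1 else 0) - 1) * eta) * f z"
  using assms unfolding H0_def mem_Collect_eq by blast+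

lemma w_outside: "a \<in> Zn n \<Longrightarrow> z \<notin> Ck k \<Longrightarrow> w a z = 0"
  using w_H0 H0_D(1) by blast

text \<open>Raising y_j by eta lowers z_1, ..., z_j by eta. The j multipliers of the z-coordinates
  telescope: only y_j and z_1 = -\<open>SS y\<close> survive, a form that is the same for every
  j.\<close>

lemma H0_quasi:
  assumes "f \<in> H0 k eta" "j \<in> {1..k}"
  shows "f (\<lambda>t. if 1 \<le> t \<and> t \<le> j then Zf y t - eta else Zf y t) = - ee (- y j - 2 * SS y - 3 * eta) * f (Zf y)"
proof -
  have quasi: "f (z(i := z i + eta)) = (-1) ^ ncf i * ee (- of_nat (ncf i) * z i + z (i - 1) + z (i + 1)
                + ((if i = 1 then 1 else 0) - 1) * eta) * f z" if "z \<in> Ck k" "i \<in> {1..k}" for z i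
    using H0_D(4)[OF assms(1) that] .
  define z where "z = Zf y"
  define zz where "zz m = (\<lambda>t. if 1 \<le> t \<and> t \<le> m then z t - eta else z t)" for m
  have zzC: "zz m \<in> Ck k" if "m \<le> k" for m
    using that Zf_Ck[of y] by (auto simp: Ck_def zz_def z_def)
  have z0: "z 0 = 0" by (simp add: z_def Zf_def)
  have *: "f (zz m) = - ee (2 * z 1 - 3 * eta - (z (m + 1) - z m)) * f (zz 0)" if "1 \<le> m" "m \<le> k" for m
    using that
  proof (induction m rule: dec_induct)
    case base
    have u: "(zz 1)(1 := zz 1 1 + eta) = zz 0" by (auto simp: zz_def fun_eq_iff)
    have "f (zz 0) = (-1) ^ 3 * ee (- 3 * (z 1 - eta) + z 2) * f (zz 1)"
      using quasi[OF zzC[of 1], of 1] base k_pos z0 unfolding u by (simp add: zz_def ncf_def numeral_2_eq_2)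
    moreover have "ee (2 * z 1 - 3 * eta - (z (1 + 1) - z 1)) * ee (- 3 * (z 1 - eta) + z 2) = 1"
      unfolding ee_add[symmetric] by (simp add: algebra_simps numeral_2_eq_2)
    ultimately show ?case by (simp add: mult.assoc[symmetric])
  next
    case (step m)
    have u: "(zz (Suc m))(Suc m := zz (Suc m) (Suc m) + eta) = zz m" by (auto simp: zz_def fun_eq_iff)
    have "f (zz m) = (-1) ^ 2 * ee (- 2 * (z (Suc m) - eta) + (z m - eta) + z (Suc m + 1) - eta) * f (zz (Suc m))"
      using quasi[OF zzC[of "Suc m"], of "Suc m"] step unfolding u by (simp add: zz_def ncf_def)
    then have 1: "f (zz m) = ee (- 2 * z (Suc m) + z m + z (Suc m + 1)) * f (zz (Suc m))"
      by (simp add: algebra_simps)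
    have "f (zz (Suc m)) = ee (2 * z (Suc m) - z m - z (Suc m + 1)) * f (zz m)"
      unfolding 1 mult.assoc[symmetric] ee_add[symmetric] by simp
    also have "f (zz m) = - ee (2 * z 1 - 3 * eta - (z (m + 1) - z m)) * f (zz 0)" using step by simp
    also have "ee (2 * z (Suc m) - z m - z (Suc m + 1)) * (- ee (2 * z 1 - 3 * eta - (z (m + 1) - z m)) * f (zz 0))
      = - (ee (2 * z (Suc m) - z m - z (Suc m + 1)) * ee (2 * z 1 - 3 * eta - (z (m + 1) - z m))) * f (zz 0)" by simp
    also have "\<dots> = - ee (2 * z 1 - 3 * eta - (z (Suc m + 1) - z (Suc m))) * f (zz 0)"
      unfolding ee_add[symmetric] by (simp add: algebra_simps)
    finally show ?case .
  qed
  have "zz 0 = z" by (auto simp: zz_def)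
  moreover have "z (j + 1) - z j = y j" using Zf_Suc assms(2) by (simp add: z_def)
  moreover have "z 1 = - SS y" using Zf_1 by (simp add: z_def)
  ultimately have "f (zz j) = - ee (2 * (- SS y) - 3 * eta - y j) * f (Zf y)"
    using *[of j] assms(2) by (simp add: z_def)
  also have "2 * (- SS y) - 3 * eta - y j = - y j - 2 * SS y - 3 * eta" by simp
  finally show ?thesis unfolding zz_def z_def .
qed

lemma Zf_upd:
  assumes "j \<in> {1..k}"
  shows "Zf (y(j := y j + q)) = (\<lambda>t. if 1 \<le> t \<and> t \<le> j then Zf y t - q else Zf y t)"
proof
  fix t
  show "Zf (y(j := y j + q)) t = (if 1 \<le> t \<and> t \<le> j then Zf y t - q else Zf y t)"
  proof (cases "1 \<le> t \<and> t \<le> j")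
    case True
    then have "(\<Sum>s\<in>{t..k}. (y(j := y j + q)) s) = (\<Sum>s\<in>{t..k}. y s) + (\<Sum>s\<in>{t..k}. if s = j then q else 0)"
      by (simp only: sum.distrib[symmetric]) (rule sum.cong, auto)
    also have "(\<Sum>s\<in>{t..k}. if s = j then q else 0) = q" using True assms by simp
    finally show ?thesis using True assms by (simp add: Zf_def)
  next
    case False
    then have "(\<Sum>s\<in>{t..k}. (y(j := y j + q)) s) = (\<Sum>s\<in>{t..k}. y s)" if "1 \<le> t"
      using that by (intro sum.cong) auto
    thus ?thesis using False by (auto simp: Zf_def)
  qed
qed

lemma W_eta:
  assumes "j \<in> {1..k}"
  shows "W a (y(j := y j + eta)) = - ee (- y j - 2 * SS y - 3 * eta) * W a y"
  unfolding W_def Zf_upd[OF assms] by (rule H0_quasi[OF w_H0 assms]) simp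

lemma W_1:
  assumes "j \<in> {1..k}"
  shows "W a (y(j := y j + 1)) = W a y"
proof -
  have per: "w (a mod int n) (z(i := z i + 1)) = w (a mod int n) z" if "z \<in> Ck k" "i \<in> {1..k}" for z i
    using H0_D(3)[OF w_H0 that] by simp
  define zz where "zz m = (\<lambda>t. if 1 \<le> t \<and> t \<le> m then Zf y t - 1 else Zf y t)" for m
  have zzC: "zz m \<in> Ck k" if "m \<le> k" for m
    using that Zf_Ck[of y] by (auto simp: Ck_def zz_def)
  have "w (a mod int n) (zz m) = w (a mod int n) (zz 0)" if "m \<le> k" for m
    using that
  proof (induction m)
    case (Suc m)
    have "(zz (Suc m))(Suc m := zz (Suc m) (Suc m) + 1) = zz m" by (auto simp: zz_def fun_eq_iff)
    then show ?case using per[OF zzC[of "Suc m"], of "Suc m"] Suc by simp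
  qed simp
  moreover have "zz 0 = Zf y" by (auto simp: zz_def fun_eq_iff)
  ultimately show ?thesis using assms unfolding W_def Zf_upd[OF assms] by (simp add: zz_def)
qed

lemma W_sh_1: "W a (sh y 1) = W a y"
proof -
  define yy where "yy m = (\<lambda>i. if 1 \<le> i \<and> i \<le> m then y i + 1 else y i)" for m
  have "W a (yy m) = W a y" if "m \<le> k" for m
    using that
  proof (induction m)
    case 0
    have "yy 0 = y" by (auto simp: yy_def fun_eq_iff)
    thus ?case by simp
  next
    case (Suc m)
    have "(yy m)(Suc m := yy m (Suc m) + 1) = yy (Suc m)" by (auto simp: yy_def fun_eq_iff)
    then show ?case using W_1[of "Suc m" a "yy m"] Suc by simp
  qed
  from this[of k] have "W a (yy k) = W a y" by simp
  moreover have "W a (yy k) = W a (sh y 1)" by (rule W_cong) (simp add: yy_def)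
  ultimately show ?thesis by simp
qed

text \<open>The translation vector (2 i - 1) / n has consecutive differences 2 / n, and its last
  entry gives - z_k the increment 2 / n - 1. In the coordinates y it is a uniform shift by 2 / n, up
  to the period 1 in the last one.\<close>

lemma W_2n: "W a (sh y (2 / of_nat n)) = ee (of_int a / of_nat n) * W a y"
proof -
  have k1: "k \<in> {1..k}" using k_pos by simp
  define y' where "y' = sh y (2 / of_nat n)"
  have "translate k (1 / of_nat n) (\<lambda>i. 2 * i - 1) (Zf y) = Zf (y'(k := y' k + (-1)))"
  proof
    fix t
    show "translate k (1 / of_nat n) (\<lambda>i. 2 * i - 1) (Zf y) t = Zf (y'(k := y' k + (-1))) t"
    proof (cases "t \<in> {1..k}")
      case True
      have "(\<Sum>s\<in>{t..k}. y' s) = (\<Sum>s\<in>{t..k}. y s) + of_nat (Suc k - t) * (2 / of_nat n)"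
        by (simp add: y'_def sum.distrib)
      moreover have "Zf (y'(k := y' k + (-1))) t = Zf y' t + 1"
        by (subst Zf_upd[OF k1]) (use True in auto)
      ultimately have "Zf (y'(k := y' k + (-1))) t = Zf y t - of_nat (Suc k - t) * (2 / of_nat n) + 1"
        using True by (simp add: Zf_def)
      moreover have "1 / of_nat n * of_nat (2 * t - 1) = 1 - of_nat (Suc k - t) * (2 / of_nat n :: complex)"
        using True by (simp add: of_nat_diff field_simps) (simp add: of_nat_n)
      ultimately show ?thesis using True by (simp add: translate_def)
    next
      case False
      thus ?thesis unfolding translate_def Zf_def by (simp only: if_False)
    qed
  qed
  then have "W a (y'(k := y' k + (-1))) = ee (of_int (a mod int n) / of_nat n) * W a y"
    unfolding W_def using w_translate_1n[rule_format, of "a mod int n" "Zf y"] by simp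
  moreover have "W a (y'(k := y' k + (-1))) = W a y'"
    using W_1[OF k1, of a "y'(k := y' k + (-1))"] by simp
  moreover have "ee (of_int (a mod int n) / of_nat n) = ee (of_int a / of_nat n)"
  proof (rule ee_eqI)
    have "(of_int a :: complex) = of_int (a div int n) * of_nat n + of_int (a mod int n)"
      by (metis div_mult_mod_eq of_int_add of_int_mult of_int_of_nat_eq)
    then have "of_int (a mod int n) / of_nat n - of_int a / of_nat n = (of_int (- (a div int n)) :: complex)"
      by (simp add: field_simps)
    thus "of_int (a mod int n) / of_nat n - of_int a / of_nat n \<in> (\<int> :: complex set)" by simp
  qed
  ultimately show ?thesis by (simp add: y'_def)
qed

text \<open>Since n is odd, 1/n is a multiple of 2/n modulo 1, namely 1/n + 1 = (k + 1)
  (2/n).\<close>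

lemma W_1n: "W a (sh y (1 / of_nat n)) = ee ((of_nat k + 1) * of_int a / of_nat n) * W a y"
proof -
  have it: "W a (sh y (of_nat m * (2 / of_nat n))) = ee (of_nat m * of_int a / of_nat n) * W a y" for m
  proof (induction m)
    case (Suc m)
    have "W a (sh y (of_nat (Suc m) * (2 / of_nat n))) = W a (sh (sh y (of_nat m * (2 / of_nat n))) (2 / of_nat n))"
      by (simp add: distrib_right add.commute add_divide_distrib)
    also have "\<dots> = ee (of_int a / of_nat n) * (ee (of_nat m * of_int a / of_nat n) * W a y)"
      by (simp only: W_2n Suc)
    also have "\<dots> = ee (of_nat (Suc m) * of_int a / of_nat n) * W a y"
      by (simp add: mult.assoc[symmetric] ee_add[symmetric] add_divide_distrib distrib_right)
    finally show ?case .
  qed simp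
  have "W a (sh (sh y (1 / of_nat n)) 1) = ee (of_nat (k + 1) * of_int a / of_nat n) * W a y"
  proof -
    have "1 / of_nat n + 1 = of_nat (k + 1) * (2 / of_nat n :: complex)"
      by (simp add: field_simps) (simp add: of_nat_n)
    then show ?thesis using it[of "k + 1"] by simp
  qed
  thus ?thesis unfolding W_sh_1 by (simp add: add.commute)
qed

definition cw :: complex where
  "cw = (SOME c. c \<noteq> 0 \<and> (\<forall>a\<in>Zn n. \<forall>z\<in>Ck k.
          w a (translate k (eta / of_nat n) (\<lambda>i. k - i + 1) z) = c * ee (- z 1) * w ((a + 1) mod int n) z))"

lemma cw: "cw \<noteq> 0" "\<And>a z. a \<in> Zn n \<Longrightarrow> z \<in> Ck k \<Longrightarrow>
   w a (translate k (eta / of_nat n) (\<lambda>i. k - i + 1) z) = cw * ee (- z 1) * w ((a + 1) mod int n) z"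
proof -
  from someI_ex[OF w_translate_etan] show "cw \<noteq> 0" "\<And>a z. a \<in> Zn n \<Longrightarrow> z \<in> Ck k \<Longrightarrow>
   w a (translate k (eta / of_nat n) (\<lambda>i. k - i + 1) z) = cw * ee (- z 1) * w ((a + 1) mod int n) z"
    unfolding cw_def[symmetric] by blast+
qed

text \<open>The vector (k, k - 1, ..., 1) has consecutive differences -1, including the step to
  z_(k+1) = 0, and thus acts on y as a uniform shift by - eta / n.\<close>

lemma W_etan: "W a (sh y (- (eta / of_nat n))) = cw * ee (SS y) * W (a + 1) y"
proof -
  have "translate k (eta / of_nat n) (\<lambda>i. k - i + 1) (Zf y) = Zf (sh y (- (eta / of_nat n)))"
  proof
    fix t
    show "translate k (eta / of_nat n) (\<lambda>i. k - i + 1) (Zf y) t = Zf (sh y (- (eta / of_nat n))) t"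
    proof (cases "t \<in> {1..k}")
      case True
      then have "(\<Sum>s\<in>{t..k}. sh y (- (eta / of_nat n)) s) = (\<Sum>s\<in>{t..k}. y s) - of_nat (k - t + 1) * (eta / of_nat n)"
        by (simp add: sum.distrib Suc_diff_le sum_subtractf sum_negf)
      thus ?thesis using True by (simp add: translate_def Zf_def)
    next
      case False
      thus ?thesis unfolding translate_def Zf_def by (simp only: if_False)
    qed
  qed
  then show ?thesis
    unfolding W_def using cw(2)[of "a mod int n" "Zf y"] Zf_1[of y] by (simp add: mod_simps)
qed

lemma W_add_1: "W (a + 1) y = inverse cw * ee (- SS y) * W a (sh y (- (eta / of_nat n)))"
  unfolding W_etan using cw(1) by (simp add: ee_minus field_simps)

lemma SS_sh [simp]: "SS (sh y u) = SS y + of_nat k * u"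
  by (simp add: SS_def sum.distrib)

lemma SS_upd: "j \<in> {1..k} \<Longrightarrow> SS (y(j := q)) = SS y - y j + q"
proof -
  assume j: "j \<in> {1..k}"
  have "SS (y(j := q)) = q + (\<Sum>s\<in>{1..k} - {j}. y s)"
    unfolding SS_def using j by (subst sum.remove[of _ j]) (auto intro!: sum.cong)
  moreover have "SS y = y j + (\<Sum>s\<in>{1..k} - {j}. y s)"
    unfolding SS_def using j by (subst sum.remove[of _ j]) auto
  ultimately show ?thesis by simp
qed

lemma SS_sk [simp]: "SS (sk k y u q) = SS y + of_nat k * u + q"
  using k_pos by (simp add: SS_def sk_def sum.distrib)

lemma Zf_add: "Zf (\<lambda>i. y i + t * v i) = (\<lambda>i. Zf y i + t * Zf v i)"
  by (rule ext) (simp add: Zf_def sum.distrib sum_distrib_left)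

text \<open>The zero counting later is one-variable function theory; Frechet differentiability
  enters it through restrictions to complex lines.\<close>

lemma holomorphic_Ck_line:
  assumes f: "holomorphic_Ck k f" and z: "z \<in> Ck k" and v: "v \<in> Ck k"
  shows "(\<lambda>t. f (\<lambda>i. z i + t * v i)) holomorphic_on UNIV"
proof (rule holomorphic_onI)
  fix t0 :: complex
  define p where "p = (\<lambda>i. z i + t0 * v i)"
  have p: "p \<in> Ck k" using z v by (simp add: p_def Ck_def)
  obtain d where d: "\<And>e. e > 0 \<Longrightarrow> \<exists>\<delta>>0. \<forall>h\<in>Ck k.
        (\<Sum>i=1..k. cmod (h i)) < \<delta> \<longrightarrow>
        cmod (f (\<lambda>i. p i + h i) - f p - (\<Sum>i=1..k. d i * h i)) \<le> e * (\<Sum>i=1..k. cmod (h i))"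
    using f p unfolding holomorphic_Ck_def by blast
  define V where "V = (\<Sum>i=1..k. cmod (v i))"
  define D where "D = (\<Sum>i=1..k. d i * v i)"
  have V0: "V \<ge> 0" by (simp add: V_def sum_nonneg)
  have "((\<lambda>t. f (\<lambda>i. z i + t * v i)) has_derivative (\<lambda>h. D * h)) (at t0)"
    unfolding has_derivative_at_alt
  proof (intro conjI allI impI)
    show "bounded_linear ((*) D)" by (rule bounded_linear_mult_right)
    fix e :: real assume e: "e > 0"
    \<comment> \<open>The 1 added to V covers the constant line v = 0.\<close>
    define e' where "e' = e / (V + 1)"
    have e': "e' > 0" using e V0 by (simp add: e'_def)
    obtain \<delta> where \<delta>: "\<delta> > 0" "\<And>h. h \<in> Ck k \<Longrightarrow> (\<Sum>i=1..k. cmod (h i)) < \<delta> \<Longrightarrow>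
        cmod (f (\<lambda>i. p i + h i) - f p - (\<Sum>i=1..k. d i * h i)) \<le> e' * (\<Sum>i=1..k. cmod (h i))"
      using d[OF e'] by blast
    show "\<exists>da>0. \<forall>t. norm (t - t0) < da \<longrightarrow>
        norm (f (\<lambda>i. z i + t * v i) - f (\<lambda>i. z i + t0 * v i) - D * (t - t0)) \<le> e * norm (t - t0)"
    proof (intro exI[of _ "\<delta> / (V + 1)"] conjI allI impI)
      show "\<delta> / (V + 1) > 0" using \<delta>(1) V0 by simp
      fix t assume t: "norm (t - t0) < \<delta> / (V + 1)"
      define h where "h = (\<lambda>i. (t - t0) * v i)"
      have hC: "h \<in> Ck k" using v by (simp add: h_def Ck_def)
      have hs: "(\<Sum>i=1..k. cmod (h i)) = norm (t - t0) * V"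
        by (simp add: h_def V_def norm_mult sum_distrib_left)
      have "norm (t - t0) * V \<le> norm (t - t0) * (V + 1)" using V0 by (intro mult_left_mono) auto
      also have "\<dots> < \<delta>" using t V0 by (simp add: field_simps)
      finally have "(\<Sum>i=1..k. cmod (h i)) < \<delta>" unfolding hs .
      from \<delta>(2)[OF hC this] have "cmod (f (\<lambda>i. p i + h i) - f p - (\<Sum>i=1..k. d i * h i)) \<le> e' * (norm (t - t0) * V)"
        unfolding hs .
      moreover have "(\<lambda>i. p i + h i) = (\<lambda>i. z i + t * v i)" by (simp add: p_def h_def fun_eq_iff algebra_simps)
      moreover have "(\<Sum>i=1..k. d i * h i) = D * (t - t0)"
        by (simp add: h_def D_def sum_distrib_left sum_distrib_right mult_ac)
      moreover have "e' * (norm (t - t0) * V) \<le> e * norm (t - t0)"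
      proof -
        have "e' * V \<le> e' * (V + 1)" using e' by (intro mult_left_mono) auto
        also have "\<dots> = e" using V0 by (simp add: e'_def)
        finally have "e' * V * norm (t - t0) \<le> e * norm (t - t0)" by (intro mult_right_mono) auto
        thus ?thesis by (simp add: mult_ac)
      qed
      ultimately show "norm (f (\<lambda>i. z i + t * v i) - f (\<lambda>i. z i + t0 * v i) - D * (t - t0)) \<le> e * norm (t - t0)"
        by (simp add: p_def)
    qed
  qed
  then show "(\<lambda>t. f (\<lambda>i. z i + t * v i)) field_differentiable at t0 within UNIV"
    unfolding field_differentiable_def has_field_derivative_def by auto
qed

lemma W_holomorphic:
  assumes "\<And>i. i \<in> {1..k} \<Longrightarrow> \<exists>p v. \<forall>t. g t i = p + t * v"
  shows "(\<lambda>t. W a (g t)) holomorphic_on UNIV"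
proof -
  obtain p v where pv: "\<And>i t. i \<in> {1..k} \<Longrightarrow> g t i = p i + t * v i" using assms by metis
  have "(\<lambda>t. w (a mod int n) (\<lambda>i. Zf p i + t * Zf v i)) holomorphic_on UNIV"
    by (intro holomorphic_Ck_line H0_D(2)[OF w_H0]) auto
  moreover have "W a (g t) = w (a mod int n) (\<lambda>i. Zf p i + t * Zf v i)" for t
    unfolding W_def Zf_add[symmetric] using Zf_cong[of "g t"] pv by metis
  ultimately show ?thesis by simp
qed

lemma W_independent:
  assumes "\<And>y. (\<Sum>a\<in>Zn n. c a * W a y) = 0" "b \<in> Zn n"
  shows "c b = 0"
proof -
  note inj = w_inj and ind = w_indep
  have "(\<Sum>a\<in>Zn n. fscale (c a) (w a)) = 0"
  proof
    fix z
    show "(\<Sum>a\<in>Zn n. fscale (c a) (w a)) z = (0 :: (nat \<Rightarrow> complex) \<Rightarrow> complex) z"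
    proof (cases "z \<in> Ck k")
      case True
      then obtain y where "z = Zf y" using Zf_surj by metis
      then have "(\<Sum>a\<in>Zn n. c a * w a z) = (\<Sum>a\<in>Zn n. c a * W a y)"
        by (intro sum.cong) (auto simp: W_def)
      thus ?thesis using assms(1)[of y] by (simp add: cfun_sum_scale_apply)
    qed (simp add: cfun_sum_scale_apply w_outside)
  qed
  then have "(\<Sum>f\<in>w ` Zn n. fscale (c (the_inv_into (Zn n) w f)) f) = 0"
    by (simp add: sum.reindex[OF inj] the_inv_into_f_f[OF inj])
  then have "c (the_inv_into (Zn n) w (w b)) = 0"
    by (rule cfun.independentD[OF ind finite_imageI[OF finite_Zn] order_refl]) (use assms(2) in simp)
  thus ?thesis using the_inv_into_f_f[OF inj assms(2)] by simp
qed

end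

section \<open>Transformation factors as single exponentials\<close>

lemma ee_cong_int: "x = y + of_int m \<Longrightarrow> ee x = ee y"
  by (simp add: ee_add)

lemma ee_half_add: "ee (1 / 2 + x) = - ee x"
  by (simp add: ee_add)

lemma ee_half_diff: "ee (1 / 2 - x) = - ee (- x)"
  using ee_half_add[of "- x"] by simp

context odd_theta
begin

lemma th_cong: "int n dvd a - b \<Longrightarrow> th a z = th b z"
  by (metis mod_eq_dvd_iff th_mod)

lemma QQ_cong: "int n dvd a - b \<Longrightarrow> QQ a z = QQ b z"
  by (simp add: QQ_def mod_eq_dvd_iff[symmetric])

lemma coprime_k_n: "coprime (int k) (int n)"
proof -
  have "coprime k n" unfolding n_def by (metis coprime_Suc_right_nat coprime_mult_right_iff Suc_eq_plus1 coprime_commute mult.commute dvd_add_times_triv_left_iff gcd_add_mult coprime_iff_gcd_eq_1 gcd.commute gcd_1_nat One_nat_def)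
  thus ?thesis by simp
qed

text \<open>Signs are absorbed as e(1/2), so that comparing products of multipliers becomes a
  comparison of exponents modulo integers.\<close>

lemma TT_etan_alt: "TT (z + eta / of_nat n) = ee (1 / 2 - of_nat n * z + of_nat k * eta) * TT z"
proof -
  have "ee (1 / 2 - of_nat n * z + of_nat k * eta) = ee (1 / 2) * ee (- of_nat n * z + of_nat k * eta)"
    unfolding ee_add[symmetric] by (rule arg_cong[where f = ee]) simp
  thus ?thesis unfolding TT_etan by simp
qed

lemma TT_etan_minus: "TT (z - eta / of_nat n) = ee (1 / 2 + of_nat n * z - of_nat k * eta - eta) * TT z"
proof -
  have "TT z = ee (1 / 2 - of_nat n * (z - eta / of_nat n) + of_nat k * eta) * TT (z - eta / of_nat n)"
    using TT_etan_alt[of "z - eta / of_nat n"] by simp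
  moreover have "ee (1 / 2 + of_nat n * z - of_nat k * eta - eta) * ee (1 / 2 - of_nat n * (z - eta / of_nat n) + of_nat k * eta) = 1"
    unfolding ee_add[symmetric] by (simp add: algebra_simps)
  ultimately show ?thesis by (simp add: mult.assoc[symmetric])
qed

lemma TT_eta_alt: "TT (z + eta) = ee (1 / 2 - (of_nat n)\<^sup>2 * z) * TT z"
  unfolding TT_eta by (simp only: ee_half_diff)

lemma TT_eta_minus: "TT (z - eta) = ee (1 / 2 + (of_nat n)\<^sup>2 * z - (of_nat n)\<^sup>2 * eta) * TT z"
proof -
  have "TT z = ee (1 / 2 - (of_nat n)\<^sup>2 * (z - eta)) * TT (z - eta)"
    using TT_eta_alt[of "z - eta"] by simp
  moreover have "ee (1 / 2 + (of_nat n)\<^sup>2 * z - (of_nat n)\<^sup>2 * eta) * ee (1 / 2 - (of_nat n)\<^sup>2 * (z - eta)) = 1"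
    unfolding ee_add[symmetric] by (simp add: algebra_simps)
  ultimately show ?thesis by (simp add: mult.assoc[symmetric])
qed

lemma TT_2eta: "TT (z + 2 * eta) = ee (- 2 * (of_nat n)\<^sup>2 * z - (of_nat n)\<^sup>2 * eta) * TT z"
proof -
  have "TT (z + 2 * eta) = ee (1 / 2 - (of_nat n)\<^sup>2 * (z + eta)) * (ee (1 / 2 - (of_nat n)\<^sup>2 * z) * TT z)"
    using TT_eta_alt[of "z + eta"] by (simp add: TT_eta_alt add.assoc)
  also have "\<dots> = ee ((1 / 2 - (of_nat n)\<^sup>2 * (z + eta)) + (1 / 2 - (of_nat n)\<^sup>2 * z)) * TT z"
    by (simp only: ee_add mult.assoc)
  also have "ee ((1 / 2 - (of_nat n)\<^sup>2 * (z + eta)) + (1 / 2 - (of_nat n)\<^sup>2 * z)) = ee (- 2 * (of_nat n)\<^sup>2 * z - (of_nat n)\<^sup>2 * eta)"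
    by (rule ee_cong_int[of _ _ 1]) (simp add: algebra_simps)
  finally show ?thesis .
qed

lemma th_eta_alt: "th a (z + eta) = ee (1 / 2 - of_nat n * z) * th a z"
  unfolding th_eta by (simp only: ee_half_diff mult_minus_left)

lemma QQ_eta: "QQ a (z + eta) = ee (- of_nat n * (of_nat n - 1) * z) * QQ a z"
proof -
  have c: "card (Zn n - {a mod int n}) = 2 * k" by (subst card_Diff_singleton) (auto, simp add: n_def)
  have "QQ a (z + eta) = (\<Prod>b\<in>Zn n - {a mod int n}. (-1) * (ee (- of_nat n * z) * th b z))"
    unfolding QQ_def th_eta by simp
  also have "\<dots> = ee (- of_nat n * z) ^ (2 * k) * QQ a z"
    by (simp only: prod.distrib prod_constant QQ_def c) simp
  also have "ee (- of_nat n * z) ^ (2 * k) = ee (- of_nat n * (of_nat n - 1) * z)"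
    unfolding ee_power by (simp add: of_nat_n algebra_simps)
  finally show ?thesis .
qed

lemma QQ_eta_minus: "QQ a (z - eta) = ee (of_nat n * (of_nat n - 1) * (z - eta)) * QQ a z"
  using QQ_eta[of a "z - eta"] by (simp add: mult.assoc[symmetric] ee_add[symmetric])

lemma QQ_2eta: "QQ a (z + 2 * eta) = ee (- of_nat n * (of_nat n - 1) * (2 * z + eta)) * QQ a z"
proof -
  have "QQ a (z + 2 * eta) = ee (- of_nat n * (of_nat n - 1) * (z + eta)) * (ee (- of_nat n * (of_nat n - 1) * z) * QQ a z)"
    using QQ_eta[of a "z + eta"] by (simp add: QQ_eta add.assoc)
  also have "\<dots> = ee (- of_nat n * (of_nat n - 1) * (z + eta) + - of_nat n * (of_nat n - 1) * z) * QQ a z"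
    by (simp only: ee_add mult.assoc)
  finally show ?thesis by (simp add: algebra_simps)
qed

lemma ee_gth_power: "ee (gth z) ^ (n - 1) = ee (of_nat (2 * k) * gth z)"
  by (simp add: ee_power n_def)

lemma sum_Zn_single:
  assumes "\<And>r. r \<in> Zn n \<Longrightarrow> r \<noteq> s mod int n \<Longrightarrow> g r = 0"
  shows "(\<Sum>r\<in>Zn n. g r) = g (s mod int n)"
proof -
  have "(\<Sum>r\<in>Zn n. g r) = (\<Sum>r\<in>{s mod int n}. g r)"
    by (rule sum.mono_neutral_right) (use assms in auto)
  thus ?thesis by simp
qed

end

context theta_w
begin

lemma k_mem: "k \<in> {1..k}" using k_pos by simp

lemma sk_sh: "sk k (sh y u) v q = sk k y (u + v) q" by (simp add: sk_def fun_eq_iff)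

lemma sh_sk: "sh (sk k y u q) v = sk k y (u + v) q" by (simp add: sk_def fun_eq_iff)

lemma sk_0: "sk k y u 0 = sh y u" by (simp add: sk_def fun_eq_iff)

lemma sk_upd: "(sk k y u q)(k := sk k y u q k + p) = sk k y u (q + p)"
  by (auto simp: sk_def fun_eq_iff)

lemma sk_k: "sk k y u q k = y k + u + q" by (simp add: sk_def)

lemma W_sh_minus_1n: "W a (sh y (- (1 / of_nat n))) = ee (- ((of_nat k + 1) * of_int a / of_nat n)) * W a y"
  using W_1n[of a "sh y (- (1 / of_nat n))"] by (simp add: mult.assoc[symmetric] ee_add[symmetric])

lemma W_sh_etan: "W a (sh y (eta / of_nat n)) = inverse cw * ee (- SS y - of_nat k * eta / of_nat n) * W (a - 1) y"
  using W_add_1[of "a - 1" "sh y (eta / of_nat n)"] by (simp add: algebra_simps)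

lemma W_sh_2etan: "W a (sh y (2 * eta / of_nat n)) = inverse cw ^ 2 * ee (- 2 * SS y - 3 * of_nat k * eta / of_nat n) * W (a - 2) y"
proof -
  have "sh y (2 * eta / of_nat n) = sh (sh y (eta / of_nat n)) (eta / of_nat n)" by (simp add: add_divide_distrib)
  then have "W a (sh y (2 * eta / of_nat n)) = inverse cw * ee (- SS (sh y (eta / of_nat n)) - of_nat k * eta / of_nat n)
      * (inverse cw * ee (- SS y - of_nat k * eta / of_nat n) * W (a - 1 - 1) y)"
    by (simp only: W_sh_etan)
  also have "\<dots> = inverse cw ^ 2 * (ee (- SS (sh y (eta / of_nat n)) - of_nat k * eta / of_nat n) * ee (- SS y - of_nat k * eta / of_nat n)) * W (a - 1 - 1) y"
    by (simp add: power2_eq_square mult_ac)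
  also have "ee (- SS (sh y (eta / of_nat n)) - of_nat k * eta / of_nat n) * ee (- SS y - of_nat k * eta / of_nat n)
      = ee (- 2 * SS y - 3 * of_nat k * eta / of_nat n)"
    unfolding ee_add[symmetric] by (rule arg_cong[where f = ee]) (simp add: algebra_simps)
  finally have "W a (sh y (2 * eta / of_nat n)) = inverse cw ^ 2 * ee (- 2 * SS y - 3 * of_nat k * eta / of_nat n) * W (a - 1 - 1) y" .
  moreover have "a - 1 - 1 = a - 2" by simp
  ultimately show ?thesis by (simp only:)
qed

lemma W_sk_int: "W a (sk k y u (q + of_int m)) = W a (sk k y u q)"
proof -
  have "W a (sk k y u (q + 1)) = W a (sk k y u q)" for q
    using W_1[OF k_mem, of a "sk k y u q"] by (simp only: sk_upd)
  from shift_int_period[of "\<lambda>q. W a (sk k y u q)" 1, OF this] show ?thesis by simp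
qed

lemma W_sk_eta: "W a (sk k y u (q + eta)) = ee (1 / 2 - (y k + u + q) - 2 * SS (sk k y u q) - 3 * eta) * W a (sk k y u q)"
proof -
  have "ee (1 / 2 - (y k + u + q) - 2 * SS (sk k y u q) - 3 * eta) = ee (1 / 2) * ee (- sk k y u q k - 2 * SS (sk k y u q) - 3 * eta)"
    unfolding ee_add[symmetric] by (rule arg_cong[where f = ee]) (simp only: sk_k, simp)
  thus ?thesis using W_eta[OF k_mem, of a "sk k y u q"] unfolding sk_upd by simp
qed

lemma W_sk_eta_minus: "W a (sk k y u (q - eta)) = ee (1 / 2 + (y k + u + q) + 2 * SS (sk k y u q)) * W a (sk k y u q)"
proof -
  have "W a (sk k y u q) = ee (1 / 2 - (y k + u + (q - eta)) - 2 * SS (sk k y u (q - eta)) - 3 * eta) * W a (sk k y u (q - eta))"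
    using W_sk_eta[of a y u "q - eta"] by simp
  moreover have "ee (1 / 2 + (y k + u + q) + 2 * SS (sk k y u q)) * ee (1 / 2 - (y k + u + (q - eta)) - 2 * SS (sk k y u (q - eta)) - 3 * eta) = 1"
    unfolding ee_add[symmetric] by (simp add: algebra_simps)
  ultimately show ?thesis by (simp add: mult.assoc[symmetric])
qed

lemma W_sk_eta_multiple:
  "W a (sk k y u (q + of_nat m * eta)) =
     ee (of_nat m / 2 - of_nat m * (y k + u + q) - 2 * of_nat m * SS (sk k y u q) - 3 * of_nat m * (of_nat m + 1) / 2 * eta) * W a (sk k y u q)"
proof (induction m)
  case (Suc m)
  have "W a (sk k y u (q + of_nat (Suc m) * eta)) = W a (sk k y u ((q + of_nat m * eta) + eta))"
    by (simp add: algebra_simps)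
  also have "\<dots> = ee (1 / 2 - (y k + u + (q + of_nat m * eta)) - 2 * SS (sk k y u (q + of_nat m * eta)) - 3 * eta) *
     (ee (of_nat m / 2 - of_nat m * (y k + u + q) - 2 * of_nat m * SS (sk k y u q) - 3 * of_nat m * (of_nat m + 1) / 2 * eta) * W a (sk k y u q))"
    unfolding W_sk_eta Suc ..
  also have "\<dots> = ee (of_nat (Suc m) / 2 - of_nat (Suc m) * (y k + u + q) - 2 * of_nat (Suc m) * SS (sk k y u q) - 3 * of_nat (Suc m) * (of_nat (Suc m) + 1) / 2 * eta) * W a (sk k y u q)"
    unfolding mult.assoc[symmetric] ee_add[symmetric]
    by (rule arg_cong[where f = "\<lambda>x. ee x * W a (sk k y u q)"]) (simp add: field_simps)
  finally show ?case .
qed simp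

lemma W_sh_etan_multiple:
  "W a (sh y (- (of_nat m * eta / of_nat n))) =
     cw ^ m * ee (of_nat m * SS y - of_nat k * of_nat m * (of_nat m - 1) / (2 * of_nat n) * eta) * W (a + int m) y"
proof (induction m arbitrary: a)
  case (Suc m)
  have "sh y (- (of_nat (Suc m) * eta / of_nat n)) = sh (sh y (- (of_nat m * eta / of_nat n))) (- (eta / of_nat n))"
    unfolding sh_sh by (rule arg_cong[where f = "sh y"]) (simp add: field_simps)
  then have "W a (sh y (- (of_nat (Suc m) * eta / of_nat n))) = cw * ee (SS (sh y (- (of_nat m * eta / of_nat n)))) *
     (cw ^ m * ee (of_nat m * SS y - of_nat k * of_nat m * (of_nat m - 1) / (2 * of_nat n) * eta) * W (a + 1 + int m) y)"
    by (simp only: W_etan Suc)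
  also have "\<dots> = cw ^ Suc m * (ee (SS (sh y (- (of_nat m * eta / of_nat n)))) * ee (of_nat m * SS y - of_nat k * of_nat m * (of_nat m - 1) / (2 * of_nat n) * eta)) * W (a + int (Suc m)) y"
    by (simp add: mult_ac add_ac)
  also have "ee (SS (sh y (- (of_nat m * eta / of_nat n)))) * ee (of_nat m * SS y - of_nat k * of_nat m * (of_nat m - 1) / (2 * of_nat n) * eta)
     = ee (of_nat (Suc m) * SS y - of_nat k * of_nat (Suc m) * (of_nat (Suc m) - 1) / (2 * of_nat n) * eta)"
    unfolding ee_add[symmetric] by (rule arg_cong[where f = ee]) (simp add: field_simps)
  finally show ?case .
qed simp

text \<open>Moving by -2 eta takes 2 n steps of eta / n, after which the index has returned modulo
  n. Shifts by 2 eta occur because A moves twice as fast as B on the line used for the exchange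
  identity.\<close>

lemma W_sh_minus_2eta:
  "W a (sh y (- (2 * eta))) = cw ^ (2 * n) * ee (2 * of_nat n * SS y - of_nat k * (2 * of_nat n - 1) * eta) * W a y"
proof -
  have "W (a + int (2 * n)) y = W a y" by (rule W_cong_mod) simp
  thus ?thesis using W_sh_etan_multiple[of a y "2 * n"] by simp
qed

lemma W_sh_2eta:
  "W a (sh y (2 * eta)) = inverse (cw ^ (2 * n)) * ee (- 2 * of_nat n * SS y - of_nat k * (2 * of_nat n + 1) * eta) * W a y"
proof -
  have "W a y = cw ^ (2 * n) * ee (2 * of_nat n * SS (sh y (2 * eta)) - of_nat k * (2 * of_nat n - 1) * eta) * W a (sh y (2 * eta))"
    using W_sh_minus_2eta[of a "sh y (2 * eta)"] by simp
  then have "inverse (cw ^ (2 * n)) * ee (- 2 * of_nat n * SS y - of_nat k * (2 * of_nat n + 1) * eta) * W a y =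
     (inverse (cw ^ (2 * n)) * cw ^ (2 * n)) * (ee (- 2 * of_nat n * SS y - of_nat k * (2 * of_nat n + 1) * eta) *
       ee (2 * of_nat n * SS (sh y (2 * eta)) - of_nat k * (2 * of_nat n - 1) * eta)) * W a (sh y (2 * eta))"
    by (simp only: mult_ac)
  also have "ee (- 2 * of_nat n * SS y - of_nat k * (2 * of_nat n + 1) * eta) *
       ee (2 * of_nat n * SS (sh y (2 * eta)) - of_nat k * (2 * of_nat n - 1) * eta) = 1"
    unfolding ee_add[symmetric] by (simp add: algebra_simps)
  also have "inverse (cw ^ (2 * n)) * cw ^ (2 * n) = 1" using cw(1) by simp
  finally show ?thesis by (simp only: mult_1)
qed

end

section \<open>The exchange identity\<close>

context theta_w
begin

text \<open>\<open>LL i j A B y y'\<close> is the relation \<open>(i, j)\<close> with \<open>- \<tau>, \<tau>\<close> replaced by \<open>A, B\<close> and denominators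
  cleared, evaluated at \<open>(y, y')\<close>; \<open>QQ a = TT / th a\<close>. The parameter \<open>e\<close> is free.\<close>

definition LL :: "int \<Rightarrow> int \<Rightarrow> complex \<Rightarrow> complex \<Rightarrow> (nat \<Rightarrow> complex) \<Rightarrow> (nat \<Rightarrow> complex) \<Rightarrow> complex" where
  "LL i j A B y y' = (\<Sum>r\<in>Zn n. th (j - i + r * (int k - 1)) (A + B) * QQ (j - i - r) A * QQ (int k * r) B * W (j - r) y * W (i + r) y')"

definition R1 :: "int \<Rightarrow> int \<Rightarrow> complex \<Rightarrow> complex \<Rightarrow> complex \<Rightarrow> (nat \<Rightarrow> complex) \<Rightarrow> complex" where
  "R1 i j A B e y = TT (A + e) * TT B * W i (sh y A) * W j (sk k y (2 * B) (of_nat n * (e - B)))"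

definition R2 :: "int \<Rightarrow> int \<Rightarrow> complex \<Rightarrow> complex \<Rightarrow> complex \<Rightarrow> (nat \<Rightarrow> complex) \<Rightarrow> complex" where
  "R2 i j A B e y = ee ((of_nat n)\<^sup>2 * e) * TT (B - e) * TT A * W i (sk k y A (of_nat n * e)) * W j (sk k y (2 * B) (- (of_nat n * B)))"

text \<open>The constant \<open>QQ 0 0\<close> is what remains of the coefficients of
  \<open>LL\<close> at A = 0 or B = 0, where only one summand survives.\<close>

definition DD :: "int \<Rightarrow> int \<Rightarrow> complex \<Rightarrow> complex \<Rightarrow> complex \<Rightarrow> (nat \<Rightarrow> complex) \<Rightarrow> complex" where
  "DD i j A B e y = TT e * LL i j A B y (sk k y (A + 2 * B) (of_nat n * (e - B))) - QQ 0 0 * (R1 i j A B e y - R2 i j A B e y)"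

text \<open>A transformation law of the difference reduces to its three terms having one and the
  same multiplier u; the indices and y may change along with the parameters.\<close>

lemma DD_multiplier:
  assumes "TT e' * LL i j A' B' z (sk k z (A' + 2 * B') (of_nat n * (e' - B'))) =
             u * (TT e * LL i' j' A B y (sk k y (A + 2 * B) (of_nat n * (e - B))))"
    and "R1 i j A' B' e' z = u * R1 i' j' A B e y" "R2 i j A' B' e' z = u * R2 i' j' A B e y"
  shows "DD i j A' B' e' z = u * DD i' j' A B e y"
  unfolding DD_def assms by (simp add: algebra_simps)

lemma TT_1n_eqI: "A' = A + 1 / of_nat n \<Longrightarrow> TT A' = TT A"
  by (simp add: TT_1n)

lemma th_1n_eqI: "z' = z + 1 / of_nat n \<Longrightarrow> th a z' = ee (of_int a / of_nat n) * th a z"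
  by (simp only: th_1n)

lemma th_etan_eqI: "z' = z + eta / of_nat n \<Longrightarrow> b = a + 1 \<Longrightarrow> th a z' = ee (gth z) * th b z"
  by (simp only: th_etan)

lemma TT_etan_eqI: "z' = z + eta / of_nat n \<Longrightarrow> TT z' = ee (1 / 2 - of_nat n * z + of_nat k * eta) * TT z"
  by (simp only: TT_etan_alt)

lemma TT_etan_minus_eqI: "z' = z - eta / of_nat n \<Longrightarrow> TT z' = ee (1 / 2 + of_nat n * z - of_nat k * eta - eta) * TT z"
  by (simp only: TT_etan_minus)

lemma sk_eqI: "u' = u \<Longrightarrow> q' = q \<Longrightarrow> sk k y u' q' = sk k y u q" by simp

text \<open>The combined exponent of one th-factor at x and of the 2 k = n - 1 factors of a
  \<open>QQ\<close> at z.\<close>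

lemma gth_combination: "gth x + of_nat (2 * k) * gth z = - x - of_nat (2 * k) * z - 1 / 2 + of_nat k * eta"
proof -
  define g where "g = (- 1 / 2 + of_nat k * eta) / of_nat n"
  have 1: "gth u = - u + g" for u
    by (simp add: gth_def g_def n_div_2[symmetric] field_simps)
  have "g + of_nat (2 * k) * g = of_nat n * g" by (simp add: of_nat_n algebra_simps)
  also have "\<dots> = - 1 / 2 + of_nat k * eta" by (simp add: g_def)
  finally have "g + of_nat (2 * k) * g = - 1 / 2 + of_nat k * eta" .
  then show ?thesis unfolding 1 by (simp add: algebra_simps)
qed

text \<open>Moving y against A keeps y + A, and with it the second argument y + A + 2 B,
  fixed.\<close>

lemma DD_A_1n:
  "DD i j (A + 1 / of_nat n) B e (sh y (- (1 / of_nat n))) = ee (- ((of_nat k + 1) * of_int j / of_nat n)) * DD i j A B e y"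
proof (rule DD_multiplier)
  let ?u = "ee (- ((of_nat k + 1) * of_int j / of_nat n))"
  have y': "sk k (sh y (- (1 / of_nat n))) (A + 1 / of_nat n + 2 * B) q = sk k y (A + 2 * B) q" for q
    unfolding sk_sh by (rule sk_eqI) simp_all
  have "LL i j (A + 1 / of_nat n) B (sh y (- (1 / of_nat n))) y' = ?u * LL i j A B y y'" for y'
    unfolding LL_def sum_distrib_left
  proof (rule sum.cong)
    fix r
    have 1: "th (j - i + r * (int k - 1)) (A + 1 / of_nat n + B) = ee (of_int (j - i + r * (int k - 1)) / of_nat n) * th (j - i + r * (int k - 1)) (A + B)"
      by (rule th_1n_eqI) simp
    \<comment> \<open>The dependence on r cancels up to integers, as (k - 1) + 1 + (k + 1) =
      n.\<close>
    have E: "ee (of_int (j - i + r * (int k - 1)) / of_nat n) * ee (- (of_int (j - i - r) / of_nat n)) *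
       ee (- ((of_nat k + 1) * of_int (j - r) / of_nat n)) = ?u"
      unfolding ee_add[symmetric] by (rule ee_cong_int[of _ _ r]) (simp add: field_simps, simp add: of_nat_n algebra_simps)
    show "th (j - i + r * (int k - 1)) (A + 1 / of_nat n + B) * QQ (j - i - r) (A + 1 / of_nat n) * QQ (int k * r) B *
        W (j - r) (sh y (- (1 / of_nat n))) * W (i + r) y' =
        ?u * (th (j - i + r * (int k - 1)) (A + B) * QQ (j - i - r) A * QQ (int k * r) B * W (j - r) y * W (i + r) y')"
      unfolding 1 QQ_1n W_sh_minus_1n E[symmetric] by (simp only: mult_ac)
  qed simp
  then show "TT e * LL i j (A + 1 / of_nat n) B (sh y (- (1 / of_nat n)))
       (sk k (sh y (- (1 / of_nat n))) (A + 1 / of_nat n + 2 * B) (of_nat n * (e - B))) =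
      ?u * (TT e * LL i j A B y (sk k y (A + 2 * B) (of_nat n * (e - B))))"
    unfolding y' by (simp only: mult_ac)
  have t: "TT (A + 1 / of_nat n + e) = TT (A + e)" by (rule TT_1n_eqI) simp
  have s1: "sh (sh y (- (1 / of_nat n))) (A + 1 / of_nat n) = sh y A" by simp
  have s2: "sk k (sh y (- (1 / of_nat n))) u q = sh (sk k y u q) (- (1 / of_nat n))" for u q
    unfolding sk_sh sh_sk by (rule sk_eqI) simp_all
  have s3: "sk k (sh y (- (1 / of_nat n))) (A + 1 / of_nat n) q = sk k y A q" for q
    unfolding sk_sh by (rule sk_eqI) simp_all
  show "R1 i j (A + 1 / of_nat n) B e (sh y (- (1 / of_nat n))) = ?u * R1 i j A B e y"
    unfolding R1_def t s1 s2 W_sh_minus_1n by (simp only: mult_ac)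
  show "R2 i j (A + 1 / of_nat n) B e (sh y (- (1 / of_nat n))) = ?u * R2 i j A B e y"
    unfolding R2_def TT_1n s3 unfolding s2 W_sh_minus_1n by (simp only: mult_ac)
qed

text \<open>The step eta / n raises the indices of th at A + B, of \<open>QQ\<close> at A and of the
  first W by one, which amounts to replacing j by j + 1.\<close>

lemma DD_A_etan:
  "DD i j (A + eta / of_nat n) B e (sh y (- (eta / of_nat n))) =
     (cw * ee (1 / 2 - of_nat n * A - B + of_nat k * eta + SS y)) * DD i (j + 1) A B e y"
proof (rule DD_multiplier)
  let ?u = "cw * ee (1 / 2 - of_nat n * A - B + of_nat k * eta + SS y)"
  have y': "sk k (sh y (- (eta / of_nat n))) (A + eta / of_nat n + 2 * B) q = sk k y (A + 2 * B) q" for q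
    unfolding sk_sh by (rule sk_eqI) simp_all
  have "LL i j (A + eta / of_nat n) B (sh y (- (eta / of_nat n))) y' = ?u * LL i (j + 1) A B y y'" for y'
    unfolding LL_def sum_distrib_left
  proof (rule sum.cong)
    fix r
    have 1: "th (j - i + r * (int k - 1)) (A + eta / of_nat n + B) = ee (gth (A + B)) * th (j + 1 - i + r * (int k - 1)) (A + B)"
      by (rule th_etan_eqI) simp_all
    have 2: "QQ (j - i - r) (A + eta / of_nat n) = ee (of_nat (2 * k) * gth A) * QQ (j + 1 - i - r) A"
      unfolding QQ_etan ee_gth_power by (simp add: algebra_simps)
    have 3: "W (j - r) (sh y (- (eta / of_nat n))) = cw * ee (SS y) * W (j + 1 - r) y"
      unfolding W_etan by (simp add: algebra_simps)
    have E: "ee (gth (A + B)) * ee (of_nat (2 * k) * gth A) * ee (SS y) = ee (1 / 2 - of_nat n * A - B + of_nat k * eta + SS y)"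
      unfolding ee_add[symmetric] by (rule ee_cong_int[of _ _ "-1"]) (simp only: gth_combination, simp add: of_nat_n algebra_simps)
    show "th (j - i + r * (int k - 1)) (A + eta / of_nat n + B) * QQ (j - i - r) (A + eta / of_nat n) * QQ (int k * r) B *
        W (j - r) (sh y (- (eta / of_nat n))) * W (i + r) y' =
        ?u * (th (j + 1 - i + r * (int k - 1)) (A + B) * QQ (j + 1 - i - r) A * QQ (int k * r) B * W (j + 1 - r) y * W (i + r) y')"
      unfolding 1 2 3 E[symmetric] by (simp only: mult_ac)
  qed simp
  then show "TT e * LL i j (A + eta / of_nat n) B (sh y (- (eta / of_nat n)))
       (sk k (sh y (- (eta / of_nat n))) (A + eta / of_nat n + 2 * B) (of_nat n * (e - B))) =
      ?u * (TT e * LL i (j + 1) A B y (sk k y (A + 2 * B) (of_nat n * (e - B))))"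
    unfolding y' by (simp only: mult_ac)
  have t: "TT (A + eta / of_nat n + e) = ee (1 / 2 - of_nat n * (A + e) + of_nat k * eta) * TT (A + e)" by (rule TT_etan_eqI) simp
  have s1: "sh (sh y (- (eta / of_nat n))) (A + eta / of_nat n) = sh y A" by simp
  have s2: "sk k (sh y (- (eta / of_nat n))) u q = sh (sk k y u q) (- (eta / of_nat n))" for u q
    unfolding sk_sh sh_sk by (rule sk_eqI) simp_all
  have s3: "sk k (sh y (- (eta / of_nat n))) (A + eta / of_nat n) q = sk k y A q" for q
    unfolding sk_sh by (rule sk_eqI) simp_all
  have E1: "ee (1 / 2 - of_nat n * (A + e) + of_nat k * eta) * ee (SS (sk k y (2 * B) (of_nat n * (e - B))))
     = ee (1 / 2 - of_nat n * A - B + of_nat k * eta + SS y)"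
    unfolding ee_add[symmetric] by (rule arg_cong[where f = ee]) (simp add: of_nat_n algebra_simps)
  show "R1 i j (A + eta / of_nat n) B e (sh y (- (eta / of_nat n))) = ?u * R1 i (j + 1) A B e y"
    unfolding R1_def t s1 s2 W_etan E1[symmetric] by (simp only: mult_ac)
  have E2: "ee (1 / 2 - of_nat n * A + of_nat k * eta) * ee (SS (sk k y (2 * B) (- (of_nat n * B))))
     = ee (1 / 2 - of_nat n * A - B + of_nat k * eta + SS y)"
    unfolding ee_add[symmetric] by (rule arg_cong[where f = ee]) (simp add: of_nat_n algebra_simps)
  show "R2 i j (A + eta / of_nat n) B e (sh y (- (eta / of_nat n))) = ?u * R2 i (j + 1) A B e y"
    unfolding R2_def TT_etan_alt s3 unfolding s2 W_etan E2[symmetric] by (simp only: mult_ac)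
qed

text \<open>The parameter e moves together with B, so that the shift n (e - B) of the last
  coordinate does not change.\<close>

lemma DD_B_1n:
  "DD i j A (B + 1 / of_nat n) (e + 1 / of_nat n) y = ee (of_int j / of_nat n) * DD i j A B e y"
proof (rule DD_multiplier)
  let ?u = "ee (of_int j / of_nat n)"
  have q: "of_nat n * (e + 1 / of_nat n - (B + 1 / of_nat n)) = of_nat n * (e - B)" by simp
  have y': "sk k y (A + 2 * (B + 1 / of_nat n)) q = sh (sk k y (A + 2 * B) q) (2 / of_nat n)" for q
    unfolding sh_sk by (rule sk_eqI) simp_all
  have "LL i j A (B + 1 / of_nat n) y (sh y' (2 / of_nat n)) = ?u * LL i j A B y y'" for y'
    unfolding LL_def sum_distrib_left
  proof (rule sum.cong)
    fix r
    have 1: "th (j - i + r * (int k - 1)) (A + (B + 1 / of_nat n)) = ee (of_int (j - i + r * (int k - 1)) / of_nat n) * th (j - i + r * (int k - 1)) (A + B)"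
      by (rule th_1n_eqI) simp
    have E: "ee (of_int (j - i + r * (int k - 1)) / of_nat n) * ee (- (of_int (int k * r) / of_nat n)) * ee (of_int (i + r) / of_nat n) = ?u"
      unfolding ee_add[symmetric] by (rule arg_cong[where f = ee]) (simp add: field_simps)
    show "th (j - i + r * (int k - 1)) (A + (B + 1 / of_nat n)) * QQ (j - i - r) A * QQ (int k * r) (B + 1 / of_nat n) *
        W (j - r) y * W (i + r) (sh y' (2 / of_nat n)) =
        ?u * (th (j - i + r * (int k - 1)) (A + B) * QQ (j - i - r) A * QQ (int k * r) B * W (j - r) y * W (i + r) y')"
      unfolding 1 QQ_1n W_2n E[symmetric] by (simp only: mult_ac)
  qed simp
  then show "TT (e + 1 / of_nat n) * LL i j A (B + 1 / of_nat n) y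
       (sk k y (A + 2 * (B + 1 / of_nat n)) (of_nat n * (e + 1 / of_nat n - (B + 1 / of_nat n)))) =
      ?u * (TT e * LL i j A B y (sk k y (A + 2 * B) (of_nat n * (e - B))))"
    unfolding q y' TT_1n by (simp only: mult_ac)
  have t: "TT (A + (e + 1 / of_nat n)) = TT (A + e)" by (rule TT_1n_eqI) simp
  have s2: "sk k y (2 * (B + 1 / of_nat n)) q = sh (sk k y (2 * B) q) (2 / of_nat n)" for q
    unfolding sh_sk by (rule sk_eqI) simp_all
  show "R1 i j A (B + 1 / of_nat n) (e + 1 / of_nat n) y = ?u * R1 i j A B e y"
    unfolding R1_def t q s2 W_2n TT_1n by (simp only: mult_ac)
  have e2: "ee ((of_nat n)\<^sup>2 * (e + 1 / of_nat n)) = ee ((of_nat n)\<^sup>2 * e)"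
    by (rule ee_cong_int[of _ _ "int n"]) (simp add: distrib_left power2_eq_square)
  have b: "B + 1 / of_nat n - (e + 1 / of_nat n) = B - e" by simp
  have w1: "W i (sk k y A (of_nat n * (e + 1 / of_nat n))) = W i (sk k y A (of_nat n * e))"
    using W_sk_int[of i y A "of_nat n * e" 1] by (simp add: distrib_left)
  have w2: "W j (sk k y u (- (of_nat n * (B + 1 / of_nat n)))) = W j (sk k y u (- (of_nat n * B)))" for u
    using W_sk_int[of j y u "- (of_nat n * B)" "-1"] by (simp add: distrib_left)
  show "R2 i j A (B + 1 / of_nat n) (e + 1 / of_nat n) y = ?u * R2 i j A B e y"
    unfolding R2_def e2 b w1 w2 unfolding s2 W_2n by (simp only: mult_ac)
qed

text \<open>The step raises the index k r of \<open>QQ\<close> by one; the substitution r -> r + 2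
  undoes this, since 2 k + 1 = n. The index of th then changes by 2 (k - 1) + 1 = n - 2, and j has
  become j - 2 in every factor.\<close>

lemma LL_B_etan:
  "LL i j A (B + eta / of_nat n) y (sh y' (2 * eta / of_nat n)) =
   (inverse cw ^ 2 * ee (1 / 2 - A - of_nat n * B + of_nat k * eta - 2 * SS y' - 3 * of_nat k * eta / of_nat n)) * LL i (j - 2) A B y y'"
    (is "_ = ?u * _")
proof -
  define f where "f r = th (j - i + r * (int k - 1)) (A + (B + eta / of_nat n)) * QQ (j - i - r) A * QQ (int k * r) (B + eta / of_nat n) *
        W (j - r) y * W (i + r) (sh y' (2 * eta / of_nat n))" for r
  have per: "f (r + int n) = f r" for r
  proof -
    have "th (j - i + (r + int n) * (int k - 1)) z = th (j - i + r * (int k - 1)) z" for z by (rule th_cong) (simp add: algebra_simps)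
    moreover have "QQ (j - i - (r + int n)) z = QQ (j - i - r) z" for z by (rule QQ_cong) simp
    moreover have "QQ (int k * (r + int n)) z = QQ (int k * r) z" for z by (rule QQ_cong) (simp add: algebra_simps)
    moreover have "W (j - (r + int n)) z = W (j - r) z" for z by (rule W_cong_mod) simp
    moreover have "W (i + (r + int n)) z = W (i + r) z" for z by (rule W_cong_mod) simp
    ultimately show ?thesis by (simp only: f_def)
  qed
  have "LL i j A (B + eta / of_nat n) y (sh y' (2 * eta / of_nat n)) = (\<Sum>r\<in>Zn n. f r)" by (simp only: LL_def f_def)
  also have "\<dots> = (\<Sum>r\<in>Zn n. f (1 * r + 2))" using sum_Zn_affine[of n 1 f 2] per by simp
  also have "\<dots> = ?u * LL i (j - 2) A B y y'"
    unfolding LL_def sum_distrib_left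
  proof (rule sum.cong)
    fix r
    have 1: "th (j - i + (1 * r + 2) * (int k - 1)) (A + (B + eta / of_nat n)) = ee (gth (A + B)) * th (j - 2 - i + r * (int k - 1)) (A + B)"
    proof -
      have "th (j - i + (1 * r + 2) * (int k - 1)) (A + (B + eta / of_nat n)) = ee (gth (A + B)) * th (j - i + (1 * r + 2) * (int k - 1) + 1) (A + B)"
        by (rule th_etan_eqI) simp_all
      also have "th (j - i + (1 * r + 2) * (int k - 1) + 1) (A + B) = th (j - 2 - i + r * (int k - 1)) (A + B)"
        by (rule th_cong) (simp add: n_def algebra_simps)
      finally show ?thesis .
    qed
    have 2: "QQ (j - i - (1 * r + 2)) A = QQ (j - 2 - i - r) A" by (rule QQ_cong) simp
    have 3: "QQ (int k * (1 * r + 2)) (B + eta / of_nat n) = ee (of_nat (2 * k) * gth B) * QQ (int k * r) B"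
    proof -
      have "QQ (int k * (1 * r + 2) + 1) B = QQ (int k * r) B" by (rule QQ_cong) (simp add: n_def algebra_simps)
      thus ?thesis unfolding QQ_etan ee_gth_power by simp
    qed
    have 4: "W (j - (1 * r + 2)) y = W (j - 2 - r) y" by (rule W_cong_mod) simp
    have 5: "W (i + (1 * r + 2)) (sh y' (2 * eta / of_nat n)) = inverse cw ^ 2 * ee (- 2 * SS y' - 3 * of_nat k * eta / of_nat n) * W (i + r) y'"
      unfolding W_sh_2etan by (simp add: algebra_simps)
    have E: "ee (gth (A + B)) * ee (of_nat (2 * k) * gth B) * ee (- 2 * SS y' - 3 * of_nat k * eta / of_nat n)
       = ee (1 / 2 - A - of_nat n * B + of_nat k * eta - 2 * SS y' - 3 * of_nat k * eta / of_nat n)"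
      unfolding ee_add[symmetric] by (rule ee_cong_int[of _ _ "-1"]) (simp only: gth_combination, simp add: of_nat_n algebra_simps)
    show "f (1 * r + 2) = ?u * (th (j - 2 - i + r * (int k - 1)) (A + B) * QQ (j - 2 - i - r) A * QQ (int k * r) B * W (j - 2 - r) y * W (i + r) y')"
      unfolding f_def 1 2 3 4 5 E[symmetric] by (simp only: mult_ac)
  qed simp
  finally show ?thesis .
qed

lemma DD_B_etan:
  "DD i j A (B + eta / of_nat n) (e + eta / of_nat n) y =
   (inverse cw ^ 2 * ee (- 3 * of_nat n * e - A + 2 * B - 2 * SS y - 2 * of_nat k * A
       - of_nat n * B + 2 * of_nat k * eta - 3 * of_nat k * eta / of_nat n)) * DD i (j - 2) A B e y"
proof (rule DD_multiplier)
  let ?u = "inverse cw ^ 2 * ee (- 3 * of_nat n * e - A + 2 * B - 2 * SS y - 2 * of_nat k * A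
       - of_nat n * B + 2 * of_nat k * eta - 3 * of_nat k * eta / of_nat n)"
  have q: "of_nat n * (e + eta / of_nat n - (B + eta / of_nat n)) = of_nat n * (e - B)" by simp
  have y': "sk k y (A + 2 * (B + eta / of_nat n)) q = sh (sk k y (A + 2 * B) q) (2 * eta / of_nat n)" for q
    unfolding sh_sk by (rule sk_eqI) simp_all
  have E0: "ee (1 / 2 - of_nat n * e + of_nat k * eta) *
      ee (1 / 2 - A - of_nat n * B + of_nat k * eta - 2 * SS (sk k y (A + 2 * B) (of_nat n * (e - B))) - 3 * of_nat k * eta / of_nat n)
     = ee (- 3 * of_nat n * e - A + 2 * B - 2 * SS y - 2 * of_nat k * A
       - of_nat n * B + 2 * of_nat k * eta - 3 * of_nat k * eta / of_nat n)"
    unfolding ee_add[symmetric] by (rule ee_cong_int[of _ _ 1]) (simp add: of_nat_n field_simps)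
  show "TT (e + eta / of_nat n) * LL i j A (B + eta / of_nat n) y
       (sk k y (A + 2 * (B + eta / of_nat n)) (of_nat n * (e + eta / of_nat n - (B + eta / of_nat n)))) =
      ?u * (TT e * LL i (j - 2) A B y (sk k y (A + 2 * B) (of_nat n * (e - B))))"
    unfolding q y' TT_etan_alt LL_B_etan E0[symmetric] by (simp only: mult_ac)
  have t: "TT (A + (e + eta / of_nat n)) = ee (1 / 2 - of_nat n * (A + e) + of_nat k * eta) * TT (A + e)" by (rule TT_etan_eqI) simp
  have s2: "sk k y (2 * (B + eta / of_nat n)) q = sh (sk k y (2 * B) q) (2 * eta / of_nat n)" for q
    unfolding sh_sk by (rule sk_eqI) simp_all
  have E1: "ee (1 / 2 - of_nat n * (A + e) + of_nat k * eta) * ee (1 / 2 - of_nat n * B + of_nat k * eta) *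
      ee (- 2 * SS (sk k y (2 * B) (of_nat n * (e - B))) - 3 * of_nat k * eta / of_nat n)
     = ee (- 3 * of_nat n * e - A + 2 * B - 2 * SS y - 2 * of_nat k * A
       - of_nat n * B + 2 * of_nat k * eta - 3 * of_nat k * eta / of_nat n)"
    unfolding ee_add[symmetric] by (rule ee_cong_int[of _ _ 1]) (simp add: of_nat_n field_simps)
  show "R1 i j A (B + eta / of_nat n) (e + eta / of_nat n) y = ?u * R1 i (j - 2) A B e y"
    unfolding R1_def t q s2 W_sh_2etan TT_etan_alt E1[symmetric] by (simp only: mult_ac)
  have e2: "ee ((of_nat n)\<^sup>2 * (e + eta / of_nat n)) = ee (of_nat n * eta) * ee ((of_nat n)\<^sup>2 * e)"
    unfolding ee_add[symmetric] by (rule arg_cong[where f = ee]) (simp add: power2_eq_square algebra_simps)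
  have b: "B + eta / of_nat n - (e + eta / of_nat n) = B - e" by simp
  have p1: "of_nat n * (e + eta / of_nat n) = of_nat n * e + eta" by (simp add: algebra_simps)
  have p2: "- (of_nat n * (B + eta / of_nat n)) = - (of_nat n * B) - eta" by (simp add: algebra_simps)
  have E2: "ee (of_nat n * eta) *
      ee (1 / 2 - (y k + A + of_nat n * e) - 2 * SS (sk k y A (of_nat n * e)) - 3 * eta) *
      (ee (- 2 * SS (sk k y (2 * B) (- (of_nat n * B) - eta)) - 3 * of_nat k * eta / of_nat n) *
       ee (1 / 2 + (y k + 2 * B + - (of_nat n * B)) + 2 * SS (sk k y (2 * B) (- (of_nat n * B)))))
     = ee (- 3 * of_nat n * e - A + 2 * B - 2 * SS y - 2 * of_nat k * A
       - of_nat n * B + 2 * of_nat k * eta - 3 * of_nat k * eta / of_nat n)"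
    unfolding ee_add[symmetric] by (rule ee_cong_int[of _ _ 1]) (simp add: of_nat_n field_simps)
  show "R2 i j A (B + eta / of_nat n) (e + eta / of_nat n) y = ?u * R2 i (j - 2) A B e y"
    unfolding R2_def e2 b p1 p2 unfolding s2 W_sh_2etan W_sk_eta W_sk_eta_minus E2[symmetric]
    by (simp only: mult_ac)
qed

text \<open>The factor n in the shift of the last coordinate turns the steps 1/n and eta / n of e
  into lattice periods of that coordinate.\<close>

lemma DD_e_1n: "DD i j A B (e + 1 / of_nat n) y = 1 * DD i j A B e y"
proof (rule DD_multiplier)
  have w1: "W a (sk k y u (of_nat n * (e + 1 / of_nat n - B))) = W a (sk k y u (of_nat n * (e - B)))" for a u
    using W_sk_int[of a y u "of_nat n * (e - B)" 1] by (simp add: algebra_simps)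
  show "TT (e + 1 / of_nat n) * LL i j A B y (sk k y (A + 2 * B) (of_nat n * (e + 1 / of_nat n - B))) =
      1 * (TT e * LL i j A B y (sk k y (A + 2 * B) (of_nat n * (e - B))))"
    unfolding LL_def w1 TT_1n by simp
  have t: "TT (A + (e + 1 / of_nat n)) = TT (A + e)" by (rule TT_1n_eqI) simp
  show "R1 i j A B (e + 1 / of_nat n) y = 1 * R1 i j A B e y" unfolding R1_def t w1 by simp
  have t2: "TT (B - (e + 1 / of_nat n)) = TT (B - e)" by (rule TT_1n_eqI[symmetric]) simp
  have e2: "ee ((of_nat n)\<^sup>2 * (e + 1 / of_nat n)) = ee ((of_nat n)\<^sup>2 * e)"
    by (rule ee_cong_int[of _ _ "int n"]) (simp add: distrib_left power2_eq_square)
  have w2: "W i (sk k y A (of_nat n * (e + 1 / of_nat n))) = W i (sk k y A (of_nat n * e))"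
    using W_sk_int[of i y A "of_nat n * e" 1] by (simp add: distrib_left)
  show "R2 i j A B (e + 1 / of_nat n) y = 1 * R2 i j A B e y" unfolding R2_def t2 e2 w2 by simp
qed

lemma DD_e_etan:
  "DD i j A B (e + eta / of_nat n) y =
    ee (- of_nat n * e + of_nat k * eta - (y k + (A + 2 * B) + of_nat n * (e - B))
       - 2 * SS (sk k y (A + 2 * B) (of_nat n * (e - B))) - 3 * eta) * DD i j A B e y"
proof (rule DD_multiplier)
  let ?u = "ee (- of_nat n * e + of_nat k * eta - (y k + (A + 2 * B) + of_nat n * (e - B))
       - 2 * SS (sk k y (A + 2 * B) (of_nat n * (e - B))) - 3 * eta)"
  have q: "of_nat n * (e + eta / of_nat n - B) = of_nat n * (e - B) + eta" by (simp add: algebra_simps)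
  have E0: "ee (1 / 2 - of_nat n * e + of_nat k * eta) *
     ee (1 / 2 - (y k + (A + 2 * B) + of_nat n * (e - B)) - 2 * SS (sk k y (A + 2 * B) (of_nat n * (e - B))) - 3 * eta) = ?u"
    unfolding ee_add[symmetric] by (rule ee_cong_int[of _ _ 1]) simp
  show "TT (e + eta / of_nat n) * LL i j A B y (sk k y (A + 2 * B) (of_nat n * (e + eta / of_nat n - B))) =
      ?u * (TT e * LL i j A B y (sk k y (A + 2 * B) (of_nat n * (e - B))))"
    unfolding LL_def q W_sk_eta TT_etan_alt E0[symmetric] sum_distrib_left by (simp only: mult_ac)
  have t: "TT (A + (e + eta / of_nat n)) = ee (1 / 2 - of_nat n * (A + e) + of_nat k * eta) * TT (A + e)" by (rule TT_etan_eqI) simp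
  have E1: "ee (1 / 2 - of_nat n * (A + e) + of_nat k * eta) *
     ee (1 / 2 - (y k + 2 * B + of_nat n * (e - B)) - 2 * SS (sk k y (2 * B) (of_nat n * (e - B))) - 3 * eta) = ?u"
    unfolding ee_add[symmetric] by (rule ee_cong_int[of _ _ 1]) (simp add: of_nat_n algebra_simps)
  show "R1 i j A B (e + eta / of_nat n) y = ?u * R1 i j A B e y"
    unfolding R1_def t q W_sk_eta E1[symmetric] by (simp only: mult_ac)
  have t2: "TT (B - (e + eta / of_nat n)) = ee (1 / 2 + of_nat n * (B - e) - of_nat k * eta - eta) * TT (B - e)"
    by (rule TT_etan_minus_eqI) simp
  have e2: "ee ((of_nat n)\<^sup>2 * (e + eta / of_nat n)) = ee (of_nat n * eta) * ee ((of_nat n)\<^sup>2 * e)"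
    unfolding ee_add[symmetric] by (rule arg_cong[where f = ee]) (simp add: power2_eq_square algebra_simps)
  have p1: "of_nat n * (e + eta / of_nat n) = of_nat n * e + eta" by (simp add: algebra_simps)
  have E2: "ee (of_nat n * eta) * ee (1 / 2 + of_nat n * (B - e) - of_nat k * eta - eta) *
     ee (1 / 2 - (y k + A + of_nat n * e) - 2 * SS (sk k y A (of_nat n * e)) - 3 * eta) = ?u"
    unfolding ee_add[symmetric] by (rule ee_cong_int[of _ _ 1]) (simp add: of_nat_n algebra_simps)
  show "R2 i j A B (e + eta / of_nat n) y = ?u * R2 i j A B e y"
    unfolding R2_def t2 e2 p1 W_sk_eta E2[symmetric] by (simp only: mult_ac)
qed

lemma k_mult_mod: "r \<in> Zn n \<Longrightarrow> r \<noteq> 0 \<Longrightarrow> (int k * r) mod int n \<noteq> 0"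
proof
  assume r: "r \<in> Zn n" "r \<noteq> 0" "(int k * r) mod int n = 0"
  then have "int n dvd int k * r" by auto
  then have "int n dvd r" using coprime_k_n by (simp add: coprime_dvd_mult_right_iff coprime_commute)
  thus False using r zdvd_not_zless[of r "int n"] by (auto simp: Zn_iff)
qed

text \<open>Only the summand r = j - i survives, because \<open>QQ a\<close> vanishes at 0 unless a
  is 0 modulo n. The result is the term R1, while R2 carries \<open>TT 0\<close> = 0.\<close>

lemma DD_A_0: "DD i j 0 B e y = 0"
proof -
  let ?s = "(j - i) mod int n"
  have s: "int n dvd ?s - (j - i)" by (simp add: mod_eq_dvd_iff[symmetric])
  have "LL i j 0 B y y' = TT B * QQ 0 0 * W i y * W j y'" for y'
  proof -
    have "LL i j 0 B y y' = th (j - i + ?s * (int k - 1)) (0 + B) * QQ (j - i - ?s) 0 * QQ (int k * ?s) B * W (j - ?s) y * W (i + ?s) y'"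
      unfolding LL_def
    proof (rule sum_Zn_single)
      fix r assume r: "r \<in> Zn n" "r \<noteq> ?s"
      have "(j - i - r) mod int n \<noteq> 0"
      proof
        assume "(j - i - r) mod int n = 0"
        then have "(j - i) mod int n = r mod int n" by (metis mod_eq_dvd_iff mod_0_imp_dvd)
        thus False using r by simp
      qed
      then show "th (j - i + r * (int k - 1)) (0 + B) * QQ (j - i - r) 0 * QQ (int k * r) B * W (j - r) y * W (i + r) y' = 0"
        by (simp add: QQ_at_0)
    qed
    also have "th (j - i + ?s * (int k - 1)) (0 + B) = th (int k * ?s) B"
    proof -
      have "int n dvd (j - i + ?s * (int k - 1)) - int k * ?s" using s by (simp add: algebra_simps) (metis dvd_minus_iff minus_diff_eq minus_add_distrib uminus_add_conv_diff add.commute diff_diff_eq)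
      thus ?thesis using th_cong by simp
    qed
    also have "QQ (j - i - ?s) 0 = QQ 0 0"
      by (rule QQ_cong) (use s in \<open>simp add: dvd_diff_commute\<close>)
    also have "W (j - ?s) y = W i y"
    proof (rule W_cong_mod)
      have "j - ?s - i = - (?s - (j - i))" by simp
      thus "int n dvd j - ?s - i" using s by (simp only: dvd_minus_iff)
    qed
    also have "W (i + ?s) y' = W j y'"
    proof (rule W_cong_mod)
      have e: "i + ?s - j = ?s - (j - i)" by simp
      show "int n dvd i + ?s - j" unfolding e by (rule s)
    qed
    finally show ?thesis by (simp add: TT_QQ[of B "int k * ?s"] mult_ac)
  qed
  thus ?thesis unfolding DD_def R1_def R2_def by (simp add: TT_0)
qed

text \<open>Only r = 0 survives. R1 carries \<open>TT 0\<close>, and the factor e(n^2 e) in R2 is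
  the one that turns \<open>TT (- e)\<close> into - \<open>TT e\<close>.\<close>

lemma DD_B_0: "DD i j A 0 e y = 0"
proof -
  have "LL i j A 0 y y' = TT A * QQ 0 0 * W j y * W i y'" for y'
  proof -
    have "LL i j A 0 y y' = th (j - i + (0 mod int n) * (int k - 1)) (A + 0) * QQ (j - i - (0 mod int n)) A * QQ (int k * (0 mod int n)) 0 * W (j - (0 mod int n)) y * W (i + (0 mod int n)) y'"
      unfolding LL_def
    proof (rule sum_Zn_single)
      fix r assume r: "r \<in> Zn n" "r \<noteq> 0 mod int n"
      then have "QQ (int k * r) 0 = 0" by (intro QQ_at_0 k_mult_mod) auto
      then show "th (j - i + r * (int k - 1)) (A + 0) * QQ (j - i - r) A * QQ (int k * r) 0 * W (j - r) y * W (i + r) y' = 0"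
        by simp
    qed
    thus ?thesis by (simp add: TT_QQ[of A "j - i"] mult_ac)
  qed
  moreover have "ee ((of_nat n)\<^sup>2 * e) * TT (- e) = - TT e"
    unfolding TT_reflect by (simp add: ee_minus)
  ultimately show ?thesis unfolding DD_def R1_def R2_def by (simp add: TT_0 sk_0 mult_ac)
qed

text \<open>The term with \<open>LL\<close> carries \<open>TT 0\<close>, and R1 and R2 coincide at e
  = 0.\<close>

lemma DD_e_0: "DD i j A B 0 y = 0"
  unfolding DD_def R1_def R2_def by (simp add: TT_0 sk_0)

text \<open>Transport of \<open>DD_A_0\<close> by the steps 1/n and eta / n, which generate (1/n)
  Lambda.\<close>

lemma DD_zero_A:
  assumes "TT A = 0"
  shows "DD i j A B e y = 0"
proof -
  obtain a b :: int where A: "A = of_int a * (1 / of_nat n) + of_int b * (eta / of_nat n)"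
    using assms unfolding TT_zero_iff nLam_iff by blast
  \<comment> \<open>The quantifiers absorb the changes of the index and of y made by each
    step.\<close>
  define P where "P A \<longleftrightarrow> (\<forall>i j y. DD i j A B e y = 0)" for A
  have 1: "P (z + 1 / of_nat n) = P z" for z
  proof -
    have "DD i j (z + 1 / of_nat n) B e y = ee (- ((of_nat k + 1) * of_int j / of_nat n)) * DD i j z B e (sh y (1 / of_nat n))" for i j y
      using DD_A_1n[of i j z B e "sh y (1 / of_nat n)"] by simp
    moreover have "DD i j z B e y = inverse (ee (- ((of_nat k + 1) * of_int j / of_nat n))) * DD i j (z + 1 / of_nat n) B e (sh y (- (1 / of_nat n)))" for i j y
      using DD_A_1n[of i j z B e y] by simp
    ultimately show ?thesis unfolding P_def by (metis mult_zero_right)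
  qed
  have 2: "P (z + eta / of_nat n) = P z" for z
  proof -
    have "DD i j (z + eta / of_nat n) B e y = (cw * ee (1 / 2 - of_nat n * z - B + of_nat k * eta + SS (sh y (eta / of_nat n)))) * DD i (j + 1) z B e (sh y (eta / of_nat n))" for i j y
      using DD_A_etan[of i j z B e "sh y (eta / of_nat n)"] by simp
    moreover have "DD i (j - 1 + 1) z B e y = inverse (cw * ee (1 / 2 - of_nat n * z - B + of_nat k * eta + SS y)) * DD i (j - 1) (z + eta / of_nat n) B e (sh y (- (eta / of_nat n)))" for i j y
      using DD_A_etan[of i "j - 1" z B e y] cw(1) by (simp add: field_simps)
    ultimately show ?thesis unfolding P_def by (metis mult_zero_right diff_add_cancel)
  qed
  have "P A = P 0"
    using shift_int_period[of P "1 / of_nat n" "of_int b * (eta / of_nat n)" a] shift_int_period[of P "eta / of_nat n" 0 b] 1 2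
    by (simp add: A add.commute)
  thus ?thesis using DD_A_0 by (simp add: P_def)
qed

lemma DD_zero_B:
  assumes "TT B = 0"
  shows "DD i j A B e y = 0"
proof -
  obtain a b :: int where B: "B = of_int a * (1 / of_nat n) + of_int b * (eta / of_nat n)"
    using assms unfolding TT_zero_iff nLam_iff by blast
  \<comment> \<open>Here e is quantified too, since it moves along with B.\<close>
  define P where "P B \<longleftrightarrow> (\<forall>i j e y. DD i j A B e y = 0)" for B
  have 1: "P (z + 1 / of_nat n) = P z" for z
    unfolding P_def
  proof (intro iffI allI)
    fix i j e y assume "\<forall>i j e y. DD i j A (z + 1 / of_nat n) e y = 0"
    then show "DD i j A z e y = 0" using DD_B_1n[of i j A z e y] by simp
  next
    fix i j e y assume "\<forall>i j e y. DD i j A z e y = 0"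
    then show "DD i j A (z + 1 / of_nat n) e y = 0" using DD_B_1n[of i j A z "e - 1 / of_nat n" y] by simp
  qed
  have 2: "P (z + eta / of_nat n) = P z" for z
    unfolding P_def
  proof (intro iffI allI)
    fix i j e y assume "\<forall>i j e y. DD i j A (z + eta / of_nat n) e y = 0"
    then show "DD i j A z e y = 0" using DD_B_etan[of i "j + 2" A z e y] cw(1) by simp
  next
    fix i j e y assume "\<forall>i j e y. DD i j A z e y = 0"
    then show "DD i j A (z + eta / of_nat n) e y = 0" using DD_B_etan[of i j A z "e - eta / of_nat n" y] by simp
  qed
  have "P B = P 0"
    using shift_int_period[of P "1 / of_nat n" "of_int b * (eta / of_nat n)" a] shift_int_period[of P "eta / of_nat n" 0 b] 1 2
    by (simp add: B add.commute)
  thus ?thesis using DD_B_0 by (simp add: P_def)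
qed

lemma DD_zero_e:
  assumes "TT e = 0"
  shows "DD i j A B e y = 0"
proof -
  obtain a b :: int where e: "e = of_int a * (1 / of_nat n) + of_int b * (eta / of_nat n)"
    using assms unfolding TT_zero_iff nLam_iff by blast
  define P where "P e \<longleftrightarrow> DD i j A B e y = 0" for e
  have 1: "P (z + 1 / of_nat n) = P z" for z unfolding P_def DD_e_1n by simp
  have 2: "P (z + eta / of_nat n) = P z" for z unfolding P_def DD_e_etan by simp
  have "P e = P 0"
    using shift_int_period[of P "1 / of_nat n" "of_int b * (eta / of_nat n)" a] shift_int_period[of P "eta / of_nat n" 0 b] 1 2
    by (simp add: e add.commute)
  thus ?thesis using DD_e_0 by (simp add: P_def)
qed

end

section \<open>Affine lines in parameter space and the proof of the exchange identity\<close>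

definition affine_fun :: "(complex \<Rightarrow> complex) \<Rightarrow> bool" where
  "affine_fun f \<longleftrightarrow> (\<exists>p v. \<forall>t. f t = p + t * v)"

named_theorems affine_fun_intros

lemma affine_fun_const [affine_fun_intros]: "affine_fun (\<lambda>t. c)"
  unfolding affine_fun_def by (rule exI[of _ c], rule exI[of _ 0]) simp

lemma affine_fun_id [affine_fun_intros]: "affine_fun (\<lambda>t. t)"
  unfolding affine_fun_def by (rule exI[of _ 0], rule exI[of _ 1]) simp

lemma affine_fun_add [affine_fun_intros]: "affine_fun f \<Longrightarrow> affine_fun g \<Longrightarrow> affine_fun (\<lambda>t. f t + g t)"
proof -
  assume "affine_fun f" "affine_fun g"
  then obtain p v p' v' where "\<forall>t. f t = p + t * v" "\<forall>t. g t = p' + t * v'" unfolding affine_fun_def by blast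
  then have "\<forall>t. f t + g t = (p + p') + t * (v + v')" by (simp add: algebra_simps)
  thus ?thesis unfolding affine_fun_def by blast
qed

lemma affine_fun_mult [affine_fun_intros]: "affine_fun f \<Longrightarrow> affine_fun (\<lambda>t. c * f t)"
proof -
  assume "affine_fun f"
  then obtain p v where "\<forall>t. f t = p + t * v" unfolding affine_fun_def by blast
  then have "\<forall>t. c * f t = (c * p) + t * (c * v)" by (simp add: algebra_simps)
  thus ?thesis unfolding affine_fun_def by blast
qed

lemma affine_fun_minus [affine_fun_intros]: "affine_fun f \<Longrightarrow> affine_fun (\<lambda>t. - f t)"
  using affine_fun_mult[of f "-1"] by simp

lemma affine_fun_diff [affine_fun_intros]: "affine_fun f \<Longrightarrow> affine_fun g \<Longrightarrow> affine_fun (\<lambda>t. f t - g t)"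
  using affine_fun_add[of f "\<lambda>t. - g t"] affine_fun_minus[of g] by simp

lemma affine_fun_sh [affine_fun_intros]: "affine_fun (\<lambda>t. y t i) \<Longrightarrow> affine_fun u \<Longrightarrow> affine_fun (\<lambda>t. sh (y t) (u t) i)"
  unfolding sh_def by (intro affine_fun_intros)

lemma affine_fun_sk [affine_fun_intros]:
  "affine_fun (\<lambda>t. y t i) \<Longrightarrow> affine_fun u \<Longrightarrow> affine_fun q \<Longrightarrow> affine_fun (\<lambda>t. sk k (y t) (u t) (q t) i)"
  by (cases "i = k") (simp_all add: sk_def affine_fun_intros)

lemma affine_fun_upd [affine_fun_intros]:
  "affine_fun (\<lambda>t. y t i) \<Longrightarrow> affine_fun u \<Longrightarrow> affine_fun (\<lambda>t. ((y t)(j := u t)) i)"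
  by (cases "i = j") simp_all

lemma deriv_mult_simple_zero:
  assumes "f holomorphic_on UNIV" "g holomorphic_on UNIV" "f z = 0" "deriv f z \<noteq> 0" "g z \<noteq> 0"
  shows "deriv (\<lambda>t. f t * g t) z \<noteq> 0"
proof -
  have "((\<lambda>t. f t * g t) has_field_derivative deriv f z * g z + deriv g z * f z) (at z)"
    by (intro DERIV_mult entire_deriv_has assms)
  then have "deriv (\<lambda>t. f t * g t) z = deriv f z * g z" using assms by (simp add: DERIV_imp_deriv)
  thus ?thesis using assms by simp
qed

lemma deriv_affine:
  assumes "f holomorphic_on UNIV"
  shows "deriv (\<lambda>t. f (p + v * t)) z = v * deriv f (p + v * z)"
proof -
  have "((\<lambda>t. p + v * t) has_field_derivative v) (at z)" by (auto intro!: derivative_eq_intros)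
  then have "((\<lambda>t. f (p + v * t)) has_field_derivative deriv f (p + v * z) * v) (at z)"
    by (rule DERIV_chain2[OF entire_deriv_has[OF assms]])
  thus ?thesis by (simp add: DERIV_imp_deriv)
qed

context theta_w
begin

lemma W_line:
  assumes "\<And>i. affine_fun (\<lambda>t. g t i)"
  shows "(\<lambda>t. W a (g t)) holomorphic_on UNIV"
  by (rule W_holomorphic) (use assms in \<open>simp add: affine_fun_def\<close>)

lemma DD_line_holomorphic:
  assumes "affine_fun A" "affine_fun B" "affine_fun e" "\<And>l. affine_fun (\<lambda>t. y t l)"
  shows "(\<lambda>t. DD i j (A t) (B t) (e t) (y t)) holomorphic_on UNIV"
proof -
  have hol: "f holomorphic_on UNIV" if f: "affine_fun f" for f
  proof -
    obtain p v where "f = (\<lambda>t. p + t * v)" using f unfolding affine_fun_def by blast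
    thus ?thesis by (auto intro!: holomorphic_intros)
  qed
  have q: "affine_fun (\<lambda>t. of_nat n * (e t - B t))" "affine_fun (\<lambda>t. of_nat n * e t)" "affine_fun (\<lambda>t. - (of_nat n * B t))"
    "affine_fun (\<lambda>t. 2 * B t)" "affine_fun (\<lambda>t. A t + 2 * B t)"
    by (intro affine_fun_intros assms)+
  show ?thesis unfolding DD_def LL_def R1_def R2_def
    by (intro holomorphic_intros W_line affine_fun_intros assms q entire_compose[OF TT_holomorphic]
        entire_compose[OF th_holomorphic] entire_compose[OF QQ_holomorphic] hol)
qed

text \<open>Along (A + 2 t, B - t, e - t) the combinations A + 2 B and e - B are constant, so both
  arguments of \<open>LL\<close> stay fixed and only its coefficients vary. The order in t is 6 n^2
  - 4 n: n^2 from \<open>TT e\<close>, n from th at A + B, and 4 n (n - 1) + n (n - 1) from the two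
  \<open>QQ\<close>.\<close>

lemma DD_line_eta:
  "DD i j (A + 2 * eta) (B - eta) (e - eta) y =
    ee ((of_nat n)\<^sup>2 * e + (of_nat n - 2 * (of_nat n)\<^sup>2) * A + ((of_nat n)\<^sup>2 - 2 * of_nat n) * B
       + (2 * of_nat n - 3 * (of_nat n)\<^sup>2) * eta) * DD i j A B e y"
proof (rule DD_multiplier)
  let ?u = "ee ((of_nat n)\<^sup>2 * e + (of_nat n - 2 * (of_nat n)\<^sup>2) * A + ((of_nat n)\<^sup>2 - 2 * of_nat n) * B
       + (2 * of_nat n - 3 * (of_nat n)\<^sup>2) * eta)"
  have y': "sk k y (A + 2 * eta + 2 * (B - eta)) (of_nat n * (e - eta - (B - eta))) = sk k y (A + 2 * B) (of_nat n * (e - B))"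
    by (rule sk_eqI) simp_all
  have E0: "ee (1 / 2 + (of_nat n)\<^sup>2 * e - (of_nat n)\<^sup>2 * eta) * (ee (1 / 2 - of_nat n * (A + B)) *
      ee (- of_nat n * (of_nat n - 1) * (2 * A + eta)) * ee (of_nat n * (of_nat n - 1) * (B - eta))) = ?u"
    unfolding ee_add[symmetric] by (rule ee_cong_int[of _ _ 1]) (simp add: power2_eq_square algebra_simps)
  have "LL i j (A + 2 * eta) (B - eta) y y' = (ee (1 / 2 - of_nat n * (A + B)) *
      ee (- of_nat n * (of_nat n - 1) * (2 * A + eta)) * ee (of_nat n * (of_nat n - 1) * (B - eta))) * LL i j A B y y'" for y'
    unfolding LL_def sum_distrib_left
  proof (rule sum.cong)
    fix r
    have a: "A + 2 * eta + (B - eta) = (A + B) + eta" by simp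
    show "th (j - i + r * (int k - 1)) (A + 2 * eta + (B - eta)) * QQ (j - i - r) (A + 2 * eta) * QQ (int k * r) (B - eta) * W (j - r) y * W (i + r) y' =
      (ee (1 / 2 - of_nat n * (A + B)) *
      ee (- of_nat n * (of_nat n - 1) * (2 * A + eta)) * ee (of_nat n * (of_nat n - 1) * (B - eta))) *
      (th (j - i + r * (int k - 1)) (A + B) * QQ (j - i - r) A * QQ (int k * r) B * W (j - r) y * W (i + r) y')"
      unfolding a th_eta_alt QQ_2eta QQ_eta_minus by (simp only: mult_ac)
  qed simp
  then show "TT (e - eta) * LL i j (A + 2 * eta) (B - eta) y (sk k y (A + 2 * eta + 2 * (B - eta)) (of_nat n * (e - eta - (B - eta)))) =
    ?u * (TT e * LL i j A B y (sk k y (A + 2 * B) (of_nat n * (e - B))))"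
    unfolding y' TT_eta_minus E0[symmetric] by (simp only: mult_ac)
  have a: "A + 2 * eta + (e - eta) = (A + e) + eta" "of_nat n * (e - eta - (B - eta)) = of_nat n * (e - B)" "B - eta - (e - eta) = B - e"
    by simp_all
  have s1: "sh y (A + 2 * eta) = sh (sh y A) (2 * eta)" by simp
  have s2: "sk k y (2 * (B - eta)) q = sh (sk k y (2 * B) q) (- (2 * eta))" for q
    unfolding sh_sk by (rule sk_eqI) simp_all
  have s3: "sk k y (A + 2 * eta) q = sh (sk k y A q) (2 * eta)" for q
    unfolding sh_sk by (rule sk_eqI) simp_all
  have c: "inverse (cw ^ (2 * n)) * cw ^ (2 * n) = 1" using cw(1) by simp
  define C where "C = cw ^ (2 * n)"
  have C: "inverse C * C = 1" using c by (simp add: C_def)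
  have E1: "ee (1 / 2 - (of_nat n)\<^sup>2 * (A + e)) * ee (1 / 2 + (of_nat n)\<^sup>2 * B - (of_nat n)\<^sup>2 * eta) *
     ee (- 2 * of_nat n * SS (sh y A) - of_nat k * (2 * of_nat n + 1) * eta) *
     ee (2 * of_nat n * SS (sk k y (2 * B) (of_nat n * (e - B))) - of_nat k * (2 * of_nat n - 1) * eta) = ?u"
    unfolding ee_add[symmetric] by (rule ee_cong_int[of _ _ 1]) (simp add: of_nat_n power2_eq_square algebra_simps)
  have "R1 i j (A + 2 * eta) (B - eta) (e - eta) y = (inverse C * C) *
     (ee (1 / 2 - (of_nat n)\<^sup>2 * (A + e)) * ee (1 / 2 + (of_nat n)\<^sup>2 * B - (of_nat n)\<^sup>2 * eta) *
     ee (- 2 * of_nat n * SS (sh y A) - of_nat k * (2 * of_nat n + 1) * eta) *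
     ee (2 * of_nat n * SS (sk k y (2 * B) (of_nat n * (e - B))) - of_nat k * (2 * of_nat n - 1) * eta)) * R1 i j A B e y"
    unfolding R1_def a s1 s2 TT_eta_alt TT_eta_minus W_sh_2eta W_sh_minus_2eta C_def by (simp only: mult_ac)
  thus "R1 i j (A + 2 * eta) (B - eta) (e - eta) y = ?u * R1 i j A B e y" unfolding E1 C by simp
  have p1: "of_nat n * (e - eta) = of_nat n * e - of_nat n * eta" "- (of_nat n * (B - eta)) = - (of_nat n * B) + of_nat n * eta"
    by (simp_all add: algebra_simps)
  \<comment> \<open>Steps by eta in the last coordinate, n of them, lead from n (e - eta) back to n
    e; X is their multiplier.\<close>
  define X where "X = ee (of_nat n / 2 - of_nat n * (y k + A + (of_nat n * e - of_nat n * eta))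
     - 2 * of_nat n * SS (sk k y A (of_nat n * e - of_nat n * eta)) - 3 * of_nat n * (of_nat n + 1) / 2 * eta)"
  have w: "W i (sk k y A (of_nat n * e - of_nat n * eta)) = inverse X * W i (sk k y A (of_nat n * e))"
    using W_sk_eta_multiple[of i y A "of_nat n * e - of_nat n * eta" n] by (simp add: X_def)
  have X: "inverse X = ee (- (of_nat n / 2 - of_nat n * (y k + A + (of_nat n * e - of_nat n * eta))
     - 2 * of_nat n * SS (sk k y A (of_nat n * e - of_nat n * eta)) - 3 * of_nat n * (of_nat n + 1) / 2 * eta))"
    unfolding X_def by (simp only: ee_minus)
  have e2: "ee ((of_nat n)\<^sup>2 * (e - eta)) = ee (- ((of_nat n)\<^sup>2 * eta)) * ee ((of_nat n)\<^sup>2 * e)"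
    unfolding ee_add[symmetric] by (rule arg_cong[where f = ee]) (simp add: algebra_simps)
  have E2: "ee (- ((of_nat n)\<^sup>2 * eta)) * ee (- 2 * (of_nat n)\<^sup>2 * A - (of_nat n)\<^sup>2 * eta) *
     (ee (- 2 * of_nat n * SS (sk k y A (of_nat n * e - of_nat n * eta)) - of_nat k * (2 * of_nat n + 1) * eta) * inverse X) *
     (ee (2 * of_nat n * SS (sk k y (2 * B) (- (of_nat n * B) + of_nat n * eta)) - of_nat k * (2 * of_nat n - 1) * eta) *
      ee (of_nat n / 2 - of_nat n * (y k + 2 * B + - (of_nat n * B)) - 2 * of_nat n * SS (sk k y (2 * B) (- (of_nat n * B)))
         - 3 * of_nat n * (of_nat n + 1) / 2 * eta)) = ?u"
    unfolding X ee_add[symmetric] by (rule arg_cong[where f = ee]) (simp add: of_nat_n power2_eq_square field_simps)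
  have "R2 i j (A + 2 * eta) (B - eta) (e - eta) y = (inverse C * C) *
     (ee (- ((of_nat n)\<^sup>2 * eta)) * ee (- 2 * (of_nat n)\<^sup>2 * A - (of_nat n)\<^sup>2 * eta) *
     (ee (- 2 * of_nat n * SS (sk k y A (of_nat n * e - of_nat n * eta)) - of_nat k * (2 * of_nat n + 1) * eta) * inverse X) *
     (ee (2 * of_nat n * SS (sk k y (2 * B) (- (of_nat n * B) + of_nat n * eta)) - of_nat k * (2 * of_nat n - 1) * eta) *
      ee (of_nat n / 2 - of_nat n * (y k + 2 * B + - (of_nat n * B)) - 2 * of_nat n * SS (sk k y (2 * B) (- (of_nat n * B)))
         - 3 * of_nat n * (of_nat n + 1) / 2 * eta))) * R2 i j A B e y"
    unfolding R2_def a(3) e2 p1 TT_2eta s3 unfolding s2 W_sh_2eta W_sh_minus_2eta w W_sk_eta_multiple C_def by (simp only: mult_ac)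
  thus "R2 i j (A + 2 * eta) (B - eta) (e - eta) y = ?u * R2 i j A B e y" unfolding E2 C by simp
qed

lemma th_plus_1: "th a (z + 1) = th a z"
proof -
  have "th a (z + of_nat m * (1 / of_nat n)) = ee (of_nat m * of_int a / of_nat n) * th a z" for m
  proof (induction m)
    case (Suc m)
    have "th a (z + of_nat (Suc m) * (1 / of_nat n)) = th a ((z + of_nat m * (1 / of_nat n)) + 1 / of_nat n)"
      by (simp add: algebra_simps add_divide_distrib)
    also have "\<dots> = ee (of_int a / of_nat n) * (ee (of_nat m * of_int a / of_nat n) * th a z)" by (simp only: th_1n Suc)
    also have "\<dots> = ee (of_nat (Suc m) * of_int a / of_nat n) * th a z"
      unfolding mult.assoc[symmetric] ee_add[symmetric] by (simp add: add_divide_distrib distrib_right)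
    finally show ?case .
  qed simp
  from this[of n] show ?thesis by simp
qed

lemma QQ_plus_1: "QQ a (z + 1) = QQ a z" by (simp add: QQ_def th_plus_1)

lemma QQ_minus_1: "QQ a (z - 1) = QQ a z" using QQ_plus_1[of a "z - 1"] by simp
lemma TT_minus_1: "TT (z - 1) = TT z" using TT_1[of "z - 1"] by simp

lemma QQ_plus_2: "QQ a (z + 2) = QQ a z"
  using QQ_plus_1[of a "z + 1"] QQ_plus_1[of a z] by (simp add: add.assoc)

lemma TT_plus_2: "TT (z + 2) = TT z"
  using TT_1[of "z + 1"] TT_1[of z] by (simp add: add.assoc)

lemma W_sh_int: "W a (sh y (u + of_int m)) = W a (sh y u)"
proof -
  have "W a (sh y (v + 1)) = W a (sh y v)" for v using W_sh_1[of a "sh y v"] by simp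
  from shift_int_period[of "\<lambda>v. W a (sh y v)" 1, OF this] show ?thesis by simp
qed

lemma W_sk_shift_int: "W a (sk k y (u + of_int m) q) = W a (sk k y u q)"
  using W_sh_int[of a "sk k y u q" 0 m] by (simp add: sh_sk)

lemma DD_line_1: "DD i j (A + 2) (B - 1) (e - 1) y = 1 * DD i j A B e y"
proof (rule DD_multiplier)
  have y': "sk k y (A + 2 + 2 * (B - 1)) (of_nat n * (e - 1 - (B - 1))) = sk k y (A + 2 * B) (of_nat n * (e - B))"
    by (rule sk_eqI) simp_all
  have a: "A + 2 + (B - 1) = (A + B) + 1" "A + 2 + (e - 1) = (A + e) + 1" "of_nat n * (e - 1 - (B - 1)) = of_nat n * (e - B)" "B - 1 - (e - 1) = B - e"
    by simp_all
  show "TT (e - 1) * LL i j (A + 2) (B - 1) y (sk k y (A + 2 + 2 * (B - 1)) (of_nat n * (e - 1 - (B - 1)))) =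
    1 * (TT e * LL i j A B y (sk k y (A + 2 * B) (of_nat n * (e - B))))"
    unfolding y' LL_def a TT_minus_1 th_plus_1 QQ_plus_2 QQ_minus_1 by simp
  have s1: "W i (sh y (A + 2)) = W i (sh y A)" using W_sh_int[of i y A 2] by simp
  have s2: "W j (sk k y (2 * (B - 1)) q) = W j (sk k y (2 * B) q)" for q
    using W_sk_shift_int[of j y "2 * B" "-2" q] by (simp add: algebra_simps)
  have s3: "W i (sk k y (A + 2) q) = W i (sk k y A q)" for q
    using W_sk_shift_int[of i y A 2 q] by simp
  show "R1 i j (A + 2) (B - 1) (e - 1) y = 1 * R1 i j A B e y"
    unfolding R1_def a s1 s2 TT_1 TT_minus_1 by simp
  have e2: "ee ((of_nat n)\<^sup>2 * (e - 1)) = ee ((of_nat n)\<^sup>2 * e)"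
    by (rule ee_cong_int[of _ _ "- (int n)\<^sup>2"]) (simp add: algebra_simps)
  have w1: "W i (sk k y A (of_nat n * (e - 1))) = W i (sk k y A (of_nat n * e))"
    using W_sk_int[of i y A "of_nat n * e" "- int n"] by (simp add: algebra_simps)
  have w2: "W j (sk k y u (- (of_nat n * (B - 1)))) = W j (sk k y u (- (of_nat n * B)))" for u
    using W_sk_int[of j y u "- (of_nat n * B)" "int n"] by (simp add: algebra_simps)
  show "R2 i j (A + 2) (B - 1) (e - 1) y = 1 * R2 i j A B e y"
    unfolding R2_def a e2 TT_plus_2 s3 w1 s2 w2 by simp
qed

text \<open>Along the line \<open>(A + 2 t, B - t, e - t)\<close> the quotient of the difference by the three
  factors \<open>TT\<close> is entire and a theta function of negative order \<open>- 4 n\<close>.\<close>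

lemma DD_zero_generic:
  assumes g1: "of_nat n * (A + 2 * B) \<notin> Lam" and g2: "of_nat n * (A + 2 * e) \<notin> Lam" and g3: "of_nat n * (B - e) \<notin> Lam"
  shows "DD i j A B e y = 0"
proof -
  define D where "D t = DD i j (A + 2 * t) (B - t) (e - t) y" for t
  define f1 where "f1 t = TT (A + 2 * t)" for t
  define f2 where "f2 t = TT (B + (-1) * t)" for t
  define f3 where "f3 t = TT (e + (-1) * t)" for t
  have hol: "f1 holomorphic_on UNIV" "f2 holomorphic_on UNIV" "f3 holomorphic_on UNIV"
    unfolding f1_def f2_def f3_def by (intro holomorphic_intros entire_compose[OF TT_holomorphic])+
  have Dhol: "D holomorphic_on UNIV" unfolding D_def
    by (intro DD_line_holomorphic affine_fun_intros)
  have d1: "deriv f1 t \<noteq> 0" if "f1 t = 0" for t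
    using that TT_deriv unfolding f1_def deriv_affine[OF TT_holomorphic] by simp
  have d2: "deriv f2 t \<noteq> 0" if "f2 t = 0" for t
    using that TT_deriv unfolding f2_def deriv_affine[OF TT_holomorphic] by simp
  have d3: "deriv f3 t \<noteq> 0" if "f3 t = 0" for t
    using that TT_deriv unfolding f3_def deriv_affine[OF TT_holomorphic] by simp
  \<comment> \<open>The combinations A + 2 B, A + 2 e and B - e are constant on the line, so the
    genericity conditions exclude a common zero of two factors; hence the product has simple zeros
    only.\<close>
  have n12: "\<not> (f1 t = 0 \<and> f2 t = 0)" for t
  proof
    assume "f1 t = 0 \<and> f2 t = 0"
    then have "of_nat n * (A + 2 * t) + of_int 2 * (of_nat n * (B + (-1) * t)) \<in> Lam"
      unfolding f1_def f2_def TT_zero_iff by (intro Lam_add Lam_mult_int) auto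
    thus False using g1 by (simp add: algebra_simps)
  qed
  have n13: "\<not> (f1 t = 0 \<and> f3 t = 0)" for t
  proof
    assume "f1 t = 0 \<and> f3 t = 0"
    then have "of_nat n * (A + 2 * t) + of_int 2 * (of_nat n * (e + (-1) * t)) \<in> Lam"
      unfolding f1_def f3_def TT_zero_iff by (intro Lam_add Lam_mult_int) auto
    thus False using g2 by (simp add: algebra_simps)
  qed
  have n23: "\<not> (f2 t = 0 \<and> f3 t = 0)" for t
  proof
    assume "f2 t = 0 \<and> f3 t = 0"
    then have "of_nat n * (B + (-1) * t) - of_nat n * (e + (-1) * t) \<in> Lam"
      unfolding f2_def f3_def TT_zero_iff by (intro Lam_diff) auto
    thus False using g3 by (simp add: algebra_simps)
  qed
  define P where "P t = f1 t * (f2 t * f3 t)" for t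
  have Phol: "P holomorphic_on UNIV" unfolding P_def by (intro holomorphic_intros hol)
  have Pz: "D t = 0 \<and> deriv P t \<noteq> 0" if "P t = 0" for t
  proof -
    consider "f1 t = 0" | "f2 t = 0" | "f3 t = 0" using \<open>P t = 0\<close> unfolding P_def by auto
    then show ?thesis
    proof cases
      case 1
      then have "D t = 0" unfolding D_def f1_def by (intro DD_zero_A) simp
      moreover have "deriv (\<lambda>t. f1 t * (f2 t * f3 t)) t \<noteq> 0"
        by (rule deriv_mult_simple_zero) (use 1 d1 n12 n13 hol in \<open>auto intro!: holomorphic_intros\<close>)
      ultimately show ?thesis unfolding P_def[abs_def] by simp
    next
      case 2
      then have "D t = 0" unfolding D_def f2_def by (intro DD_zero_B) simp
      moreover have "deriv (\<lambda>t. f2 t * (f1 t * f3 t)) t \<noteq> 0"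
        by (rule deriv_mult_simple_zero) (use 2 d2 n12 n23 hol in \<open>auto intro!: holomorphic_intros\<close>)
      ultimately show ?thesis unfolding P_def[abs_def] by (simp add: mult_ac)
    next
      case 3
      then have "D t = 0" unfolding D_def f3_def by (intro DD_zero_e) simp
      moreover have "deriv (\<lambda>t. f3 t * (f1 t * f2 t)) t \<noteq> 0"
        by (rule deriv_mult_simple_zero) (use 3 d3 n13 n23 hol in \<open>auto intro!: holomorphic_intros\<close>)
      ultimately show ?thesis unfolding P_def[abs_def] by (simp add: mult_ac)
    qed
  qed
  obtain H where H: "H holomorphic_on UNIV" "\<And>t. D t = P t * H t"
    by (rule entire_division[OF Dhol Phol Pz]) (assumption, rule that)
  have cnt: "countable {t. P t = 0}"
  proof -
    have "{t. P t = 0} \<subseteq> {t. (of_nat n * 2) * t + of_nat n * A \<in> Lam} \<union> ({t. - of_nat n * t + of_nat n * B \<in> Lam} \<union> {t. - of_nat n * t + of_nat n * e \<in> Lam})"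
      unfolding P_def f1_def f2_def f3_def by (auto simp: TT_zero_iff algebra_simps)
    moreover have "countable \<dots>" by (intro countable_Un countable_affine_Lam) auto
    ultimately show ?thesis by (rule countable_subset)
  qed
  have P1: "P (t + 1) = P t" for t
  proof -
    have "f1 (t + 1) = f1 t" using TT_plus_2[of "A + 2 * t"] by (simp add: f1_def algebra_simps)
    moreover have "f2 (t + 1) = f2 t" using TT_minus_1[of "B - t"] by (simp add: f2_def algebra_simps)
    moreover have "f3 (t + 1) = f3 t" using TT_minus_1[of "e - t"] by (simp add: f3_def algebra_simps)
    ultimately show ?thesis by (simp add: P_def)
  qed
  have D1: "D (t + 1) = D t" for t
    using DD_line_1[of i j "A + 2 * t" "B - t" "e - t" y] by (simp add: D_def algebra_simps)
  define p where "p t = ee (- 2 * (of_nat n)\<^sup>2 * (A + 2 * t) - (of_nat n)\<^sup>2 * eta) *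
      (ee (1 / 2 + (of_nat n)\<^sup>2 * (B - t) - (of_nat n)\<^sup>2 * eta) * ee (1 / 2 + (of_nat n)\<^sup>2 * (e - t) - (of_nat n)\<^sup>2 * eta))" for t
  have P2: "P (t + eta) = p t * P t" for t
  proof -
    have a: "A + 2 * (t + eta) = (A + 2 * t) + 2 * eta" "B + (-1) * (t + eta) = (B - t) - eta" "e + (-1) * (t + eta) = (e - t) - eta"
      "B + (-1) * t = B - t" "e + (-1) * t = e - t"
      by simp_all
    show ?thesis unfolding P_def f1_def f2_def f3_def p_def a TT_2eta TT_eta_minus by (simp only: mult_ac)
  qed
  \<comment> \<open>The three factors \<open>TT\<close> have total order 4 n^2 + n^2 + n^2 = 6 n^2
    in t, whereas the difference has only 6 n^2 - 4 n.\<close>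
  define C where "C = ee (of_nat n * A - 2 * of_nat n * B + 2 * of_nat n * eta)"
  have D2: "D (t + eta) = (C * ee (- of_int (- 4 * int n) * t) * p t) * D t" for t
  proof -
    have "D (t + eta) = DD i j ((A + 2 * t) + 2 * eta) ((B - t) - eta) ((e - t) - eta) y"
      unfolding D_def by (simp add: algebra_simps)
    also have "\<dots> = ee ((of_nat n)\<^sup>2 * (e - t) + (of_nat n - 2 * (of_nat n)\<^sup>2) * (A + 2 * t) + ((of_nat n)\<^sup>2 - 2 * of_nat n) * (B - t)
       + (2 * of_nat n - 3 * (of_nat n)\<^sup>2) * eta) * D t"
      unfolding DD_line_eta D_def ..
    also have "ee ((of_nat n)\<^sup>2 * (e - t) + (of_nat n - 2 * (of_nat n)\<^sup>2) * (A + 2 * t) + ((of_nat n)\<^sup>2 - 2 * of_nat n) * (B - t)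
       + (2 * of_nat n - 3 * (of_nat n)\<^sup>2) * eta) = C * ee (- of_int (- 4 * int n) * t) * p t"
      unfolding C_def p_def ee_add[symmetric] by (rule ee_cong_int[of _ _ "-1"]) (simp add: algebra_simps)
    finally show ?thesis .
  qed
  have "qper (- 4 * int n) C H"
    unfolding qper_def
  proof (intro conjI allI)
    show "H holomorphic_on UNIV" by (rule H)
    show "C \<noteq> 0" by (simp add: C_def)
    fix t
    have "H (t + 1) - H t = 0"
    proof (rule entire_zero_off_countable[OF _ cnt, of "\<lambda>t. H (t + 1) - H t"])
      fix t assume t: "t \<notin> {t. P t = 0}"
      have "P t * H (t + 1) = P t * H t" using D1[of t] unfolding H(2) P1 .
      thus "H (t + 1) - H t = 0" using t by simp
    qed (intro holomorphic_intros H entire_compose[OF H(1)])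
    thus "H (t + 1) = H t" by simp
    have "H (t + eta) - C * ee (- of_int (- 4 * int n) * t) * H t = 0"
    proof (rule entire_zero_off_countable[OF _ cnt, of "\<lambda>t. H (t + eta) - C * ee (- of_int (- 4 * int n) * t) * H t"])
      fix t assume t: "t \<notin> {t. P t = 0}"
      have p0: "p t \<noteq> 0" by (simp add: p_def)
      have "p t * P t * H (t + eta) = (C * ee (- of_int (- 4 * int n) * t) * p t) * (P t * H t)"
        using D2[of t] unfolding H(2) P2 .
      then have "(p t * P t) * H (t + eta) = (p t * P t) * (C * ee (- of_int (- 4 * int n) * t) * H t)"
        by (simp only: mult_ac)
      then have "H (t + eta) = C * ee (- of_int (- 4 * int n) * t) * H t"
        using t p0 by (subst (asm) mult_cancel_left) auto
      thus "H (t + eta) - C * ee (- of_int (- 4 * int n) * t) * H t = 0" by simp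
    qed (intro holomorphic_intros H entire_compose[OF H(1)])
    thus "H (t + eta) = C * ee (- of_int (- 4 * int n) * t) * H t" by (simp only: right_minus_eq)
  qed
  then have "H 0 = 0" by (rule qper_neg_zero) simp
  then have "D 0 = 0" unfolding H(2) by simp
  thus ?thesis by (simp add: D_def)
qed

theorem DD_zero: "DD i j A B e y = 0"
proof -
  \<comment> \<open>Moving A and e together by u changes all three quantities of the genericity
    conditions, with factors 1, 3 and -1.\<close>
  define f where "f u = DD i j (A + u) B (e + u) y" for u
  have "f 0 = 0"
  proof (rule entire_zero_off_countable[of f])
    show "f holomorphic_on UNIV" unfolding f_def by (intro DD_line_holomorphic affine_fun_intros)
    show "countable ({u. of_nat n * u + of_nat n * (A + 2 * B) \<in> Lam} \<union> ({u. (of_nat n * 3) * u + of_nat n * (A + 2 * e) \<in> Lam}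
        \<union> {u. - of_nat n * u + of_nat n * (B - e) \<in> Lam}))"
      by (intro countable_Un countable_affine_Lam) auto
    fix u assume "u \<notin> {u. of_nat n * u + of_nat n * (A + 2 * B) \<in> Lam} \<union> ({u. (of_nat n * 3) * u + of_nat n * (A + 2 * e) \<in> Lam}
        \<union> {u. - of_nat n * u + of_nat n * (B - e) \<in> Lam})"
    then show "f u = 0" unfolding f_def by (intro DD_zero_generic) (auto simp: algebra_simps)
  qed
  thus ?thesis by (simp add: f_def)
qed

end

section \<open>Symmetry of the theta basis\<close>

text \<open>Chain rule for a linear substitution M, given by its matrix m and a bound C, in the
  epsilon-delta form of \<open>holomorphic_Ck\<close>. It serves to show that permuted basis
  elements are again sections.\<close>

lemma holomorphic_Ck_linear_compose:
  assumes f: "holomorphic_Ck k f"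
    and MC: "\<And>h. M h \<in> Ck k"
    and add: "\<And>z h. M (\<lambda>i. z i + h i) = (\<lambda>i. M z i + M h i)"
    and lin: "\<And>h t. h \<in> Ck k \<Longrightarrow> M h t = (\<Sum>i=1..k. h i * m i t)"
    and bound: "\<And>h. h \<in> Ck k \<Longrightarrow> (\<Sum>i=1..k. cmod (M h i)) \<le> C * (\<Sum>i=1..k. cmod (h i))"
    and eq: "\<And>z. z \<in> Ck k \<Longrightarrow> g z = f (M z)"
  shows "holomorphic_Ck k g"
  unfolding holomorphic_Ck_def
proof
  fix z assume z: "z \<in> Ck k"
  obtain d where d: "\<And>e. e > 0 \<Longrightarrow> \<exists>\<delta>>0. \<forall>h\<in>Ck k.
        (\<Sum>i=1..k. cmod (h i)) < \<delta> \<longrightarrow>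
        cmod (f (\<lambda>i. M z i + h i) - f (M z) - (\<Sum>i=1..k. d i * h i)) \<le> e * (\<Sum>i=1..k. cmod (h i))"
    using f MC[of z] unfolding holomorphic_Ck_def by blast
  define C' where "C' = \<bar>C\<bar> + 1"
  have C': "C' > 0" by (simp add: C'_def)
  have bound': "(\<Sum>i=1..k. cmod (M h i)) \<le> C' * (\<Sum>i=1..k. cmod (h i))" if "h \<in> Ck k" for h
  proof -
    have "C * (\<Sum>i=1..k. cmod (h i)) \<le> C' * (\<Sum>i=1..k. cmod (h i))"
      by (intro mult_right_mono sum_nonneg) (auto simp: C'_def)
    thus ?thesis using bound[OF that] by linarith
  qed
  define d' where "d' i = (\<Sum>t=1..k. d t * m i t)" for i
  have dd: "(\<Sum>t=1..k. d t * M h t) = (\<Sum>i=1..k. d' i * h i)" if "h \<in> Ck k" for h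
  proof -
    have "(\<Sum>t=1..k. d t * M h t) = (\<Sum>t=1..k. \<Sum>i=1..k. d t * (h i * m i t))"
      by (simp add: lin[OF that] sum_distrib_left)
    also have "\<dots> = (\<Sum>i=1..k. \<Sum>t=1..k. d t * (h i * m i t))" by (rule sum.swap)
    also have "\<dots> = (\<Sum>i=1..k. d' i * h i)" by (simp add: d'_def sum_distrib_left mult_ac)
    finally show ?thesis .
  qed
  show "\<exists>d. \<forall>\<epsilon>>0. \<exists>\<delta>>0. \<forall>h\<in>Ck k. (\<Sum>i=1..k. cmod (h i)) < \<delta> \<longrightarrow>
       cmod (g (\<lambda>i. z i + h i) - g z - (\<Sum>i=1..k. d i * h i)) \<le> \<epsilon> * (\<Sum>i=1..k. cmod (h i))"
  proof (intro exI[of _ d'] allI impI)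
    fix e :: real assume e: "e > 0"
    obtain \<delta> where \<delta>: "\<delta> > 0" "\<And>h. h \<in> Ck k \<Longrightarrow> (\<Sum>i=1..k. cmod (h i)) < \<delta> \<Longrightarrow>
        cmod (f (\<lambda>i. M z i + h i) - f (M z) - (\<Sum>i=1..k. d i * h i)) \<le> e / C' * (\<Sum>i=1..k. cmod (h i))"
      using d[of "e / C'"] e C' by auto
    show "\<exists>\<delta>>0. \<forall>h\<in>Ck k. (\<Sum>i=1..k. cmod (h i)) < \<delta> \<longrightarrow>
       cmod (g (\<lambda>i. z i + h i) - g z - (\<Sum>i=1..k. d' i * h i)) \<le> e * (\<Sum>i=1..k. cmod (h i))"
    proof (intro exI[of _ "\<delta> / C'"] conjI ballI impI)
      show "\<delta> / C' > 0" using \<delta>(1) C' by simp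
      fix h assume h: "h \<in> Ck k" and small: "(\<Sum>i=1..k. cmod (h i)) < \<delta> / C'"
      have "C' * (\<Sum>i=1..k. cmod (h i)) < \<delta>" using small C' by (simp add: field_simps)
      then have "(\<Sum>i=1..k. cmod (M h i)) < \<delta>" using bound'[OF h] by linarith
      from \<delta>(2)[OF MC this] have "cmod (f (\<lambda>i. M z i + M h i) - f (M z) - (\<Sum>i=1..k. d i * M h i)) \<le> e / C' * (\<Sum>i=1..k. cmod (M h i))" .
      also have "\<dots> \<le> e / C' * (C' * (\<Sum>i=1..k. cmod (h i)))"
        using e C' by (intro mult_left_mono bound'[OF h]) auto
      also have "\<dots> = e * (\<Sum>i=1..k. cmod (h i))" using C' by simp
      finally have "cmod (f (\<lambda>i. M z i + M h i) - f (M z) - (\<Sum>i=1..k. d i * M h i)) \<le> e * (\<Sum>i=1..k. cmod (h i))" .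
      moreover have "(\<lambda>i. z i + h i) \<in> Ck k" using z h by (simp add: Ck_def)
      ultimately show "cmod (g (\<lambda>i. z i + h i) - g z - (\<Sum>i=1..k. d' i * h i)) \<le> e * (\<Sum>i=1..k. cmod (h i))"
        by (simp only: eq[OF z] eq add dd[OF h])
    qed
  qed
qed

context theta_w
begin

definition Yf :: "(nat \<Rightarrow> complex) \<Rightarrow> nat \<Rightarrow> complex" where "Yf z = (\<lambda>i. z (i + 1) - z i)"

lemma Zf_Yf: "z \<in> Ck k \<Longrightarrow> Zf (Yf z) = z"
  unfolding Yf_def by (rule Zf_surj)

lemma Yf_Zf: "i \<in> {1..k} \<Longrightarrow> Yf (Zf y) i = y i"
  unfolding Yf_def by (rule Zf_Suc)

lemma W_eta_minus:
  assumes "j \<in> {1..k}"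
  shows "W a (y(j := y j - eta)) = - ee (y j + 2 * SS y) * W a y"
proof -
  have "W a y = - ee (- (y j - eta) - 2 * (SS y - eta) - 3 * eta) * W a (y(j := y j - eta))"
    using W_eta[OF assms, of a "y(j := y j - eta)"] by (simp add: SS_upd[OF assms])
  then have "- ee (y j + 2 * SS y) * W a y = (ee (y j + 2 * SS y) * ee (- (y j - eta) - 2 * (SS y - eta) - 3 * eta)) * W a (y(j := y j - eta))"
    by simp
  also have "ee (y j + 2 * SS y) * ee (- (y j - eta) - 2 * (SS y - eta) - 3 * eta) = 1"
    unfolding ee_add[symmetric] by (simp add: algebra_simps)
  finally show ?thesis by (simp only: mult_1)
qed

lemma W_1_minus: "j \<in> {1..k} \<Longrightarrow> W a (y(j := y j - 1)) = W a y"
  using W_1[of j a "y(j := y j - 1)"] by simp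

text \<open>Opposite shifts leave \<open>SS y\<close> unchanged, so the multiplier sees only the two
  coordinates involved and has order two along such a line.\<close>

lemma W_pair_eta:
  assumes "p \<in> {1..k}" "q \<in> {1..k}" "p \<noteq> q"
  shows "W a (y(p := y p + eta, q := y q - eta)) = ee (y q - y p - eta) * W a y"
proof -
  define v where "v = y(p := y p + eta)"
  have "y(p := y p + eta, q := y q - eta) = v(q := v q - eta)" using assms by (simp add: v_def)
  then have "W a (y(p := y p + eta, q := y q - eta)) = - ee (v q + 2 * SS v) * (- ee (- y p - 2 * SS y - 3 * eta) * W a y)"
    using W_eta_minus[OF assms(2), of a v] W_eta[OF assms(1), of a y] by (simp add: v_def)
  also have "\<dots> = (ee (v q + 2 * SS v) * ee (- y p - 2 * SS y - 3 * eta)) * W a y" by simp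
  also have "ee (v q + 2 * SS v) * ee (- y p - 2 * SS y - 3 * eta) = ee (y q - y p - eta)"
    unfolding ee_add[symmetric] using assms by (simp add: v_def SS_upd algebra_simps)
  finally show ?thesis .
qed

lemma W_pair_1:
  assumes "p \<in> {1..k}" "q \<in> {1..k}" "p \<noteq> q"
  shows "W a (y(p := y p + 1, q := y q - 1)) = W a y"
  using W_1_minus[OF assms(2), of a "y(p := y p + 1)"] W_1[OF assms(1), of a y] assms by simp

lemma transpose_mem: "p \<in> {1..k} \<Longrightarrow> q \<in> {1..k} \<Longrightarrow> i \<in> {1..k} \<Longrightarrow> Transposition.transpose p q i \<in> {1..k}"
  by (simp add: Transposition.transpose_def)

lemma bij_transpose_Ck: "p \<in> {1..k} \<Longrightarrow> q \<in> {1..k} \<Longrightarrow> bij_betw (Transposition.transpose p q) {1..k} {1..k}"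
  by (rule bij_betwI[where g = "Transposition.transpose p q"]) (auto simp: Transposition.transpose_def)

lemma SS_transpose: "p \<in> {1..k} \<Longrightarrow> q \<in> {1..k} \<Longrightarrow> SS (\<lambda>i. y (Transposition.transpose p q i)) = SS y"
  unfolding SS_def by (rule sum.reindex_bij_betw[OF bij_transpose_Ck])

text \<open>For i > 1 the coordinate z_i enters y_(i-1) with sign + and y_i with sign -, whereas z_1
  enters only y_1; hence the separate treatment of the index 1.\<close>

lemma Yf_upd_transpose:
  assumes "z \<in> Ck k" "i \<in> {1..k}" "p \<in> {1..k}" "q \<in> {1..k}" "i \<noteq> 1" "l \<in> {1..k}"
  defines "s \<equiv> Transposition.transpose p q"
  defines "y \<equiv> (\<lambda>j. Yf z (s j))"
  shows "Yf (z(i := z i + c)) (s l) = (y(s (i - 1) := y (s (i - 1)) + c, s i := y (s i) - c)) l"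
proof -
  have ss: "s (s x) = x" for x by (simp add: s_def)
  have inj: "s x = s x' \<longleftrightarrow> x = x'" for x x' using ss by metis
  have "Yf (z(i := z i + c)) m = (Yf z m + (if m = i - 1 then c else 0)) - (if m = i then c else 0)" for m
    using assms(2,5) by (auto simp: Yf_def)
  moreover have "s l = i - 1 \<longleftrightarrow> l = s (i - 1)" "s l = i \<longleftrightarrow> l = s i" using ss by metis+
  moreover have "s (i - 1) \<noteq> s i" using inj assms(2) by auto
  ultimately show ?thesis by (auto simp: y_def ss)
qed

lemma Yf_upd_transpose_1:
  assumes "z \<in> Ck k" "p \<in> {1..k}" "q \<in> {1..k}" "l \<in> {1..k}"
  defines "s \<equiv> Transposition.transpose p q"
  defines "y \<equiv> (\<lambda>j. Yf z (s j))"
  shows "Yf (z(1 := z 1 + c)) (s l) = (y(s 1 := y (s 1) - c)) l"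
proof -
  have ss: "s (s x) = x" for x by (simp add: s_def)
  have "s l \<in> {1..k}" unfolding s_def using transpose_mem assms by blast
  then have "Yf (z(1 := z 1 + c)) (s l) = Yf z (s l) - (if s l = 1 then c else 0)"
    by (auto simp: Yf_def)
  moreover have "s l = 1 \<longleftrightarrow> l = s 1" using ss by metis
  ultimately show ?thesis by (auto simp: y_def ss)
qed

text \<open>In the coordinates y the laws \<open>W_1\<close> and \<open>W_eta\<close> have the same
  form for every coordinate and involve the others only through the symmetric sum \<open>SS\<close>;
  the defining conditions of \<open>H0\<close> are therefore invariant under permuting y.\<close>

lemma permuted_basis_in_H0:
  assumes a: "a \<in> Zn n" and pq: "p \<in> {1..k}" "q \<in> {1..k}"
  defines "g \<equiv> (\<lambda>z. if z \<in> Ck k then W a (\<lambda>i. Yf z (Transposition.transpose p q i)) else 0)"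
  shows "g \<in> H0 k eta"
proof -
  define s where "s = Transposition.transpose p q"
  have smem: "i \<in> {1..k} \<Longrightarrow> s i \<in> {1..k}" for i unfolding s_def using transpose_mem pq by blast
  have ss: "s (s x) = x" for x by (simp add: s_def)
  have updC: "z(i := z i + c) \<in> Ck k" if "z \<in> Ck k" "i \<in> {1..k}" for z i c
    using that by (auto simp: Ck_def)
  have hol: "holomorphic_Ck k g"
  \<comment> \<open>The matrix m is read off from the images of unit vectors. Each of the k
    coordinates of an image is a partial sum of differences, at most twice the norm of h, whence the
    bound 2 k.\<close>
  proof (rule holomorphic_Ck_linear_compose[where f = "w a" and M = "\<lambda>h. Zf (\<lambda>i. Yf h (s i))"
        and m = "\<lambda>i. Zf (\<lambda>l. Yf (\<lambda>j. if j = i then 1 else 0) (s l))" and C = "real (2 * k)"])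
    show "holomorphic_Ck k (w a)" by (rule H0_D(2)[OF w_H0[OF a]])
    show "Zf (\<lambda>i. Yf h (s i)) \<in> Ck k" for h by simp
    show "Zf (\<lambda>i. Yf (\<lambda>i. z i + h i) (s i)) = (\<lambda>i. Zf (\<lambda>i. Yf z (s i)) i + Zf (\<lambda>i. Yf h (s i)) i)" for z h
      by (rule ext) (simp add: Zf_def Yf_def sum.distrib sum_subtractf)
    show "Zf (\<lambda>i. Yf h (s i)) t = (\<Sum>i=1..k. h i * Zf (\<lambda>l. Yf (\<lambda>j. if j = i then 1 else 0) (s l)) t)"
      if h: "h \<in> Ck k" for h t
    proof -
      have hj: "h j = (\<Sum>i=1..k. h i * (if j = i then 1 else 0))" for j
      proof -
        have "(\<Sum>i=1..k. h i * (if j = i then 1 else 0)) = (\<Sum>i=1..k. if j = i then h j else 0)"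
          by (intro sum.cong) auto
        also have "\<dots> = h j" using h by (auto simp: Ck_def)
        finally show ?thesis by simp
      qed
      have Y: "Yf h l = (\<Sum>i=1..k. h i * Yf (\<lambda>j. if j = i then 1 else 0) l)" for l
        unfolding Yf_def by (subst (1 2) hj) (simp only: sum_subtractf[symmetric] right_diff_distrib)
      show ?thesis
      proof (cases "t \<in> {1..k}")
        case True
        have "(\<Sum>l\<in>{t..k}. Yf h (s l)) = (\<Sum>l\<in>{t..k}. \<Sum>i=1..k. h i * Yf (\<lambda>j. if j = i then 1 else 0) (s l))"
          by (simp only: Y[symmetric])
        also have "\<dots> = (\<Sum>i=1..k. h i * (\<Sum>l\<in>{t..k}. Yf (\<lambda>j. if j = i then 1 else 0) (s l)))"
          by (subst sum.swap) (simp only: sum_distrib_left)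
        finally show ?thesis using True by (simp add: Zf_def sum_negf)
      next
        case False
        thus ?thesis unfolding Zf_def by (simp only: if_False mult_zero_right sum.neutral_const)
      qed
    qed
    show "(\<Sum>i=1..k. cmod (Zf (\<lambda>i. Yf h (s i)) i)) \<le> real (2 * k) * (\<Sum>i=1..k. cmod (h i))" if h: "h \<in> Ck k" for h
    proof -
      define N where "N = (\<Sum>i=1..k. cmod (h i))"
      have 1: "(\<Sum>l=1..k. cmod (Yf h (s l))) = (\<Sum>l=1..k. cmod (Yf h l))"
        unfolding s_def by (rule sum.reindex_bij_betw[OF bij_transpose_Ck[OF pq]])
      have "(\<Sum>l=1..k. cmod (Yf h l)) \<le> (\<Sum>l=1..k. cmod (h (l + 1)) + cmod (h l))"
        unfolding Yf_def by (intro sum_mono norm_triangle_ineq4)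
      also have "\<dots> = (\<Sum>l=1..k. cmod (h (l + 1))) + N" by (simp add: sum.distrib N_def)
      also have "(\<Sum>l=1..k. cmod (h (l + 1))) \<le> N"
      proof -
        have "(\<Sum>l=1..k. cmod (h (l + 1))) = (\<Sum>l\<in>{2..k + 1}. cmod (h l))"
          by (rule sum.reindex_bij_witness[where i = "\<lambda>l. l - 1" and j = "\<lambda>l. l + 1"]) auto
        also have "\<dots> = (\<Sum>l\<in>{2..k}. cmod (h l))"
          using h by (intro sum.mono_neutral_right) (auto simp: Ck_def)
        also have "\<dots> \<le> N" unfolding N_def by (intro sum_mono2) auto
        finally show ?thesis .
      qed
      finally have 2: "(\<Sum>l=1..k. cmod (Yf h (s l))) \<le> 2 * N" using 1 by simp
      have "cmod (Zf (\<lambda>i. Yf h (s i)) t) \<le> 2 * N" if "t \<in> {1..k}" for t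
      proof -
        have "cmod (Zf (\<lambda>i. Yf h (s i)) t) = cmod (\<Sum>l\<in>{t..k}. Yf h (s l))"
          using that by (simp add: Zf_def)
        also have "\<dots> \<le> (\<Sum>l\<in>{t..k}. cmod (Yf h (s l)))" by (rule norm_sum)
        also have "\<dots> \<le> (\<Sum>l\<in>{1..k}. cmod (Yf h (s l)))" using that by (intro sum_mono2) auto
        finally show ?thesis using 2 by simp
      qed
      then have "(\<Sum>i=1..k. cmod (Zf (\<lambda>i. Yf h (s i)) i)) \<le> (\<Sum>i=1..k. 2 * N)" by (intro sum_mono)
      also have "\<dots> = real (2 * k) * N" by simp
      finally show ?thesis by (simp only: N_def)
    qed
    show "g z = w a (Zf (\<lambda>i. Yf z (s i)))" if "z \<in> Ck k" for z
      using that a by (simp add: g_def W_def s_def)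
  qed
  have gz: "g z = W a (\<lambda>i. Yf z (s i))" if "z \<in> Ck k" for z using that by (simp add: g_def s_def)
  have per: "g (z(i := z i + 1)) = g z" if z: "z \<in> Ck k" "i \<in> {1..k}" for z i
  proof (cases "i = 1")
    case True
    define y where "y = (\<lambda>j. Yf z (s j))"
    have "W a (\<lambda>l. Yf (z(1 := z 1 + 1)) (s l)) = W a (y(s 1 := y (s 1) - 1))"
      unfolding y_def s_def by (rule W_cong) (rule Yf_upd_transpose_1[OF z(1) pq])
    also have "\<dots> = W a y" using smem z(2) True by (intro W_1_minus) auto
    finally show ?thesis using gz updC z True by (simp add: y_def)
  next
    case False
    define y where "y = (\<lambda>j. Yf z (s j))"
    have "W a (\<lambda>l. Yf (z(i := z i + 1)) (s l)) = W a (y(s (i - 1) := y (s (i - 1)) + 1, s i := y (s i) - 1))"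
      unfolding y_def s_def by (rule W_cong) (rule Yf_upd_transpose[OF z pq False])
    also have "\<dots> = W a y"
    proof (rule W_pair_1)
      have "i - 1 \<in> {1..k}" using z(2) False by auto
      thus "s (i - 1) \<in> {1..k}" "s i \<in> {1..k}" using smem z(2) by blast+
      show "s (i - 1) \<noteq> s i" using ss[of i] ss[of "i - 1"] z(2) by (metis False Suc_eq_plus1 Suc_n_not_le_n atLeastAtMost_iff diff_le_self le_add_diff_inverse2)
    qed
    finally show ?thesis using gz updC z by (simp add: y_def)
  qed
  have quasi: "g (z(i := z i + eta)) = (-1) ^ ncf i * ee (- of_nat (ncf i) * z i + z (i - 1) + z (i + 1)
                + ((if i = 1 then 1 else 0) - 1) * eta) * g z" if z: "z \<in> Ck k" "i \<in> {1..k}" for z i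
  proof (cases "i = 1")
    case True
    define y where "y = (\<lambda>j. Yf z (s j))"
    have "W a (\<lambda>l. Yf (z(1 := z 1 + eta)) (s l)) = W a (y(s 1 := y (s 1) - eta))"
      unfolding y_def s_def by (rule W_cong) (rule Yf_upd_transpose_1[OF z(1) pq])
    also have "\<dots> = - ee (y (s 1) + 2 * SS y) * W a y" using smem z(2) True by (intro W_eta_minus) auto
    also have "y (s 1) = z 2 - z 1" by (simp add: y_def ss Yf_def numeral_2_eq_2)
    also have "SS y = - z 1"
    proof -
      have "SS y = SS (Yf z)" unfolding y_def s_def by (rule SS_transpose[OF pq])
      also have "\<dots> = - Zf (Yf z) 1" by (simp only: Zf_1) simp
      finally show ?thesis by (simp only: Zf_Yf[OF z(1)])
    qed
    also have "z 2 - z 1 + 2 * - z 1 = - 3 * z 1 + z 2" by simp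
    finally have "W a (\<lambda>l. Yf (z(1 := z 1 + eta)) (s l)) = - ee (- 3 * z 1 + z 2) * W a y" .
    moreover have "z 0 = 0" using z(1) by (simp add: Ck_def)
    ultimately show ?thesis using gz updC z True by (simp add: y_def ncf_def numeral_2_eq_2 numeral_3_eq_3)
  next
    case False
    define y where "y = (\<lambda>j. Yf z (s j))"
    have i1: "i - 1 \<in> {1..k}" using z(2) False by auto
    have "W a (\<lambda>l. Yf (z(i := z i + eta)) (s l)) = W a (y(s (i - 1) := y (s (i - 1)) + eta, s i := y (s i) - eta))"
      unfolding y_def s_def by (rule W_cong) (rule Yf_upd_transpose[OF z pq False])
    also have "\<dots> = ee (y (s i) - y (s (i - 1)) - eta) * W a y"
    proof (rule W_pair_eta)
      show "s (i - 1) \<in> {1..k}" "s i \<in> {1..k}" using smem z(2) i1 by blast+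
      have "i - 1 \<noteq> i" using z(2) by auto
      then show "s (i - 1) \<noteq> s i" using ss by metis
    qed
    also have "y (s i) - y (s (i - 1)) - eta = - of_nat (ncf i) * z i + z (i - 1) + z (i + 1) + ((if i = 1 then 1 else 0) - 1) * eta"
      using False z(2) by (simp add: y_def ss Yf_def ncf_def)
    finally have "W a (\<lambda>l. Yf (z(i := z i + eta)) (s l)) = ee (- of_nat (ncf i) * z i + z (i - 1) + z (i + 1) + ((if i = 1 then 1 else 0) - 1) * eta) * W a y" .
    moreover have "(-1 :: complex) ^ ncf i = 1" using False by (simp add: ncf_def)
    ultimately show ?thesis using gz[OF updC[OF z]] gz[OF z(1)] by (simp only: y_def mult_1)
  qed
  show ?thesis unfolding H0_def mem_Collect_eq
  proof (intro conjI ballI allI impI)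
    show "g z = 0" if "z \<notin> Ck k" for z using that by (simp add: g_def)
  qed (use hol per quasi in blast)+
qed

lemma W_nonzero: "\<exists>y. W a y \<noteq> 0"
proof (rule ccontr)
  assume "\<nexists>y. W a y \<noteq> 0"
  then have 0: "W a y = 0" for y by blast
  have "(\<Sum>b\<in>Zn n. (if b = a mod int n then 1 else 0) * W b y) = W (a mod int n) y" for y
  proof -
    have "(\<Sum>b\<in>Zn n. (if b = a mod int n then 1 else 0) * W b y) = (\<Sum>b\<in>Zn n. if b = a mod int n then W b y else 0)"
      by (intro sum.cong) auto
    thus ?thesis by simp
  qed
  then have "(\<Sum>b\<in>Zn n. (if b = a mod int n then 1 else 0) * W b y) = 0" for y using 0 by simp
  from W_independent[OF this, of "a mod int n"] show False by simp
qed

text \<open>The permutation acts on the span of the basis and commutes with uniform shifts. The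
  shift by 1/n has the W_a as eigenvectors with distinct eigenvalues, so the permutation is
  diagonal; the shift by - eta / n links W_a to W_(a+1), so all diagonal entries agree.\<close>

lemma W_transpose:
  assumes pq: "p \<in> {1..k}" "q \<in> {1..k}"
  obtains l where "l \<noteq> 0" "\<And>a y. W a (\<lambda>i. y (Transposition.transpose p q i)) = l * W a y"
proof -
  define s where "s = Transposition.transpose p q"
  have ss: "s (s x) = x" for x by (simp add: s_def)
  have ex: "\<exists>c. \<forall>y. W a (\<lambda>i. y (s i)) = c * W a y" if a: "a \<in> Zn n" for a
  proof -
    define g where "g = (\<lambda>z. if z \<in> Ck k then W a (\<lambda>i. Yf z (Transposition.transpose p q i)) else 0)"
    have "g \<in> cfun.span (w ` Zn n)"
      unfolding w_span g_def by (rule permuted_basis_in_H0[OF a pq])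
    then obtain u where u: "g = (\<Sum>v\<in>w ` Zn n. fscale (u v) v)"
      unfolding cfun.span_finite[OF finite_imageI[OF finite_Zn]] by blast
    define c where "c b = u (w b)" for b
    have g: "g = (\<Sum>b\<in>Zn n. fscale (c b) (w b))"
      unfolding u by (simp add: sum.reindex[OF w_inj] c_def)
    have eq: "W a (\<lambda>i. y (s i)) = (\<Sum>b\<in>Zn n. c b * W b y)" for y
    proof -
      have "W a (\<lambda>i. y (s i)) = W a (\<lambda>i. Yf (Zf y) (s i))"
      proof (rule W_cong)
        fix i assume "i \<in> {1..k}"
        then have "s i \<in> {1..k}" unfolding s_def using transpose_mem pq by blast
        thus "y (s i) = Yf (Zf y) (s i)" by (simp only: Yf_Zf)
      qed
      also have "\<dots> = g (Zf y)" by (simp add: g_def s_def)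
      also have "\<dots> = (\<Sum>b\<in>Zn n. c b * w b (Zf y))" unfolding g by (simp add: cfun_sum_scale_apply)
      also have "\<dots> = (\<Sum>b\<in>Zn n. c b * W b y)" by (intro sum.cong) (auto simp: W_def)
      finally show ?thesis .
    qed
    have c0: "c b = 0" if b: "b \<in> Zn n" "b \<noteq> a" for b
    proof -
      let ?e = "\<lambda>b. ee ((of_nat k + 1) * of_int b / of_nat n)"
      have "(\<Sum>b\<in>Zn n. (c b * (?e b - ?e a)) * W b y) = 0" for y
      proof -
        have "W a (\<lambda>i. sh y (1 / of_nat n) (s i)) = W a (sh (\<lambda>i. y (s i)) (1 / of_nat n))"
          by (simp add: sh_def)
        then have "(\<Sum>b\<in>Zn n. c b * (?e b * W b y)) = ?e a * (\<Sum>b\<in>Zn n. c b * W b y)"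
          unfolding eq W_1n .
        thus ?thesis by (simp add: sum_distrib_left sum_subtractf algebra_simps)
      qed
      from W_independent[OF this b(1)] have "c b = 0 \<or> ?e b = ?e a" by auto
      moreover have "?e b \<noteq> ?e a"
      proof
        assume "?e b = ?e a"
        then have "ee ((of_nat k + 1) * of_int b / of_nat n - (of_nat k + 1) * of_int a / of_nat n) = 1"
          by (simp add: ee_diff)
        then obtain m :: int where "(of_nat k + 1) * of_int b / of_nat n - (of_nat k + 1) * of_int a / of_nat n = (of_int m :: complex)"
          by (auto simp: ee_eq_1_iff Ints_def)
        then have "(of_int ((int k + 1) * (b - a)) :: complex) = of_int (m * int n)"
          using of_nat_n_nonzero by (simp add: divide_simps diff_divide_distrib[symmetric]) (simp add: algebra_simps)
        then have "(int k + 1) * (b - a) = m * int n" by (simp only: of_int_eq_iff)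
        \<comment> \<open>Doubling isolates b - a because 2 (k + 1) = n + 1.\<close>
        then have "int n dvd 2 * ((int k + 1) * (b - a))" by simp
        moreover have "2 * ((int k + 1) * (b - a)) = int n * (b - a) + (b - a)" by (simp add: n_def algebra_simps)
        ultimately have "int n dvd b - a" by (metis dvd_add_right_iff dvd_triv_left)
        then have "b mod int n = a mod int n" by (simp add: mod_eq_dvd_iff)
        thus False using a b by simp
      qed
      ultimately show ?thesis by simp
    qed
    have "W a (\<lambda>i. y (s i)) = c a * W a y" for y
    proof -
      have "(\<Sum>b\<in>Zn n. c b * W b y) = (\<Sum>b\<in>{a}. c b * W b y)"
        by (rule sum.mono_neutral_right) (use a c0 in auto)
      thus ?thesis by (simp add: eq)
    qed
    thus ?thesis by blast
  qed
  have ex': "\<exists>c. \<forall>y. W a (\<lambda>i. y (s i)) = c * W a y" for a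
    using ex[of "a mod int n"] by simp
  then obtain c where c: "\<And>a y. W a (\<lambda>i. y (s i)) = c a * W a y" by metis
  have cc: "c (a + 1) = c a" for a
  proof -
    obtain y where y: "W (a + 1) y \<noteq> 0" using W_nonzero by blast
    have "W a (\<lambda>i. sh y (- (eta / of_nat n)) (s i)) = W a (sh (\<lambda>i. y (s i)) (- (eta / of_nat n)))"
      by (simp add: sh_def)
    then have "c a * (cw * ee (SS y) * W (a + 1) y) = cw * ee (SS (\<lambda>i. y (s i))) * (c (a + 1) * W (a + 1) y)"
      unfolding c W_etan .
    moreover have "SS (\<lambda>i. y (s i)) = SS y" unfolding s_def by (rule SS_transpose[OF pq])
    ultimately have "c a * (cw * ee (SS y) * W (a + 1) y) = c (a + 1) * (cw * ee (SS y) * W (a + 1) y)"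
      by (simp add: mult_ac)
    thus ?thesis using y cw(1) by simp
  qed
  have call: "c a = c 0" for a
    by (induction a rule: int_induct[where k = 0]) (use cc in \<open>auto, metis diff_add_cancel\<close>)
  have "c 0 \<noteq> 0"
  proof
    assume "c 0 = 0"
    then have "W 0 (\<lambda>i. (\<lambda>i. y (s i)) (s i)) = 0" for y using c[of 0 "\<lambda>i. y (s i)"] by simp
    then have "W 0 y = 0" for y by (simp add: ss)
    thus False using W_nonzero by blast
  qed
  moreover have "W a (\<lambda>i. y (Transposition.transpose p q i)) = c 0 * W a y" for a y using c[of a y] call[of a] by (simp add: s_def)
  ultimately show ?thesis using that by blast
qed

end

section \<open>Vanishing of bilinear forms on shifted diagonals\<close>

context half_plane
begin

definition half_periods :: "complex list" where
  "half_periods = [0, 1/2, eta/2, (1 + eta)/2]"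

lemma half_periods_double: "h \<in> set half_periods \<Longrightarrow> 2 * h \<in> Lam"
proof -
  assume "h \<in> set half_periods"
  then have "h = 0 \<or> h = 1/2 \<or> h = eta/2 \<or> h = (1 + eta)/2" by (simp add: half_periods_def)
  then have "2 * h = 0 \<or> 2 * h = 1 \<or> 2 * h = eta \<or> 2 * h = 1 + eta" by (elim disjE) (simp_all add: mult.commute[of h 2])
  then show ?thesis using Lam_add[OF Lam_basis(4,3)] by (elim disjE) simp_all
qed

lemma half_periods_distinct: "distinct_mod (map (\<lambda>h. a + h) half_periods)"
proof -
  have *: "- x \<notin> Lam" if "x \<notin> Lam" for x using that by (simp add: Lam_minus_iff)
  have "(1 - eta)/2 \<notin> Lam"
  proof
    assume "(1 - eta)/2 \<in> Lam"
    from Lam_add[OF this Lam_basis(3)] have "(1 - eta)/2 + eta \<in> Lam" .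
    moreover have "(1 - eta)/2 + eta = (1 + eta)/2" by (simp add: field_simps)
    ultimately show False using half_not_Lam by simp
  qed
  then have "1/2 - eta/2 \<notin> Lam" by (simp only: diff_divide_distrib not_False_eq_True)
  moreover have "1/2 - (1 + eta)/2 = - (eta/2)" "eta/2 - (1 + eta)/2 = - (1/2)"
    by (simp_all add: field_simps)
  ultimately show ?thesis
    using half_not_Lam *[OF half_not_Lam(1)] *[OF half_not_Lam(2)] *[OF half_not_Lam(3)]
    by (simp add: half_periods_def distinct_mod_def)
qed

lemma distinct_mod_append:
  "distinct_mod (xs @ ys) \<longleftrightarrow> distinct_mod xs \<and> distinct_mod ys \<and> (\<forall>x\<in>set xs. \<forall>y\<in>set ys. x - y \<notin> Lam)"
  by (simp add: distinct_mod_def sorted_wrt_append)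

text \<open>Doubling removes the half periods modulo Lambda, so it suffices to compare 2 a with 2
  b.\<close>

lemma half_periods_distinct_2:
  assumes "2 * (a - b) \<notin> Lam"
  shows "distinct_mod (map (\<lambda>h. a + h) half_periods @ map (\<lambda>h. b + h) half_periods)"
  unfolding distinct_mod_append
proof (intro conjI half_periods_distinct ballI notI)
  fix x y assume "x \<in> set (map (\<lambda>h. a + h) half_periods)" "y \<in> set (map (\<lambda>h. b + h) half_periods)" and xy: "x - y \<in> Lam"
  then obtain h h' where h: "x = a + h" "y = b + h'" "2 * h \<in> Lam" "2 * h' \<in> Lam"
    using half_periods_double by auto
  have "of_nat 2 * (x - y) - (2 * h - 2 * h') \<in> Lam" by (intro Lam_diff Lam_mult_nat xy h)
  moreover have "of_nat 2 * (x - y) - (2 * h - 2 * h') = 2 * (a - b)" by (simp add: h algebra_simps)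
  ultimately show False using assms by simp
qed

text \<open>The points q / 2 + h are the fixed points of z -> q - z modulo Lambda. By reflection the
  derivatives at such a point and at its mirror image are opposite; by quasi-periodicity they are
  equal, the multiplier being 1 there. So they vanish.\<close>

lemma qper_reflected_double_zero:
  assumes f: "qper 6 (ee (3 * q - 3 * eta)) f" and r: "\<And>z. f (q - z) = f z"
    and h: "h \<in> set half_periods" and z: "f (q / 2 + h) = 0"
  shows "deriv f (q / 2 + h) = 0"
proof -
  have hol: "f holomorphic_on UNIV" and 1: "\<And>z. f (z + 1) = f z"
    and e: "\<And>z. f (z + eta) = (ee (3 * q - 3 * eta) * ee (- 6 * z)) * f z"
    using f by (auto simp: qper_def)
  have d1: "deriv f (z + 1) = deriv f z" if "f z = 0" for z
    using deriv_quasi[OF hol holomorphic_on_const[of 1], of 1 z] 1 that by simp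
  have de: "deriv f (z + eta) = (ee (3 * q - 3 * eta) * ee (- 6 * z)) * deriv f z" if "f z = 0" for z
    by (rule deriv_quasi[OF hol _ e that]) (intro holomorphic_intros)
  have "((\<lambda>z. f (q - z)) has_field_derivative deriv f (q - z) * (- 1)) (at z)" for z
    by (rule DERIV_chain2[where f = f, OF entire_deriv_has[OF hol]]) (auto intro!: derivative_eq_intros)
  then have dr: "deriv f (q - z) = - deriv f z" for z
    using DERIV_unique[OF _ entire_deriv_has[OF hol, of z]] by (simp add: r) (metis minus_minus)
  define z1 where "z1 = q / 2 - h"
  have z1: "q - (q / 2 + h) = z1" by (simp add: z1_def)
  have "deriv f z1 = - deriv f (q / 2 + h)" using dr[of "q / 2 + h"] by (simp only: z1)
  moreover have f1: "f z1 = 0" using r[of "q / 2 + h"] z by (simp only: z1)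
  moreover have "deriv f (q / 2 + h) = deriv f z1"
  proof -
    have "h = 0 \<or> h = 1/2 \<or> h = eta/2 \<or> h = (1 + eta)/2" using h by (simp add: half_periods_def)
    then consider "h = 0" | "h = 1/2" | "h = eta/2" | "h = (1 + eta)/2" by blast
    then show ?thesis
    proof cases
      case 1 thus ?thesis by (simp add: z1_def)
    next
      case 2
      have "q / 2 + h = z1 + 1" unfolding z1_def 2 by simp
      thus ?thesis using d1[OF f1] by simp
    next
      case 3
      have "q / 2 + h = z1 + eta" unfolding z1_def 3 by simp
      moreover have "ee (3 * q - 3 * eta) * ee (- 6 * z1) = 1"
        unfolding ee_add[symmetric] z1_def 3 by simp
      ultimately show ?thesis using de[OF f1] by simp
    next
      case 4
      have "q / 2 + h = (z1 + eta) + 1" unfolding z1_def 4 by (simp add: field_simps)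
      moreover have "f (z1 + eta) = 0" using e f1 by simp
      moreover have "ee (3 * q - 3 * eta) * ee (- 6 * z1) = ee (of_int 3)"
        unfolding ee_add[symmetric] z1_def 4 by (intro arg_cong[where f = ee]) (simp add: field_simps)
      ultimately show ?thesis using de[OF f1] d1[of "z1 + eta"] by (simp only: ee_of_int mult_1)
    qed
  qed
  ultimately show ?thesis by simp
qed

end

context theta_w
begin

section \<open>Vectors of theta values up to a common factor\<close>

text \<open>Equality of the points of projective space that belong to y and v; the essential feature
  is that m does not depend on a.\<close>

definition weq :: "(nat \<Rightarrow> complex) \<Rightarrow> (nat \<Rightarrow> complex) \<Rightarrow> bool" where
  "weq y v \<longleftrightarrow> (\<exists>m. m \<noteq> 0 \<and> (\<forall>a. W a v = m * W a y))"

lemma weq_refl: "weq y y" unfolding weq_def by (rule exI[of _ 1]) simp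

lemma weq_sym: "weq y v \<Longrightarrow> weq v y"
proof -
  assume "weq y v"
  then obtain m where "m \<noteq> 0" "\<And>a. W a v = m * W a y" unfolding weq_def by blast
  then show ?thesis unfolding weq_def by (intro exI[of _ "inverse m"]) simp
qed

lemma weq_trans: "weq y v \<Longrightarrow> weq v x \<Longrightarrow> weq y x"
proof -
  assume "weq y v" "weq v x"
  then obtain m m' where "m \<noteq> 0" "\<And>a. W a v = m * W a y" "m' \<noteq> 0" "\<And>a. W a x = m' * W a v" unfolding weq_def by blast
  then show ?thesis unfolding weq_def by (intro exI[of _ "m' * m"]) simp
qed

lemma weq_cong: "(\<And>i. i \<in> {1..k} \<Longrightarrow> v i = y i) \<Longrightarrow> weq y v"
  unfolding weq_def by (intro exI[of _ 1] conjI allI, simp, simp only: mult_1, rule W_cong)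

lemma weq_upd_Lam:
  assumes j: "j \<in> {1..k}" and l: "l \<in> Lam"
  shows "weq y (y(j := y j + l))"
proof -
  have mult: "weq y (y(j := y j + of_int m * p))" if step: "\<And>y. weq y (y(j := y j + p))" for p m y
  proof (induction m rule: int_induct[where k = 0])
    case base show ?case using weq_refl by simp
  next
    case (step1 i)
    have "weq (y(j := y j + of_int i * p)) (y(j := y j + of_int (i + 1) * p))"
      using step[of "y(j := y j + of_int i * p)"] by (simp add: algebra_simps)
    with step1 show ?case using weq_trans by blast
  next
    case (step2 i)
    have "weq (y(j := y j + of_int (i - 1) * p)) (y(j := y j + of_int i * p))"
      using step[of "y(j := y j + of_int (i - 1) * p)"] by (simp add: algebra_simps)
    with step2 show ?case using weq_trans weq_sym by blast
  qed
  have 1: "weq y (y(j := y j + 1))" for y unfolding weq_def using W_1[OF j] by (intro exI[of _ 1]) auto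
  have e: "weq y (y(j := y j + eta))" for y
    unfolding weq_def using W_eta[OF j, of _ y] by (intro exI[of _ "- ee (- y j - 2 * SS y - 3 * eta)"]) auto
  obtain a b :: int where ab: "l = of_int a + of_int b * eta" using l unfolding Lam_iff by blast
  have "weq y (y(j := y j + of_int a))" using mult[OF 1, of y a] by simp
  moreover have "weq (y(j := y j + of_int a)) (y(j := y j + l))"
    using mult[OF e, of "y(j := y j + of_int a)" b] by (simp add: ab add.assoc)
  ultimately show ?thesis by (rule weq_trans)
qed

lemma weq_Lam:
  assumes "\<And>i. i \<in> {1..k} \<Longrightarrow> v i - y i \<in> Lam"
  shows "weq y v"
proof -
  define x where "x m = (\<lambda>i. if 1 \<le> i \<and> i \<le> m then v i else y i)" for m
  have "weq y (x m)" if "m \<le> k" for m using that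
  proof (induction m)
    case 0 show ?case by (rule weq_cong) (simp add: x_def)
  next
    case (Suc m)
    then have m: "Suc m \<in> {1..k}" by simp
    have "weq (x m) ((x m)(Suc m := x m (Suc m) + (v (Suc m) - y (Suc m))))"
      by (rule weq_upd_Lam[OF m assms[OF m]])
    moreover have "(x m)(Suc m := x m (Suc m) + (v (Suc m) - y (Suc m))) = x (Suc m)"
      by (auto simp: x_def fun_eq_iff le_Suc_eq)
    ultimately show ?case using Suc weq_trans by auto
  qed
  then have "weq y (x k)" by simp
  moreover have "weq (x k) v" by (rule weq_cong) (simp add: x_def)
  ultimately show ?thesis by (rule weq_trans)
qed

lemma weq_transpose: "p \<in> {1..k} \<Longrightarrow> q \<in> {1..k} \<Longrightarrow> weq y (\<lambda>i. y (Transposition.transpose p q i))"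
  unfolding weq_def using W_transpose[of p q] by metis

lemma weq_permutes:
  assumes "p permutes {1..k}"
  shows "weq y (\<lambda>i. y (p i))"
proof -
  have "finite {1..k}" by simp
  from assms this have "\<forall>y. weq y (\<lambda>i. y (p i))"
  proof (induction p rule: permutes_induct)
    case id thus ?case using weq_refl by simp
  next
    case (swap a b p)
    show ?case
    proof
      fix y
      have "weq y (\<lambda>i. y (Transposition.transpose a b i))" by (rule weq_transpose) (use swap in auto)
      moreover have "weq (\<lambda>i. y (Transposition.transpose a b i)) (\<lambda>i. y (Transposition.transpose a b (p i)))"
        using swap.IH by fast
      ultimately show "weq y (\<lambda>i. y ((Transposition.transpose a b \<circ> p) i))" unfolding o_def by (rule weq_trans)
    qed
  qed
  thus ?thesis by blast
qed

lemma weq_permutes_Lam: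
  assumes "p permutes {1..k}" "\<And>i. i \<in> {1..k} \<Longrightarrow> v i - y (p i) \<in> Lam"
  shows "weq y v"
proof (rule weq_trans)
  show "weq y (\<lambda>i. y (p i))" by (rule weq_permutes[OF assms(1)])
  show "weq (\<lambda>i. y (p i)) v" by (rule weq_Lam) (rule assms(2))
qed

definition BF :: "(int \<times> int \<Rightarrow> complex) \<Rightarrow> (nat \<Rightarrow> complex) \<Rightarrow> (nat \<Rightarrow> complex) \<Rightarrow> complex" where
  "BF t y y' = (\<Sum>a\<in>Zn n. \<Sum>b\<in>Zn n. t (a, b) * W a y * W b y')"

lemma BF_factor:
  assumes "\<And>a. W a v = m * W a y" "\<And>a. W a v' = m' * W a y'"
  shows "BF t v v' = (m * m') * BF t y y'"
  unfolding BF_def assms by (simp add: sum_distrib_left mult_ac)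

lemma BF_weq:
  assumes "weq y v" "weq y' v'"
  shows "BF t v v' = 0 \<longleftrightarrow> BF t y y' = 0"
proof -
  obtain m m' where "m \<noteq> 0" "\<And>a. W a v = m * W a y" "m' \<noteq> 0" "\<And>a. W a v' = m' * W a y'"
    using assms unfolding weq_def by blast
  then show ?thesis using BF_factor[of v m y v' m' y' t] by simp
qed

lemma BF_line:
  assumes "\<And>i. affine_fun (\<lambda>t. g t i)" "\<And>i. affine_fun (\<lambda>t. g' t i)"
  shows "(\<lambda>x. BF t (g x) (g' x)) holomorphic_on UNIV"
  unfolding BF_def by (intro holomorphic_intros W_line assms)

lemma BF_swap: "(\<And>a b. t (a, b) = t (b, a)) \<Longrightarrow> BF t y y' = BF t y' y"
  unfolding BF_def by (subst sum.swap) (simp add: mult_ac)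

text \<open>Linear independence of the W_a is used once in each argument.\<close>

lemma BF_zero_imp:
  assumes "\<And>y y'. BF t y y' = 0" "a \<in> Zn n" "b \<in> Zn n"
  shows "t (a, b) = 0"
proof -
  have "(\<Sum>a\<in>Zn n. t (a, b) * W a y) = 0" for y
  proof (rule W_independent[OF _ assms(3)])
    fix y'
    have "(\<Sum>b\<in>Zn n. (\<Sum>a\<in>Zn n. t (a, b) * W a y) * W b y') = BF t y y'"
      unfolding BF_def by (subst sum.swap) (simp add: sum_distrib_right)
    thus "(\<Sum>b\<in>Zn n. (\<Sum>a\<in>Zn n. t (a, b) * W a y) * W b y') = 0" using assms(1) by simp
  qed
  from W_independent[OF this assms(2)] show ?thesis .
qed

lemma qper_pair_line:
  assumes p: "p \<in> {1..k}" and q: "q \<in> {1..k}" and pq: "p \<noteq> q"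
  shows "qper 2 (ee (y q - y p - eta)) (\<lambda>x. BF t (y(p := y p + x, q := y q - x)) v)"
  unfolding qper_def
proof (intro conjI allI)
  show "(\<lambda>x. BF t (y(p := y p + x, q := y q - x)) v) holomorphic_on UNIV"
    by (rule BF_line) (intro affine_fun_intros)+
  show "BF t (y(p := y p + (z + 1), q := y q - (z + 1))) v = BF t (y(p := y p + z, q := y q - z)) v" for z
    using BF_factor[of "y(p := y p + (z + 1), q := y q - (z + 1))" 1 "y(p := y p + z, q := y q - z)" v 1 v t]
      W_pair_1[OF p q pq, of _ "y(p := y p + z, q := y q - z)"] pq by (simp add: fun_upd_twist algebra_simps)
  fix z
  define x where "x = y(p := y p + z, q := y q - z)"
  have "y(p := y p + (z + eta), q := y q - (z + eta)) = x(p := x p + eta, q := x q - eta)"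
    using pq by (auto simp: x_def fun_eq_iff)
  moreover have "x q - x p - eta = (y q - y p - eta) + (- of_int 2 * z)" using pq by (simp add: x_def)
  ultimately show "BF t (y(p := y p + (z + eta), q := y q - (z + eta))) v
      = ee (y q - y p - eta) * ee (- of_int 2 * z) * BF t (y(p := y p + z, q := y q - z)) v"
    using BF_factor[of "x(p := x p + eta, q := x q - eta)" "ee (x q - x p - eta)" x v 1 v t, OF W_pair_eta[OF p q pq]]
    by (simp only: ee_add x_def[symmetric]) simp
qed simp

text \<open>\<open>U\<close> contains the coordinates in which \<open>v\<close> differs from \<open>y + x\<close>. Moving two of them in opposite
  directions gives a function of order two with three zeros, each matching one more coordinate.\<close>

lemma BF_zero_of_unmatched:
  assumes H: "\<And>y q. BF t y (sk k y x q) = 0"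
  shows "U \<subseteq> {1..k} \<Longrightarrow> card U = Suc m \<Longrightarrow> (\<And>i. i \<in> {1..k} - U \<Longrightarrow> v i = y i + x) \<Longrightarrow> BF t y v = 0"
proof (induction m arbitrary: U y v)
  case 0
  then obtain p where U: "U = {p}" by (metis card_1_singletonE One_nat_def)
  then have p: "p \<in> {1..k}" using 0 by simp
  let ?s = "Transposition.transpose p k"
  have "BF t (\<lambda>i. y (?s i)) (\<lambda>i. v (?s i)) = 0 \<longleftrightarrow> BF t y v = 0"
    by (intro BF_weq weq_transpose p k_mem)
  moreover have "BF t (\<lambda>i. y (?s i)) (sk k (\<lambda>i. y (?s i)) x (v p - y p - x)) = 0" by (rule H)
  moreover have "BF t (\<lambda>i. y (?s i)) (\<lambda>i. v (?s i)) = 0 \<longleftrightarrow> BF t (\<lambda>i. y (?s i)) (sk k (\<lambda>i. y (?s i)) x (v p - y p - x)) = 0"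
  proof (rule BF_weq[OF weq_refl weq_cong])
    fix i assume i: "i \<in> {1..k}"
    show "v (?s i) = sk k (\<lambda>i. y (?s i)) x (v p - y p - x) i"
    proof (cases "i = k")
      case False
      have "?s i \<noteq> p" using False by (metis transpose_involutory transpose_apply_first)
      then show ?thesis using False 0(3)[of "?s i"] transpose_mem[OF p k_mem i] U by (simp add: sk_def)
    qed (simp add: sk_def)
  qed
  ultimately show ?case by simp
next
  case (Suc m)
  then obtain p where p: "p \<in> U" by (metis card_eq_SucD insertI1)
  have fin: "finite U" using Suc.prems(1) finite_subset by blast
  have "card (U - {p}) = Suc m" using p fin Suc.prems(2) by simp
  then obtain q where q': "q \<in> U - {p}" by (metis card_eq_SucD insertI1)
  then have q: "q \<in> U" and pq: "p \<noteq> q" by auto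
  have pk: "p \<in> {1..k}" and qk: "q \<in> {1..k}" using p q Suc.prems(1) by auto
  have z: "BF t y v = 0" if match: "\<And>i. i \<in> {1..k} - U \<Longrightarrow> v i = y i + x"
    and g: "v p - v q \<notin> Lam" "y q + y p + 2 * x - 2 * v q \<notin> Lam" "v p + v q - 2 * x - y p - y q \<notin> Lam" for y v
  proof -
    let ?f = "\<lambda>z. BF t (y(p := y p + z, q := y q - z)) v"
    \<comment> \<open>At z = e1 coordinate p is matched, at z = e2 coordinate q. At z = e3
      coordinate p takes the value v q - x, so swapping p and q in the first argument matches
      q.\<close>
    define e1 e2 e3 where e: "e1 = v p - x - y p" "e2 = y q + x - v q" "e3 = v q - x - y p"
    have "?f 0 = 0"
    proof (rule qper_too_many_zeros[OF qper_pair_line[OF pk qk pq], of "[e1, e3, e2]"])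
      show "distinct_mod [e1, e3, e2]"
      proof -
        have "e1 - e3 = v p - v q" "e1 - e2 = v p + v q - 2 * x - y p - y q" "e3 - e2 = - (y q + y p + 2 * x - 2 * v q)"
          by (simp_all add: e)
        moreover have "e3 - e2 \<notin> Lam" using g(2) calculation(3) by (simp only: Lam_minus_iff not_False_eq_True)
        ultimately show ?thesis using g by (simp add: distinct_mod_def)
      qed
      have f1: "?f e1 = 0"
      proof (rule Suc.IH[of "U - {p}"])
        show "card (U - {p}) = Suc m" by fact
        fix i assume "i \<in> {1..k} - (U - {p})"
        thus "v i = (y(p := y p + e1, q := y q - e1)) i + x" using match q by (cases "i = p") (auto simp: e pq)
      qed (use Suc.prems in auto)
      have f2: "?f e2 = 0"
      proof (rule Suc.IH[of "U - {q}"])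
        show "card (U - {q}) = Suc m" using q fin Suc.prems(2) by simp
        fix i assume "i \<in> {1..k} - (U - {q})"
        thus "v i = (y(p := y p + e2, q := y q - e2)) i + x" using match p by (cases "i = q") (auto simp: e pq)
      qed (use Suc.prems in auto)
      have f3: "?f e3 = 0"
      proof -
        let ?y = "y(p := y p + e3, q := y q - e3)" and ?s = "Transposition.transpose p q"
        have "BF t (\<lambda>i. ?y (?s i)) v = 0"
        proof (rule Suc.IH[of "U - {q}"])
          show "card (U - {q}) = Suc m" using q fin Suc.prems(2) by simp
          fix i assume i: "i \<in> {1..k} - (U - {q})"
          show "v i = ?y (?s i) + x"
          proof (cases "i = q")
            case False
            then have "i \<noteq> p" using i p by auto
            then show ?thesis using False match i by (simp add: transpose_apply_other)
          qed (simp add: e pq)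
        qed (use Suc.prems in auto)
        thus ?thesis using BF_weq[OF weq_transpose[OF pk qk] weq_refl] by blast
      qed
      show "?f z = 0" if "z \<in> set [e1, e3, e2]" for z using that f1 f2 f3 by auto
    qed simp
    thus ?thesis by simp
  qed
  \<comment> \<open>The speeds 1 and 3 make the three quantities that must avoid Lambda vary with
    the nonzero coefficients 3, 1 and 2.\<close>
  let ?Y = "\<lambda>u. y(p := y p + u)" and ?V = "\<lambda>u. v(p := v p + 3 * u)"
  let ?C = "{u. 3 * u + (v p - v q) \<in> Lam} \<union> {u. 1 * u + (y q + y p + 2 * x - 2 * v q) \<in> Lam} \<union> {u. 2 * u + (v p + v q - 2 * x - y p - y q) \<in> Lam}"
  have "BF t (?Y 0) (?V 0) = 0"
  proof (rule entire_zero_off_countable[of "\<lambda>u. BF t (?Y u) (?V u)" ?C])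
    show "(\<lambda>u. BF t (?Y u) (?V u)) holomorphic_on UNIV" by (rule BF_line) (intro affine_fun_intros)+
    show "countable ?C" by (intro countable_Un countable_affine_Lam) auto
    fix u assume u: "u \<notin> ?C"
    show "BF t (?Y u) (?V u) = 0"
    proof (rule z)
      show "?V u i = ?Y u i + x" if "i \<in> {1..k} - U" for i using that Suc.prems(3)[OF that] p by auto
      show "?V u p - ?V u q \<notin> Lam" "?Y u q + ?Y u p + 2 * x - 2 * ?V u q \<notin> Lam" "?V u p + ?V u q - 2 * x - ?Y u p - ?Y u q \<notin> Lam"
        using u pq by (simp_all add: algebra_simps)
    qed
  qed
  thus ?case by simp
qed

lemma BF_zero_of_sk:
  assumes "\<And>y q. BF t y (sk k y x q) = 0" "a \<in> Zn n" "b \<in> Zn n"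
  shows "t (a, b) = 0"
proof (rule BF_zero_imp[OF _ assms(2,3)])
  fix y v
  show "BF t y v = 0"
    by (rule BF_zero_of_unmatched[OF assms(1), of "{1..k}" "k - 1"]) (use k_pos in auto)
qed

text \<open>W has order three in a single coordinate, one from y_k and two from 2 \<open>SS\<close>;
  moving the last coordinates of both arguments in opposite directions gives order six.\<close>

lemma qper_sk_line:
  "qper 6 (ee (x + 3 * q + 2 * of_nat k * x - 3 * eta)) (\<lambda>z. BF t (sk k y 0 z) (sk k y x (q - z)))"
  unfolding qper_def
proof (intro conjI allI)
  show "(\<lambda>z. BF t (sk k y 0 z) (sk k y x (q - z))) holomorphic_on UNIV"
    by (rule BF_line) (intro affine_fun_intros)+
  show "BF t (sk k y 0 (z + 1)) (sk k y x (q - (z + 1))) = BF t (sk k y 0 z) (sk k y x (q - z))" for z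
    using BF_factor[of "sk k y 0 (z + 1)" 1 "sk k y 0 z" "sk k y x (q - (z + 1))" 1 "sk k y x (q - z)" t]
      W_sk_int[of _ y 0 z 1] W_sk_int[of _ y x "q - z" "-1"] by (simp add: algebra_simps)
  fix z
  define m m' where mm: "m = ee (1 / 2 - (y k + 0 + z) - 2 * SS (sk k y 0 z) - 3 * eta)"
    "m' = ee (1 / 2 + (y k + x + (q - z)) + 2 * SS (sk k y x (q - z)))"
  have "BF t (sk k y 0 (z + eta)) (sk k y x (q - z - eta)) = (m * m') * BF t (sk k y 0 z) (sk k y x (q - z))"
    by (rule BF_factor) (simp_all only: mm W_sk_eta W_sk_eta_minus)
  moreover have "m * m' = ee (x + 3 * q + 2 * of_nat k * x - 3 * eta) * ee (- of_int 6 * z)"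
    unfolding mm ee_add[symmetric] by (rule ee_cong_int[of _ _ 1]) (simp add: algebra_simps)
  ultimately show "BF t (sk k y 0 (z + eta)) (sk k y x (q - (z + eta))) =
      ee (x + 3 * q + 2 * of_nat k * x - 3 * eta) * ee (- of_int 6 * z) * BF t (sk k y 0 z) (sk k y x (q - z))"
    by (simp add: algebra_simps)
qed simp

lemma sk_sk: "sk k (sk k y u p) v q = sk k y (u + v) (p + q)"
  by (auto simp: sk_def)

lemma BF_sk_Lam:
  assumes "l \<in> Lam"
  shows "BF t y (sk k v u (q + l)) = 0 \<longleftrightarrow> BF t y (sk k v u q) = 0"
proof (rule BF_weq[OF weq_refl weq_Lam])
  show "sk k v u (q + l) i - sk k v u q i \<in> Lam" for i using assms by (simp add: sk_def)
qed

text \<open>A symmetric line carries eight zeros of a function of order six.\<close>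

lemma BF_sk_zero:
  assumes 0: "\<And>y. BF t y (sh y x) = 0" and c: "\<And>y. BF t y (sk k y x c) = 0" "c \<notin> Lam"
  shows "BF t y (sk k y x q) = 0"
proof -
  let ?f = "\<lambda>z. BF t (sk k y 0 z) (sk k y x (q - z))"
  have "?f 0 = 0"
  proof (rule qper_too_many_zeros[OF qper_sk_line])
    \<comment> \<open>The arguments differ by x in every coordinate and by a further q - 2 z in the
      last one. This lies in Lambda at the first four points and in c + Lambda at the other
      four.\<close>
    show "distinct_mod (map (\<lambda>h. q / 2 + h) half_periods @ map (\<lambda>h. (q - c) / 2 + h) half_periods)"
    proof (rule half_periods_distinct_2)
      have "2 * (q / 2 - (q - c) / 2) = c" by (simp add: field_simps)
      thus "2 * (q / 2 - (q - c) / 2) \<notin> Lam" using c by simp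
    qed
    show "?f z = 0" if "z \<in> set (map (\<lambda>h. q / 2 + h) half_periods @ map (\<lambda>h. (q - c) / 2 + h) half_periods)" for z
    proof -
      from that obtain h where h: "h \<in> set half_periods" "z = q / 2 + h \<or> z = (q - c) / 2 + h" by auto
      have l: "- (2 * h) \<in> Lam" using half_periods_double[OF h(1)] Lam_minus by blast
      from h(2) show ?thesis
      proof
        assume z: "z = q / 2 + h"
        have "sk k y x (q - z) = sk k (sk k y 0 z) x (0 + - (2 * h))" unfolding sk_sk by (simp add: z field_simps)
        thus ?thesis using BF_sk_Lam[OF l] 0[of "sk k y 0 z"] by (simp only: sk_0)
      next
        assume z: "z = (q - c) / 2 + h"
        have "q - z = z + (c + - (2 * h))" by (simp add: z field_simps)
        then have "sk k y x (q - z) = sk k (sk k y 0 z) x (c + - (2 * h))" unfolding sk_sk by simp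
        thus ?thesis using BF_sk_Lam[OF l] c(1)[of "sk k y 0 z"] by (simp only:)
      qed
    qed
  qed (simp add: half_periods_def)
  thus ?thesis by (simp add: sk_0)
qed

text \<open>Only the four points q / 2 + h are known zeros. Symmetry of t makes the function
  invariant under z -> q - z, so these zeros are double, and eight exceeds the order six.\<close>

lemma BF_sk_zero_symmetric:
  assumes 0: "\<And>y. BF t y y = 0" and s: "\<And>a b. t (a, b) = t (b, a)"
  shows "BF t y (sk k y 0 q) = 0"
proof -
  let ?f = "\<lambda>z. BF t (sk k y 0 z) (sk k y 0 (q - z))"
  have qp: "qper 6 (ee (3 * q - 3 * eta)) ?f" using qper_sk_line[of 0 q t y] by simp
  have "?f 0 = 0"
  proof (rule qper_double_zeros[OF qp half_periods_distinct[of "q / 2"]])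
    fix z assume "z \<in> set (map (\<lambda>h. q / 2 + h) half_periods)"
    then obtain h where h: "h \<in> set half_periods" and z: "z = q / 2 + h" by auto
    have l: "- (2 * h) \<in> Lam" using half_periods_double[OF h] Lam_minus by blast
    have "q - z = z + - (2 * h)" by (simp add: z field_simps)
    then have "?f z = 0" using BF_sk_Lam[OF l, of t "sk k y 0 z" y 0 z] 0[of "sk k y 0 z"] by (simp only:)
    moreover have "?f (q - x) = ?f x" for x using BF_swap[of t, OF s] by simp
    ultimately show "?f z = 0 \<and> deriv ?f z = 0"
      using qper_reflected_double_zero[OF qp _ h] unfolding z by blast
  qed (simp add: half_periods_def)
  thus ?thesis by (simp add: sk_0)
qed

end

section \<open>The relations as a linear operator\<close>

lemma complex_off_countable:
  assumes "countable C"
  obtains z :: complex where "z \<notin> C"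
  using assms uncountable_UNIV_complex by (metis UNIV_eq_I)

context half_plane
begin

text \<open>As 2 omega is in Lambda, excluding d + omega also excludes d - omega; two conditions per
  pair of entries suffice.\<close>

lemma distinct_mod_double:
  assumes w: "\<omega> \<notin> Lam" "2 * \<omega> \<in> Lam"
    and zs: "sorted_wrt (\<lambda>x y. x - y \<notin> Lam \<and> x - y + \<omega> \<notin> Lam) zs"
  shows "distinct_mod (concat (map (\<lambda>z. [z, z + \<omega>]) zs))"
  using zs
proof (induction zs)
  case (Cons z zs)
  have l: "d - \<omega> \<in> Lam \<Longrightarrow> d + \<omega> \<in> Lam" for d
    using Lam_add[OF _ w(2), of "d - \<omega>"] by (simp add: algebra_simps)
  have "z - (z + \<omega>) \<notin> Lam" using w(1) Lam_minus_iff[of \<omega>] by simp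
  moreover have "z - (y + \<omega>) \<notin> Lam" "z + \<omega> - y \<notin> Lam" "z - y \<notin> Lam" "z + \<omega> - (y + \<omega>) \<notin> Lam" if "y \<in> set zs" for y
    using Cons.prems that l[of "z - y"] by (auto simp: algebra_simps)
  ultimately show ?case using Cons by (auto simp: distinct_mod_def)
qed (simp add: distinct_mod_def)

end

context theta_w
begin

definition scaled_relation :: "complex \<Rightarrow> complex \<Rightarrow> int \<Rightarrow> int \<Rightarrow> int \<times> int \<Rightarrow> complex" where
  "scaled_relation A B i j = (\<Sum>r\<in>Zn n. fscale (th (j - i + r * (int k - 1)) (A + B) * QQ (j - i - r) A * QQ (int k * r) B)
     (xx n (j - r) (i + r)))"

definition relation_map :: "complex \<Rightarrow> complex \<Rightarrow> (int \<times> int \<Rightarrow> complex) \<Rightarrow> int \<times> int \<Rightarrow> complex" where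
  "relation_map A B t = (\<Sum>p\<in>Zn n \<times> Zn n. fscale (t p) (scaled_relation A B (fst p) (snd p)))"

definition K :: "complex \<Rightarrow> (int \<times> int \<Rightarrow> complex) set" where
  "K x = {t \<in> tensor_square n. \<forall>y. BF t y (sh y x) = 0}"

lemma BF_sum: "BF (\<Sum>x\<in>S. fscale (c x) (F x)) y v = (\<Sum>x\<in>S. c x * BF (F x) y v)"
proof -
  have "BF (\<Sum>x\<in>S. fscale (c x) (F x)) y v = (\<Sum>a\<in>Zn n. \<Sum>b\<in>Zn n. \<Sum>x\<in>S. c x * F x (a, b) * W a y * W b v)"
    by (simp add: BF_def cfun_sum_scale_apply sum_distrib_right)
  also have "\<dots> = (\<Sum>a\<in>Zn n. \<Sum>x\<in>S. \<Sum>b\<in>Zn n. c x * F x (a, b) * W a y * W b v)"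
    by (intro sum.cong refl sum.swap)
  also have "\<dots> = (\<Sum>x\<in>S. \<Sum>a\<in>Zn n. \<Sum>b\<in>Zn n. c x * F x (a, b) * W a y * W b v)"
    by (rule sum.swap)
  finally show ?thesis by (simp add: BF_def sum_distrib_left mult.assoc)
qed

lemma BF_scale: "BF (fscale c t) y v = c * BF t y v"
  by (simp add: BF_def fscale_def sum_distrib_left mult.assoc)

lemma BF_add: "BF (t + u) y v = BF t y v + BF u y v"
  by (simp add: BF_def sum.distrib algebra_simps)

lemma BF_xx: "BF (xx n a b) y v = W a y * W b v"
proof -
  have "BF (xx n a b) y v = (\<Sum>c\<in>Zn n. \<Sum>d\<in>Zn n. if d = b mod int n then (if c = a mod int n then W c y * W d v else 0) else 0)"
    unfolding BF_def by (intro sum.cong) (auto simp: xx_def)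
  also have "\<dots> = W a y * W b v" by (simp add: sum.delta)
  finally show ?thesis .
qed

lemma BF_scaled_relation: "BF (scaled_relation A B i j) y v = LL i j A B y v"
  unfolding scaled_relation_def BF_sum BF_xx LL_def by (simp add: mult.assoc)

lemma BF_relation_map: "BF (relation_map A B t) y v = (\<Sum>p\<in>Zn n \<times> Zn n. t p * LL (fst p) (snd p) A B y v)"
  unfolding relation_map_def BF_sum BF_scaled_relation ..

lemma BF_prod: "BF t y v = (\<Sum>p\<in>Zn n \<times> Zn n. t p * (W (fst p) y * W (snd p) v))"
  unfolding BF_def by (subst sum.cartesian_product) (simp add: case_prod_beta mult.assoc)

lemma tensor_square_subspace: "cfun.subspace (tensor_square n)"
  by (auto simp: cfun.subspace_def tensor_square_def fscale_def)

lemma xx_tensor_square: "xx n a b \<in> tensor_square n"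
  by (auto simp: tensor_square_def xx_def)

lemma scaled_relation_tensor_square: "scaled_relation A B i j \<in> tensor_square n"
  unfolding scaled_relation_def
  by (intro cfun.subspace_sum[OF tensor_square_subspace] cfun.subspace_scale[OF tensor_square_subspace] xx_tensor_square)

lemma relation_map_tensor_square: "relation_map A B t \<in> tensor_square n"
  unfolding relation_map_def
  by (intro cfun.subspace_sum[OF tensor_square_subspace] cfun.subspace_scale[OF tensor_square_subspace] scaled_relation_tensor_square)

lemma K_subspace: "cfun.subspace (K x)"
  using tensor_square_subspace by (auto simp: cfun.subspace_def K_def BF_scale BF_add) (simp add: BF_def)

lemma tensor_square_zero:
  assumes "t \<in> tensor_square n" "\<And>a b. a \<in> Zn n \<Longrightarrow> b \<in> Zn n \<Longrightarrow> t (a, b) = 0"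
  shows "t = 0"
proof
  fix p show "t p = 0 p" using assms by (cases p) (auto simp: tensor_square_def)
qed

text \<open>\<open>DD_zero\<close>, multiplied by the coefficients of t and summed over all
  indices.\<close>

lemma BF_relation_map_identity:
  "TT e * BF (relation_map A B t) y (sk k y (A + 2 * B) (of_nat n * (e - B))) =
     QQ 0 0 * (TT (A + e) * TT B * BF t (sh y A) (sk k y (2 * B) (of_nat n * (e - B)))
       - ee ((of_nat n)\<^sup>2 * e) * TT (B - e) * TT A * BF t (sk k y A (of_nat n * e)) (sk k y (2 * B) (- (of_nat n * B))))"
proof -
  have DD: "TT e * LL i j A B y (sk k y (A + 2 * B) (of_nat n * (e - B))) = QQ 0 0 * (R1 i j A B e y - R2 i j A B e y)" for i j
    using DD_zero[of i j A B e y] by (simp add: DD_def)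
  have "TT e * BF (relation_map A B t) y (sk k y (A + 2 * B) (of_nat n * (e - B)))
     = (\<Sum>p\<in>Zn n \<times> Zn n. t p * (QQ 0 0 * (R1 (fst p) (snd p) A B e y - R2 (fst p) (snd p) A B e y)))"
    unfolding BF_relation_map sum_distrib_left by (intro sum.cong refl) (simp only: DD[symmetric] mult_ac)
  also have "\<dots> = QQ 0 0 * ((\<Sum>p\<in>Zn n \<times> Zn n. t p * R1 (fst p) (snd p) A B e y) - (\<Sum>p\<in>Zn n \<times> Zn n. t p * R2 (fst p) (snd p) A B e y))"
    unfolding sum_subtractf[symmetric] sum_distrib_left by (intro sum.cong refl) (simp add: algebra_simps)
  also have "(\<Sum>p\<in>Zn n \<times> Zn n. t p * R1 (fst p) (snd p) A B e y) = TT (A + e) * TT B * BF t (sh y A) (sk k y (2 * B) (of_nat n * (e - B)))"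
    unfolding BF_prod R1_def sum_distrib_left by (intro sum.cong refl) (simp only: mult_ac)
  also have "(\<Sum>p\<in>Zn n \<times> Zn n. t p * R2 (fst p) (snd p) A B e y) = ee ((of_nat n)\<^sup>2 * e) * TT (B - e) * TT A * BF t (sk k y A (of_nat n * e)) (sk k y (2 * B) (- (of_nat n * B)))"
    unfolding BF_prod R2_def sum_distrib_left by (intro sum.cong refl) (simp only: mult_ac)
  finally show ?thesis .
qed

text \<open>At e = B the product R2 vanishes, as it contains \<open>TT (B - e)\<close>, and the last
  coordinate gets no extra shift.\<close>

lemma BF_relation_map_diagonal:
  assumes "TT B \<noteq> 0"
  shows "BF (relation_map A B t) y (sh y (A + 2 * B)) = QQ 0 0 * TT (A + B) * BF t (sh y A) (sh y (2 * B))"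
proof -
  have "TT B * BF (relation_map A B t) y (sh y (A + 2 * B)) = TT B * (QQ 0 0 * TT (A + B) * BF t (sh y A) (sh y (2 * B)))"
    using BF_relation_map_identity[of B A B t y] by (simp add: TT_0 sk_0 mult_ac)
  thus ?thesis using assms by simp
qed

lemma all_sh: "(\<forall>y. P (sh y A) (sh y B)) \<longleftrightarrow> (\<forall>y. P y (sh y (B - A)))"
proof
  assume a: "\<forall>y. P (sh y A) (sh y B)"
  show "\<forall>y. P y (sh y (B - A))"
  proof
    fix y show "P y (sh y (B - A))" using a[rule_format, of "sh y (- A)"] by simp
  qed
next
  assume a: "\<forall>y. P y (sh y (B - A))"
  show "\<forall>y. P (sh y A) (sh y B)"
  proof
    fix y show "P (sh y A) (sh y B)" using a[rule_format, of "sh y A"] by simp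
  qed
qed

lemma relation_map_in_K_iff:
  assumes "of_nat n * B \<notin> Lam" "of_nat n * (A + B) \<notin> Lam" "t \<in> tensor_square n"
  shows "relation_map A B t \<in> K (A + 2 * B) \<longleftrightarrow> t \<in> K (2 * B - A)"
proof -
  have "TT B \<noteq> 0" "TT (A + B) \<noteq> 0" using assms by (simp_all add: TT_zero_iff)
  then have "relation_map A B t \<in> K (A + 2 * B) \<longleftrightarrow> (\<forall>y. BF t (sh y A) (sh y (2 * B)) = 0)"
    by (simp add: K_def relation_map_tensor_square BF_relation_map_diagonal QQ_0_0)
  also have "\<dots> \<longleftrightarrow> (\<forall>y. BF t y (sh y (2 * B - A)) = 0)"
    using all_sh[of "\<lambda>y v. BF t y v = 0" A "2 * B"] .
  also have "\<dots> \<longleftrightarrow> t \<in> K (2 * B - A)" using assms(3) by (simp add: K_def)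
  finally show ?thesis .
qed

text \<open>Here A + B = 0, so the factor \<open>TT (A + B)\<close> annihilates the diagonal values
  for every t.\<close>

lemma relation_map_in_K:
  assumes "of_nat n * tau \<notin> Lam"
  shows "relation_map (- tau) tau t \<in> K tau"
proof -
  have "TT tau \<noteq> 0" using assms by (simp add: TT_zero_iff)
  thus ?thesis using BF_relation_map_diagonal[of tau "- tau" t] by (simp add: K_def relation_map_tensor_square TT_0)
qed

text \<open>Vanishing for the extra shifts 0 and c of the last coordinate spreads to every extra
  shift by \<open>BF_sk_zero\<close>, and from there to all pairs by
  \<open>BF_zero_of_sk\<close>.\<close>

lemma K_inter_eq_0:
  assumes t: "t \<in> K x" and c: "\<And>y. BF t y (sk k y x c) = 0" "c \<notin> Lam"
  shows "t = 0"
proof (rule tensor_square_zero)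
  show "t \<in> tensor_square n" using t by (simp add: K_def)
  have "BF t y (sk k y x q) = 0" for y q by (rule BF_sk_zero[OF _ c]) (use t in \<open>simp add: K_def\<close>)
  then show "t (a, b) = 0" if "a \<in> Zn n" "b \<in> Zn n" for a b using that by (rule BF_zero_of_sk)
qed

lemma BF_sk_shift:
  assumes "\<And>y. BF t (sk k y u p) (sk k y v q) = 0"
  shows "BF t y (sk k y (v - u) (q - p)) = 0"
  using assms[of "sk k y (- u) (- p)"] by (simp add: sk_sk sh_sk) (simp add: sk_0)

text \<open>Two choices of e give two families of zeros: e = B puts t in K(2 B - A), and e = -A
  removes R1 and leaves vanishing with the extra shift n (A - B) of the last coordinate.\<close>

lemma relation_map_inj:
  assumes g: "of_nat n * A \<notin> Lam" "of_nat n * B \<notin> Lam" "of_nat n * (A + B) \<notin> Lam" "of_nat n * (A - B) \<notin> Lam"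
    and t: "t \<in> tensor_square n" and 0: "relation_map A B t = 0"
  shows "t = 0"
proof (rule K_inter_eq_0)
  have nz: "TT A \<noteq> 0" "TT B \<noteq> 0" "TT (A + B) \<noteq> 0" using g by (simp_all add: TT_zero_iff)
  have "0 \<in> K (A + 2 * B)" using K_subspace by (rule cfun.subspace_0)
  then show "t \<in> K (2 * B - A)" using relation_map_in_K_iff[OF g(2,3) t] 0 by simp
  have BF0: "BF 0 y v = 0" for y v by (simp add: BF_def)
  show "BF t y (sk k y (2 * B - A) (- (of_nat n * B) - of_nat n * (- A))) = 0" for y
  proof (rule BF_sk_shift)
    fix y
    show "BF t (sk k y A (of_nat n * - A)) (sk k y (2 * B) (- (of_nat n * B))) = 0"
      using BF_relation_map_identity[of "- A" A B t y] nz unfolding 0 BF0 by (simp add: TT_0 QQ_0_0 add.commute)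
  qed
  have "- (of_nat n * B) - of_nat n * (- A) = of_nat n * (A - B)" by (simp add: algebra_simps)
  then show "- (of_nat n * B) - of_nat n * (- A) \<notin> Lam" using g(4) by (simp only: not_False_eq_True)
qed

text \<open>For \<open>A = - B\<close> both terms of the identity carry the factor \<open>TT (e - B)\<close>, which cancels.\<close>

lemma relation_map_kernel_exchange:
  assumes tau: "of_nat n * tau \<notin> Lam" and 0: "relation_map (- tau) tau t = 0"
  shows "BF t y (sk k y (3 * tau) (d - of_nat n * tau)) = BF t (sk k y 0 d) (sk k y (3 * tau) (- (of_nat n * tau)))"
proof -
  define y' where "y' = sh y tau"
  define f where "f e = BF t (sh y' (- tau)) (sk k y' (2 * tau) (of_nat n * (e - tau)))
     - BF t (sk k y' (- tau) (of_nat n * e)) (sk k y' (2 * tau) (- (of_nat n * tau)))" for e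
  have nz: "TT tau \<noteq> 0" using tau by (simp add: TT_zero_iff)
  have BF0: "BF 0 y v = 0" for y v by (simp add: BF_def)
  have "f (d / of_nat n) = 0"
  proof (rule entire_zero_off_countable[of f "{e. of_nat n * e + (- (of_nat n * tau)) \<in> Lam}"])
    show "f holomorphic_on UNIV" unfolding f_def
      by (intro holomorphic_intros BF_line affine_fun_intros)
    show "countable {e. of_nat n * e + (- (of_nat n * tau)) \<in> Lam}" by (intro countable_affine_Lam) simp
    fix e assume "e \<notin> {e. of_nat n * e + (- (of_nat n * tau)) \<in> Lam}"
    then have nze: "TT (e - tau) \<noteq> 0" by (simp add: TT_zero_iff algebra_simps)
    have "ee ((of_nat n)\<^sup>2 * e) * TT (tau - e) * TT (- tau)
        = (ee ((of_nat n)\<^sup>2 * e) * ee (- ((of_nat n)\<^sup>2 * (e - tau))) * ee (- ((of_nat n)\<^sup>2 * tau))) * TT (e - tau) * TT tau"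
      using TT_reflect[of "e - tau"] TT_reflect[of tau] by simp
    also have "ee ((of_nat n)\<^sup>2 * e) * ee (- ((of_nat n)\<^sup>2 * (e - tau))) * ee (- ((of_nat n)\<^sup>2 * tau)) = 1"
      unfolding ee_add[symmetric] by (simp add: algebra_simps)
    finally have m: "ee ((of_nat n)\<^sup>2 * e) * TT (tau - e) * TT (- tau) = TT (e - tau) * TT tau" by simp
    have "QQ 0 0 * (TT (e - tau) * TT tau * f e) = 0"
      using BF_relation_map_identity[of e "- tau" tau t y'] unfolding 0 BF0 m f_def
      by (simp add: right_diff_distrib)
    thus "f e = 0" using nz nze by (simp add: QQ_0_0)
  qed
  moreover have "of_nat n * (d / of_nat n - tau) = d - of_nat n * tau" "of_nat n * (d / of_nat n) = d"
    by (simp_all add: field_simps)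
  ultimately have "BF t (sh y' (- tau)) (sk k y' (2 * tau) (d - of_nat n * tau))
     = BF t (sk k y' (- tau) d) (sk k y' (2 * tau) (- (of_nat n * tau)))"
    unfolding f_def by (simp only: right_minus_eq)
  thus ?thesis by (simp add: y'_def sk_sh algebra_simps)
qed

text \<open>With d = n tau the left side of \<open>relation_map_kernel_exchange\<close> is a
  diagonal value for 3 tau, zero by assumption; the right side then is a zero with extra shift -2 n
  tau.\<close>

lemma relation_map_kernel_inter_K:
  assumes tau: "of_nat n * tau \<notin> Lam" "2 * of_nat n * tau \<notin> Lam" and 0: "relation_map (- tau) tau t = 0"
    and t: "t \<in> K (3 * tau)"
  shows "t = 0"
proof (rule K_inter_eq_0[OF t])
  show "BF t y (sk k y (3 * tau) (- (of_nat n * tau) - of_nat n * tau)) = 0" for y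
  proof -
    have "BF t y (sk k y (3 * tau - 0) (- (of_nat n * tau) - of_nat n * tau)) = 0"
    proof (rule BF_sk_shift)
      fix y
      show "BF t (sk k y 0 (of_nat n * tau)) (sk k y (3 * tau) (- (of_nat n * tau))) = 0"
        unfolding relation_map_kernel_exchange[OF tau(1) 0, symmetric] using t by (simp add: K_def sk_0)
    qed
    thus ?thesis by simp
  qed
  have "- (of_nat n * tau) - of_nat n * tau = - (2 * of_nat n * tau)" by simp
  then show "- (of_nat n * tau) - of_nat n * tau \<notin> Lam" using tau(2) by (simp only: Lam_minus_iff not_False_eq_True)
qed

lemma symmetric_inter_K:
  assumes t: "t \<in> K 0" and s: "\<And>a b. t (a, b) = t (b, a)"
  shows "t = 0"
proof (rule tensor_square_zero)
  show "t \<in> tensor_square n" using t by (simp add: K_def)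
  have "BF t y (sk k y 0 q) = 0" for y q     by (rule BF_sk_zero_symmetric, use t in \<open>simp add: K_def\<close>, rule s)
  then show "t (a, b) = 0" if "a \<in> Zn n" "b \<in> Zn n" for a b using that by (rule BF_zero_of_sk)
qed

end

section \<open>The exceptional case of \<open>2n\<close>-torsion\<close>

context theta_w
begin

lemma diag_Lam:
  assumes "\<And>i. i \<in> {1..k} \<Longrightarrow> v i - y i \<in> Lam"
  shows "BF t v (sh v x) = 0 \<longleftrightarrow> BF t y (sh y x) = 0"
  by (intro BF_weq weq_Lam) (use assms in simp_all)

lemma diag_cong:
  assumes "\<And>i. i \<in> {1..k} \<Longrightarrow> v i = y i"
  shows "BF t v (sh v x) = 0 \<longleftrightarrow> BF t y (sh y x) = 0"
  by (rule diag_Lam) (simp add: assms)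

lemma diag_transpose:
  assumes "p \<in> {1..k}" "q \<in> {1..k}"
  shows "BF t (\<lambda>i. y (Transposition.transpose p q i)) (sh (\<lambda>i. y (Transposition.transpose p q i)) x) = 0
    \<longleftrightarrow> BF t y (sh y x) = 0"
  using BF_weq[OF weq_transpose[OF assms, of y] weq_transpose[OF assms, of "sh y x"]] by (simp add: sh_def)

text \<open>Invariance in the last coordinate transfers to coordinate j by the transposition of j
  and k.\<close>

lemma diag_upd:
  assumes w: "\<And>y. BF t (sk k y 0 \<omega>) (sh (sk k y 0 \<omega>) x) = 0 \<longleftrightarrow> BF t y (sh y x) = 0"
    and j: "j \<in> {1..k}"
  shows "BF t (y(j := y j + \<omega>)) (sh (y(j := y j + \<omega>)) x) = 0 \<longleftrightarrow> BF t y (sh y x) = 0"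
proof -
  let ?s = "Transposition.transpose j k"
  let ?v = "y(j := y j + \<omega>)"
  have "(\<lambda>i. ?v (?s i)) = sk k (\<lambda>i. y (?s i)) 0 \<omega>"
  proof
    fix i show "?v (?s i) = sk k (\<lambda>i. y (?s i)) 0 \<omega> i"
      by (cases "i = k") (auto simp: sk_def Transposition.transpose_def)
  qed
  then show ?thesis
    using diag_transpose[OF j k_mem, of t ?v x] diag_transpose[OF j k_mem, of t y x] w by (simp only:)
qed

text \<open>Both arguments contain z in their last coordinate, each contributing order
  three.\<close>

lemma qper_diag_coordinate:
  "qper 6 (ee (- 4 * (SS y - y k) - x - 2 * of_nat k * x - 6 * eta)) (\<lambda>z. BF t (y(k := z)) (sh (y(k := z)) x))"
  unfolding qper_def
proof (intro conjI allI)
  show "(\<lambda>z. BF t (y(k := z)) (sh (y(k := z)) x)) holomorphic_on UNIV"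
    by (rule BF_line) (intro affine_fun_intros)+
  have shu: "sh (y(k := z + c)) x = (sh (y(k := z)) x)(k := sh (y(k := z)) x k + c)" for z c
    by (auto simp: fun_eq_iff)
  show "BF t (y(k := z + 1)) (sh (y(k := z + 1)) x) = BF t (y(k := z)) (sh (y(k := z)) x)" for z
  proof -
    have "BF t (y(k := z + 1)) (sh (y(k := z + 1)) x) = (1 * 1) * BF t (y(k := z)) (sh (y(k := z)) x)"
    proof (rule BF_factor)
      show "W a (y(k := z + 1)) = 1 * W a (y(k := z))" for a
        using W_1[OF k_mem, of a "y(k := z)"] by simp
      show "W a (sh (y(k := z + 1)) x) = 1 * W a (sh (y(k := z)) x)" for a
        unfolding shu W_1[OF k_mem] by simp
    qed
    thus ?thesis by simp
  qed
  fix z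
  define m m' where mm: "m = - ee (- z - 2 * SS (y(k := z)) - 3 * eta)"
    "m' = - ee (- (z + x) - 2 * SS (sh (y(k := z)) x) - 3 * eta)"
  have "BF t (y(k := z + eta)) (sh (y(k := z + eta)) x) = (m * m') * BF t (y(k := z)) (sh (y(k := z)) x)"
  proof (rule BF_factor)
    show "W a (y(k := z + eta)) = m * W a (y(k := z))" for a
      using W_eta[OF k_mem, of a "y(k := z)"] by (simp add: mm)
    show "W a (sh (y(k := z + eta)) x) = m' * W a (sh (y(k := z)) x)" for a
      unfolding shu W_eta[OF k_mem] mm by simp
  qed
  moreover have "m * m' = ee (- 4 * (SS y - y k) - x - 2 * of_nat k * x - 6 * eta) * ee (- of_int 6 * z)"
    unfolding mm minus_mult_minus ee_add[symmetric] SS_sh SS_upd[OF k_mem]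
    by (rule arg_cong[where f = ee]) (simp add: algebra_simps)
  ultimately show "BF t (y(k := z + eta)) (sh (y(k := z + eta)) x) =
     ee (- 4 * (SS y - y k) - x - 2 * of_nat k * x - 6 * eta) * ee (- of_int 6 * z) * BF t (y(k := z)) (sh (y(k := z)) x)"
    by simp
qed simp

text \<open>Each of the two arguments contributes order two along a pair of opposite shifts.\<close>

lemma qper_diag_pair:
  assumes u: "u \<in> {1..k}" and uk: "u \<noteq> k"
  shows "qper 4 (ee (2 * (y k - y u - eta)))
    (\<lambda>z. BF t (y(u := y u + z, k := y k - z)) (sh (y(u := y u + z, k := y k - z)) x))"
  unfolding qper_def
proof (intro conjI allI)
  let ?v = "\<lambda>z. y(u := y u + z, k := y k - z)"
  show "(\<lambda>z. BF t (?v z) (sh (?v z) x)) holomorphic_on UNIV"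
    by (rule BF_line) (intro affine_fun_intros)+
  have v: "?v (z + c) = (?v z)(u := ?v z u + c, k := ?v z k - c)" for z c using uk by (auto simp: fun_eq_iff)
  have sv: "sh (?v (z + c)) x = (sh (?v z) x)(u := sh (?v z) x u + c, k := sh (?v z) x k - c)" for z c
    using uk by (auto simp: fun_eq_iff)
  show "BF t (?v (z + 1)) (sh (?v (z + 1)) x) = BF t (?v z) (sh (?v z) x)" for z
  proof -
    have "BF t (?v (z + 1)) (sh (?v (z + 1)) x) = (1 * 1) * BF t (?v z) (sh (?v z) x)"
    proof (rule BF_factor)
      show "W a (?v (z + 1)) = 1 * W a (?v z)" for a unfolding v W_pair_1[OF u k_mem uk] by simp
      show "W a (sh (?v (z + 1)) x) = 1 * W a (sh (?v z) x)" for a unfolding sv W_pair_1[OF u k_mem uk] by simp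
    qed
    thus ?thesis by simp
  qed
  fix z
  define m where "m = ee (y k - y u - 2 * z - eta)"
  have "BF t (?v (z + eta)) (sh (?v (z + eta)) x) = (m * m) * BF t (?v z) (sh (?v z) x)"
  proof (rule BF_factor)
    have "?v z k - ?v z u - eta = y k - y u - 2 * z - eta" using uk by simp
    then show "W a (?v (z + eta)) = m * W a (?v z)" for a
      unfolding v W_pair_eta[OF u k_mem uk] m_def by (simp only:)
    have "sh (?v z) x k - sh (?v z) x u - eta = y k - y u - 2 * z - eta" using uk by simp
    then show "W a (sh (?v (z + eta)) x) = m * W a (sh (?v z) x)" for a
      unfolding sv W_pair_eta[OF u k_mem uk] m_def by (simp only:)
  qed
  moreover have "m * m = ee (2 * (y k - y u - eta)) * ee (- of_int 4 * z)"
    unfolding m_def ee_add[symmetric] by (rule arg_cong[where f = ee]) (simp add: algebra_simps)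
  ultimately show "BF t (?v (z + eta)) (sh (?v (z + eta)) x) = ee (2 * (y k - y u - eta)) * ee (- of_int 4 * z) * BF t (?v z) (sh (?v z) x)"
    by simp
qed simp

definition pt :: "complex \<Rightarrow> nat \<Rightarrow> complex \<Rightarrow> nat \<Rightarrow> complex" where
  "pt q m a = (\<lambda>i. if i = k then a else if i \<le> k - m then 0 else q)"

text \<open>All coordinates are set free one after the other, from the last one on; \<open>pt q m a\<close> is the test
  point for the step that frees the \<open>m\<close>-th one. Zeros come in pairs \<open>u, u + \<omega>\<close>.\<close>

lemma diag_zero_of_points:
  assumes o: "\<omega> \<notin> Lam" "2 * \<omega> \<in> Lam"
    and w: "\<And>y. BF t (sk k y 0 \<omega>) (sh (sk k y 0 \<omega>) x) = 0 \<longleftrightarrow> BF t y (sh y x) = 0"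
    and q: "q \<notin> Lam" "q + \<omega> \<notin> Lam"
    and a: "sorted_wrt (\<lambda>x y. x - y \<notin> Lam \<and> x - y + \<omega> \<notin> Lam) [0, a1, a2]"
    and gen: "\<And>m. m \<in> {1..k} \<Longrightarrow>
       -2 * a2 + (- 4 * SS (pt q m 0) - x - 2 * of_nat k * x - 6 * eta - (2 * a1 + 3 * \<omega>)) \<notin> Lam"
    and z0: "BF t (\<lambda>i. 0) (sh (\<lambda>i. 0) x) = 0"
    and z1: "\<And>m. m \<in> {1..k} \<Longrightarrow> BF t (pt q m a1) (sh (pt q m a1) x) = 0"
    and z2: "\<And>m. m \<in> {1..k} \<Longrightarrow> BF t (pt q m a2) (sh (pt q m a2) x) = 0"
  shows "BF t y (sh y x) = 0"
proof -
  let ?Z = "\<lambda>y. BF t y (sh y x) = 0"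
  note dupd = diag_upd[OF w]
  have H: "\<forall>y. (\<forall>i\<in>{1..k-m}. y i = 0) \<longrightarrow> ?Z y" if "m \<le> k" for m
    using that
  proof (induction m)
    case 0
    show ?case
    proof (intro allI impI)
      fix y assume "\<forall>i\<in>{1..k-0}. y i = (0::complex)"
      then have "?Z y \<longleftrightarrow> ?Z (\<lambda>i. 0)" by (intro diag_cong) simp
      thus "?Z y" using z0 by simp
    qed
  next
    case (Suc m)
    define M where "M = Suc m"
    have M: "M \<in> {1..k}" using Suc by (simp add: M_def)
    \<comment> \<open>One free coordinate equal to 0 suffices: by symmetry it can be moved to
      position k - m, where the induction hypothesis expects a zero.\<close>
    have IH: "?Z y" if y: "\<And>i. i \<in> {1..k-M} \<Longrightarrow> y i = 0" and u: "u \<in> {k-m..k}" "y u = 0" for y u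
    proof -
      let ?s = "Transposition.transpose u (k - m)"
      have "?Z (\<lambda>i. y (?s i))"
      proof (rule Suc.IH[rule_format])
        show "m \<le> k" using Suc by simp
        fix i assume i: "i \<in> {1..k-m}"
        show "y (?s i) = 0"
        proof (cases "i = k - m")
          case False
          then have "?s i = i" "i \<in> {1..k-M}" using i u Suc.prems by (auto simp: M_def transpose_apply_other)
          thus ?thesis using y by simp
        qed (use u in simp)
      qed
      thus ?thesis using diag_transpose[of u "k - m" t y x] u Suc.prems by simp
    qed
    \<comment> \<open>The order six is met by exactly six zeros, namely 0, a1, a2 and their
      translates by omega; \<open>gen\<close> says that their sum violates Abel's condition.\<close>
    have base: "?Z (pt q M z)" for z
    proof -
      let ?f = "\<lambda>z. BF t ((pt q M 0)(k := z)) (sh ((pt q M 0)(k := z)) x)"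
      let ?zs = "concat (map (\<lambda>z. [z, z + \<omega>]) [0, a1, a2])"
      have pt: "(pt q M 0)(k := z) = pt q M z" for z by (auto simp: pt_def)
      have fw: "?f (z + \<omega>) = 0 \<longleftrightarrow> ?f z = 0" for z
        using dupd[OF k_mem, of "(pt q M 0)(k := z)"] by simp
      have "?f z = 0"
      proof (rule qper_generic_zeros[OF qper_diag_coordinate distinct_mod_double[OF o a]])
        have "?f 0 = 0" unfolding pt by (rule IH[of _ k]) (use Suc.prems in \<open>auto simp: pt_def M_def\<close>)
        moreover have "?f a1 = 0" "?f a2 = 0" unfolding pt using z1[OF M] z2[OF M] by auto
        ultimately show "?f z = 0" if "z \<in> set ?zs" for z using that fw[of 0] fw[of a1] fw[of a2] by auto
        show "int (length ?zs) = 6" by simp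
        show "(- 1) ^ length ?zs * ee (- 4 * (SS (pt q M 0) - pt q M 0 k) - x - 2 * of_nat k * x - 6 * eta)
            * ee (- sum_list ?zs) \<noteq> ee (of_int j * eta)" for j
        proof
          define X where "X = -2 * a2 + (- 4 * SS (pt q M 0) - x - 2 * of_nat k * x - 6 * eta - (2 * a1 + 3 * \<omega>))"
          have pk: "pt q M 0 k = 0" by (simp add: pt_def)
          assume "(- 1) ^ length ?zs * ee (- 4 * (SS (pt q M 0) - pt q M 0 k) - x - 2 * of_nat k * x - 6 * eta)
            * ee (- sum_list ?zs) = ee (of_int j * eta)"
          moreover have "ee (- 4 * (SS (pt q M 0) - pt q M 0 k) - x - 2 * of_nat k * x - 6 * eta) * ee (- sum_list ?zs) = ee X"
            unfolding ee_add[symmetric] X_def pk by (rule arg_cong[where f = ee]) (simp add: algebra_simps)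
          ultimately have "ee X = ee (of_int j * eta)" by simp
          then have "ee (X - of_int j * eta) = 1" by (simp add: ee_diff)
          then obtain l :: int where "X - of_int j * eta = of_int l" by (auto simp: ee_eq_1_iff Ints_def)
          then have "X = of_int l + of_int j * eta" by (simp add: algebra_simps)
          then have "X \<in> Lam" by simp
          thus False using gen[OF M] by (simp add: X_def)
        qed
      qed
      thus ?thesis by (simp only: pt)
    qed
    \<comment> \<open>The coordinates still fixed at q are freed from position k - 1 downwards, j of
      them so far.\<close>
    have G: "\<forall>y. (\<forall>i\<in>{1..k-M}. y i = 0) \<longrightarrow> (\<forall>i\<in>{k-M+1..k-1-j}. y i = q) \<longrightarrow> ?Z y" if "j \<le> m" for j
      using that
    proof (induction j)
      case 0
      show ?case
      proof (intro allI impI)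
        fix y assume y: "\<forall>i\<in>{1..k-M}. y i = (0::complex)" "\<forall>i\<in>{k-M+1..k-1-0}. y i = q"
        have "?Z y \<longleftrightarrow> ?Z (pt q M (y k))"
          by (rule diag_cong) (use y in \<open>auto simp: pt_def\<close>)
        thus "?Z y" using base by simp
      qed
    next
      case (Suc j)
      define u where "u = k - 1 - j"
      have u: "u \<in> {1..k}" "u \<noteq> k" "u \<in> {k-m..k}" "u \<notin> {1..k-M}" "u \<notin> {k-M+1..k-1-Suc j}"
        using Suc.prems \<open>Suc m \<le> k\<close> by (auto simp: u_def M_def)
      have kk: "k \<notin> {1..k-M}" "k \<notin> {k-M+1..k-1-Suc j}" using M by auto
      have step: "?Z y" if y: "\<And>i. i \<in> {1..k-M} \<Longrightarrow> y i = 0" "\<And>i. i \<in> {k-M+1..k-1-Suc j} \<Longrightarrow> y i = q"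
        and g: "q - y u - y k \<notin> Lam" "q - y u - y k + \<omega> \<notin> Lam" "- y u - y k \<notin> Lam" "- y u - y k + \<omega> \<notin> Lam" for y
      proof -
        let ?v = "\<lambda>z. y(u := y u + z, k := y k - z)"
        let ?f = "\<lambda>z. BF t (?v z) (sh (?v z) x)"
        \<comment> \<open>At these values of z coordinate u becomes q, coordinate u becomes 0, and
          the last coordinate becomes 0, respectively. With the translates by omega they give six
          zeros against order four.\<close>
        let ?l = "[q - y u, - y u, y k]"
        let ?zs = "concat (map (\<lambda>z. [z, z + \<omega>]) ?l)"
        have fw: "?f (z + \<omega>) = 0 \<longleftrightarrow> ?f z = 0" for z
        proof -
          have "(?v (z + \<omega>))(k := ?v (z + \<omega>) k + \<omega>) = (?v z)(u := ?v z u + \<omega>)" using u by (auto simp: fun_eq_iff)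
          thus ?thesis using dupd[OF k_mem, of "?v (z + \<omega>)"] dupd[OF u(1), of "?v z"] by (simp only:)
        qed
        have yv: "?v z i = y i" if "i \<noteq> u" "i \<noteq> k" for z i using that by simp
        have "?f 0 = 0"
        proof (rule qper_too_many_zeros[OF qper_diag_pair[OF u(1,2)]])
          have "sorted_wrt (\<lambda>x y. x - y \<notin> Lam \<and> x - y + \<omega> \<notin> Lam) ?l" using q g by simp
          then show "distinct_mod ?zs" by (rule distinct_mod_double[OF o])
          have "?f (q - y u) = 0"
          proof (rule Suc.IH[rule_format])
            show "j \<le> m" using Suc.prems by simp
            show "?v (q - y u) i = 0" if "i \<in> {1..k-M}" for i using that y u kk by auto
            show "?v (q - y u) i = q" if "i \<in> {k-M+1..k-1-j}" for i
            proof (cases "i = u")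
              case False
              then have "i \<in> {k-M+1..k-1-Suc j}" "i \<noteq> k" using that M by (auto simp: u_def)
              thus ?thesis using y(2) False by simp
            qed (use u in simp)
          qed
          moreover have "?f (- y u) = 0"
          proof (rule IH[OF _ u(3)])
            show "?v (- y u) i = 0" if "i \<in> {1..k-M}" for i using that y u kk by auto
          qed (use u in simp)
          moreover have "?f (y k) = 0"
          proof (rule IH[of _ k])
            show "?v (y k) i = 0" if "i \<in> {1..k-M}" for i using that y u kk by auto
          qed (use \<open>Suc m \<le> k\<close> in auto)
          ultimately show "?f z = 0" if "z \<in> set ?zs" for z
            using that fw[of "q - y u"] fw[of "- y u"] fw[of "y k"] by auto
        qed simp
        thus ?thesis by simp
      qed
      show ?case
      proof (intro allI impI)
        fix y assume y: "\<forall>i\<in>{1..k-M}. y i = (0::complex)" "\<forall>i\<in>{k-M+1..k-1-Suc j}. y i = q"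
        \<comment> \<open>Only coordinate u is perturbed; the four conditions depend on y u + y k
          and fail for countably many s.\<close>
        let ?Y = "\<lambda>s. y(u := y u + s)"
        let ?C = "{s. (-1) * s + (q - y u - y k) \<in> Lam} \<union> {s. (-1) * s + (q - y u - y k + \<omega>) \<in> Lam}
          \<union> {s. (-1) * s + (- y u - y k) \<in> Lam} \<union> {s. (-1) * s + (- y u - y k + \<omega>) \<in> Lam}"
        have "BF t (?Y 0) (sh (?Y 0) x) = 0"
        proof (rule entire_zero_off_countable[of "\<lambda>s. BF t (?Y s) (sh (?Y s) x)" ?C])
          show "(\<lambda>s. BF t (?Y s) (sh (?Y s) x)) holomorphic_on UNIV" by (rule BF_line) (intro affine_fun_intros)+
          show "countable ?C" by (intro countable_Un countable_affine_Lam) auto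
          fix s assume s: "s \<notin> ?C"
          show "?Z (?Y s)"
          proof (rule step)
            show "?Y s i = 0" if "i \<in> {1..k-M}" for i using that y u by auto
            show "?Y s i = q" if "i \<in> {k-M+1..k-1-Suc j}" for i using that y u by auto
            show "q - ?Y s u - ?Y s k \<notin> Lam" "q - ?Y s u - ?Y s k + \<omega> \<notin> Lam" "- ?Y s u - ?Y s k \<notin> Lam" "- ?Y s u - ?Y s k + \<omega> \<notin> Lam"
              using s u by (simp_all add: algebra_simps)
          qed
        qed
        thus "?Z y" by simp
      qed
    qed
    show ?case
    proof (intro allI impI)
      fix y assume "\<forall>i\<in>{1..k-Suc m}. y i = (0::complex)"
      then show "?Z y" using G[of m, rule_format, of y] by (auto simp: M_def)
    qed
  qed
  show ?thesis using H[of k] by simp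
qed

text \<open>One point is the origin and each of the k steps needs two more, n in all; they do not
  depend on t. The parameters q, a1, a2 are chosen off countable sets, a2 last since the condition
  on the sum of zeros involves a1.\<close>

lemma diag_test_points:
  assumes o: "\<omega> \<notin> Lam" "2 * \<omega> \<in> Lam"
  obtains P :: "(nat \<Rightarrow> complex) set" where "finite P" "card P \<le> n"
    "\<And>t y. (\<And>y. BF t (sk k y 0 \<omega>) (sh (sk k y 0 \<omega>) x) = 0 \<longleftrightarrow> BF t y (sh y x) = 0) \<Longrightarrow>
       (\<And>v. v \<in> P \<Longrightarrow> BF t v (sh v x) = 0) \<Longrightarrow> BF t y (sh y x) = 0"
proof -
  obtain q where "q \<notin> {u. 1 * u + 0 \<in> Lam} \<union> {u. 1 * u + \<omega> \<in> Lam}"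
    by (rule complex_off_countable[of "{u. 1 * u + 0 \<in> Lam} \<union> {u. 1 * u + \<omega> \<in> Lam}"]) (intro countable_Un countable_affine_Lam, auto)
  then have q: "q \<notin> Lam" "q + \<omega> \<notin> Lam" by auto
  obtain a1 where "a1 \<notin> {u. -1 * u + 0 \<in> Lam} \<union> {u. -1 * u + \<omega> \<in> Lam}"
    by (rule complex_off_countable[of "{u. -1 * u + 0 \<in> Lam} \<union> {u. -1 * u + \<omega> \<in> Lam}"]) (intro countable_Un countable_affine_Lam, auto)
  then have a1: "0 - a1 \<notin> Lam" "0 - a1 + \<omega> \<notin> Lam" by auto
  define X where "X m = - 4 * SS (pt q m 0) - x - 2 * of_nat k * x - 6 * eta - (2 * a1 + 3 * \<omega>)" for m
  let ?C = "{u. -1 * u + 0 \<in> Lam} \<union> {u. -1 * u + \<omega> \<in> Lam} \<union> {u. -1 * u + a1 \<in> Lam} \<union> {u. -1 * u + (a1 + \<omega>) \<in> Lam}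
     \<union> (\<Union>m\<in>{1..k}. {u. -2 * u + X m \<in> Lam})"
  have "countable ?C" by (intro countable_Un countable_UN countable_affine_Lam) auto
  then obtain a2 where a2': "a2 \<notin> ?C" by (rule complex_off_countable)
  then have a2: "0 - a2 \<notin> Lam" "0 - a2 + \<omega> \<notin> Lam" "a1 - a2 \<notin> Lam" "a1 - a2 + \<omega> \<notin> Lam"
    by (auto simp: algebra_simps)
  have gen: "-2 * a2 + X m \<notin> Lam" if "m \<in> {1..k}" for m using a2' that by auto
  define P where "P = insert (\<lambda>i. 0) ((\<lambda>m. pt q m a1) ` {1..k} \<union> (\<lambda>m. pt q m a2) ` {1..k})"
  show ?thesis
  proof (rule that[of P])
    show "finite P" by (simp add: P_def)
    have "card P \<le> Suc (card ((\<lambda>m. pt q m a1) ` {1..k} \<union> (\<lambda>m. pt q m a2) ` {1..k}))"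
      unfolding P_def by (rule card_insert_le_m1) auto
    also have "\<dots> \<le> Suc (card ((\<lambda>m. pt q m a1) ` {1..k}) + card ((\<lambda>m. pt q m a2) ` {1..k}))"
      using card_Un_le by blast
    also have "\<dots> \<le> Suc (card {1..k} + card {1..k})" by (intro Suc_le_mono[THEN iffD2] add_mono card_image_le) auto
    finally show "card P \<le> n" by (simp add: n_def)
    fix t y assume w: "\<And>y. BF t (sk k y 0 \<omega>) (sh (sk k y 0 \<omega>) x) = 0 \<longleftrightarrow> BF t y (sh y x) = 0"
      and v: "\<And>v. v \<in> P \<Longrightarrow> BF t v (sh v x) = 0"
    show "BF t y (sh y x) = 0"
    proof (rule diag_zero_of_points[OF o w q])
      show "sorted_wrt (\<lambda>x y. x - y \<notin> Lam \<and> x - y + \<omega> \<notin> Lam) [0, a1, a2]" using a1 a2 by simp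
      show "-2 * a2 + (- 4 * SS (pt q m 0) - x - 2 * of_nat k * x - 6 * eta - (2 * a1 + 3 * \<omega>)) \<notin> Lam"
        if "m \<in> {1..k}" for m using gen[OF that] unfolding X_def .
    qed (use v in \<open>auto simp: P_def\<close>)
  qed
qed

text \<open>Exchange with d = omega relates the diagonal value at y to the pair whose last
  coordinates are shifted by omega and -omega. As 2 omega is a period, -omega may be replaced by
  omega; this is the invariance that \<open>diag_test_points\<close> asks for.\<close>

lemma relation_map_kernel_test_points:
  assumes tau: "of_nat n * tau \<notin> Lam" "2 * of_nat n * tau \<in> Lam"
  obtains P :: "(nat \<Rightarrow> complex) set" where "finite P" "card P \<le> n"
    "\<And>t. t \<in> tensor_square n \<Longrightarrow> relation_map (- tau) tau t = 0 \<Longrightarrow> (\<And>v. v \<in> P \<Longrightarrow> BF t v (sh v (3 * tau)) = 0) \<Longrightarrow> t \<in> K (3 * tau)"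
proof -
  define \<omega> where "\<omega> = of_nat n * tau"
  have o: "\<omega> \<notin> Lam" "2 * \<omega> \<in> Lam" using tau by (simp_all add: \<omega>_def mult.assoc)
  obtain P where P: "finite P" "card P \<le> n"
    "\<And>t y. (\<And>y. BF t (sk k y 0 \<omega>) (sh (sk k y 0 \<omega>) (3 * tau)) = 0 \<longleftrightarrow> BF t y (sh y (3 * tau)) = 0) \<Longrightarrow>
       (\<And>v. v \<in> P \<Longrightarrow> BF t v (sh v (3 * tau)) = 0) \<Longrightarrow> BF t y (sh y (3 * tau)) = 0"
    by (rule diag_test_points[OF o, of "3 * tau"]) (rule that, assumption, assumption, blast)
  show ?thesis
  proof (rule that[OF P(1,2)])
    fix t assume t: "t \<in> tensor_square n" and 0: "relation_map (- tau) tau t = 0" and v: "\<And>v. v \<in> P \<Longrightarrow> BF t v (sh v (3 * tau)) = 0"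
    have "BF t (sk k y 0 \<omega>) (sh (sk k y 0 \<omega>) (3 * tau)) = 0 \<longleftrightarrow> BF t y (sh y (3 * tau)) = 0" for y
    proof -
      have "BF t y (sh y (3 * tau)) = BF t (sk k y 0 \<omega>) (sk k y (3 * tau) (- \<omega>))"
        using relation_map_kernel_exchange[OF tau(1) 0, of y \<omega>] by (simp add: \<omega>_def sk_0)
      moreover have "sh (sk k y 0 \<omega>) (3 * tau) = sk k y (3 * tau) (- \<omega> + 2 * \<omega>)" by (simp add: sh_sk)
      ultimately show ?thesis using BF_sk_Lam[OF o(2), of t "sk k y 0 \<omega>" y "3 * tau" "- \<omega>"] by (simp only:)
    qed
    from P(3)[OF this v] show "t \<in> K (3 * tau)" using t by (simp add: K_def)
  qed
qed

end

section \<open>Dimensions of spaces of functions\<close>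

text \<open>The space of all functions may have infinite dimension, so finiteness enters through a
  finite set T whose span contains S.\<close>

lemma cfun_basis:
  fixes S :: "('a \<Rightarrow> complex) set"
  assumes "finite T" "S \<subseteq> cfun.span T" "B \<subseteq> S" "cfun.independent B"
  obtains C where "B \<subseteq> C" "C \<subseteq> S" "cfun.independent C" "S \<subseteq> cfun.span C" "finite C" "card C = cfun.dim S"
proof -
  obtain C where C: "B \<subseteq> C" "C \<subseteq> S" "cfun.independent C" "S \<subseteq> cfun.span C"
    using cfun.maximal_independent_subset_extend[OF assms(3,4)] by blast
  have "C \<subseteq> cfun.span T" using C(2) assms(2) by blast
  then have "finite C" using cfun.independent_span_bound[OF assms(1) C(3)] by blast
  moreover have "cfun.dim S = card C" using C by (intro cfun.dim_unique) auto
  ultimately show ?thesis using that C by auto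
qed

lemma cfun_dim_mono:
  fixes S :: "('a \<Rightarrow> complex) set"
  assumes "finite T" "V \<subseteq> cfun.span T" "S \<subseteq> V"
  shows "cfun.dim S \<le> cfun.dim V"
proof -
  obtain B where B: "B \<subseteq> S" "cfun.independent B" "card B = cfun.dim S"
    by (rule cfun_basis[OF assms(1), of S "{}"]) (use assms in \<open>auto simp: cfun.independent_empty\<close>)
  obtain C where C: "V \<subseteq> cfun.span C" "finite C" "card C = cfun.dim V"
    by (rule cfun_basis[OF assms(1,2), of "{}"]) (auto simp: cfun.independent_empty)
  show ?thesis using cfun.independent_span_bound[OF C(2) B(2)] B(1,3) C(1,3) assms(3) by force
qed

lemma cfun_subspace_eq:
  fixes S :: "('a \<Rightarrow> complex) set"
  assumes "finite T" "V \<subseteq> cfun.span T" "S \<subseteq> V" "cfun.subspace S" "cfun.dim V \<le> cfun.dim S"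
  shows "S = V"
proof -
  obtain B where B: "B \<subseteq> S" "cfun.independent B" "card B = cfun.dim S"
    by (rule cfun_basis[OF assms(1), of S "{}"]) (use assms in \<open>auto simp: cfun.independent_empty\<close>)
  obtain C where C: "B \<subseteq> C" "V \<subseteq> cfun.span C" "finite C" "card C = cfun.dim V"
    by (rule cfun_basis[OF assms(1,2), of B]) (use B assms in auto)
  have "B = C" using C B assms(5) by (intro card_seteq) auto
  then have "V \<subseteq> S" using C(2) cfun.span_minimal[OF B(1) assms(4)] by blast
  thus ?thesis using assms(3) by blast
qed

text \<open>A basis B of the kernel within S is extended to a basis C of S; f is injective on the
  span of C - B, and the image of C - B is a basis of the span of the image.\<close>

lemma cfun_rank_nullity:
  fixes f :: "('a \<Rightarrow> complex) \<Rightarrow> 'b \<Rightarrow> complex"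
  assumes add: "\<And>x y. f (x + y) = f x + f y" and scale: "\<And>c x. f (fscale c x) = fscale c (f x)"
    and T: "finite T" "S \<subseteq> cfun.span T" and S: "cfun.subspace S"
  shows "cfun.dim S = cfun.dim {x \<in> S. f x = 0} + cfun.dim (f ` S)"
proof -
  interpret lin: Vector_Spaces.linear "fscale :: complex \<Rightarrow> ('a \<Rightarrow> complex) \<Rightarrow> 'a \<Rightarrow> complex"
    "fscale :: complex \<Rightarrow> ('b \<Rightarrow> complex) \<Rightarrow> 'b \<Rightarrow> complex" f
    by unfold_locales (simp_all add: add scale)
  have lin: "Vector_Spaces.linear fscale fscale f" ..
  interpret cfun_pair: vector_space_pair "fscale :: complex \<Rightarrow> ('a \<Rightarrow> complex) \<Rightarrow> 'a \<Rightarrow> complex"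
    "fscale :: complex \<Rightarrow> ('b \<Rightarrow> complex) \<Rightarrow> 'b \<Rightarrow> complex" ..
  define N where "N = {x \<in> S. f x = 0}"
  have NS: "N \<subseteq> S" by (auto simp: N_def)
  obtain B where B: "B \<subseteq> N" "cfun.independent B" "N \<subseteq> cfun.span B" "finite B" "card B = cfun.dim N"
    by (rule cfun_basis[OF T(1), of N "{}"]) (use NS T in \<open>auto simp: cfun.independent_empty\<close>)
  obtain C where C: "B \<subseteq> C" "C \<subseteq> S" "cfun.independent C" "S \<subseteq> cfun.span C" "finite C" "card C = cfun.dim S"
    by (rule cfun_basis[OF T, of B]) (use B NS in auto)
  define D where "D = C - B"
  have D: "cfun.independent D" "D \<subseteq> C"     unfolding D_def by (rule cfun.independent_mono[OF C(3)]) auto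
  have spanD: "cfun.span D \<subseteq> S" using C(2) D(2) S by (intro cfun.span_minimal) auto
  have zero: "x = 0" if x: "x \<in> cfun.span D" "f x = 0" for x
  proof -
    have xB: "x \<in> cfun.span B" using x spanD B(3) by (auto simp: N_def)
    \<comment> \<open>A vector in both spans has coordinates supported on D and on B, which are
      disjoint.\<close>
    have "cfun.representation C x = cfun.representation D x" "cfun.representation C x = cfun.representation B x"
      using cfun.representation_extend[OF C(3)] x(1) xB C(1) D(2) by blast+
    then have "cfun.representation B x b = 0" for b
      using cfun.representation_ne_zero[of D x b] cfun.representation_ne_zero[of B x b] by (auto simp: D_def)
    thus ?thesis using cfun.sum_nonzero_representation_eq[OF B(2) xB] by simp
  qed
  have inj: "inj_on f (cfun.span D)"
  proof (rule inj_onI)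
    fix x y assume "x \<in> cfun.span D" "y \<in> cfun.span D" "f x = f y"
    then have "x - y = 0" by (intro zero cfun.span_diff) (simp_all add: lin.diff)
    thus "x = y" by simp
  qed
  have ind: "cfun.independent (f ` D)"
    by (rule cfun_pair.linear_independent_injective_image[OF lin D(1) inj])
  have "f ` S \<subseteq> cfun.span (f ` D)"
  proof
    fix y assume "y \<in> f ` S"
    then obtain x where x: "x \<in> cfun.span C" "y = f x" using C(4) by blast
    have "C \<subseteq> B \<union> D" by (auto simp: D_def)
    then have "x \<in> cfun.span (B \<union> D)" using x(1) cfun.span_mono by blast
    then obtain b d where "b \<in> cfun.span B" "d \<in> cfun.span D" "x = b + d"
      unfolding cfun.span_Un by blast
    moreover have "f b = 0"
    proof -
      have "cfun.subspace N" unfolding N_def cfun.subspace_def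
        using S by (auto simp: lin.add scale cfun.subspace_0 cfun.subspace_add cfun.subspace_scale lin.zero)
      then have "cfun.span B \<subseteq> N" using B(1) by (intro cfun.span_minimal)
      thus ?thesis using \<open>b \<in> _\<close> by (auto simp: N_def)
    qed
    ultimately have "y = f d" using x by (simp add: lin.add)
    thus "y \<in> cfun.span (f ` D)" using \<open>d \<in> _\<close> by (simp add: cfun_pair.linear_span_image[OF lin])
  qed
  moreover have "f ` D \<subseteq> f ` S" using C(2) D(2) by blast
  ultimately have "cfun.dim (f ` S) = card (f ` D)" using ind by (intro cfun.dim_unique) auto
  also have "\<dots> = card D" using inj cfun.span_superset by (intro card_image) (blast intro: inj_on_subset)
  finally have "cfun.dim (f ` S) = card D" .
  moreover have "card C = card B + card D" unfolding D_def using C(1,5) B(4)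
    by (simp add: card_Diff_subset card_mono)
  ultimately show ?thesis using B(5) C(6) by (simp add: N_def)
qed

text \<open>Coordinate spaces: evaluation at finitely many points has rank at most their number, and
  \<open>tensor_square\<close> is of this kind too.\<close>

definition supported_on :: "'a set \<Rightarrow> ('a \<Rightarrow> complex) set" where
  "supported_on P = {f. \<forall>x. x \<notin> P \<longrightarrow> f x = 0}"

lemma supported_on_basis:
  fixes P :: "'a set"
  assumes P: "finite P"
  defines "e \<equiv> \<lambda>p x :: 'a. if x = p then 1 else (0 :: complex)"
  shows "supported_on P \<subseteq> cfun.span (e ` P)" "cfun.dim (supported_on P) = card P"
proof -
  have sum_e: "(\<Sum>p\<in>P. fscale (c p) (e p)) x = (if x \<in> P then c x else 0)" for c x
  proof -
    have "(\<Sum>p\<in>P. fscale (c p) (e p)) x = (\<Sum>p\<in>P. if x = p then c p else 0)"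
      unfolding cfun_sum_scale_apply e_def by (intro sum.cong) auto
    thus ?thesis using P by simp
  qed
  show 1: "supported_on P \<subseteq> cfun.span (e ` P)"
  proof
    fix f :: "'a \<Rightarrow> complex" assume f: "f \<in> supported_on P"
    have "f = (\<Sum>p\<in>P. fscale (f p) (e p))"
      unfolding fun_eq_iff sum_e using f by (auto simp: supported_on_def)
    also have "\<dots> \<in> cfun.span (e ` P)"
      by (intro cfun.span_sum cfun.span_scale cfun.span_base) auto
    finally show "f \<in> cfun.span (e ` P)" .
  qed
  have inj: "inj_on e P" by (rule inj_onI) (metis e_def one_neq_zero)
  have "cfun.independent (e ` P)"
  proof (rule cfun.independent_if_scalars_zero)
    show "finite (e ` P)" using P by simp
    fix c v assume 0: "(\<Sum>x\<in>e ` P. fscale (c x) x) = 0" and "v \<in> e ` P"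
    then obtain p where p: "p \<in> P" "v = e p" by blast
    have "(\<Sum>p\<in>P. fscale (c (e p)) (e p)) = 0" using 0 by (simp add: sum.reindex[OF inj])
    then have "(\<Sum>p\<in>P. fscale (c (e p)) (e p)) p = 0" by simp
    thus "c v = 0" using p by (simp add: sum_e)
  qed
  moreover have "e ` P \<subseteq> supported_on P" by (auto simp: e_def supported_on_def)
  ultimately have "cfun.dim (supported_on P) = card (e ` P)" using 1 by (intro cfun.dim_unique) auto
  thus "cfun.dim (supported_on P) = card P" using card_image[OF inj] by simp
qed

lemma cfun_dim_supported_le:
  assumes "finite P" "S \<subseteq> supported_on P"
  shows "cfun.dim S \<le> card P"
  using cfun_dim_mono[OF _ supported_on_basis(1)[OF assms(1)] assms(2)] supported_on_basis(2)[OF assms(1)] assms(1)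
  by simp

lemma cfun_zero_dim: "cfun.dim {0 :: 'a \<Rightarrow> complex} = 0"
  using cfun_dim_supported_le[of "{}" "{0 :: 'a \<Rightarrow> complex}"] by (simp add: supported_on_def)

section \<open>Dimension counts for \<open>K\<close> and the relation operator\<close>

context theta_w
begin

lemma tensor_square_eq: "tensor_square n = supported_on (Zn n \<times> Zn n)"
  by (auto simp: tensor_square_def supported_on_def)

lemma tensor_square_finite_span:
  obtains T where "finite T" "tensor_square n \<subseteq> cfun.span T"
proof -
  have fin: "finite (Zn n \<times> Zn n)" by simp
  show ?thesis by (rule that[OF finite_imageI[OF fin]]) (unfold tensor_square_eq, rule supported_on_basis(1)[OF fin])
qed

lemma dim_tensor_square: "cfun.dim (tensor_square n) = n * n"
  unfolding tensor_square_eq by (subst supported_on_basis(2)) (simp_all add: card_cartesian_product)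

lemma dim_mono_tensor: "S \<subseteq> V \<Longrightarrow> V \<subseteq> tensor_square n \<Longrightarrow> cfun.dim S \<le> cfun.dim V"
  by (rule tensor_square_finite_span) (rule cfun_dim_mono, auto)

lemma subspace_eq_tensor:
  "S \<subseteq> V \<Longrightarrow> V \<subseteq> tensor_square n \<Longrightarrow> cfun.subspace S \<Longrightarrow> cfun.dim V \<le> cfun.dim S \<Longrightarrow> S = V"
  by (rule tensor_square_finite_span) (rule cfun_subspace_eq, auto)

lemma rank_nullity_tensor:
  fixes f :: "(int \<times> int \<Rightarrow> complex) \<Rightarrow> 'b \<Rightarrow> complex"
  assumes "\<And>x y. f (x + y) = f x + f y" "\<And>c x. f (fscale c x) = fscale c (f x)"
    "cfun.subspace S" "S \<subseteq> tensor_square n"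
  shows "cfun.dim S = cfun.dim {x \<in> S. f x = 0} + cfun.dim (f ` S)"
proof (rule tensor_square_finite_span)
  fix T assume "finite T" "tensor_square n \<subseteq> cfun.span T"
  then show ?thesis by (intro cfun_rank_nullity[OF assms(1,2) _ _ assms(3)]) (use assms(4) in auto)
qed

lemma relation_map_add: "relation_map A B (t + u) = relation_map A B t + relation_map A B u"
  by (simp add: relation_map_def cfun.scale_left_distrib sum.distrib)

lemma relation_map_scale: "relation_map A B (fscale c t) = fscale c (relation_map A B t)"
  by (simp add: relation_map_def cfun.scale_sum_right) (simp add: fscale_def)

lemma K_tensor: "K x \<subseteq> tensor_square n" by (auto simp: K_def)

lemma relation_map_image_subspace: "cfun.subspace (relation_map A B ` tensor_square n)"
proof -
  interpret Vector_Spaces.linear "fscale :: complex \<Rightarrow> (int \<times> int \<Rightarrow> complex) \<Rightarrow> _"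
    "fscale :: complex \<Rightarrow> (int \<times> int \<Rightarrow> complex) \<Rightarrow> _" "relation_map A B"
    by unfold_locales (simp_all add: relation_map_add relation_map_scale)
  show ?thesis by (rule subspace_image[OF tensor_square_subspace])
qed

lemma dim_K_le_generic:
  assumes g: "of_nat n * A \<notin> Lam" "of_nat n * B \<notin> Lam" "of_nat n * (A + B) \<notin> Lam" "of_nat n * (A - B) \<notin> Lam"
  shows "cfun.dim (K (2 * B - A)) \<le> cfun.dim (K (A + 2 * B))"
proof -
  have "{t \<in> K (2 * B - A). relation_map A B t = 0} \<subseteq> {0}" using relation_map_inj[OF g] K_tensor by blast
  then have "cfun.dim {t \<in> K (2 * B - A). relation_map A B t = 0} = 0"
    using dim_mono_tensor[of "{t \<in> K (2 * B - A). relation_map A B t = 0}" "{0}"] cfun.subspace_0[OF tensor_square_subspace]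
    by (simp add: cfun_zero_dim)
  then have "cfun.dim (K (2 * B - A)) = cfun.dim (relation_map A B ` K (2 * B - A))"
    using rank_nullity_tensor[of "relation_map A B", OF relation_map_add relation_map_scale K_subspace K_tensor, of "2 * B - A"] by simp
  also have "\<dots> \<le> cfun.dim (K (A + 2 * B))"
    using relation_map_in_K_iff[OF g(2,3)] K_tensor by (intro dim_mono_tensor) blast+
  finally show ?thesis .
qed

text \<open>A generic u serves as an intermediate value. The choice A = (u - x) / 2, B = (x + u) / 4
  solves 2 B - A = x and A + 2 B = u; changing the sign of A exchanges the two, which allows the
  passage from u to x'.\<close>

lemma dim_K_le: "cfun.dim (K x) \<le> cfun.dim (K x')"
proof -
  let ?n = "of_nat n :: complex"
  \<comment> \<open>The four sets are the exceptions for A, B, A + B and A - B, in this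
    order.\<close>
  let ?C = "\<lambda>x. {u. ?n * (1/2) * u + ?n * (- x/2) \<in> Lam} \<union> {u. ?n * (1/4) * u + ?n * (x/4) \<in> Lam}
     \<union> {u. ?n * (3/4) * u + ?n * (- x/4) \<in> Lam} \<union> {u. ?n * (1/4) * u + ?n * (-3*x/4) \<in> Lam}"
  have count: "countable (?C x)" for x by (intro countable_Un countable_affine_Lam) simp_all
  obtain u where u: "u \<notin> ?C x \<union> ?C x'" by (rule complex_off_countable[OF countable_Un[OF count count]])
  have e: "?n * ((u - x)/2) = ?n * (1/2) * u + ?n * (- x/2)" "?n * ((x + u)/4) = ?n * (1/4) * u + ?n * (x/4)"
    "?n * ((u - x)/2 + (x + u)/4) = ?n * (3/4) * u + ?n * (- x/4)"
    "?n * ((u - x)/2 - (x + u)/4) = ?n * (1/4) * u + ?n * (-3*x/4)" for x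
    by (simp_all add: field_simps)
  have A: "?n * ((u - x)/2) \<notin> Lam" "?n * ((x + u)/4) \<notin> Lam" "?n * ((u - x)/2 + (x + u)/4) \<notin> Lam"
    "?n * ((u - x)/2 - (x + u)/4) \<notin> Lam" if "u \<notin> ?C x" for x
    unfolding e using that by blast+
  have 1: "cfun.dim (K x) \<le> cfun.dim (K u)"
  proof -
    have "2 * ((x + u)/4) - (u - x)/2 = x" "(u - x)/2 + 2 * ((x + u)/4) = u" by (simp_all add: field_simps)
    moreover have "u \<notin> ?C x" using u by blast
    ultimately show ?thesis using dim_K_le_generic[OF A(1,2,3,4)[of x]] by (simp only: simp_thms)
  qed
  have 2: "cfun.dim (K u) \<le> cfun.dim (K x')"
  proof -
    have m: "?n * (- ((u - x')/2)) = - (?n * ((u - x')/2))"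
      "?n * (- ((u - x')/2) + (x' + u)/4) = - (?n * ((u - x')/2 - (x' + u)/4))"
      "?n * (- ((u - x')/2) - (x' + u)/4) = - (?n * ((u - x')/2 + (x' + u)/4))"
      by (simp_all add: field_simps)
    have "2 * ((x' + u)/4) - (- ((u - x')/2)) = u" "- ((u - x')/2) + 2 * ((x' + u)/4) = x'" by (simp_all add: field_simps)
    moreover have "u \<notin> ?C x'" using u by blast
    ultimately show ?thesis using dim_K_le_generic[of "- ((u - x')/2)" "(x' + u)/4"] A[OF \<open>u \<notin> ?C x'\<close>]
      by (simp only: m Lam_minus_iff simp_thms)
  qed
  from 1 2 show ?thesis by (rule order_trans)
qed

text \<open>The upper triangular part of the antisymmetrization is injective on \<open>K 0\<close>.\<close>

lemma dim_K_bound: "2 * cfun.dim (K x) + n \<le> n * n"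
proof -
  define h where "h t = (\<lambda>p :: int \<times> int. if fst p < snd p then t p - t (snd p, fst p) else (0 :: complex))" for t
  let ?U = "{p \<in> Zn n \<times> Zn n. fst p < snd p}"
  let ?D = "{p \<in> Zn n \<times> Zn n. snd p < fst p}"
  let ?E = "(\<lambda>a. (a, a)) ` Zn n"
  have fin: "finite ?U" "finite ?D" by (auto intro: finite_subset[of _ "Zn n \<times> Zn n"] finite_cartesian_product)
  have ker: "{t \<in> K 0. h t = 0} \<subseteq> {0}"
  proof
    fix t assume t: "t \<in> {t \<in> K 0. h t = 0}"
    have lt: "t (a, b) = t (b, a)" if "a < b" for a b
    proof -
      have "h t (a, b) = 0" using t by simp
      thus ?thesis using that by (simp add: h_def)
    qed
    have "t (a, b) = t (b, a)" for a b using lt[of a b] lt[of b a] by (cases a b rule: linorder_cases) auto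
    then show "t \<in> {0}" using symmetric_inter_K t by blast
  qed
  then have "cfun.dim {t \<in> K 0. h t = 0} = 0"
    using dim_mono_tensor[OF ker] cfun.subspace_0[OF tensor_square_subspace] by (simp add: cfun_zero_dim)
  moreover have "cfun.dim (K 0) = cfun.dim {t \<in> K 0. h t = 0} + cfun.dim (h ` K 0)"
    by (rule rank_nullity_tensor[OF _ _ K_subspace K_tensor]) (auto simp: h_def fscale_def fun_eq_iff algebra_simps)
  moreover have "cfun.dim (h ` K 0) \<le> card ?U"
  proof (rule cfun_dim_supported_le[OF fin(1)], safe)
    fix t assume "t \<in> K 0"
    then have "t \<in> tensor_square n" using K_tensor by blast
    then show "h t \<in> supported_on ?U" by (auto simp: h_def supported_on_def tensor_square_def)
  qed
  ultimately have "cfun.dim (K x) \<le> card ?U" using dim_K_le[of x 0] by simp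
  moreover have "card ?D = card ?U"
    by (rule bij_betw_same_card[of prod.swap]) (auto intro!: bij_betwI[where g = prod.swap])
  moreover have "card (?U \<union> ?D \<union> ?E) = card ?U + card ?D + card ?E"
  proof -
    have "card (?U \<union> ?D) = card ?U + card ?D" using fin by (intro card_Un_disjoint) auto
    moreover have "card (?U \<union> ?D \<union> ?E) = card (?U \<union> ?D) + card ?E" using fin by (intro card_Un_disjoint) auto
    ultimately show ?thesis by simp
  qed
  moreover have "?U \<union> ?D \<union> ?E = Zn n \<times> Zn n" by auto
  moreover have "card ?E = n" by (subst card_image) (auto simp: inj_on_def)
  ultimately show ?thesis by (simp add: card_cartesian_product)
qed

theorem relation_map_image_eq_K:
  assumes tau: "of_nat n * tau \<notin> Lam"
  shows "relation_map (- tau) tau ` tensor_square n = K tau"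
proof (rule subspace_eq_tensor[OF _ K_tensor relation_map_image_subspace])
  let ?T = "relation_map (- tau) tau"
  let ?L = "{t \<in> tensor_square n. ?T t = 0}"
  show "?T ` tensor_square n \<subseteq> K tau" using relation_map_in_K[OF tau] by blast
  have img: "?T ` tensor_square n \<subseteq> tensor_square n" using relation_map_tensor_square by blast
  have rn: "n * n = cfun.dim ?L + cfun.dim (?T ` tensor_square n)"
    using rank_nullity_tensor[of ?T, OF relation_map_add relation_map_scale tensor_square_subspace] by (simp add: dim_tensor_square)
  show "cfun.dim (K tau) \<le> cfun.dim (?T ` tensor_square n)"
  proof (cases "2 * of_nat n * tau \<in> Lam")
    case False
    have "{t \<in> K (3 * tau). ?T t = 0} \<subseteq> {0}" using relation_map_kernel_inter_K[OF tau False] by blast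
    then have "cfun.dim {t \<in> K (3 * tau). ?T t = 0} = 0"
      using dim_mono_tensor[of "{t \<in> K (3 * tau). ?T t = 0}" "{0}"] cfun.subspace_0[OF tensor_square_subspace]
      by (simp add: cfun_zero_dim)
    then have "cfun.dim (K (3 * tau)) = cfun.dim (?T ` K (3 * tau))"
      using rank_nullity_tensor[of ?T, OF relation_map_add relation_map_scale K_subspace K_tensor, of "3 * tau"] by simp
    also have "\<dots> \<le> cfun.dim (?T ` tensor_square n)"
      by (rule dim_mono_tensor[OF _ img]) (use K_tensor in blast)
    finally show ?thesis using dim_K_le[of tau "3 * tau"] by simp
  next
    case True
    obtain P where P: "finite P" "card P \<le> n"
      "\<And>t. t \<in> tensor_square n \<Longrightarrow> ?T t = 0 \<Longrightarrow> (\<And>v. v \<in> P \<Longrightarrow> BF t v (sh v (3 * tau)) = 0) \<Longrightarrow> t \<in> K (3 * tau)"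
      by (rule relation_map_kernel_test_points[OF tau True]) (rule that, assumption, assumption, blast)
    \<comment> \<open>Evaluation at the test points: restricted to the kernel of the operator it has
      rank at most n, and what it annihilates there lies in K(3 tau).\<close>
    define f where "f t = (\<lambda>v. if v \<in> P then BF t v (sh v (3 * tau)) else 0)" for t
    have L: "cfun.subspace ?L" unfolding cfun.subspace_def
      using tensor_square_subspace relation_map_scale[of "- tau" tau 0 0]
      by (auto simp: relation_map_add relation_map_scale cfun.subspace_0 cfun.subspace_add cfun.subspace_scale)
    have "cfun.dim ?L = cfun.dim {t \<in> ?L. f t = 0} + cfun.dim (f ` ?L)"
      by (rule rank_nullity_tensor[OF _ _ L]) (simp_all add: f_def fun_eq_iff BF_add BF_scale cfun_scale_apply)
    moreover have "cfun.dim {t \<in> ?L. f t = 0} \<le> cfun.dim (K (3 * tau))"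
    proof (rule dim_mono_tensor[OF subsetI K_tensor])
      fix t assume t: "t \<in> {t \<in> ?L. f t = 0}"
      show "t \<in> K (3 * tau)"
      proof (rule P(3))
        fix v assume "v \<in> P"
        moreover have "f t v = 0" using t by simp
        ultimately show "BF t v (sh v (3 * tau)) = 0" by (simp add: f_def)
      qed (use t in auto)
    qed
    moreover have "cfun.dim (f ` ?L) \<le> card P"
      by (rule cfun_dim_supported_le[OF P(1)]) (auto simp: f_def supported_on_def)
    ultimately have "cfun.dim ?L \<le> cfun.dim (K (3 * tau)) + n" using P(2) by simp
    \<comment> \<open>With D = dim K(tau) the kernel has dimension at most D + n, so the image has
      dimension at least n^2 - n - D, and 2 D <= n^2 - n makes this at least D.\<close>
    then show ?thesis using rn dim_K_bound[of tau] dim_K_le[of "3 * tau" tau] by linarith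
  qed
qed

section \<open>From the operator to the quadratic relations\<close>

text \<open>Every denominator is cleared by 1 / th_a = \<open>QQ a\<close> / \<open>TT\<close>, and
  the common denominator does not depend on r.\<close>

lemma relation_eq_scaled_relation:
  assumes "TT (- tau) \<noteq> 0" "TT tau \<noteq> 0"
  shows "relation n k eta tau i j = fscale (1 / (TT (- tau) * TT tau)) (scaled_relation (- tau) tau i j)"
proof -
  have nz: "th a (- tau) \<noteq> 0" "QQ a (- tau) \<noteq> 0" "th a tau \<noteq> 0" "QQ a tau \<noteq> 0" for a
    using assms TT_QQ[of "- tau" a] TT_QQ[of tau a] by auto
  have "c / (th a (- tau) * th b tau) = 1 / (TT (- tau) * TT tau) * (c * QQ a (- tau) * QQ b tau)" for a b c
    unfolding TT_QQ[of "- tau" a] TT_QQ[of tau b] using nz by (simp add: field_simps)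
  then show ?thesis unfolding relation_def scaled_relation_def cfun.scale_sum_right cfun.scale_scale
    by (simp only: add.left_inverse)
qed

lemma relation_map_xx: "i \<in> Zn n \<Longrightarrow> j \<in> Zn n \<Longrightarrow> relation_map A B (xx n i j) = scaled_relation A B i j"
proof -
  assume "i \<in> Zn n" "j \<in> Zn n"
  then have "relation_map A B (xx n i j) = (\<Sum>p\<in>Zn n \<times> Zn n. if p = (i, j) then scaled_relation A B (fst p) (snd p) else 0)"
    unfolding relation_map_def by (intro sum.cong) (auto simp: xx_def)
  thus ?thesis using \<open>i \<in> _\<close> \<open>j \<in> _\<close> by simp
qed

theorem quadratic_relations_eq_K:
  assumes tau: "of_nat n * tau \<notin> Lam"
  shows "quadratic_relations n k eta tau = K tau"
proof -
  have nz: "TT tau \<noteq> 0" using tau by (simp add: TT_zero_iff)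
  have nz': "TT (- tau) \<noteq> 0" using tau Lam_minus_iff[of "of_nat n * tau"] by (simp add: TT_zero_iff)
  show ?thesis
  proof
    show "quadratic_relations n k eta tau \<subseteq> K tau"
      unfolding quadratic_relations_def
    proof (rule cfun.span_minimal[OF _ K_subspace], safe)
      fix i j assume "i \<in> Zn n" "j \<in> Zn n"
      then have "scaled_relation (- tau) tau i j \<in> K tau" using relation_map_in_K[OF tau, of "xx n i j"] by (simp add: relation_map_xx)
      then show "relation n k eta tau i j \<in> K tau"
        unfolding relation_eq_scaled_relation[OF nz' nz] by (rule cfun.subspace_scale[OF K_subspace])
    qed
    show "K tau \<subseteq> quadratic_relations n k eta tau"
      unfolding relation_map_image_eq_K[OF tau, symmetric]
    proof safe
      fix t
      have "scaled_relation (- tau) tau i j = fscale (TT (- tau) * TT tau) (relation n k eta tau i j)" for i j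
        unfolding relation_eq_scaled_relation[OF nz' nz] using nz nz' by simp
      moreover have "relation n k eta tau i j \<in> quadratic_relations n k eta tau" if "i \<in> Zn n" "j \<in> Zn n" for i j
        unfolding quadratic_relations_def by (rule cfun.span_base) (use that in blast)
      ultimately show "relation_map (- tau) tau t \<in> quadratic_relations n k eta tau"
        unfolding relation_map_def quadratic_relations_def
        by (intro cfun.span_sum cfun.span_scale) (auto intro!: cfun.span_scale)
    qed
  qed
qed

end

section \<open>The graph of the translation\<close>

context half_plane
begin

lemma lattice_rel_iff: "(x, y) \<in> lattice_rel eta \<longleftrightarrow> x - y \<in> Lam"
  by (simp add: lattice_rel_def Lam_def)

lemma mem_ell_point: "y \<in> ell_point eta x \<longleftrightarrow> x - y \<in> Lam"
  by (simp add: ell_point_def lattice_rel_iff)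

lemma ell_point_eq_imp: "ell_point eta x = ell_point eta y \<Longrightarrow> x - y \<in> Lam"
proof -
  assume "ell_point eta x = ell_point eta y"
  moreover have "y \<in> ell_point eta y" by (simp add: mem_ell_point)
  ultimately show ?thesis by (simp add: mem_ell_point[symmetric])
qed

lemma ell_curve_eq: "ell_curve eta = range (ell_point eta)"
  by (auto simp: ell_curve_def quotient_def ell_point_def)

lemma translate_ell_point: "(\<lambda>u. u + tau) ` ell_point eta x = ell_point eta (x + tau)"
proof safe
  fix u assume "u \<in> ell_point eta (x + tau)"
  then have "u - tau \<in> ell_point eta x" by (simp add: mem_ell_point algebra_simps)
  then show "u \<in> (\<lambda>u. u + tau) ` ell_point eta x" by (intro image_eqI[of _ _ "u - tau"]) simp_all
qed (simp add: mem_ell_point)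

lemma sym_point_cong: "(\<And>i. i \<in> {1..k} \<Longrightarrow> y i = v i) \<Longrightarrow> sym_point eta k y = sym_point eta k v"
  unfolding sym_point_def by (intro image_mset_cong) simp

lemma sym_point_in_sym_power: "sym_point eta k y \<in> sym_power eta k"
  by (auto simp: sym_point_def sym_power_def ell_curve_eq)

lemma sigma'_sym_point: "sigma' tau (sym_point eta k y) = sym_point eta k (\<lambda>i. y i + tau)"
  by (simp add: sigma'_def sym_point_def translate_ell_point image_mset.compositionality o_def)

lemma sym_power_eq: "sym_power eta k = range (sym_point eta k)"
proof
  show "sym_power eta k \<subseteq> range (sym_point eta k)"
  proof
    fix M assume M: "M \<in> sym_power eta k"
    obtain xs where xs: "mset xs = M" using ex_mset by blast
    have len: "length xs = k" using M xs by (auto simp: sym_power_def)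
    have "\<forall>P\<in>set xs. \<exists>x. P = ell_point eta x" using M xs by (auto simp: sym_power_def ell_curve_eq)
    then obtain c where c: "\<And>P. P \<in> set xs \<Longrightarrow> P = ell_point eta (c P)" by metis
    have "image_mset (\<lambda>i. ell_point eta (c (xs ! (i - 1)))) (mset_set {1..k}) = image_mset (\<lambda>i. xs ! (i - 1)) (mset_set {1..k})"
      by (rule image_mset_cong) (use c len in auto)
    also have "\<dots> = image_mset (\<lambda>i. xs ! (i - 1)) (mset (map Suc [0..<k]))"
      by (simp only: map_Suc_upt One_nat_def atLeastLessThanSuc_atLeastAtMost[symmetric] mset_upt)
    also have "image_mset (\<lambda>i. xs ! (i - 1)) (mset (map Suc [0..<k])) = mset (map (\<lambda>i. xs ! i) [0..<k])"
      by (simp add: image_mset.compositionality o_def)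
    also have "\<dots> = M" using len xs by (metis map_nth)
    finally have "M = sym_point eta k (\<lambda>i. c (xs ! (i - 1)))" unfolding sym_point_def by (rule sym)
    then show "M \<in> range (sym_point eta k)" by simp
  qed
qed (use sym_point_in_sym_power in blast)

end

context theta_w
begin

lemma rho_Zf: "rho eta k (Zf y) = sym_point eta k y"
  unfolding rho_def by (rule sym_point_cong) (rule Zf_Suc)

lemma rho_Yf: "rho eta k z = sym_point eta k (Yf z)"
  by (simp add: rho_def Yf_def)

text \<open>Representatives of equal multisets of points of E differ by a permutation of the
  coordinates and by lattice translations, and the theta vector is invariant under both up to a
  common factor.\<close>

lemma sym_point_eq_imp_weq:
  assumes "sym_point eta k v = sym_point eta k y"
  shows "weq y v"
proof -
  obtain p where p: "p permutes {1..k}" "\<forall>i\<in>{1..k}. ell_point eta (v i) = ell_point eta (y (p i))"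
    using image_mset_eq_implies_permutes[of "{1..k}" "\<lambda>i. ell_point eta (v i)" "\<lambda>i. ell_point eta (y i)"] assms
    by (auto simp: sym_point_def)
  show ?thesis
  proof (rule weq_permutes_Lam[OF p(1)])
    fix i assume "i \<in> {1..k}"
    then show "v i - y (p i) \<in> Lam" using p(2) by (intro ell_point_eq_imp) simp
  qed
qed

lemma Phi_Zf: "Phi k w (Zf y) = proj_point (\<lambda>a. if a \<in> Zn n then W a y else 0)"
  unfolding Phi_def n_alt by (rule arg_cong[where f = proj_point]) (auto simp: W_def)

lemma Phi_weq:
  assumes "weq y v"
  shows "Phi k w (Zf v) = Phi k w (Zf y)"
proof -
  obtain m where m: "m \<noteq> 0" "\<And>a. W a v = m * W a y" using assms unfolding weq_def by blast
  let ?u = "\<lambda>a. if a \<in> Zn n then W a y else 0"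
  have v: "(\<lambda>a. if a \<in> Zn n then W a v else 0) = fscale m ?u" by (auto simp: m fscale_def)
  have "proj_point (fscale m ?u) = proj_point ?u"
  proof
    show "proj_point (fscale m ?u) \<subseteq> proj_point ?u"
    proof
      fix q assume "q \<in> proj_point (fscale m ?u)"
      then obtain c where "c \<noteq> 0" "q = fscale c (fscale m ?u)" unfolding proj_point_def by blast
      then show "q \<in> proj_point ?u" unfolding proj_point_def mem_Collect_eq
        using m(1) by (intro exI[of _ "c * m"]) (simp add: cfun.scale_scale)
    qed
    show "proj_point ?u \<subseteq> proj_point (fscale m ?u)"
    proof
      fix q assume "q \<in> proj_point ?u"
      then obtain c where "c \<noteq> 0" "q = fscale c ?u" unfolding proj_point_def by blast
      then show "q \<in> proj_point (fscale m ?u)" unfolding proj_point_def mem_Collect_eq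
        using m(1) by (intro exI[of _ "c / m"]) (simp add: cfun.scale_scale)
    qed
  qed
  then show ?thesis unfolding Phi_Zf v .
qed

text \<open>Here the description by \<open>THE\<close> is seen to be well defined: all z over the
  same point of the symmetric power have proportional theta vectors.\<close>

lemma sym_embedding_sym_point: "sym_embedding k eta w (sym_point eta k y) = Phi k w (Zf y)"
  unfolding sym_embedding_def
proof (rule the_equality)
  show "Phi k w (Zf y) \<in> char_variety k w \<and> (\<exists>z\<in>Ck k. rho eta k z = sym_point eta k y \<and> Phi k w z = Phi k w (Zf y))"
    using rho_Zf Zf_Ck unfolding char_variety_def by blast
  fix q assume "q \<in> char_variety k w \<and> (\<exists>z\<in>Ck k. rho eta k z = sym_point eta k y \<and> Phi k w z = q)"
  then obtain z where z: "z \<in> Ck k" "sym_point eta k (Yf z) = sym_point eta k y" "Phi k w z = q"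
    unfolding rho_Yf by blast
  have "Phi k w (Zf (Yf z)) = Phi k w (Zf y)" by (rule Phi_weq[OF sym_point_eq_imp_weq[OF z(2)]])
  then show "q = Phi k w (Zf y)" using z(3) by (simp only: Zf_Yf[OF z(1)])
qed

text \<open>Bilinearity makes the vanishing independent of the chosen homogeneous
  coordinates.\<close>

lemma vanishes_at_Phi: "vanishes_at n t (Phi k w (Zf y)) (Phi k w (Zf v)) \<longleftrightarrow> BF t y v = 0"
proof -
  let ?u = "\<lambda>y a. if a \<in> Zn n then W a y else 0"
  have eq: "(\<Sum>a\<in>Zn n. \<Sum>b\<in>Zn n. t (a, b) * fscale c (?u y) a * fscale d (?u v) b) = c * d * BF t y v" for c d
    unfolding BF_def sum_distrib_left by (intro sum.cong refl) (simp add: fscale_def)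
  have mem: "fscale 1 (?u y) \<in> proj_point (?u y)" for y
    unfolding proj_point_def by (intro CollectI exI[of _ 1] conjI refl) simp
  show ?thesis
  proof
    assume "vanishes_at n t (Phi k w (Zf y)) (Phi k w (Zf v))"
    from this[unfolded vanishes_at_def Phi_Zf, rule_format, OF mem mem]
    show "BF t y v = 0" unfolding eq by simp
  next
    assume 0: "BF t y v = 0"
    show "vanishes_at n t (Phi k w (Zf y)) (Phi k w (Zf v))"
      unfolding vanishes_at_def Phi_Zf
    proof (intro ballI)
      fix p q assume "p \<in> proj_point (?u y)" "q \<in> proj_point (?u v)"
      then obtain c d where p: "p = fscale c (?u y)" and q: "q = fscale d (?u v)"
        unfolding proj_point_def mem_Collect_eq by (elim exE conjE)
      show "(\<Sum>a\<in>Zn n. \<Sum>b\<in>Zn n. t (a, b) * p a * q b) = 0" unfolding p q eq 0 by simp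
    qed
  qed
qed

lemma vanishing_on_graph_eq_K:
  "{t \<in> tensor_square n. \<forall>(P, Q) \<in> graph_sigma' k eta tau w. vanishes_at n t P Q} = K tau"
proof -
  have "graph_sigma' k eta tau w = (\<lambda>y. (Phi k w (Zf y), Phi k w (Zf (sh y tau)))) ` UNIV"
  proof -
    have "graph_sigma' k eta tau w =
        (\<lambda>p. (sym_embedding k eta w p, sym_embedding k eta w (sigma' tau p))) ` sym_power eta k"
      unfolding graph_sigma'_def by blast
    then show ?thesis unfolding sym_power_eq image_image sigma'_sym_point sym_embedding_sym_point sh_def .
  qed
  then show ?thesis unfolding K_def by (auto simp: vanishes_at_Phi)
qed

end

theorem theorem1p2:
  fixes k :: nat and eta tau :: complex and w :: "int \<Rightarrow> (nat \<Rightarrow> complex) \<Rightarrow> complex"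
  assumes "k \<ge> 1"
    and "Im eta > 0"
    and "tau \<notin> (\<lambda>x. x / of_nat (2 * k + 1)) ` period_lattice eta"
    and "2 * tau \<notin> period_lattice eta"
    and "theta_basis k eta w"
  shows "quadratic_relations (2 * k + 1) k eta tau =
    {t \<in> tensor_square (2 * k + 1).
       \<forall>(P, Q) \<in> graph_sigma' k eta tau w. vanishes_at (2 * k + 1) t P Q}"
proof -
  interpret theta_w eta k w
    using assms by unfold_locales auto
  have "of_nat n * tau \<notin> Lam"
  proof
    assume "of_nat n * tau \<in> Lam"
    then have "of_nat n * tau / of_nat (2 * k + 1) \<in> (\<lambda>x. x / of_nat (2 * k + 1)) ` period_lattice eta"
      unfolding Lam_def by (rule imageI)
    moreover have "of_nat n * tau / of_nat (2 * k + 1) = tau" unfolding n_alt by simp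
    ultimately show False using assms(3) by simp
  qed
  then show ?thesis unfolding n_alt vanishing_on_graph_eq_K by (rule quadratic_relations_eq_K)
qed

end
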